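(* Let $s\ge0$ and let $\Omega\subset\mathbb{R}^n$ be an open set such that $\Omega_e:=\mathbb{R}^n\setminus\overline\Omega\neq\emptyset$. The generalized fractional Calderón problem is well-defined and has the uniqueness property (in the weak sense) in the following cases. (i) For $(-\Delta)^s+q$ in $\Omega$, where $s\in\mathbb{R}_+\setminus\mathbb{Z}$ and $q\in L^\infty(\mathbb{R}^n)$ satisfies $q\ge c>0$ a.e. in $\Omega$ for some constant $c=c(q)$. Here $L(u,v)=\langle(-\Delta)^{s/2}u,(-\Delta)^{s/2}v\rangle_{L^2(\mathbb{R}^n)}$ and the local perturbation is $Q(u,v)=\langle qu,v\rangle_{L^2(\mathbb{R}^n)}$. (ii) For $(-\Delta)^t+(-\Delta)^{s/2}(\gamma(-\Delta)^{s/2})+q$ in $\Omega$, where $t\in\mathbb{R}_+\setminus\mathbb{Z}$, $s\in2\mathbb{Z}$, $t<s$, and $\gamma,q\in L^\infty(\mathbb{R}^n)$ are uniformly positive in $\Omega$ (i.e. $\gamma\ge c>0$ and $q\ge c>0$ a.e. in $\Omega$ for some constant $c$). Here $L(u,v)=\langle(-\Delta)^{t/2}u,(-\Delta)^{t/2}v\rangle_{L^2(\mathbb{R}^n)}$ and the local perturbation is $Q(u,v)=\langle\gamma(-\Delta)^{s/2}u,(-\Delta)^{s/2}v\rangle_{L^2(\mathbb{R}^n)}+\langle qu,v\rangle_{L^2(\mathbb{R}^n)}$. Explicitly, in each case: for every $Q$ of the stated type the exterior DN map $\Lambda_{L,Q}$ is well-defined; and if $W_1,W_2\subset\Omega_e$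 are disjoint nonempty open sets and $Q_1,Q_2$ are two perturbations of the stated type with $\Lambda_{L,Q_1}[f][g]=\Lambda_{L,Q_2}[f][g]$ for all $f\in C_c^\infty(W_1)$, $g\in C_c^\infty(W_2)$, then $Q_1=Q_2$ in $\widetilde{H}^s(\Omega)\times\widetilde{H}^s(\Omega)$.
   Context: $H^s(\mathbb{R}^n)$ is the $L^2$-based (real) Bessel potential space, $\widetilde{H}^s(\Omega)$ is the closure of $C_c^\infty(\Omega)$ in $H^s(\mathbb{R}^n)$, and $(-\Delta)^{r/2}u=\mathcal{F}^{-1}(|\xi|^r\hat u)$. Bilinear forms are considered on $H^s(\mathbb{R}^n)\times H^s(\mathbb{R}^n)$. Given $L$ and $Q$, put $B=L+Q$. The exterior DN map being well-defined means that for each $f\in H^s(\mathbb{R}^n)$ there is a unique $u_f\in H^s(\mathbb{R}^n)$ with $u_f-f\in\widetilde{H}^s(\Omega)$ and $B(u_f,\phi)=0$ for all $\phi\in\widetilde{H}^s(\Omega)$, and that $\Lambda_{L,Q}[f][g]:=B(u_f,g)$ defines a bounded linear map $\Lambda_{L,Q}\colon X\to X^*$, where $X:=H^s(\mathbb{R}^n)/\widetilde{H}^s(\Omega)$. *)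

theory Defs
  imports "HOL-Analysis.Analysis"
begin

text \<open>Elements of function spaces are represented by functions; equality in the spaces is equality
  almost everywhere with respect to Lebesgue measure.\<close>

section \<open>Function spaces\<close>

definition L2 :: "('a::euclidean_space \<Rightarrow> 'b::euclidean_space) \<Rightarrow> bool" where
  "L2 f \<longleftrightarrow> f \<in> borel_measurable lebesgue \<and> integrable lebesgue (\<lambda>x. (norm (f x))\<^sup>2)"

definition L2_norm :: "('a::euclidean_space \<Rightarrow> 'b::euclidean_space) \<Rightarrow> real" where
  "L2_norm f = sqrt (\<integral>x. (norm (f x))\<^sup>2 \<partial>lebesgue)"

definition L2_inner :: "('a::euclidean_space \<Rightarrow> real) \<Rightarrow> ('a \<Rightarrow> real) \<Rightarrow> real" where
  "L2_inner u v = (\<integral>x. u x * v x \<partial>lebesgue)"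

definition Linf :: "('a::euclidean_space \<Rightarrow> real) \<Rightarrow> bool" where
  "Linf q \<longleftrightarrow> q \<in> borel_measurable lebesgue \<and> (\<exists>M. AE x in lebesgue. \<bar>q x\<bar> \<le> M)"

definition uniformly_positive_on :: "'a::euclidean_space set \<Rightarrow> ('a \<Rightarrow> real) \<Rightarrow> bool" where
  "uniformly_positive_on \<Omega> q \<longleftrightarrow> (\<exists>c>0. AE x in lebesgue. x \<in> \<Omega> \<longrightarrow> c \<le> q x)"

text \<open>Functions of class \<open>C\<^sup>k\<close> on the whole space, via iterated partial derivatives.\<close>

fun Ck :: "nat \<Rightarrow> ('a::euclidean_space \<Rightarrow> real) \<Rightarrow> bool" where
  "Ck 0 f \<longleftrightarrow> continuous_on UNIV f"
| "Ck (Suc k) f \<longleftrightarrow> (\<forall>x. f differentiable (at x)) \<and>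
     (\<forall>i\<in>Basis. Ck k (\<lambda>x. frechet_derivative f (at x) i))"

definition Cc_inf :: "'a::euclidean_space set \<Rightarrow> ('a \<Rightarrow> real) set" where
  "Cc_inf W = {f. (\<forall>k. Ck k f) \<and> compact (closure {x. f x \<noteq> 0}) \<and> closure {x. f x \<noteq> 0} \<subseteq> W}"

section \<open>The Fourier transform on \<open>L\<^sup>2\<close>\<close>

definition fourier_integral :: "('a::euclidean_space \<Rightarrow> complex) \<Rightarrow> 'a \<Rightarrow> complex" where
  "fourier_integral f \<xi> = (\<integral>x. cis (- (x \<bullet> \<xi>)) * f x \<partial>lebesgue)"

text \<open>The transform of an \<open>L\<^sup>2\<close> function is the \<open>L\<^sup>2\<close> limit of the Fourier integrals of its truncations
  to balls (which are integrable); it is determined almost everywhere.\<close>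

definition fourier_L2 :: "('a::euclidean_space \<Rightarrow> complex) \<Rightarrow> 'a \<Rightarrow> complex" where
  "fourier_L2 f = (SOME g. L2 g \<and>
     ((\<lambda>R::real. \<integral>\<^sup>+\<xi>. ennreal ((norm (fourier_integral (\<lambda>x. indicator (ball 0 R) x * f x) \<xi> - g \<xi>))\<^sup>2)
        \<partial>lebesgue) \<longlongrightarrow> 0) at_top)"

definition inv_fourier_L2 :: "('a::euclidean_space \<Rightarrow> complex) \<Rightarrow> 'a \<Rightarrow> complex" where
  "inv_fourier_L2 g x = fourier_L2 g (- x) / of_real ((2 * pi) ^ DIM('a))"

abbreviation fourier_real :: "('a::euclidean_space \<Rightarrow> real) \<Rightarrow> 'a \<Rightarrow> complex" where
  "fourier_real u \<equiv> fourier_L2 (\<lambda>x. complex_of_real (u x))"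

section \<open>Bessel potential spaces and the fractional Laplacian\<close>

text \<open>For \<open>s \<ge> 0\<close>, the only case in which these definitions are used, the tempered distributions in
  \<open>H\<^sup>s\<close> are \<open>L\<^sup>2\<close> functions.\<close>

definition bessel_weighted :: "real \<Rightarrow> ('a::euclidean_space \<Rightarrow> real) \<Rightarrow> 'a \<Rightarrow> complex" where
  "bessel_weighted s u = (\<lambda>\<xi>. of_real ((1 + (norm \<xi>)\<^sup>2) powr (s / 2)) * fourier_real u \<xi>)"

definition Hs :: "real \<Rightarrow> ('a::euclidean_space \<Rightarrow> real) set" where
  "Hs s = {u. L2 u \<and> L2 (bessel_weighted s u)}"

definition Hs_norm :: "real \<Rightarrow> ('a::euclidean_space \<Rightarrow> real) \<Rightarrow> real" where
  "Hs_norm s u = L2_norm (bessel_weighted s u)"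

definition Hs_tilde :: "real \<Rightarrow> 'a::euclidean_space set \<Rightarrow> ('a \<Rightarrow> real) set" where
  "Hs_tilde s \<Omega> = {u \<in> Hs s. \<forall>\<epsilon>>0. \<exists>\<phi>\<in>Cc_inf \<Omega>. Hs_norm s (\<lambda>x. u x - \<phi> x) < \<epsilon>}"

text \<open>\<open>frac_lap_half r u\<close> is \<open>(-\<Delta>)\<^bsup>r/2\<^esup> u\<close>. As \<open>u\<close> is real and the multiplier is even, the inverse
  transform is real almost everywhere, so that \<open>Re\<close> only changes the type.\<close>

definition frac_lap_half :: "real \<Rightarrow> ('a::euclidean_space \<Rightarrow> real) \<Rightarrow> 'a \<Rightarrow> real" where
  "frac_lap_half r u =
     (\<lambda>x. Re (inv_fourier_L2 (\<lambda>\<xi>. of_real (norm \<xi> powr r) * fourier_real u \<xi>) x))"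

section \<open>The abstract trace space and its dual\<close>

definition trace_rel :: "real \<Rightarrow> 'a::euclidean_space set \<Rightarrow> (('a \<Rightarrow> real) \<times> ('a \<Rightarrow> real)) set" where
  "trace_rel s \<Omega> = {(f, g). f \<in> Hs s \<and> g \<in> Hs s \<and> (\<lambda>x. f x - g x) \<in> Hs_tilde s \<Omega>}"

definition trace_space :: "real \<Rightarrow> 'a::euclidean_space set \<Rightarrow> ('a \<Rightarrow> real) set set" where
  "trace_space s \<Omega> = Hs s // trace_rel s \<Omega>"

definition trace_class :: "real \<Rightarrow> 'a::euclidean_space set \<Rightarrow> ('a \<Rightarrow> real) \<Rightarrow> ('a \<Rightarrow> real) set" where
  "trace_class s \<Omega> f = trace_rel s \<Omega> `` {f}"

definition trace_norm :: "real \<Rightarrow> ('a::euclidean_space \<Rightarrow> real) set \<Rightarrow> real" where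
  "trace_norm s F = (INF f\<in>F. Hs_norm s f)"

definition trace_dual :: "real \<Rightarrow> 'a::euclidean_space set \<Rightarrow> (('a \<Rightarrow> real) set \<Rightarrow> real) set" where
  "trace_dual s \<Omega> = {l.
     (\<forall>f\<in>Hs s. \<forall>g\<in>Hs s. \<forall>a b. l (trace_class s \<Omega> (\<lambda>x. a * f x + b * g x)) =
        a * l (trace_class s \<Omega> f) + b * l (trace_class s \<Omega> g)) \<and>
     (\<exists>C. \<forall>F\<in>trace_space s \<Omega>. \<bar>l F\<bar> \<le> C * trace_norm s F)}"

definition trace_dual_norm :: "real \<Rightarrow> 'a::euclidean_space set \<Rightarrow> (('a \<Rightarrow> real) set \<Rightarrow> real) \<Rightarrow> real" where
  "trace_dual_norm s \<Omega> l = (SUP F\<in>{F \<in> trace_space s \<Omega>. trace_norm s F \<le> 1}. \<bar>l F\<bar>)"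

text \<open>Bounded linear maps from the trace space to its dual; equality in the dual is equality on
  the trace space.\<close>

definition bounded_linear_to_dual ::
    "real \<Rightarrow> 'a::euclidean_space set \<Rightarrow> (('a \<Rightarrow> real) set \<Rightarrow> ('a \<Rightarrow> real) set \<Rightarrow> real) \<Rightarrow> bool" where
  "bounded_linear_to_dual s \<Omega> \<Lambda> \<longleftrightarrow>
     (\<forall>F\<in>trace_space s \<Omega>. \<Lambda> F \<in> trace_dual s \<Omega>) \<and>
     (\<forall>f\<in>Hs s. \<forall>g\<in>Hs s. \<forall>a b. \<forall>G\<in>trace_space s \<Omega>.
        \<Lambda> (trace_class s \<Omega> (\<lambda>x. a * f x + b * g x)) G =
          a * \<Lambda> (trace_class s \<Omega> f) G + b * \<Lambda> (trace_class s \<Omega> g) G) \<and>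
     (\<exists>C. \<forall>F\<in>trace_space s \<Omega>. trace_dual_norm s \<Omega> (\<Lambda> F) \<le> C * trace_norm s F)"

section \<open>The generalized fractional Calderon problem\<close>

type_synonym 'a form = "('a \<Rightarrow> real) \<Rightarrow> ('a \<Rightarrow> real) \<Rightarrow> real"

definition add_form :: "'a form \<Rightarrow> 'a form \<Rightarrow> 'a form" where
  "add_form L Q = (\<lambda>u v. L u v + Q u v)"

definition dirichlet_solution ::
    "real \<Rightarrow> 'a::euclidean_space set \<Rightarrow> 'a form \<Rightarrow> ('a \<Rightarrow> real) \<Rightarrow> ('a \<Rightarrow> real) \<Rightarrow> bool" where
  "dirichlet_solution s \<Omega> B f u \<longleftrightarrow>
     u \<in> Hs s \<and> (\<lambda>x. u x - f x) \<in> Hs_tilde s \<Omega> \<and> (\<forall>\<phi>\<in>Hs_tilde s \<Omega>. B u \<phi> = 0)"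

definition DN_map ::
    "real \<Rightarrow> 'a::euclidean_space set \<Rightarrow> 'a form \<Rightarrow> 'a form \<Rightarrow> ('a \<Rightarrow> real) \<Rightarrow> ('a \<Rightarrow> real) \<Rightarrow> real" where
  "DN_map s \<Omega> L Q f g =
     (let B = add_form L Q in B (SOME u. dirichlet_solution s \<Omega> B f u) g)"

text \<open>\<open>DN_map\<close> acts on representatives. Being well-defined means that solutions exist and are unique
  almost everywhere, and that \<open>B u\<^sub>f g\<close> does not depend on the chosen representatives of the
  solution and of the classes of \<open>f\<close> and \<open>g\<close>, and induces a bounded linear map from the trace space
  to its dual.\<close>

definition DN_well_defined ::
    "real \<Rightarrow> 'a::euclidean_space set \<Rightarrow> 'a form \<Rightarrow> 'a form \<Rightarrow> bool" where
  "DN_well_defined s \<Omega> L Q \<longleftrightarrow>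
     (let B = add_form L Q in
       (\<forall>f\<in>Hs s. \<exists>u. dirichlet_solution s \<Omega> B f u \<and>
          (\<forall>u'. dirichlet_solution s \<Omega> B f u' \<longrightarrow> (AE x in lebesgue. u' x = u x))) \<and>
       (\<exists>\<Lambda>. bounded_linear_to_dual s \<Omega> \<Lambda> \<and>
          (\<forall>f\<in>Hs s. \<forall>g\<in>Hs s. \<forall>u. dirichlet_solution s \<Omega> B f u \<longrightarrow>
             \<Lambda> (trace_class s \<Omega> f) (trace_class s \<Omega> g) = B u g)))"

definition calderon_well_defined ::
    "real \<Rightarrow> 'a::euclidean_space set \<Rightarrow> 'a form \<Rightarrow> 'a form set \<Rightarrow> bool" where
  "calderon_well_defined s \<Omega> L \<Q> \<longleftrightarrow> (\<forall>Q\<in>\<Q>. DN_well_defined s \<Omega> L Q)"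

definition calderon_weak_uniqueness ::
    "real \<Rightarrow> 'a::euclidean_space set \<Rightarrow> 'a form \<Rightarrow> 'a form set \<Rightarrow> bool" where
  "calderon_weak_uniqueness s \<Omega> L \<Q> \<longleftrightarrow>
     (\<forall>W\<^sub>1 W\<^sub>2. open W\<^sub>1 \<and> open W\<^sub>2 \<and> W\<^sub>1 \<noteq> {} \<and> W\<^sub>2 \<noteq> {} \<and> W\<^sub>1 \<inter> W\<^sub>2 = {} \<and>
          W\<^sub>1 \<subseteq> - closure \<Omega> \<and> W\<^sub>2 \<subseteq> - closure \<Omega> \<longrightarrow>
        (\<forall>Q\<^sub>1\<in>\<Q>. \<forall>Q\<^sub>2\<in>\<Q>.
          (\<forall>f\<in>Cc_inf W\<^sub>1. \<forall>g\<in>Cc_inf W\<^sub>2. DN_map s \<Omega> L Q\<^sub>1 f g = DN_map s \<Omega> L Q\<^sub>2 f g) \<longrightarrow>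
          (\<forall>u\<in>Hs_tilde s \<Omega>. \<forall>v\<in>Hs_tilde s \<Omega>. Q\<^sub>1 u v = Q\<^sub>2 u v)))"

section \<open>The operators\<close>

definition frac_lap_form :: "real \<Rightarrow> 'a::euclidean_space form" where
  "frac_lap_form r = (\<lambda>u v. L2_inner (frac_lap_half r u) (frac_lap_half r v))"

definition potential_form :: "('a::euclidean_space \<Rightarrow> real) \<Rightarrow> 'a form" where
  "potential_form q = (\<lambda>u v. L2_inner (\<lambda>x. q x * u x) v)"

definition conductivity_form :: "real \<Rightarrow> ('a::euclidean_space \<Rightarrow> real) \<Rightarrow> 'a form" where
  "conductivity_form s \<gamma> =
     (\<lambda>u v. L2_inner (\<lambda>x. \<gamma> x * frac_lap_half s u x) (frac_lap_half s v))"

definition potential_perturbations :: "'a::euclidean_space set \<Rightarrow> 'a form set" where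
  "potential_perturbations \<Omega> = {potential_form q |q. Linf q \<and> uniformly_positive_on \<Omega> q}"

definition conductivity_perturbations :: "real \<Rightarrow> 'a::euclidean_space set \<Rightarrow> 'a form set" where
  "conductivity_perturbations s \<Omega> =
     {add_form (conductivity_form s \<gamma>) (potential_form q) |\<gamma> q.
        Linf \<gamma> \<and> Linf q \<and> uniformly_positive_on \<Omega> \<gamma> \<and> uniformly_positive_on \<Omega> q}"

end

theory Submission
  imports Defs "HOL-Probability.Probability"
begin

text \<open>Since \<open>q\<close> and \<open>\<gamma>\<close> are positive, \<open>B\<close> is coercive on the closure of the test functions in \<open>\<Omega>\<close>, and the
  Dirichlet problem is solved by the Riesz representation theorem. If the DN maps of \<open>Q\<^sub>1\<close> and \<open>Q\<^sub>2\<close> agree,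
  then \<open>Q\<^sub>1 - Q\<^sub>2\<close> vanishes on pairs of solutions with exterior data in \<open>W\<^sub>1\<close> and \<open>W\<^sub>2\<close>. By duality such
  solutions are dense enough (Runge approximation), provided that only \<open>u = 0\<close> vanishes on an open set
  together with \<open>(-\<Delta>)\<^sup>s u\<close>, where \<open>s\<close> is not an integer.

  This unique continuation property comes from the pairing \<open>H\<^sub>k(t)\<close> of the heat flow of \<open>(-\<Delta>)\<^sup>k u\<close> at
  time \<open>t\<close> with a test function. Let \<open>\<sigma>\<close> be the fractional part of \<open>s\<close>. Writing a fractional power of
  \<open>|\<xi>|\<^sup>2\<close> as a Gamma integral gives that \<open>t powr -\<sigma> * H\<^sub>k(t)\<close> has integral \<open>0\<close> over \<open>t > 0\<close> for all large
  \<open>k\<close>, and integration by parts replaces \<open>\<sigma>\<close> by \<open>\<sigma> + 1\<close>, \<open>\<sigma> + 2\<close> and so on. By the explicit heat kernel,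
  these integrals are moments of negative order in \<open>|x - y|\<^sup>2\<close>, which is bounded below on the supports;
  since all of them vanish, so does \<open>H\<^sub>k\<close>. Hence the heat flow of \<open>(-\<Delta>)\<^sup>k u\<close> at time \<open>1\<close>, which is real
  analytic, vanishes on an open set, so everywhere, and \<open>u = 0\<close>.\<close>

text \<open>The perturbations are local: potentials act pointwise, and for even \<open>s\<close> the
  operator in \<open>conductivity_form\<close> is a differential operator. So
  \<open>Q f v = 0\<close> if \<open>f\<close> is a test function in W1 or W2 and \<open>v\<close>
  lies in the closure of the test functions in Omega, and \<open>Q f g = 0\<close> for test
  functions with disjoint supports, which is where the disjointness of W1 and W2 enters. This
  reduces solutions to their parts in Omega. L is nonlocal, and only its order must avoid the
  integers, not that of the energy space.

  In the unique continuation property the hypothesis concerns a single exponent. Replacing the test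
  function by one of its iterated Laplacians, again a test function in W, raises the exponent by
  integers; this is why every large \<open>k\<close> is available, and each integration by parts
  lowers \<open>k\<close> by one. The positive distance between the support of the test function and
  the set where u is nonzero makes \<open>H k\<close> decay faster than any power as t tends to 0,
  so the weights \<open>t powr -a\<close> stay integrable near 0 and the boundary terms
  vanish.\<close>

section \<open>Semi-inner products and Riesz representation\<close>

text \<open>Only a semi-inner product: elements of function spaces are functions and not classes, so
  \<open>B f f = 0\<close> does not force \<open>f\<close> to be zero. Values in a real vector space
  let real and complex functions share the theory.\<close>

locale semi_inner =
  fixes V :: "('x \<Rightarrow> 'b::real_vector) set" and B :: "('x \<Rightarrow> 'b) \<Rightarrow> ('x \<Rightarrow> 'b) \<Rightarrow> real"
  assumes lin: "\<lbrakk>f \<in> V; g \<in> V\<rbrakk> \<Longrightarrow> (\<lambda>x. a *\<^sub>R f x + b *\<^sub>R g x) \<in> V"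
    and sym: "\<lbrakk>f \<in> V; g \<in> V\<rbrakk> \<Longrightarrow> B f g = B g f"
    and linl: "\<lbrakk>f \<in> V; g \<in> V; h \<in> V\<rbrakk> \<Longrightarrow> B (\<lambda>x. a *\<^sub>R f x + b *\<^sub>R g x) h = a * B f h + b * B g h"
    and nonneg: "f \<in> V \<Longrightarrow> 0 \<le> B f f"
begin

lemma linr: "\<lbrakk>f \<in> V; g \<in> V; h \<in> V\<rbrakk> \<Longrightarrow> B h (\<lambda>x. a *\<^sub>R f x + b *\<^sub>R g x) = a * B h f + b * B h g"
  using linl[of f g h a b] sym[of h] lin[of f g a b] by simp

lemma quadratic: "\<lbrakk>f \<in> V; g \<in> V\<rbrakk> \<Longrightarrow>
    B (\<lambda>x. a *\<^sub>R f x + b *\<^sub>R g x) (\<lambda>x. a *\<^sub>R f x + b *\<^sub>R g x) = a\<^sup>2 * B f f + 2 * a * b * B f g + b\<^sup>2 * B g g"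
  by (simp add: linl linr lin sym[of g f] power2_eq_square algebra_simps)

lemma diff_mem: "\<lbrakk>f \<in> V; g \<in> V\<rbrakk> \<Longrightarrow> (\<lambda>x. f x - g x) \<in> V"
  using lin[of f g 1 "-1"] by simp

lemma add_mem: "\<lbrakk>f \<in> V; g \<in> V\<rbrakk> \<Longrightarrow> (\<lambda>x. f x + g x) \<in> V"
  using lin[of f g 1 "1"] by simp

lemma scale_mem: "f \<in> V \<Longrightarrow> (\<lambda>x. a *\<^sub>R f x) \<in> V"
  using lin[of f f a 0] by simp

lemma diff_left: "\<lbrakk>f \<in> V; g \<in> V; h \<in> V\<rbrakk> \<Longrightarrow> B (\<lambda>x. f x - g x) h = B f h - B g h"
  using linl[of f g h 1 "-1"] by simp

lemma diff_right: "\<lbrakk>f \<in> V; g \<in> V; h \<in> V\<rbrakk> \<Longrightarrow> B h (\<lambda>x. f x - g x) = B h f - B h g"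
  using linr[of f g h 1 "-1"] by simp

lemma scale_self: "f \<in> V \<Longrightarrow> B (\<lambda>x. a *\<^sub>R f x) (\<lambda>x. a *\<^sub>R f x) = a\<^sup>2 * B f f"
  using quadratic[of f f a 0] by simp

lemma diff_self: "\<lbrakk>f \<in> V; g \<in> V\<rbrakk> \<Longrightarrow>
    B (\<lambda>x. f x - g x) (\<lambda>x. f x - g x) = B f f - 2 * B f g + B g g"
  using quadratic[of f g 1 "-1"] by simp

lemma diff_self_commute: "\<lbrakk>f \<in> V; g \<in> V\<rbrakk> \<Longrightarrow>
    B (\<lambda>x. f x - g x) (\<lambda>x. f x - g x) = B (\<lambda>x. g x - f x) (\<lambda>x. g x - f x)"
  by (simp add: diff_self sym[of g f])

lemma Cauchy_Schwarz_sq: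
  assumes "f \<in> V" "g \<in> V"
  shows "(B f g)\<^sup>2 \<le> B f f * B g g"
proof (cases "B g g = 0")
  case False
  then have pos: "B g g > 0" using nonneg[of g] assms by simp
  have "0 \<le> (B g g)\<^sup>2 * B f f + 2 * B g g * (- B f g) * B f g + (- B f g)\<^sup>2 * B g g"
    using quadratic[of f g "B g g" "- B f g"] nonneg[OF lin[of f g "B g g" "- B f g"]] assms by simp
  also have "\<dots> = B g g * (B f f * B g g - (B f g)\<^sup>2)"
    by (simp add: power2_eq_square algebra_simps)
  finally show ?thesis using pos by (simp add: zero_le_mult_iff)
next
  case True
  have "B f g = 0"
  proof (rule ccontr)
    assume "B f g \<noteq> 0"
    \<comment> \<open>With \<open>B g g = 0\<close> the form at \<open>f + b g\<close> is affine in
      \<open>b\<close>, and this \<open>b\<close> makes its value -1.\<close>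
    define b where "b = - (B f f + 1) / (2 * B f g)"
    have "0 \<le> B f f + 2 * b * B f g"
      using quadratic[of f g 1 b] nonneg[OF lin[of f g 1 b]] assms True by simp
    also have "2 * b * B f g = - (B f f + 1)"
      using \<open>B f g \<noteq> 0\<close> by (simp add: b_def)
    finally show False by simp
  qed
  then show ?thesis using True by simp
qed

lemma Cauchy_Schwarz:
  assumes "f \<in> V" "g \<in> V"
  shows "\<bar>B f g\<bar> \<le> sqrt (B f f) * sqrt (B g g)"
  using real_sqrt_le_mono[OF Cauchy_Schwarz_sq[OF assms]] by (simp add: real_sqrt_mult)

lemma triangle:
  assumes "f \<in> V" "g \<in> V"
  shows "sqrt (B (\<lambda>x. f x + g x) (\<lambda>x. f x + g x)) \<le> sqrt (B f f) + sqrt (B g g)"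
proof (rule real_le_lsqrt)
  have "B (\<lambda>x. f x + g x) (\<lambda>x. f x + g x) = B f f + 2 * B f g + B g g"
    using quadratic[of f g 1 1] assms by simp
  also have "\<dots> \<le> (sqrt (B f f))\<^sup>2 + 2 * (sqrt (B f f) * sqrt (B g g)) + (sqrt (B g g))\<^sup>2"
    using Cauchy_Schwarz[OF assms] nonneg assms by simp
  also have "\<dots> = (sqrt (B f f) + sqrt (B g g))\<^sup>2"
    by (simp add: power2_sum)
  finally show "B (\<lambda>x. f x + g x) (\<lambda>x. f x + g x) \<le> (sqrt (B f f) + sqrt (B g g))\<^sup>2" .
qed (use nonneg assms in simp)

text \<open>The representer is the limit of a minimizing sequence of
  \<open>J v = B v v - 2 * \<ll> v\<close>. Working with sequences avoids orthogonal complements and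
  quotients by the kernel of the seminorm.\<close>

lemma Riesz:
  assumes ne: "V \<noteq> {}"
    and complete: "\<And>X. \<lbrakk>\<And>n. X n \<in> V;
        \<And>e. e > 0 \<Longrightarrow> \<exists>N. \<forall>m\<ge>N. \<forall>n\<ge>N. B (\<lambda>x. X m x - X n x) (\<lambda>x. X m x - X n x) < e\<rbrakk>
        \<Longrightarrow> \<exists>l\<in>V. (\<lambda>n::nat. B (\<lambda>x. X n x - l x) (\<lambda>x. X n x - l x)) \<longlonglongrightarrow> 0"
    and linear: "\<And>f g a b. \<lbrakk>f \<in> V; g \<in> V\<rbrakk> \<Longrightarrow> \<ll> (\<lambda>x. a *\<^sub>R f x + b *\<^sub>R g x) = a * \<ll> f + b * \<ll> g"
    and bounded: "\<And>f. f \<in> V \<Longrightarrow> \<bar>\<ll> f\<bar> \<le> C * sqrt (B f f)"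
  shows "\<exists>w\<in>V. \<forall>v\<in>V. \<ll> v = B w v"
proof -
  define J where "J v = B v v - 2 * \<ll> v" for v
  \<comment> \<open>Completing the square in \<open>sqrt (B v v)\<close> bounds \<open>J\<close>
    from below, so its infimum is finite.\<close>
  have J_lower: "J v \<ge> - C\<^sup>2" if "v \<in> V" for v
  proof -
    have "0 \<le> (sqrt (B v v) - C)\<^sup>2" by simp
    also have "\<dots> = B v v - 2 * (C * sqrt (B v v)) + C\<^sup>2"
      using nonneg[OF that] by (simp add: power2_diff)
    also have "\<dots> \<le> B v v - 2 * \<ll> v + C\<^sup>2" using bounded[OF that] by simp
    finally show ?thesis by (simp add: J_def)
  qed
  define m where "m = (INF v\<in>V. J v)"
  have bdd: "bdd_below (J ` V)" by (rule bdd_belowI2) (rule J_lower)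
  have m_le: "m \<le> J v" if "v \<in> V" for v
    unfolding m_def using bdd that by (rule cINF_lower)
  have "\<exists>v\<in>V. J v < m + 1 / Suc n" for n
  proof -
    have "Inf (J ` V) < m + 1 / Suc n" unfolding m_def by simp
    then show ?thesis using ne bdd by (subst (asm) cInf_less_iff) auto
  qed
  then obtain X where XV: "\<And>n. X n \<in> V" and XJ: "\<And>n. J (X n) < m + 1 / Suc n" by metis
  have J_quad: "J (\<lambda>x. a *\<^sub>R f x + b *\<^sub>R g x) =
      a\<^sup>2 * B f f + 2 * a * b * B f g + b\<^sup>2 * B g g - 2 * (a * \<ll> f + b * \<ll> g)"
    if "f \<in> V" "g \<in> V" for a b f g
    using that by (simp add: J_def quadratic linear)
  \<comment> \<open>Parallelogram law: \<open>m\<close> bounds \<open>J\<close> at the midpoint of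
    \<open>f\<close> and \<open>g\<close>, so two near-minimizers are close in the seminorm.\<close>
  have diff_bound: "B (\<lambda>x. f x - g x) (\<lambda>x. f x - g x) \<le> 2 * (J f - m) + 2 * (J g - m)"
    if "f \<in> V" "g \<in> V" for f g
    using m_le[OF lin[OF that, of "1/2" "1/2"]] that unfolding J_quad[OF that]
    by (subst diff_self) (auto simp: J_def power2_eq_square field_simps)
  have "\<exists>N. \<forall>p\<ge>N. \<forall>q\<ge>N. B (\<lambda>x. X p x - X q x) (\<lambda>x. X p x - X q x) < e" if "e > 0" for e
  proof -
    have "e / 4 > 0" using that by simp
    then obtain N :: nat where N: "1 / Suc N < e / 4" by (rule nat_approx_posE)
    have J: "J (X p) < m + e / 4" if "p \<ge> N" for p
    proof -
      have "1 / Suc p \<le> 1 / Suc N" using that by (auto simp: frac_le)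
      then have "1 / Suc p < e / 4" using N by (rule order_le_less_trans)
      then show ?thesis using XJ[of p] by (metis add_strict_left_mono order_less_trans)
    qed
    have "B (\<lambda>x. X p x - X q x) (\<lambda>x. X p x - X q x) < e" if "p \<ge> N" "q \<ge> N" for p q
      using diff_bound[OF XV XV, of p q] J[OF that(1)] J[OF that(2)] by argo
    then show ?thesis by blast
  qed
  then obtain w where wV: "w \<in> V" and lim: "(\<lambda>n. B (\<lambda>x. X n x - w x) (\<lambda>x. X n x - w x)) \<longlonglongrightarrow> 0"
    using complete[of X] XV by blast
  have "\<ll> v = B w v" if v: "v \<in> V" for v
  proof -
    have BX: "(\<lambda>n. B (X n) v) \<longlonglongrightarrow> B w v"
    proof (rule Lim_transform[OF tendsto_const])
      have "(\<lambda>n. sqrt (B (\<lambda>x. X n x - w x) (\<lambda>x. X n x - w x)) * sqrt (B v v)) \<longlonglongrightarrow> sqrt 0 * sqrt (B v v)"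
        by (intro tendsto_intros lim)
      then have lim0: "(\<lambda>n. sqrt (B (\<lambda>x. X n x - w x) (\<lambda>x. X n x - w x)) * sqrt (B v v)) \<longlonglongrightarrow> 0"
        by simp
      show "(\<lambda>n. B (X n) v - B w v) \<longlonglongrightarrow> 0"
        by (rule Lim_null_comparison[OF _ lim0])
          (use Cauchy_Schwarz[OF diff_mem[OF XV wV] v] in \<open>simp add: diff_left XV wV v\<close>)
    qed
    \<comment> \<open>\<open>m\<close> is at most \<open>J\<close> at \<open>X n + t v\<close>, and
      \<open>J (X n) < m + 1 / Suc n\<close>. This gives a quadratic inequality in \<open>t\<close>
      up to an error that tends to 0, and in the limit its linear coefficient must vanish.\<close>
    have key: "0 \<le> 2 * t * (B w v - \<ll> v) + t\<^sup>2 * B v v" for t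
    proof (rule LIMSEQ_le_const)
      show "(\<lambda>n. 1 / Suc n + (2 * t * (B (X n) v - \<ll> v) + t\<^sup>2 * B v v)) \<longlonglongrightarrow>
          2 * t * (B w v - \<ll> v) + t\<^sup>2 * B v v"
        using tendsto_add[OF LIMSEQ_Suc[OF lim_1_over_n] tendsto_add[OF tendsto_mult[OF tendsto_const[of "2*t"]
              tendsto_diff[OF BX tendsto_const[of "\<ll> v"]]] tendsto_const[of "t\<^sup>2 * B v v"]]] by simp
      have "0 \<le> 1 / Suc n + (2 * t * (B (X n) v - \<ll> v) + t\<^sup>2 * B v v)" for n
        using m_le[OF lin[OF XV[of n] v, of 1 t]] XJ[of n] J_quad[OF XV[of n] v, of 1 t]
        by (simp add: J_def algebra_simps)
      then show "\<exists>N. \<forall>n\<ge>N. 0 \<le> 1 / Suc n + (2 * t * (B (X n) v - \<ll> v) + t\<^sup>2 * B v v)" by blast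
    qed
    show ?thesis
    proof (rule ccontr)
      assume "\<ll> v \<noteq> B w v"
      define d where "d = B w v - \<ll> v"
      have d: "d \<noteq> 0" using \<open>\<ll> v \<noteq> B w v\<close> by (simp add: d_def)
      have Bv: "B v v + 1 > 0" using nonneg[OF v] by simp
      \<comment> \<open>The parabola has its minimum at \<open>- d / B v v\<close>; the added 1 in
        the denominator also covers \<open>B v v = 0\<close>.\<close>
      have "0 \<le> 2 * (- d / (B v v + 1)) * d + (- d / (B v v + 1))\<^sup>2 * B v v"
        using key[of "- d / (B v v + 1)"] by (simp add: d_def)
      also have "\<dots> \<le> 2 * (- d / (B v v + 1)) * d + (- d / (B v v + 1))\<^sup>2 * (B v v + 1)"
        by (intro add_left_mono mult_left_mono) auto
      also have "\<dots> = - (d\<^sup>2 / (B v v + 1))"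
        using Bv by (simp add: power2_eq_square divide_simps) 
      also have "\<dots> < 0" using d Bv by simp
      finally show False by simp
    qed
  qed
  then show ?thesis using wV by blast
qed

end

section \<open>Square integrable functions\<close>

lemma L2_measurable: "L2 f \<Longrightarrow> f \<in> borel_measurable lebesgue"
  by (simp add: L2_def)

lemma L2_integrable: "L2 f \<Longrightarrow> integrable lebesgue (\<lambda>x. (norm (f x))\<^sup>2)"
  by (simp add: L2_def)

lemma L2_dominated:
  assumes f: "f \<in> borel_measurable lebesgue" and g: "L2 g"
    and le: "AE x in lebesgue. norm (f x) \<le> C * norm (g x)"
  shows "L2 f"
  unfolding L2_def
proof
  show "integrable lebesgue (\<lambda>x. (norm (f x))\<^sup>2)"
  proof (rule Bochner_Integration.integrable_bound)
    show "integrable lebesgue (\<lambda>x. C\<^sup>2 * (norm (g x))\<^sup>2)"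
      using g by (simp add: L2_def)
    show "AE x in lebesgue. norm ((norm (f x))\<^sup>2) \<le> norm (C\<^sup>2 * (norm (g x))\<^sup>2)"
      using le by eventually_elim (auto simp flip: power_mult_distrib intro: power_mono)
  qed (use f in measurable)
qed (rule f)

lemma L2_cong_AE:
  assumes "L2 f" "AE x in lebesgue. g x = f x"
  shows "L2 g"
  by (rule L2_dominated[where C=1 and g=f])
     (use assms borel_measurable_AE[OF _ AE_symmetric] L2_measurable in auto)

lemma L2_lin:
  fixes f g :: "'a::euclidean_space \<Rightarrow> 'b::euclidean_space"
  assumes "L2 f" "L2 g"
  shows "L2 (\<lambda>x. a *\<^sub>R f x + b *\<^sub>R g x)"
  unfolding L2_def
proof
  note [measurable] = assms[THEN L2_measurable]
  show "(\<lambda>x. a *\<^sub>R f x + b *\<^sub>R g x) \<in> borel_measurable lebesgue" by measurable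
  show "integrable lebesgue (\<lambda>x. (norm (a *\<^sub>R f x + b *\<^sub>R g x))\<^sup>2)"
  proof (rule Bochner_Integration.integrable_bound)
    show "integrable lebesgue (\<lambda>x. 2 * a\<^sup>2 * (norm (f x))\<^sup>2 + 2 * b\<^sup>2 * (norm (g x))\<^sup>2)"
      using assms by (simp add: L2_def)
    have "(norm (u + v))\<^sup>2 \<le> 2 * (norm u)\<^sup>2 + 2 * (norm v)\<^sup>2" for u v :: 'b
    proof -
      have "(norm (u + v))\<^sup>2 \<le> (norm u + norm v)\<^sup>2" by (intro power_mono norm_triangle_ineq) auto
      also have "\<dots> \<le> 2 * (norm u)\<^sup>2 + 2 * (norm v)\<^sup>2"
        using sum_squares_ge_zero[of "norm u - norm v" 0] by (simp add: power2_eq_square algebra_simps)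
      finally show ?thesis .
    qed
    from this[of "a *\<^sub>R f x" "b *\<^sub>R g x" for x]
    show "AE x in lebesgue. norm ((norm (a *\<^sub>R f x + b *\<^sub>R g x))\<^sup>2)
        \<le> norm (2 * a\<^sup>2 * (norm (f x))\<^sup>2 + 2 * b\<^sup>2 * (norm (g x))\<^sup>2)"
      by (simp add: power_mult_distrib mult.assoc)
  qed measurable
qed

lemma L2_add: "\<lbrakk>L2 f; L2 g\<rbrakk> \<Longrightarrow> L2 (\<lambda>x. f x + g x)"
  using L2_lin[of f g 1 1] by simp

lemma L2_diff: "\<lbrakk>L2 f; L2 g\<rbrakk> \<Longrightarrow> L2 (\<lambda>x. f x - g x)"
  using L2_lin[of f g 1 "-1"] by simp

lemma L2_scaleR: "L2 f \<Longrightarrow> L2 (\<lambda>x. a *\<^sub>R f x)"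
  using L2_lin[of f f a 0] by simp

lemma L2_bounded_scaleR:
  fixes f :: "'a::euclidean_space \<Rightarrow> 'b::euclidean_space"
  assumes "k \<in> borel_measurable lebesgue" "AE x in lebesgue. \<bar>k x\<bar> \<le> M" "L2 f"
  shows "L2 (\<lambda>x. k x *\<^sub>R f x)"
proof (rule L2_dominated[where C=M and g=f])
  show "AE x in lebesgue. norm (k x *\<^sub>R f x) \<le> M * norm (f x)"
    using assms(2) by eventually_elim (auto intro: mult_right_mono)
  show "(\<lambda>x. k x *\<^sub>R f x) \<in> borel_measurable lebesgue"
    using assms L2_measurable by measurable
qed (rule assms)

lemma L2_restrict:
  fixes f :: "'a::euclidean_space \<Rightarrow> 'b::euclidean_space"
  assumes "L2 f" "S \<in> sets lebesgue"
  shows "L2 (\<lambda>x. indicat_real S x *\<^sub>R f x)"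
  using assms by (intro L2_bounded_scaleR[where M=1]) (auto simp: indicator_def)

text \<open>On complex-valued functions this is the real part of the Hermitian product, so that real
  and complex functions fall under one interpretation of \<open>semi_inner\<close>. Parseval, the
  adjoint formula and inversion are all stated for this real form.\<close>

definition L2_dot :: "('a::euclidean_space \<Rightarrow> 'b::euclidean_space) \<Rightarrow> ('a \<Rightarrow> 'b) \<Rightarrow> real" where
  "L2_dot f g = (\<integral>x. f x \<bullet> g x \<partial>lebesgue)"

lemma L2_dot_integrable:
  assumes "L2 f" "L2 g"
  shows "integrable lebesgue (\<lambda>x. norm (f x) * norm (g x))"
    and "integrable lebesgue (\<lambda>x. f x \<bullet> g x)"
proof -
  note [measurable] = assms[THEN L2_measurable]
  have int: "integrable lebesgue (\<lambda>x. (norm (f x))\<^sup>2 + (norm (g x))\<^sup>2)"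
    using assms by (simp add: L2_def)
  have le: "norm u * norm v \<le> (norm u)\<^sup>2 + (norm v)\<^sup>2" for u v :: 'b
  proof -
    have "0 \<le> (norm u - norm v)\<^sup>2 + (norm u)\<^sup>2 + (norm v)\<^sup>2" by simp
    then show ?thesis by (simp add: power2_diff)
  qed
  show "integrable lebesgue (\<lambda>x. norm (f x) * norm (g x))"
    by (rule Bochner_Integration.integrable_bound[OF int]) (use le in auto)
  then show "integrable lebesgue (\<lambda>x. f x \<bullet> g x)"
    by (rule Bochner_Integration.integrable_bound) (use Cauchy_Schwarz_ineq2 in auto)
qed

lemma L2_norm_nonneg [simp]: "0 \<le> L2_norm f"
  by (simp add: L2_norm_def)

lemma L2_norm_sq: "(L2_norm f)\<^sup>2 = (\<integral>x. (norm (f x))\<^sup>2 \<partial>lebesgue)"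
  by (simp add: L2_norm_def)

lemma L2_dot_self: "L2_dot f f = (L2_norm f)\<^sup>2"
  by (simp add: L2_norm_sq L2_dot_def power2_norm_eq_inner)

lemma sqrt_L2_dot_self: "sqrt (L2_dot f f) = L2_norm f"
  by (simp add: L2_dot_self)

lemma L2_dot_cong_AE:
  assumes "AE x in lebesgue. f x = f' x" "AE x in lebesgue. g x = g' x"
    "f \<in> borel_measurable lebesgue" "g \<in> borel_measurable lebesgue"
  shows "L2_dot f g = L2_dot f' g'"
  unfolding L2_dot_def
proof (rule integral_cong_AE)
  have "f' \<in> borel_measurable lebesgue" "g' \<in> borel_measurable lebesgue"
    using assms by (auto intro: borel_measurable_AE)
  then show "(\<lambda>x. f' x \<bullet> g' x) \<in> borel_measurable lebesgue" by measurable
  show "AE x in lebesgue. f x \<bullet> g x = f' x \<bullet> g' x" using assms(1,2) by eventually_elim simp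
qed (use assms in measurable)

lemma L2_norm_cong_AE:
  assumes "AE x in lebesgue. f x = g x" "f \<in> borel_measurable lebesgue"
  shows "L2_norm f = L2_norm g"
  using L2_dot_cong_AE[OF assms(1,1,2,2)] by (simp flip: sqrt_L2_dot_self)

global_interpretation L2: semi_inner "{f :: 'a::euclidean_space \<Rightarrow> 'b::euclidean_space. L2 f}" L2_dot
proof
  show "L2_dot f g = L2_dot g f" for f g :: "'a \<Rightarrow> 'b" by (simp add: L2_dot_def inner_commute)
qed (auto simp: L2_lin L2_dot_def inner_add_left L2_dot_integrable)

lemma L2_norm_triangle: "\<lbrakk>L2 f; L2 g\<rbrakk> \<Longrightarrow> L2_norm (\<lambda>x. f x + g x) \<le> L2_norm f + L2_norm g"
  using L2.triangle[of f g] by (simp add: sqrt_L2_dot_self)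

lemma L2_norm_minus_commute: "L2_norm (\<lambda>x. f x - g x) = L2_norm (\<lambda>x. g x - f x)"
  by (simp add: L2_norm_def norm_minus_commute)

lemma L2_norm_triangle_mid:
  assumes "L2 f" "L2 g" "L2 h"
  shows "L2_norm (\<lambda>x. f x - g x) \<le> L2_norm (\<lambda>x. f x - h x) + L2_norm (\<lambda>x. h x - g x)"
  using L2_norm_triangle[OF L2_diff[of f h] L2_diff[of h g]] assms by simp

lemma L2_norm_triangle_sub:
  assumes "L2 f" "L2 g"
  shows "\<bar>L2_norm f - L2_norm g\<bar> \<le> L2_norm (\<lambda>x. f x - g x)"
  using L2_norm_triangle[of "\<lambda>x. f x - g x" g] L2_norm_triangle[of "\<lambda>x. g x - f x" f] L2_diff assms
    L2_norm_minus_commute[of f g] by fastforce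

lemma L2_Cauchy_Schwarz: "\<lbrakk>L2 f; L2 g\<rbrakk> \<Longrightarrow> \<bar>L2_dot f g\<bar> \<le> L2_norm f * L2_norm g"
  using L2.Cauchy_Schwarz[of f g] by (simp add: sqrt_L2_dot_self)

lemma L2_norm_eq_0_iff: "L2 f \<Longrightarrow> L2_norm f = 0 \<longleftrightarrow> (AE x in lebesgue. f x = 0)"
  using integral_nonneg_eq_0_iff_AE[OF L2_integrable, of f] by (simp add: L2_norm_def)

lemma L2_norm_mono:
  assumes "L2 f" "L2 g" "AE x in lebesgue. norm (f x) \<le> C * norm (g x)" "C \<ge> 0"
  shows "L2_norm f \<le> C * L2_norm g"
proof -
  have "(L2_norm f)\<^sup>2 \<le> (\<integral>x. C\<^sup>2 * (norm (g x))\<^sup>2 \<partial>lebesgue)"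
    unfolding L2_norm_sq
  proof (rule integral_mono_AE)
    show "AE x in lebesgue. (norm (f x))\<^sup>2 \<le> C\<^sup>2 * (norm (g x))\<^sup>2"
      using assms(3) by eventually_elim (auto simp flip: power_mult_distrib intro: power_mono)
  qed (use assms L2_integrable in auto)
  also have "\<dots> = (C * L2_norm g)\<^sup>2" by (simp add: L2_norm_sq power_mult_distrib)
  finally show ?thesis using assms(4) by (auto intro: power2_le_imp_le)
qed

lemma L2_limit_unique:
  assumes "\<And>n. L2 (X n)" "L2 f" "L2 g"
    "((\<lambda>n. L2_norm (\<lambda>x. X n x - f x)) \<longlongrightarrow> 0) F" "((\<lambda>n. L2_norm (\<lambda>x. X n x - g x)) \<longlongrightarrow> 0) F"
    "F \<noteq> bot"
  shows "AE x in lebesgue. f x = g x"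
proof -
  have "L2_norm (\<lambda>x. f x - g x) \<le> 0"
  proof (rule tendsto_lowerbound)
    show "((\<lambda>n. L2_norm (\<lambda>x. X n x - f x) + L2_norm (\<lambda>x. X n x - g x)) \<longlongrightarrow> 0) F"
      using tendsto_add[OF assms(4,5)] by simp
    have "L2_norm (\<lambda>x. f x - g x) \<le> L2_norm (\<lambda>x. X n x - f x) + L2_norm (\<lambda>x. X n x - g x)" for n
      using L2_norm_triangle_mid[of f g "X n"] assms L2_norm_minus_commute[of f "X n"] by simp
    then show "\<forall>\<^sub>F n in F. L2_norm (\<lambda>x. f x - g x) \<le> L2_norm (\<lambda>x. X n x - f x) + L2_norm (\<lambda>x. X n x - g x)"
      by simp
  qed (rule assms)
  then have "L2_norm (\<lambda>x. f x - g x) = 0" using L2_norm_nonneg[of "\<lambda>x. f x - g x"] by linarith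
  then show ?thesis using L2_norm_eq_0_iff[OF L2_diff] assms by fastforce
qed

text \<open>Norm bounds pass to almost everywhere limits. This turns pointwise limits into norm
  estimates in \<open>L2_complete\<close> and \<open>plancherel_L1\<close>.\<close>

lemma L2_norm_Fatou:
  fixes f :: "'a::euclidean_space \<Rightarrow> 'b::euclidean_space"
  assumes X: "\<And>n::nat. L2 (X n)" and ae: "AE x in lebesgue. (\<lambda>n. X n x) \<longlonglongrightarrow> f x"
    and f: "f \<in> borel_measurable lebesgue"
    and le: "\<forall>\<^sub>F n in sequentially. L2_norm (X n) \<le> C" 
  shows "L2 f" "L2_norm f \<le> C"
proof -
  note [measurable] = f X[THEN L2_measurable]
  have C: "C \<ge> 0" using le eventually_happens'[OF sequentially_bot le] L2_norm_nonneg order_trans by blast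
  have eq: "(\<integral>\<^sup>+x. ennreal ((norm (X n x))\<^sup>2) \<partial>lebesgue) = ennreal ((L2_norm (X n))\<^sup>2)" for n
    unfolding L2_norm_sq by (rule nn_integral_eq_integral) (use X L2_integrable in auto)
  have "(\<integral>\<^sup>+x. ennreal ((norm (f x))\<^sup>2) \<partial>lebesgue) =
      (\<integral>\<^sup>+x. liminf (\<lambda>n. ennreal ((norm (X n x))\<^sup>2)) \<partial>lebesgue)"
  proof (rule nn_integral_cong_AE)
    show "AE x in lebesgue. ennreal ((norm (f x))\<^sup>2) = liminf (\<lambda>n. ennreal ((norm (X n x))\<^sup>2))"
      using ae
    proof eventually_elim
      case (elim x)
      then have "(\<lambda>n. ennreal ((norm (X n x))\<^sup>2)) \<longlonglongrightarrow> ennreal ((norm (f x))\<^sup>2)"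
        by (intro tendsto_intros) auto
      then show ?case using lim_imp_Liminf[OF sequentially_bot] by metis
    qed
  qed
  also have "\<dots> \<le> liminf (\<lambda>n. \<integral>\<^sup>+x. ennreal ((norm (X n x))\<^sup>2) \<partial>lebesgue)"
    by (rule nn_integral_liminf) measurable
  also have "\<dots> \<le> ennreal (C\<^sup>2)"
    unfolding eq
  proof (rule Liminf_le)
    show "\<forall>\<^sub>F n in sequentially. ennreal ((L2_norm (X n))\<^sup>2) \<le> ennreal (C\<^sup>2)"
      using le by eventually_elim (auto intro!: ennreal_leI power_mono)
  qed simp
  finally have *: "(\<integral>\<^sup>+x. ennreal ((norm (f x))\<^sup>2) \<partial>lebesgue) \<le> ennreal (C\<^sup>2)" .
  show L2f: "L2 f"
    unfolding L2_def integrable_iff_bounded using le_less_trans[OF *] by auto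
  have "ennreal ((L2_norm f)\<^sup>2) \<le> ennreal (C\<^sup>2)"
    using * nn_integral_eq_integral[OF L2_integrable[OF L2f]] by (simp add: L2_norm_sq)
  then show "L2_norm f \<le> C" using C by (auto intro: power2_le_imp_le)
qed

text \<open>Riesz-Fischer: a subsequence with steps below (1/2)^k converges almost everywhere, and
  Fatou's lemma shows that its limit is also the norm limit of the whole sequence.\<close>

theorem L2_complete:
  fixes X :: "nat \<Rightarrow> 'a::euclidean_space \<Rightarrow> 'b::euclidean_space"
  assumes X: "\<And>n. L2 (X n)"
    and Cauchy: "\<And>e. e > 0 \<Longrightarrow> \<exists>N. \<forall>m\<ge>N. \<forall>n\<ge>N. L2_norm (\<lambda>x. X m x - X n x) < e"
  shows "\<exists>g. L2 g \<and> (\<lambda>n. L2_norm (\<lambda>x. X n x - g x)) \<longlonglongrightarrow> 0"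
proof -
  note [measurable] = X[THEN L2_measurable]
  have "\<exists>N. \<forall>m\<ge>N. \<forall>n\<ge>N. L2_norm (\<lambda>x. X m x - X n x) < (1/2)^k" for k
    by (rule Cauchy) simp
  then obtain N where N: "\<And>k m n. m \<ge> N k \<Longrightarrow> n \<ge> N k \<Longrightarrow> L2_norm (\<lambda>x. X m x - X n x) < (1/2)^k"
    by metis
  \<comment> \<open>The partial sums make \<open>r\<close> nondecreasing with
    \<open>r k \<ge> N k\<close>; the summand \<open>k\<close> makes it tend to infinity.\<close>
  define r where "r k = (\<Sum>i\<le>k. N i) + k" for k
  have rN: "r k \<ge> N k" for k
    unfolding r_def using member_le_sum[of k "{..k}" N] by simp
  have r_Suc: "r k \<le> r (Suc k)" "r k \<ge> k" for k by (auto simp: r_def)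
  define Y where "Y k = X (r k)" for k
  have [measurable]: "Y k \<in> borel_measurable lebesgue" for k unfolding Y_def by measurable
  have step: "L2_norm (\<lambda>x. Y (Suc k) x - Y k x) < (1/2)^k" for k
    unfolding Y_def using N[of k "r (Suc k)" "r k"] rN r_Suc order_trans by blast
  \<comment> \<open>The squared steps are below (1/4)^k, so they remain summable after
    multiplication by 2^k.\<close>
  have nn: "(\<integral>\<^sup>+x. ennreal (2^k * (norm (Y (Suc k) x - Y k x))\<^sup>2) \<partial>lebesgue) \<le> ennreal ((1/2)^k)" for k
  proof -
    have L: "L2 (\<lambda>x. Y (Suc k) x - Y k x)" by (simp add: Y_def L2_diff X)
    have "(\<integral>\<^sup>+x. ennreal (2^k * (norm (Y (Suc k) x - Y k x))\<^sup>2) \<partial>lebesgue)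
        = ennreal (\<integral>x. 2^k * (norm (Y (Suc k) x - Y k x))\<^sup>2 \<partial>lebesgue)"
      by (rule nn_integral_eq_integral) (use L2_integrable[OF L] in auto)
    also have "(\<integral>x. 2^k * (norm (Y (Suc k) x - Y k x))\<^sup>2 \<partial>lebesgue) = 2^k * (L2_norm (\<lambda>x. Y (Suc k) x - Y k x))\<^sup>2"
      by (simp add: L2_norm_sq)
    also have "\<dots> \<le> 2^k * ((1/2)^k)\<^sup>2"
      by (intro mult_left_mono power_mono less_imp_le[OF step]) auto
    also have "\<dots> = (1/2)^k" by (simp add: power2_eq_square power_one_over)
    finally show ?thesis by (simp add: ennreal_leI)
  qed
  have "(\<integral>\<^sup>+x. (\<Sum>k. ennreal (2^k * (norm (Y (Suc k) x - Y k x))\<^sup>2)) \<partial>lebesgue)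
      = (\<Sum>k. \<integral>\<^sup>+x. ennreal (2^k * (norm (Y (Suc k) x - Y k x))\<^sup>2) \<partial>lebesgue)"
    by (rule nn_integral_suminf) measurable
  also have "\<dots> \<le> (\<Sum>k. ennreal ((1/2)^k))"
    by (intro suminf_le nn) auto
  also have "\<dots> = ennreal (\<Sum>k. (1/2)^k)"
    by (rule suminf_ennreal2) (auto intro: summable_geometric)
  also have "\<dots> < \<infinity>" by simp
  finally have "AE x in lebesgue. (\<Sum>k. ennreal (2^k * (norm (Y (Suc k) x - Y k x))\<^sup>2)) \<noteq> \<infinity>"
    by (intro nn_integral_noteq_infinite) auto
  then have conv: "AE x in lebesgue. convergent (\<lambda>k. Y k x)"
  proof eventually_elim
    case (elim x)
    have summ: "summable (\<lambda>k. 2^k * (norm (Y (Suc k) x - Y k x))\<^sup>2)"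
      by (rule summable_suminf_not_top) (use elim in auto)
    have "summable (\<lambda>k. norm (Y (Suc k) x - Y k x))"
    proof (rule summable_comparison_test')
      show "summable (\<lambda>k. 2^k * (norm (Y (Suc k) x - Y k x))\<^sup>2 + (1/2)^k)"
        by (intro summable_add summ summable_geometric) simp
      fix k :: nat
      \<comment> \<open>Weighted Young inequality \<open>a \<le> 2^k * a\<^sup>2 + (1/2)^k\<close>:
        summability of the weighted squares gives summability of the steps themselves.\<close>
      define a where "a = norm (Y (Suc k) x - Y k x)"
      have "0 \<le> 2^k * (a - (1/2)^k)\<^sup>2 + 2^k * a\<^sup>2" by simp
      also have "\<dots> = 2 * (2^k * a\<^sup>2) + (1/2)^k - 2 * a"
        by (simp add: power2_diff algebra_simps power2_eq_square power_one_over)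
      finally have "2 * a \<le> 2 * (2^k * a\<^sup>2) + (1/2)^k" by simp
      moreover have "(0::real) \<le> (1/2)^k" by (rule zero_le_power) simp
      ultimately have "a \<le> 2^k * a\<^sup>2 + (1/2)^k" by argo
      then show "norm (norm (Y (Suc k) x - Y k x)) \<le> 2^k * (norm (Y (Suc k) x - Y k x))\<^sup>2 + (1/2)^k"
        by (simp add: a_def)
    qed
    then have "summable (\<lambda>k. Y (Suc k) x - Y k x)" by (rule summable_norm_cancel)
    then have "convergent (\<lambda>n. \<Sum>k<n. Y (Suc k) x - Y k x)" by (simp add: summable_iff_convergent)
    then have "convergent (\<lambda>n. (\<Sum>k<n. Y (Suc k) x - Y k x) + Y 0 x)" by (intro convergent_add convergent_const)
    then show ?case by (simp add: sum_lessThan_telescope[of "\<lambda>k. Y k x"])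
  qed
  define g where "g x = lim (\<lambda>k. Y k x)" for x
  have g [measurable]: "g \<in> borel_measurable lebesgue"
    unfolding g_def by measurable
  have Yg: "AE x in lebesgue. (\<lambda>k. Y k x) \<longlonglongrightarrow> g x"
    using conv by eventually_elim (simp add: g_def convergent_LIMSEQ_iff)
  have close: "L2 (\<lambda>x. X n x - g x) \<and> L2_norm (\<lambda>x. X n x - g x) \<le> (1/2)^k" if n: "n \<ge> N k" for n k
  proof -
    have ae: "AE x in lebesgue. (\<lambda>j. X n x - Y j x) \<longlonglongrightarrow> X n x - g x"
      using Yg by eventually_elim (intro tendsto_intros)
    have "\<forall>\<^sub>F j in sequentially. L2_norm (\<lambda>x. X n x - Y j x) \<le> (1/2)^k"
      using eventually_ge_at_top[of "N k"]
    proof eventually_elim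
      case (elim j)
      then show ?case unfolding Y_def using N[of k n "r j"] n r_Suc(2)[of j] by simp
    qed
    from L2_norm_Fatou[OF _ ae _ this] show ?thesis by (simp add: Y_def L2_diff X)
  qed
  have "L2 (\<lambda>x. X (N 0) x - (X (N 0) x - g x))"
    by (rule L2_diff) (use close[of 0 "N 0"] X in auto)
  then have "L2 g" by simp
  moreover have "(\<lambda>n. L2_norm (\<lambda>x. X n x - g x)) \<longlonglongrightarrow> 0"
  proof (rule LIMSEQ_I)
    fix e :: real assume "e > 0"
    then obtain k where "(1/2)^k < e" using real_arch_pow_inv[of e "1/2"] by auto
    then show "\<exists>no. \<forall>n\<ge>no. norm (L2_norm (\<lambda>x. X n x - g x) - 0) < e"
      using close le_less_trans by (intro exI[of _ "N k"]) force
  qed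
  ultimately show ?thesis by blast
qed

lemma L2_dot_tendsto:
  assumes "\<And>n. L2 (X n)" "L2 f" "L2 h" "((\<lambda>n. L2_norm (\<lambda>x. X n x - f x)) \<longlongrightarrow> 0) F"
  shows "((\<lambda>n. L2_dot (X n) h) \<longlongrightarrow> L2_dot f h) F"
proof (rule Lim_transform[OF tendsto_const])
  have lim: "((\<lambda>n. L2_norm (\<lambda>x. X n x - f x) * L2_norm h) \<longlongrightarrow> 0) F"
    using tendsto_mult_left_zero[OF assms(4)] .
  show "((\<lambda>n. L2_dot (X n) h - L2_dot f h) \<longlongrightarrow> 0) F"
    by (rule Lim_null_comparison[OF _ lim])
       (use L2_Cauchy_Schwarz[OF L2_diff, of _ f h] assms in \<open>simp add: L2.diff_left[symmetric]\<close>)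
qed

lemma L2_norm_tendsto:
  assumes "\<And>n. L2 (X n)" "L2 f" "((\<lambda>n. L2_norm (\<lambda>x. X n x - f x)) \<longlongrightarrow> 0) F"
  shows "((\<lambda>n. L2_norm (X n)) \<longlongrightarrow> L2_norm f) F"
proof (rule Lim_transform[OF tendsto_const])
  show "((\<lambda>n. L2_norm (X n) - L2_norm f) \<longlongrightarrow> 0) F"
    by (rule Lim_null_comparison[OF _ assms(3)]) (use L2_norm_triangle_sub[OF assms(1,2)] in auto)
qed

lemma L2_dominated_convergence:
  fixes X :: "nat \<Rightarrow> 'a::euclidean_space \<Rightarrow> 'b::euclidean_space" and w :: "'a \<Rightarrow> real"
  assumes X: "\<And>n. X n \<in> borel_measurable lebesgue" and f: "f \<in> borel_measurable lebesgue" and w: "L2 w"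
    and lim: "AE x in lebesgue. (\<lambda>n. X n x) \<longlonglongrightarrow> f x"
    and le: "\<And>n. AE x in lebesgue. norm (X n x) \<le> w x" "AE x in lebesgue. norm (f x) \<le> w x"
  shows "(\<lambda>n. L2_norm (\<lambda>x. X n x - f x)) \<longlonglongrightarrow> 0"
proof -
  note [measurable] = X f L2_measurable[OF w]
  have "(\<lambda>n. \<integral>x. (norm (X n x - f x))\<^sup>2 \<partial>lebesgue) \<longlonglongrightarrow> (\<integral>x. 0 \<partial>(lebesgue :: 'a measure))"
  proof (rule integral_dominated_convergence[where w="\<lambda>x. 4 * (norm (w x))\<^sup>2"])
    show "AE x in lebesgue. (\<lambda>n. (norm (X n x - f x))\<^sup>2) \<longlonglongrightarrow> 0"
      using lim
    proof eventually_elim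
      case (elim x)
      have "(\<lambda>n. (norm (X n x - f x))\<^sup>2) \<longlonglongrightarrow> (norm (f x - f x))\<^sup>2"
        by (intro tendsto_intros elim)
      then show ?case by simp
    qed
    show "AE x in lebesgue. norm ((norm (X n x - f x))\<^sup>2) \<le> 4 * (norm (w x))\<^sup>2" for n
      using le(1)[of n] le(2)
    proof eventually_elim
      case (elim x)
      have "norm (X n x - f x) \<le> 2 * w x" using norm_triangle_ineq4[of "X n x" "f x"] elim by linarith
      then have "(norm (X n x - f x))\<^sup>2 \<le> (2 * w x)\<^sup>2" by (intro power_mono) auto
      then show ?case by (simp add: power_mult_distrib)
    qed
  qed (use L2_integrable[OF w] in auto)
  then have "(\<lambda>n. sqrt (\<integral>x. (norm (X n x - f x))\<^sup>2 \<partial>lebesgue)) \<longlonglongrightarrow> sqrt 0"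
    by (intro tendsto_real_sqrt) simp
  then show ?thesis by (simp add: L2_norm_def)
qed

lemma tendsto_L1_dominated:
  fixes X :: "nat \<Rightarrow> 'a::euclidean_space \<Rightarrow> 'b::euclidean_space" and w :: "'a \<Rightarrow> real"
  assumes X: "\<And>n. X n \<in> borel_measurable lebesgue" and f: "f \<in> borel_measurable lebesgue"
    and w: "integrable lebesgue w"
    and lim: "AE x in lebesgue. (\<lambda>n. X n x) \<longlonglongrightarrow> f x"
    and le: "\<And>n. AE x in lebesgue. norm (X n x) \<le> w x" "AE x in lebesgue. norm (f x) \<le> w x"
  shows "(\<lambda>n. \<integral>x. norm (X n x - f x) \<partial>lebesgue) \<longlonglongrightarrow> 0"
proof -
  note [measurable] = X f
  have "(\<lambda>n. \<integral>x. norm (X n x - f x) \<partial>lebesgue) \<longlonglongrightarrow> (\<integral>x. 0 \<partial>(lebesgue :: 'a measure))"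
  proof (rule integral_dominated_convergence[where w="\<lambda>x. 2 * w x"])
    show "AE x in lebesgue. (\<lambda>n. norm (X n x - f x)) \<longlonglongrightarrow> 0"
      using lim
    proof eventually_elim
      case (elim x)
      have "(\<lambda>n. norm (X n x - f x)) \<longlonglongrightarrow> norm (f x - f x)" by (intro tendsto_intros elim)
      then show ?case by simp
    qed
    show "AE x in lebesgue. norm (norm (X n x - f x)) \<le> 2 * w x" for n
      using le(1)[of n] le(2)
    proof eventually_elim
      case (elim x)
      show ?case using norm_triangle_ineq4[of "X n x" "f x"] elim by simp
    qed
  qed (use w in auto)
  then show ?thesis by simp
qed

section \<open>Density of continuous functions with compact support\<close>

definition Cc :: "('a::euclidean_space \<Rightarrow> 'b::euclidean_space) \<Rightarrow> bool" where
  "Cc g \<longleftrightarrow> continuous_on UNIV g \<and> (\<exists>R. \<forall>x. norm x > R \<longrightarrow> g x = 0)"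

lemma continuous_measurable_lebesgue:
  fixes g :: "'a::euclidean_space \<Rightarrow> 'b::topological_space"
  shows "continuous_on UNIV g \<Longrightarrow> g \<in> borel_measurable lebesgue"
  by (intro measurable_completion) (simp add: borel_measurable_continuous_onI)

lemma ident_measurable_lebesgue: "(\<lambda>x::'a::euclidean_space. x) \<in> borel_measurable lebesgue"
  by (rule continuous_measurable_lebesgue) (rule continuous_on_id)

lemma indicator_ball_integrable:
  "integrable lebesgue (\<lambda>x::'a::euclidean_space. indicat_real (cball 0 R) x * C)"
  using emeasure_bounded_finite[OF bounded_cball[of "0::'a" R]]
  by (intro integrable_mult_left integrable_real_indicator) auto

lemma L2_indicator_ball: "L2 (\<lambda>x::'a::euclidean_space. indicat_real (cball 0 R) x * C)"
proof -
  have "(\<lambda>x::'a. (norm (indicat_real (cball 0 R) x * C))\<^sup>2) = (\<lambda>x. indicat_real (cball 0 R) x * C\<^sup>2)"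
    by (auto simp: indicator_def fun_eq_iff)
  then show ?thesis
    using indicator_ball_integrable[of R "C\<^sup>2"] indicator_ball_integrable[of R C] by (auto simp: L2_def)
qed

lemma Cc_bounded:
  fixes g :: "'a::euclidean_space \<Rightarrow> 'b::euclidean_space"
  assumes "Cc g"
  obtains R M where "\<And>x. norm (g x) \<le> indicat_real (cball 0 R) x * M" "M \<ge> 0" "\<And>x. norm (g x) \<le> M"
proof -
  obtain R where R: "\<And>x. norm x > R \<Longrightarrow> g x = 0" using assms by (auto simp: Cc_def)
  have "compact (g ` cball 0 R)"
    using assms continuous_on_subset by (intro compact_continuous_image) (auto simp: Cc_def)
  then have "bounded (g ` cball 0 R)" by (rule compact_imp_bounded)
  then obtain M where M: "\<And>x. x \<in> cball 0 R \<Longrightarrow> norm (g x) \<le> M"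
    unfolding bounded_iff by blast
  have 1: "norm (g x) \<le> indicat_real (cball 0 R) x * max M 0" for x
    using M[of x] R[of x] by (cases "norm x \<le> R") (auto simp: indicator_def)
  moreover have "norm (g x) \<le> max M 0" for x
    using M[of x] R[of x] by (cases "norm x \<le> R") auto
  ultimately show ?thesis using that[of R "max M 0"] by simp
qed

lemma Cc_measurable: "Cc g \<Longrightarrow> g \<in> borel_measurable lebesgue"
  by (simp add: Cc_def continuous_measurable_lebesgue)

lemma Cc_L2: 
  assumes "Cc g" shows "L2 g"
proof -
  obtain R M where "\<And>x. norm (g x) \<le> indicat_real (cball 0 R) x * M" "M \<ge> 0"
    using Cc_bounded[OF assms] by metis
  then show ?thesis
    by (intro L2_dominated[OF Cc_measurable[OF assms] L2_indicator_ball[of R M], of 1]) auto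
qed

lemma Cc_integrable: 
  assumes "Cc g" shows "integrable lebesgue g"
proof -
  obtain R M where "\<And>x. norm (g x) \<le> indicat_real (cball 0 R) x * M" "M \<ge> 0"
    using Cc_bounded[OF assms] by metis
  then show ?thesis
    by (intro Bochner_Integration.integrable_bound[OF indicator_ball_integrable[of R M] Cc_measurable[OF assms]]) auto
qed

text \<open>Measurability supplies continuous functions that converge to \<open>f\<close> off a null
  set. Composing with the radial retraction \<open>c\<close> onto the ball of radius
  \<open>M\<close> and multiplying by \<open>cut\<close>, which is 1 up to radius \<open>R\<close>
  and 0 beyond \<open>R + 1\<close>, yields a common integrable bound without changing the
  limit.\<close>

lemma Cc_approx_seq:
  fixes f :: "'a::euclidean_space \<Rightarrow> 'b::euclidean_space"
  assumes f: "f \<in> borel_measurable lebesgue" and R: "\<And>x. norm x > R \<Longrightarrow> f x = 0" 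
    and M: "\<And>x. norm (f x) \<le> M" "M > 0"
  obtains X where "\<And>n::nat. Cc (X n)" "AE x in lebesgue. (\<lambda>n. X n x) \<longlonglongrightarrow> f x"
    "\<And>n x. norm (X n x) \<le> indicat_real (cball 0 (R + 1)) x * M"
    "\<And>x. norm (f x) \<le> indicat_real (cball 0 (R + 1)) x * M"
proof -
  have "f measurable_on UNIV"
    using f lebesgue_measurable_imp_measurable_on[of f UNIV] by simp
  then obtain N g where N: "negligible N" and g: "\<And>n::nat. continuous_on UNIV (g n)"
    and lim: "\<And>x. x \<notin> N \<Longrightarrow> (\<lambda>n. g n x) \<longlonglongrightarrow> f x"
    by (auto simp: measurable_on_def)
  define c where "c z = (M / max M (norm z)) *\<^sub>R z" for z :: 'b
  define cut where "cut x = max 0 (min 1 (R + 1 - norm x))" for x :: 'a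
  define X where "X n x = cut x *\<^sub>R c (g n x)" for n x
  have cont_c: "continuous_on UNIV c"
    unfolding c_def using M(2) by (intro continuous_intros) auto
  have cM: "norm (c z) \<le> M" for z
    using M(2) by (auto simp: c_def max_def field_simps)
  have cont_cut: "continuous_on UNIV cut"
    unfolding cut_def by (intro continuous_intros)
  have "Cc (X n)" for n
    unfolding Cc_def
  proof
    show "continuous_on UNIV (X n)"
      unfolding X_def using continuous_on_compose2[OF cont_c g[of n]] cont_cut
      by (intro continuous_intros) auto
    show "\<exists>R. \<forall>x. norm x > R \<longrightarrow> X n x = 0"
      by (intro exI[of _ "R+1"]) (auto simp: X_def cut_def)
  qed
  moreover have "AE x in lebesgue. (\<lambda>n. X n x) \<longlonglongrightarrow> f x"
  proof (rule AE_I')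
    show "N \<in> null_sets lebesgue" using N negligible_iff_null_sets by blast
    have "(\<lambda>n. X n x) \<longlonglongrightarrow> f x" if "x \<notin> N" for x
    proof -
      have "isCont c (f x)" using cont_c by (simp add: continuous_on_eq_continuous_at)
      from isCont_tendsto_compose[OF this lim[OF that]]
      have "(\<lambda>n. X n x) \<longlonglongrightarrow> cut x *\<^sub>R c (f x)" unfolding X_def by (intro tendsto_intros)
      moreover have "c (f x) = f x" using M(1)[of x] M(2) by (simp add: c_def max_def)
      moreover have "cut x *\<^sub>R f x = f x" using R[of x] by (cases "norm x > R") (auto simp: cut_def)
      ultimately show ?thesis by simp
    qed
    then show "{x \<in> space lebesgue. \<not> (\<lambda>n. X n x) \<longlonglongrightarrow> f x} \<subseteq> N" by auto
  qed
  moreover have "norm (X n x) \<le> indicat_real (cball 0 (R + 1)) x * M" for n x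
  proof (cases "norm x \<le> R + 1")
    case True
    have "cut x * norm (c (g n x)) \<le> 1 * M"
      by (intro mult_mono cM) (auto simp: cut_def)
    then show ?thesis using True by (simp add: X_def cut_def)
  qed (auto simp: X_def cut_def)
  moreover have "norm (f x) \<le> indicat_real (cball 0 (R + 1)) x * M" for x
    using R[of x] M(1)[of x] by (cases "norm x \<le> R + 1") auto
  ultimately show ?thesis using that by blast
qed

text \<open>One approximant must work in both norms: in \<open>plancherel_L1\<close>, closeness in
  L1 controls the Fourier integrals uniformly and closeness in L2 controls their norms.\<close>

lemma Cc_dense:
  fixes f :: "'a::euclidean_space \<Rightarrow> 'b::euclidean_space"
  assumes f: "L2 f" "integrable lebesgue f" and e: "e > 0"
  shows "\<exists>g. Cc g \<and> L2_norm (\<lambda>x. f x - g x) < e \<and> (\<integral>x. norm (f x - g x) \<partial>lebesgue) < e"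
proof -
  note [measurable] = L2_measurable[OF f(1)] ident_measurable_lebesgue
  define T where "T k x = (if norm x \<le> real k \<and> norm (f x) \<le> real k then f x else 0)" for k x
  have [measurable]: "T k \<in> borel_measurable lebesgue" for k
    unfolding T_def by measurable
  have nT: "norm (T k x) \<le> norm (f x)" for k x by (simp add: T_def)
  have Tlim: "(\<lambda>k. T k x) \<longlonglongrightarrow> f x" for x
  proof (rule tendsto_eventually)
    obtain K :: nat where "norm x + norm (f x) \<le> K" using real_arch_simple by blast
    then show "\<forall>\<^sub>F k in sequentially. T k x = f x"
      using norm_ge_zero[of x] norm_ge_zero[of "f x"]
      by (intro eventually_sequentiallyI[of K]) (auto simp: T_def simp del: norm_ge_zero)
  qed
  have L2n: "L2 (\<lambda>x. norm (f x))"
    by (rule L2_dominated[OF _ f(1), of _ 1]) auto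
  have T1: "(\<lambda>k. L2_norm (\<lambda>x. T k x - f x)) \<longlonglongrightarrow> 0"
    by (rule L2_dominated_convergence[OF _ _ L2n]) (use Tlim nT in auto)
  have T2: "(\<lambda>k. \<integral>x. norm (T k x - f x) \<partial>lebesgue) \<longlonglongrightarrow> 0"
    by (rule tendsto_L1_dominated[where w="\<lambda>x. norm (f x)"]) (use Tlim nT f in auto)
  have "\<forall>\<^sub>F k in sequentially. L2_norm (\<lambda>x. T k x - f x) < e/2 \<and> (\<integral>x. norm (T k x - f x) \<partial>lebesgue) < e/2"
    by (intro eventually_conj order_tendstoD[OF T1] order_tendstoD[OF T2]) (use e in auto)
  then obtain k where k: "L2_norm (\<lambda>x. T k x - f x) < e/2" "(\<integral>x. norm (T k x - f x) \<partial>lebesgue) < e/2"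
    by (auto dest: eventually_happens'[OF sequentially_bot])
  obtain X where X: "\<And>n::nat. Cc (X n)" and Xlim: "AE x in lebesgue. (\<lambda>n. X n x) \<longlonglongrightarrow> T k x"
    and Xle: "\<And>n x. norm (X n x) \<le> indicat_real (cball 0 (real k + 1)) x * (real k + 1)"
    and Tle: "\<And>x. norm (T k x) \<le> indicat_real (cball 0 (real k + 1)) x * (real k + 1)"
    by (rule Cc_approx_seq[of "T k" "real k" "real k + 1"]) (auto simp: T_def)
  note [measurable] = X[THEN Cc_measurable]
  have X1: "(\<lambda>n. L2_norm (\<lambda>x. X n x - T k x)) \<longlonglongrightarrow> 0"
    by (rule L2_dominated_convergence[OF _ _ L2_indicator_ball]) (use Xlim Xle Tle in auto)
  have X2: "(\<lambda>n. \<integral>x. norm (X n x - T k x) \<partial>lebesgue) \<longlonglongrightarrow> 0"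
    by (rule tendsto_L1_dominated[OF _ _ indicator_ball_integrable]) (use Xlim Xle Tle in auto)
  have "\<forall>\<^sub>F n in sequentially. L2_norm (\<lambda>x. X n x - T k x) < e/2 \<and> (\<integral>x. norm (X n x - T k x) \<partial>lebesgue) < e/2"
    by (intro eventually_conj order_tendstoD[OF X1] order_tendstoD[OF X2]) (use e in auto)
  then obtain n where n: "L2_norm (\<lambda>x. X n x - T k x) < e/2" "(\<integral>x. norm (X n x - T k x) \<partial>lebesgue) < e/2"
    by (auto dest: eventually_happens'[OF sequentially_bot])
  have L2T: "L2 (T k)"
    by (rule L2_dominated[OF _ f(1), of _ 1]) (use nT in auto)
  have intT: "integrable lebesgue (T k)"
    by (rule Bochner_Integration.integrable_bound[OF f(2)]) (use nT in auto)
  have "L2_norm (\<lambda>x. f x - X n x) < e"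
    using L2_norm_triangle_mid[of f "X n" "T k"] L2_norm_minus_commute[of f "T k"]
      L2_norm_minus_commute[of "T k" "X n"] n k f L2T Cc_L2[OF X] by fastforce
  moreover have "(\<integral>x. norm (f x - X n x) \<partial>lebesgue) \<le>
      (\<integral>x. norm (X n x - T k x) + norm (T k x - f x) \<partial>lebesgue)"
  proof (rule integral_mono)
    fix x
    have "f x - X n x = - ((X n x - T k x) + (T k x - f x))" by simp
    then show "norm (f x - X n x) \<le> norm (X n x - T k x) + norm (T k x - f x)"
      by (metis norm_minus_cancel norm_triangle_ineq)
  qed (use f intT Cc_integrable[OF X] in auto)
  moreover have "\<dots> < e"
    using n(2) k(2) f intT Cc_integrable[OF X] by (subst Bochner_Integration.integral_add) auto
  ultimately show ?thesis using X by fastforce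
qed

section \<open>The Fourier integral\<close>

global_interpretation lebesgue: sigma_finite_measure "lebesgue :: 'a::euclidean_space measure"
proof
  obtain A :: "nat \<Rightarrow> 'a set" where A: "range A \<subseteq> sets lborel" "(\<Union>i. A i) = space lborel"
    "\<And>i. emeasure lborel (A i) \<noteq> \<infinity>"
    by (rule lborel.sigma_finite) auto
  show "\<exists>A. countable A \<and> A \<subseteq> sets lebesgue \<and> \<Union> A = space (lebesgue :: 'a measure) \<and> (\<forall>a\<in>A. emeasure lebesgue a \<noteq> \<infinity>)"
    using A by (intro exI[of _ "range A"]) auto
qed

global_interpretation lebesgue_pair:
  pair_sigma_finite "lebesgue :: 'a::euclidean_space measure" "lebesgue :: 'b::euclidean_space measure" ..

lemma fst_measurable_lebesgue [measurable]:
    "fst \<in> borel_measurable ((lebesgue :: 'a::euclidean_space measure) \<Otimes>\<^sub>M N)"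
  using measurable_compose[OF measurable_fst ident_measurable_lebesgue] .

lemma snd_measurable_lebesgue [measurable]:
    "snd \<in> borel_measurable (N \<Otimes>\<^sub>M (lebesgue :: 'a::euclidean_space measure))"
  using measurable_compose[OF measurable_snd ident_measurable_lebesgue] .

lemma cis_measurable [measurable]: "cis \<in> borel_measurable borel"
  by (intro borel_measurable_continuous_onI continuous_intros) 

lemma inner_measurable_lebesgue:
    "(\<lambda>x. x \<bullet> y) \<in> borel_measurable (lebesgue :: 'a::euclidean_space measure)"
    "(\<lambda>x. y \<bullet> x) \<in> borel_measurable (lebesgue :: 'a::euclidean_space measure)"
  by (intro continuous_measurable_lebesgue continuous_intros)+

lemma cis_sum: "finite I \<Longrightarrow> cis (\<Sum>i\<in>I. f i) = (\<Prod>i\<in>I. cis (f i))"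
  by (induction I rule: finite_induct) (auto simp flip: cis_mult)

lemma integrable_cis_mult:
  assumes "integrable M f" "h \<in> borel_measurable M"
  shows "integrable M (\<lambda>x. cis (h x) * f x)"
  by (rule Bochner_Integration.integrable_bound[OF assms(1)]) (use assms in \<open>auto simp: norm_mult\<close>)

lemma cis_inner_measurable: "(\<lambda>x. cis (- (x \<bullet> y))) \<in> borel_measurable (lebesgue :: 'a::euclidean_space measure)"
  by (intro continuous_measurable_lebesgue continuous_intros)

lemma integrable_cis_inner:
  "integrable lebesgue f \<Longrightarrow> integrable lebesgue (\<lambda>x. cis (- (x \<bullet> y)) * f x)"
  by (rule integrable_cis_mult) (auto intro: borel_measurable_uminus inner_measurable_lebesgue)

lemma integrable_lebesgue_mult_pair:
  fixes f :: "'a::euclidean_space \<Rightarrow> 'c::{real_normed_field,banach,second_countable_topology}"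
    and g :: "'b::euclidean_space \<Rightarrow> 'c"
  assumes [measurable]: "integrable lebesgue f" "integrable lebesgue g"
  shows "integrable (lebesgue \<Otimes>\<^sub>M lebesgue) (\<lambda>p. f (fst p) * g (snd p))"
proof (rule lebesgue_pair.Fubini_integrable)
  show "integrable lebesgue (\<lambda>x. \<integral>y. norm (f (fst (x, y)) * g (snd (x, y))) \<partial>lebesgue)"
    using assms by (simp add: norm_mult)
qed (use assms in auto)

lemma integrable_lebesgue_pair_bound:
  fixes f :: "'a::euclidean_space \<Rightarrow> 'c::{real_normed_field,banach,second_countable_topology}"
    and g :: "'b::euclidean_space \<Rightarrow> 'c"
    and h :: "'a \<times> 'b \<Rightarrow> 'd::{banach,second_countable_topology}"
  assumes "integrable lebesgue f" "integrable lebesgue g" "h \<in> borel_measurable (lebesgue \<Otimes>\<^sub>M lebesgue)"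
    "\<And>x y. norm (h (x, y)) \<le> norm (f x) * norm (g y)"
  shows "integrable (lebesgue \<Otimes>\<^sub>M lebesgue) h"
  by (rule Bochner_Integration.integrable_bound[OF integrable_lebesgue_mult_pair[OF assms(1,2)] assms(3)])
    (use assms(4) in \<open>auto simp: norm_mult\<close>)

text \<open>Fubini in coordinates; it reduces the Gaussian integrals and
  \<open>japanese_integrable\<close> to dimension one.\<close>

lemma lborel_prod:
  fixes f :: "'a::euclidean_space \<Rightarrow> real \<Rightarrow> 'c::{real_normed_field,banach,second_countable_topology}"
  assumes f: "\<And>b. b \<in> Basis \<Longrightarrow> integrable lborel (f b)"
  shows "integrable lborel (\<lambda>x. \<Prod>b\<in>Basis. f b (x \<bullet> b))"
    and "(\<integral>x. (\<Prod>b\<in>Basis. f b (x \<bullet> b)) \<partial>lborel) = (\<Prod>b\<in>Basis. (\<integral>x. f b x \<partial>lborel))"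
proof -
  note [measurable] = f[THEN borel_measurable_integrable]
  interpret P: product_sigma_finite "\<lambda>_::'a. lborel :: real measure" ..
  have m: "(\<lambda>x. \<Prod>b\<in>Basis. f b (x \<bullet> b)) \<in> borel_measurable borel" by measurable
  have g [measurable]: "(\<lambda>f. \<Sum>b\<in>Basis. f b *\<^sub>R (b::'a)) \<in> borel_measurable (\<Pi>\<^sub>M b\<in>Basis. lborel)"
    by measurable
  have eq: "(\<Prod>b\<in>Basis. f b ((\<Sum>b'\<in>Basis. y b' *\<^sub>R b') \<bullet> b)) = (\<Prod>b\<in>Basis. f b (y b))" for y
    by (rule prod.cong) auto
  show "integrable lborel (\<lambda>x. \<Prod>b\<in>Basis. f b (x \<bullet> b))"
    unfolding lborel_eq[where 'a='a]
    by (subst integrable_distr_eq[OF g m]) (simp add: eq P.product_integrable_prod f)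
  show "(\<integral>x. (\<Prod>b\<in>Basis. f b (x \<bullet> b)) \<partial>lborel) = (\<Prod>b\<in>Basis. (\<integral>x. f b x \<partial>lborel))"
    unfolding lborel_eq[where 'a='a]
    by (subst integral_distr[OF g m]) (simp add: eq P.product_integral_prod f)
qed

text \<open>After rescaling, this is the characteristic function of the standard normal
  distribution.\<close>

lemma gauss_char_real:
  assumes a: "a > 0"
  shows "integrable lborel (\<lambda>x. cis (- (x * t)) * complex_of_real (exp (- (a * x\<^sup>2))))"
    and "(\<integral>x. cis (- (x * t)) * complex_of_real (exp (- (a * x\<^sup>2))) \<partial>lborel) =
      complex_of_real (sqrt (pi / a) * exp (- (t\<^sup>2 / (4 * a))))"
proof -
  \<comment> \<open>The scale for which \<open>a * (c * x)\<^sup>2\<close> is the normal exponent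
    \<open>x\<^sup>2 / 2\<close>.\<close>
  define c where "c = 1 / sqrt (2 * a)"
  have c: "c > 0" "c\<^sup>2 = 1 / (2 * a)" using a by (auto simp: c_def power_divide)
  let ?F = "\<lambda>x. cis (- (x * t)) * complex_of_real (exp (- (a * x\<^sup>2)))"
  have eq: "?F (0 + c * x) = sqrt (2 * pi) *\<^sub>R (std_normal_density x *\<^sub>R iexp (- c * t * x))" for x
  proof -
    have "a * (c * x)\<^sup>2 = x\<^sup>2 / 2" using a c(2) by (simp add: power_mult_distrib)
    then show ?thesis
      by (simp add: std_normal_density_def cis_conv_exp scaleR_conv_of_real mult_ac) 
  qed
  interpret N: prob_space std_normal_distribution by (rule prob_space_normal_density) simp
  have "integrable std_normal_distribution (\<lambda>x. iexp (- c * t * x))"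
    by (rule N.integrable_iexp) auto
  then have int: "integrable lborel (\<lambda>x. std_normal_density x *\<^sub>R iexp (- c * t * x))"
    by (subst (asm) integrable_density) (auto simp: normal_density_nonneg)
  then have "integrable lborel (\<lambda>x. ?F (0 + c * x))" unfolding eq by (rule integrable_scaleR_right)
  then show "integrable lborel ?F"
    using c(1) by (subst (asm) lborel_integrable_real_affine_iff) auto
  have "(\<integral>x. std_normal_density x *\<^sub>R iexp (- c * t * x) \<partial>lborel) = char std_normal_distribution (- c * t)"
    unfolding char_def by (subst integral_density) (auto simp: normal_density_nonneg)
  also have "\<dots> = complex_of_real (exp (- ((c * t)\<^sup>2) / 2))"
    by (simp add: char_std_normal_distribution)
  finally have *: "(\<integral>x. std_normal_density x *\<^sub>R iexp (- c * t * x) \<partial>lborel) = complex_of_real (exp (- ((c * t)\<^sup>2) / 2))" .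
  have "(\<integral>x. ?F x \<partial>lborel) = c *\<^sub>R (\<integral>x. ?F (0 + c * x) \<partial>lborel)"
    using c(1) by (subst lborel_integral_real_affine[of c _ 0]) auto
  also have "\<dots> = c *\<^sub>R (sqrt (2 * pi) *\<^sub>R complex_of_real (exp (- ((c * t)\<^sup>2) / 2)))"
    unfolding eq by (subst integral_scaleR_right) (simp only: *)
  also have "\<dots> = complex_of_real (c * sqrt (2 * pi) * exp (- ((c * t)\<^sup>2) / 2))"
    by (simp add: scaleR_conv_of_real)
  also have "c * sqrt (2 * pi) = sqrt (pi / a)"
    by (simp add: c_def real_sqrt_mult real_sqrt_divide)
  also have "(c * t)\<^sup>2 / 2 = t\<^sup>2 / (4 * a)" by (simp add: power_mult_distrib c)
  then have "- ((c * t)\<^sup>2) / 2 = - (t\<^sup>2 / (4 * a))" by simp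
  finally show "(\<integral>x. ?F x \<partial>lborel) = complex_of_real (sqrt (pi / a) * exp (- (t\<^sup>2 / (4 * a))))" .
qed

definition gauss :: "real \<Rightarrow> 'a::euclidean_space \<Rightarrow> real" where
  "gauss a x = exp (- (a * (norm x)\<^sup>2))"

text \<open>The Fourier transform of \<open>gauss a\<close>. As a function of the time
  \<open>a\<close> it is (2 pi)^n times the heat kernel, which is how it is used in the unique
  continuation argument.\<close>

definition gauss_hat :: "real \<Rightarrow> 'a::euclidean_space \<Rightarrow> real" where
  "gauss_hat a \<xi> = sqrt (pi / a) ^ DIM('a) * exp (- ((norm \<xi>)\<^sup>2 / (4 * a)))"

lemma norm_sq_Basis: "(norm (x::'a::euclidean_space))\<^sup>2 = (\<Sum>b\<in>Basis. (x \<bullet> b)\<^sup>2)"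
  by (subst power2_norm_eq_inner, subst euclidean_inner) (simp add: power2_eq_square)

lemma gauss_prod: "gauss a x = (\<Prod>b\<in>Basis. exp (- (a * (x \<bullet> b)\<^sup>2)))"
  by (simp add: gauss_def norm_sq_Basis sum_distrib_left exp_sum flip: sum_negf)

lemma gauss_continuous [continuous_intros]: "continuous_on S (gauss a)"
  unfolding gauss_def by (intro continuous_intros)

lemma gauss_measurable [measurable]: "gauss a \<in> borel_measurable borel"
  by (intro borel_measurable_continuous_onI gauss_continuous)

lemma gauss_nonneg [simp]: "0 \<le> gauss a x" and gauss_le_1: "a \<ge> 0 \<Longrightarrow> gauss a x \<le> 1"
  by (auto simp: gauss_def)

lemma gauss_hat_measurable [measurable]: "gauss_hat a \<in> borel_measurable borel"
  unfolding gauss_hat_def divide_inverse by (intro borel_measurable_continuous_onI continuous_intros)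

lemma integral_lebesgue_lborel:
  fixes f :: "'a::euclidean_space \<Rightarrow> 'b::{banach,second_countable_topology}"
  shows "f \<in> borel_measurable borel \<Longrightarrow> (\<integral>x. f x \<partial>lebesgue) = (\<integral>x. f x \<partial>lborel)"
  and "f \<in> borel_measurable borel \<Longrightarrow> integrable lebesgue f \<longleftrightarrow> integrable lborel f"
  by (auto intro: integral_completion simp: integrable_completion)

lemma gauss_integrable:
  assumes a: "a > 0" shows "integrable lebesgue (gauss a :: 'a::euclidean_space \<Rightarrow> real)"
proof -
  have "integrable lborel (\<lambda>x. cis (- (x * 0)) * complex_of_real (exp (- (a * x\<^sup>2))))"
    using gauss_char_real(1)[OF a, of 0] .
  then have "integrable lborel (\<lambda>x. complex_of_real (exp (- (a * x\<^sup>2))))" by simp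
  then have "integrable lborel (\<lambda>x. exp (- (a * x\<^sup>2)))" by (simp only: complex_of_real_integrable_eq)
  from lborel_prod(1)[of "\<lambda>_. \<lambda>x. exp (- (a * x\<^sup>2))", OF this]
  have "integrable lborel (gauss a :: 'a \<Rightarrow> real)" by (simp add: gauss_prod[abs_def])
  then show ?thesis by (subst integral_lebesgue_lborel(2)) auto
qed

lemma fourier_integral_gauss:
  assumes a: "a > 0"
  shows "fourier_integral (\<lambda>x. complex_of_real (gauss a x)) (\<xi>::'a::euclidean_space) = of_real (gauss_hat a \<xi>)"
proof -
  let ?f = "\<lambda>b x. cis (- (x * (\<xi> \<bullet> b))) * complex_of_real (exp (- (a * x\<^sup>2)))"
  have eq: "cis (- (x \<bullet> \<xi>)) * complex_of_real (gauss a x) = (\<Prod>b\<in>Basis. ?f b (x \<bullet> b))" for x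
    by (simp add: gauss_prod prod.distrib euclidean_inner[of x \<xi>] cis_sum flip: sum_negf)
  have "fourier_integral (\<lambda>x. complex_of_real (gauss a x)) \<xi> = (\<integral>x. (\<Prod>b\<in>Basis. ?f b (x \<bullet> b)) \<partial>lborel)"
    unfolding fourier_integral_def eq by (subst integral_lebesgue_lborel(1)) auto
  also have "\<dots> = (\<Prod>b\<in>Basis. complex_of_real (sqrt (pi / a) * exp (- ((\<xi> \<bullet> b)\<^sup>2 / (4 * a)))))"
    by (subst lborel_prod(2)) (use gauss_char_real[OF a] in auto)
  also have "\<dots> = of_real (gauss_hat a \<xi>)"
    by (simp add: gauss_hat_def prod.distrib norm_sq_Basis exp_sum sum_divide_distrib flip: of_real_prod sum_negf)
  finally show ?thesis .
qed

lemma gauss_integral: "a > 0 \<Longrightarrow> (\<integral>x. gauss a x \<partial>(lebesgue :: 'a::euclidean_space measure)) = sqrt (pi / a) ^ DIM('a)"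
  using fourier_integral_gauss[of a "0::'a"]
  by (simp add: fourier_integral_def gauss_hat_def cis_zero flip: of_real_power)

lemma fourier_integral_bound: "integrable lebesgue f \<Longrightarrow> norm (fourier_integral f \<xi>) \<le> (\<integral>x. norm (f x) \<partial>lebesgue)"
  unfolding fourier_integral_def
  using integral_norm_bound[of lebesgue "\<lambda>x. cis (- (x \<bullet> \<xi>)) * f x"] by (simp add: norm_mult)

lemma fourier_integral_lin:
  assumes "integrable lebesgue f" "integrable lebesgue g"
  shows "fourier_integral (\<lambda>x. a * f x + b * g x) \<xi> = a * fourier_integral f \<xi> + b * fourier_integral g \<xi>"
proof -
  have "fourier_integral (\<lambda>x. a * f x + b * g x) \<xi> =
      (\<integral>x. a * (cis (- (x \<bullet> \<xi>)) * f x) + b * (cis (- (x \<bullet> \<xi>)) * g x) \<partial>lebesgue)"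
    unfolding fourier_integral_def by (simp add: algebra_simps)
  also have "\<dots> = (\<integral>x. a * (cis (- (x \<bullet> \<xi>)) * f x) \<partial>lebesgue) + (\<integral>x. b * (cis (- (x \<bullet> \<xi>)) * g x) \<partial>lebesgue)"
    by (rule Bochner_Integration.integral_add; rule integrable_mult_right; rule integrable_cis_inner; rule assms)
  finally show ?thesis by (simp add: fourier_integral_def)
qed

lemma fourier_integral_diff:
  assumes "integrable lebesgue f" "integrable lebesgue g"
  shows "fourier_integral (\<lambda>x. f x - g x) \<xi> = fourier_integral f \<xi> - fourier_integral g \<xi>"
  using fourier_integral_lin[OF assms, of 1 "-1"] by simp

lemma fourier_integral_continuous:
  assumes f: "integrable lebesgue f"
  shows "continuous_on UNIV (fourier_integral f)"
proof -
  have "(fourier_integral f \<longlongrightarrow> fourier_integral f a) (at a)" for a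
    unfolding fourier_integral_def tendsto_at_iff_sequentially comp_def
  proof (intro allI impI)
    note [measurable] = cis_inner_measurable
    fix X assume X: "\<forall>i. X i \<in> UNIV - {a}" "X \<longlonglongrightarrow> a"
    show "(\<lambda>i. \<integral>x. cis (- (x \<bullet> X i)) * f x \<partial>lebesgue) \<longlonglongrightarrow> (\<integral>x. cis (- (x \<bullet> a)) * f x \<partial>lebesgue)"
      by (rule integral_dominated_convergence[where w="\<lambda>x. norm (f x)"])
        (use f X in \<open>auto simp: norm_mult intro!: tendsto_intros\<close>)
  qed
  then show ?thesis by (simp add: continuous_on_def)
qed

lemma fourier_integral_measurable: "integrable lebesgue f \<Longrightarrow> fourier_integral f \<in> borel_measurable borel"
  by (intro borel_measurable_continuous_onI fourier_integral_continuous)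

lemma fourier_integral_measurable_lebesgue:
    "integrable lebesgue f \<Longrightarrow> fourier_integral f \<in> borel_measurable lebesgue"
  by (intro measurable_completion) (simp add: fourier_integral_measurable)

section \<open>The multiplication formula and Plancherel's theorem\<close>

lemma fourier_multiplication:
  fixes f g :: "'a::euclidean_space \<Rightarrow> complex"
  assumes f: "integrable lebesgue f" and g: "integrable lebesgue g"
  shows "(\<integral>\<xi>. fourier_integral f \<xi> * g \<xi> \<partial>lebesgue) = (\<integral>x. f x * fourier_integral g x \<partial>lebesgue)"
proof -
  note [measurable] = f g
  let ?h = "\<lambda>p. cis (- (fst p \<bullet> snd p)) * f (fst p) * g (snd p)"
  have "integrable (lebesgue \<Otimes>\<^sub>M lebesgue) ?h"
    by (rule integrable_lebesgue_pair_bound[OF f g]) (auto simp: norm_mult)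
  then have eq: "(\<integral>y. (\<integral>x. ?h (x, y) \<partial>lebesgue) \<partial>lebesgue) = (\<integral>x. (\<integral>y. ?h (x, y) \<partial>lebesgue) \<partial>lebesgue)"
    using lebesgue_pair.Fubini_integral[of "\<lambda>x y. ?h (x, y)"] by (simp add: case_prod_beta')
  have 1: "(\<integral>x. ?h (x, y) \<partial>lebesgue) = fourier_integral f y * g y" for y
    unfolding fourier_integral_def fst_conv snd_conv by (rule integral_mult_left_zero)
  have 2: "(\<integral>y. ?h (x, y) \<partial>lebesgue) = f x * fourier_integral g x" for x
  proof -
    have "(\<integral>y. ?h (x, y) \<partial>lebesgue) = (\<integral>y. f x * (cis (- (y \<bullet> x)) * g y) \<partial>lebesgue)"
      by (simp add: mult_ac inner_commute)
    also have "\<dots> = f x * fourier_integral g x"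
      unfolding fourier_integral_def by (rule integral_mult_right_zero)
    finally show ?thesis .
  qed
  show ?thesis using eq unfolding 1 2 .
qed

text \<open>The multiplication formula with a modulated Gaussian, whose transform is a translated
  \<open>gauss_hat a\<close>. It is an inversion formula regularised by the heat kernel.\<close>

lemma fourier_gauss_inverse:
  fixes f :: "'a::euclidean_space \<Rightarrow> complex"
  assumes f: "integrable lebesgue f" and a: "a > 0"
  shows "(\<integral>\<xi>. cis (\<xi> \<bullet> y) * (of_real (gauss a \<xi>) * fourier_integral f \<xi>) \<partial>lebesgue) =
      (\<integral>x. f x * of_real (gauss_hat a (x - y)) \<partial>lebesgue)"
proof -
  let ?g = "\<lambda>\<xi>. cis (\<xi> \<bullet> y) * complex_of_real (gauss a \<xi>)"
  note [measurable] = inner_measurable_lebesgue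
  have g: "integrable lebesgue ?g"
    using gauss_integrable[OF a, where 'a='a] by (intro integrable_cis_mult) auto
  have "fourier_integral ?g x = fourier_integral (\<lambda>x. complex_of_real (gauss a x)) (x - y)" for x
    unfolding fourier_integral_def
    by (simp add: inner_diff_right cis_mult mult.assoc[symmetric] inner_commute)
  then have "fourier_integral ?g x = of_real (gauss_hat a (x - y))" for x
    by (simp add: fourier_integral_gauss[OF a])
  then show ?thesis using fourier_multiplication[OF f g] by (simp add: mult_ac)
qed

lemma cnj_measurable [measurable]: "cnj \<in> borel_measurable borel"
  by (intro borel_measurable_continuous_onI continuous_intros)

lemma lborel_integral_affine:
  fixes F :: "'a::euclidean_space \<Rightarrow> 'b::{banach,second_countable_topology}"
  assumes [measurable]: "F \<in> borel_measurable borel" and c: "c > 0"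
  shows "(\<integral>y. F y \<partial>lborel) = c ^ DIM('a) *\<^sub>R (\<integral>z. F (t + c *\<^sub>R z) \<partial>lborel)"
proof -
  have "(\<integral>y. F y \<partial>lborel) = (\<integral>y. F y \<partial>density (distr lborel borel (\<lambda>x. t + c *\<^sub>R x)) (\<lambda>_. \<bar>c\<bar> ^ DIM('a)))"
    using lborel_affine[of c t] c by simp
  also have "\<dots> = (\<integral>z. c ^ DIM('a) *\<^sub>R F (t + c *\<^sub>R z) \<partial>lborel)"
    using c by (subst integral_density; (subst integral_distr)?) auto
  finally show ?thesis by simp
qed

lemma gauss_hat_scale:
  fixes z :: "'a::euclidean_space"
  assumes c: "c > 0"
  shows "c ^ DIM('a) * gauss_hat (c\<^sup>2) (c *\<^sub>R z) = sqrt pi ^ DIM('a) * gauss (1/4) z"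
proof -
  have "c * sqrt (pi / c\<^sup>2) = sqrt pi" using c by (simp add: real_sqrt_divide)
  then have "c ^ DIM('a) * sqrt (pi / c\<^sup>2) ^ DIM('a) = sqrt pi ^ DIM('a)"
    by (metis power_mult_distrib)
  then show ?thesis using c by (simp add: gauss_hat_def gauss_def power_mult_distrib)
qed

text \<open>The substitution \<open>y = x + c k * z\<close> turns the kernels into one weight in
  \<open>z\<close> that is the same for all \<open>k\<close>, so dominated convergence applies. Its
  integral is (2 pi)^n because the transform is not normalised.\<close>

lemma gauss_approx_identity:
  fixes f :: "'a::euclidean_space \<Rightarrow> complex"
  assumes f: "continuous_on UNIV f" and M: "\<And>x. norm (f x) \<le> M"
  defines "S k x \<equiv> (\<integral>y. f y * of_real (gauss_hat (1 / Suc k) (y - x)) \<partial>lebesgue)"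
  shows "(\<lambda>k. S k x) \<longlonglongrightarrow> of_real ((2 * pi) ^ DIM('a)) * f x"
    and "norm (S k x) \<le> (2 * pi) ^ DIM('a) * M"
proof -
  note [measurable] = borel_measurable_continuous_onI[OF f]
  define c where "c k = sqrt (1 / Suc k)" for k
  have c: "c k > 0" "1 / Suc k = (c k)\<^sup>2" for k by (auto simp: c_def)
  have c0: "c \<longlonglongrightarrow> 0"
    unfolding c_def using tendsto_real_sqrt[OF LIMSEQ_Suc[OF lim_1_over_n]] by simp
  let ?w = "\<lambda>z::'a. sqrt pi ^ DIM('a) * gauss (1/4) z"
  have eq: "S k x = (\<integral>z. f (x + c k *\<^sub>R z) * of_real (?w z) \<partial>lborel)" for k x
  proof -
    have "S k x = (\<integral>y. f y * of_real (gauss_hat ((c k)\<^sup>2) (y - x)) \<partial>lborel)"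
      unfolding S_def c(2) by (subst integral_lebesgue_lborel(1)) auto
    also have "\<dots> = c k ^ DIM('a) *\<^sub>R (\<integral>z. f (x + c k *\<^sub>R z) * of_real (gauss_hat ((c k)\<^sup>2) (c k *\<^sub>R z)) \<partial>lborel)"
      by (subst lborel_integral_affine[OF _ c(1)[of k], where t=x]) auto
    also have "\<dots> = (\<integral>z. f (x + c k *\<^sub>R z) * of_real (c k ^ DIM('a) * gauss_hat ((c k)\<^sup>2) (c k *\<^sub>R z)) \<partial>lborel)"
      by (subst integral_scaleR_right[symmetric]) (simp add: scaleR_conv_of_real mult_ac)
    finally show ?thesis by (simp only: gauss_hat_scale[OF c(1)])
  qed
  have "integrable lborel (gauss (1/4) :: 'a \<Rightarrow> real)" "(\<integral>z. gauss (1/4) z \<partial>(lborel :: 'a measure)) = sqrt (4 * pi) ^ DIM('a)"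
    using gauss_integrable[of "1/4", where 'a='a] gauss_integral[of "1/4", where 'a='a]
    by (auto simp: integral_lebesgue_lborel mult.commute)
  moreover have "sqrt pi ^ DIM('a) * sqrt (4 * pi) ^ DIM('a) = (2 * pi) ^ DIM('a)"
  proof -
    have "sqrt pi * sqrt (4 * pi) = 2 * pi" by (simp add: real_sqrt_mult)
    then show ?thesis by (metis power_mult_distrib)
  qed
  ultimately have w: "integrable lborel ?w" "(\<integral>z. ?w z \<partial>lborel) = (2 * pi) ^ DIM('a)"
    by (auto simp only: integral_mult_right_zero intro: integrable_mult_right)
  have w_nn: "?w z \<ge> 0" for z by simp
  have "(\<lambda>k. S k x) \<longlonglongrightarrow> (\<integral>z. f x * of_real (?w z) \<partial>lborel)"
    unfolding eq
  proof (rule integral_dominated_convergence[where w="\<lambda>z. M * ?w z"])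
    have "(\<lambda>k. f (x + c k *\<^sub>R z)) \<longlonglongrightarrow> f x" for z
    proof -
      have "(\<lambda>k. x + c k *\<^sub>R z) \<longlonglongrightarrow> x + 0 *\<^sub>R z" by (intro tendsto_intros c0)
      then show ?thesis
        using f by (intro isCont_tendsto_compose[of x f]) (auto simp: continuous_on_eq_continuous_at)
    qed
    then show "AE z in lborel. (\<lambda>k. f (x + c k *\<^sub>R z) * of_real (?w z)) \<longlonglongrightarrow> f x * of_real (?w z)"
      by (intro AE_I2 tendsto_intros) 
    have "norm (f (x + c k *\<^sub>R z) * of_real (?w z)) \<le> M * ?w z" for k z
      unfolding norm_mult norm_of_real abs_of_nonneg[OF w_nn] by (rule mult_right_mono[OF M w_nn])
    then show "AE z in lborel. norm (f (x + c k *\<^sub>R z) * of_real (?w z)) \<le> M * ?w z" for k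
      by (rule AE_I2)
    show "integrable lborel (\<lambda>z. M * ?w z)" by (rule integrable_mult_right[OF w(1)])
  qed measurable
  also have "(\<integral>z. f x * of_real (?w z) \<partial>lborel) = f x * of_real (\<integral>z. ?w z \<partial>lborel)"
    by (simp only: integral_mult_right_zero integral_complex_of_real)
  finally show "(\<lambda>k. S k x) \<longlonglongrightarrow> of_real ((2 * pi) ^ DIM('a)) * f x"
    unfolding w(2) by (simp only: mult.commute)
  have bound: "norm (f (x + c k *\<^sub>R z) * of_real (?w z)) \<le> M * ?w z" for z
    unfolding norm_mult norm_of_real abs_of_nonneg[OF w_nn] by (rule mult_right_mono[OF M w_nn])
  have i: "integrable lborel (\<lambda>z. M * ?w z)" by (rule integrable_mult_right[OF w(1)])
  have "norm (S k x) \<le> (\<integral>z. norm (f (x + c k *\<^sub>R z) * of_real (?w z)) \<partial>lborel)"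
    unfolding eq by (rule integral_norm_bound)
  also have "\<dots> \<le> (\<integral>z. M * ?w z \<partial>lborel)"
  proof (rule integral_mono)
    show "integrable lborel (\<lambda>z. norm (f (x + c k *\<^sub>R z) * of_real (?w z)))"
    proof (rule Bochner_Integration.integrable_bound[OF i _ AE_I2])
      show "norm (norm (f (x + c k *\<^sub>R z) * of_real (?w z))) \<le> norm (M * ?w z)" for z
        using order_trans[OF bound abs_ge_self] by (simp only: real_norm_def abs_norm_cancel)
    qed measurable
  qed (use i bound in \<open>auto simp only:\<close>)
  also have "\<dots> = M * (\<integral>z. ?w z \<partial>lborel)" by (rule integral_mult_right_zero)
  finally show "norm (S k x) \<le> (2 * pi) ^ DIM('a) * M" unfolding w(2) by (simp only: mult.commute)
qed

text \<open>Integrability of the squared transform is not known in advance, so a Gaussian factor is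
  inserted. The multiplication formula moves the integral to space, where the factor is removed by
  dominated convergence; on the frequency side monotone convergence then gives both integrability
  and the value.\<close>

lemma plancherel_Cc:
  fixes f :: "'a::euclidean_space \<Rightarrow> complex"
  assumes f: "Cc f"
  shows "L2 (fourier_integral f)" "(L2_norm (fourier_integral f))\<^sup>2 = (2 * pi) ^ DIM('a) * (L2_norm f)\<^sup>2"
proof -
  obtain R M where M: "\<And>x. norm (f x) \<le> M" using Cc_bounded[OF f] by metis
  have int: "integrable lebesgue f" by (rule Cc_integrable[OF f])
  have cont: "continuous_on UNIV f" using f by (simp add: Cc_def)
  define F where "F = fourier_integral f"
  define C where "C = (\<integral>x. norm (f x) \<partial>lebesgue)"
  have F [measurable]: "F \<in> borel_measurable lebesgue" and FC: "norm (F \<xi>) \<le> C" for \<xi>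
    using int by (auto simp: F_def C_def fourier_integral_measurable_lebesgue fourier_integral_bound)
  \<comment> \<open>The conjugate makes the product of the transform with \<open>g k\<close> equal
    to its squared modulus times a Gaussian.\<close>
  define g where "g k \<xi> = complex_of_real (gauss (1 / Suc k) \<xi>) * cnj (F \<xi>)" for k \<xi>
  have gauss_m: "(\<lambda>\<xi>. complex_of_real (gauss a \<xi>)) \<in> borel_measurable (lebesgue :: 'a measure)" for a
    by (intro continuous_measurable_lebesgue continuous_intros)
  have Fcnj: "(\<lambda>\<xi>. cnj (F \<xi>)) \<in> borel_measurable lebesgue"
    using F by measurable
  have g: "integrable lebesgue (g k)" for k
  proof (rule Bochner_Integration.integrable_bound)
    show "integrable lebesgue (\<lambda>\<xi>::'a. C * gauss (1 / Suc k) \<xi>)"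
      by (intro integrable_mult_right gauss_integrable) simp
    show "AE \<xi> in lebesgue. norm (g k \<xi>) \<le> norm (C * gauss (1 / Suc k) \<xi>)"
      using FC order_trans[OF norm_ge_zero FC]
      by (intro AE_I2) (auto simp: g_def norm_mult abs_mult mult.commute[of C] intro!: mult_left_mono)
  qed (unfold g_def, intro borel_measurable_times gauss_m Fcnj)
  have ghat: "fourier_integral (g k) x = cnj (\<integral>y. f y * of_real (gauss_hat (1 / Suc k) (y - x)) \<partial>lebesgue)" for k x
  proof -
    have "fourier_integral (g k) x = (\<integral>\<xi>. cnj (cis (\<xi> \<bullet> x) * (of_real (gauss (1 / Suc k) \<xi>) * F \<xi>)) \<partial>lebesgue)"
      unfolding fourier_integral_def g_def by (simp add: cis_cnj)
    also have "\<dots> = cnj (\<integral>\<xi>. cis (\<xi> \<bullet> x) * (of_real (gauss (1 / Suc k) \<xi>) * F \<xi>) \<partial>lebesgue)"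
      by (rule Bochner_Integration.integral_cnj)
    finally show ?thesis unfolding F_def by (subst (asm) fourier_gauss_inverse[OF int]) auto
  qed
  define a where "a k = (\<integral>\<xi>. gauss (1 / Suc k) \<xi> * (norm (F \<xi>))\<^sup>2 \<partial>lebesgue)" for k
  have sq: "complex_of_real (gauss (1 / Suc k) \<xi> * (norm (F \<xi>))\<^sup>2) = F \<xi> * g k \<xi>" for k \<xi>
    unfolding of_real_mult complex_norm_square g_def by (simp add: mult_ac)
  have ga: "integrable lebesgue (\<lambda>\<xi>. F \<xi> * g k \<xi>)" for k
  proof (rule Bochner_Integration.integrable_bound)
    show "integrable lebesgue (\<lambda>\<xi>. C *\<^sub>R g k \<xi>)" using g by simp
    show "AE \<xi> in lebesgue. norm (F \<xi> * g k \<xi>) \<le> norm (C *\<^sub>R g k \<xi>)"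
      using FC order_trans[OF norm_ge_zero FC] by (auto simp: norm_mult intro!: mult_right_mono)
  qed (use g in measurable)
  have a_eq: "complex_of_real (a k) = (\<integral>x. f x * fourier_integral (g k) x \<partial>lebesgue)" for k
    unfolding a_def integral_complex_of_real[symmetric] sq
    using fourier_multiplication[OF int g] by (simp add: F_def)
  let ?L = "(2 * pi) ^ DIM('a) * (L2_norm f)\<^sup>2"
  have "(\<lambda>k. complex_of_real (a k)) \<longlonglongrightarrow>
      (\<integral>x. f x * cnj (of_real ((2 * pi) ^ DIM('a)) * f x) \<partial>lebesgue)"
    unfolding a_eq
  proof (rule integral_dominated_convergence[where w="\<lambda>x. norm (f x) * ((2 * pi) ^ DIM('a) * M)"])
    note [measurable] = borel_measurable_integrable[OF int] fourier_integral_measurable_lebesgue[OF g]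
    show "(\<lambda>x. f x * fourier_integral (g k) x) \<in> borel_measurable lebesgue" for k by measurable
    show "(\<lambda>x. f x * cnj (of_real ((2 * pi) ^ DIM('a)) * f x)) \<in> borel_measurable lebesgue" by measurable
    show "AE x in lebesgue. (\<lambda>k. f x * fourier_integral (g k) x) \<longlonglongrightarrow> f x * cnj (of_real ((2 * pi) ^ DIM('a)) * f x)"
      unfolding ghat using gauss_approx_identity(1)[OF cont M] by (intro AE_I2 tendsto_intros)
    show "AE x in lebesgue. norm (f x * fourier_integral (g k) x) \<le> norm (f x) * ((2 * pi) ^ DIM('a) * M)" for k
      unfolding ghat norm_mult complex_mod_cnj using gauss_approx_identity(2)[OF cont M]
      by (intro AE_I2 mult_left_mono) auto
  qed (use int in auto)
  also have "(\<integral>x. f x * cnj (of_real ((2 * pi) ^ DIM('a)) * f x) \<partial>lebesgue) =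
      (\<integral>x. complex_of_real ((2 * pi) ^ DIM('a) * (norm (f x))\<^sup>2) \<partial>lebesgue)"
    unfolding of_real_mult complex_norm_square complex_cnj_mult complex_cnj_complex_of_real
    by (simp only: mult_ac)
  also have "\<dots> = of_real ?L"
    unfolding integral_complex_of_real L2_norm_sq by (simp only: integral_mult_right_zero)
  finally have a_lim: "a \<longlonglongrightarrow> ?L" by (simp only: tendsto_of_real_iff)
  \<comment> \<open>The width parameter 1 / Suc k decreases, so the Gaussians increase to 1.\<close>
  have mono: "mono (\<lambda>k. gauss (1 / Suc k) \<xi> * (norm (F \<xi>))\<^sup>2)" for \<xi>
    unfolding mono_def gauss_def by (intro allI impI mult_right_mono) (auto simp: frac_le intro!: mult_right_mono)
  have lim: "(\<lambda>k. gauss (1 / Suc k) \<xi> * (norm (F \<xi>))\<^sup>2) \<longlonglongrightarrow> (norm (F \<xi>))\<^sup>2" for \<xi>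
  proof -
    have "(\<lambda>k. gauss (1 / Suc k) \<xi> * (norm (F \<xi>))\<^sup>2) \<longlonglongrightarrow> exp (- (0 * (norm \<xi>)\<^sup>2)) * (norm (F \<xi>))\<^sup>2"
      unfolding gauss_def by (intro tendsto_intros LIMSEQ_Suc[OF lim_1_over_n])
    then show ?thesis by simp
  qed
  have gi: "integrable lebesgue (\<lambda>\<xi>. gauss (1 / Suc k) \<xi> * (norm (F \<xi>))\<^sup>2)" for k
    using ga[of k] unfolding sq[symmetric] by (simp only: complex_of_real_integrable_eq)
  have Fm: "(\<lambda>\<xi>. (norm (F \<xi>))\<^sup>2) \<in> borel_measurable lebesgue" by measurable
  have "integrable lebesgue (\<lambda>\<xi>. (norm (F \<xi>))\<^sup>2)"
    by (rule integrable_monotone_convergence[OF gi AE_I2[OF mono] AE_I2[OF lim] a_lim[unfolded a_def] Fm])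
  moreover have "(\<integral>\<xi>. (norm (F \<xi>))\<^sup>2 \<partial>lebesgue) = ?L"
    by (rule integral_monotone_convergence[OF gi AE_I2[OF mono] AE_I2[OF lim] a_lim[unfolded a_def] Fm])
  ultimately show "L2 (fourier_integral f)" "(L2_norm (fourier_integral f))\<^sup>2 = ?L"
    using F by (auto simp: L2_def L2_norm_sq F_def)
qed

lemma Cc_diff: "Cc f \<Longrightarrow> Cc g \<Longrightarrow> Cc (\<lambda>x. f x - g x)"
  unfolding Cc_def
proof safe
  fix R R' assume "continuous_on UNIV f" "continuous_on UNIV g"
    and R: "\<forall>x. R < norm x \<longrightarrow> f x = 0" "\<forall>x. R' < norm x \<longrightarrow> g x = 0"
  then show "continuous_on UNIV (\<lambda>x. f x - g x)" by (intro continuous_intros)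
  show "\<exists>R. \<forall>x. R < norm x \<longrightarrow> f x - g x = 0"
    using R by (intro exI[of _ "max R R'"]) auto
qed

text \<open>Approximants from \<open>Cc_dense\<close> have transforms that converge pointwise by the
  L1 bound and are Cauchy in L2 by \<open>plancherel_Cc\<close>; Fatou's lemma identifies the two
  limits.\<close>

theorem plancherel_L1:
  fixes f :: "'a::euclidean_space \<Rightarrow> complex"
  assumes f: "L2 f" "integrable lebesgue f"
  shows "L2 (fourier_integral f)" "L2_norm (fourier_integral f) = sqrt ((2 * pi) ^ DIM('a)) * L2_norm f"
proof -
  define \<kappa> where "\<kappa> = sqrt ((2 * pi) ^ DIM('a))"
  have \<kappa>: "\<kappa> \<ge> 0" by (simp add: \<kappa>_def)
  have planch: "L2_norm (fourier_integral g) = \<kappa> * L2_norm g" if "Cc g" for g :: "'a \<Rightarrow> complex"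
    using real_sqrt_unique[OF plancherel_Cc(2)[OF that] L2_norm_nonneg, symmetric]
    by (simp add: real_sqrt_mult \<kappa>_def)
  have "\<exists>g. Cc g \<and> L2_norm (\<lambda>x. f x - g x) < 1 / Suc k \<and> (\<integral>x. norm (f x - g x) \<partial>lebesgue) < 1 / Suc k" for k
    by (rule Cc_dense[OF f]) simp
  then obtain g where g: "\<And>k. Cc (g k)" and g2: "\<And>k. L2_norm (\<lambda>x. f x - g k x) < 1 / Suc k"
    and g1: "\<And>k. (\<integral>x. norm (f x - g k x) \<partial>lebesgue) < 1 / Suc k" by metis
  let ?F = "fourier_integral f" and ?G = "\<lambda>k. fourier_integral (g k)"
  have gi: "integrable lebesgue (g k)" "L2 (g k)" "L2 (?G k)" for k
    using g Cc_integrable Cc_L2 plancherel_Cc by auto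
  have Gdiff: "L2_norm (\<lambda>\<xi>. ?G m \<xi> - ?G k \<xi>) \<le> 2 * \<kappa> / Suc k" if "m \<ge> k" for m k
  proof -
    have "(\<lambda>\<xi>. ?G m \<xi> - ?G k \<xi>) = fourier_integral (\<lambda>x. g m x - g k x)"
      by (simp add: fourier_integral_diff[OF gi(1) gi(1)] fun_eq_iff)
    then have "L2_norm (\<lambda>\<xi>. ?G m \<xi> - ?G k \<xi>) = \<kappa> * L2_norm (\<lambda>x. g m x - g k x)"
      using planch[OF Cc_diff[OF g g]] by simp
    moreover have "L2_norm (\<lambda>x. g m x - g k x) \<le> 1 / Suc m + 1 / Suc k"
      using L2_norm_triangle_mid[OF gi(2)[of m] gi(2)[of k] f(1)] g2[of m] g2[of k]
        L2_norm_minus_commute[of "g m" f] by linarith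
    moreover have "1 / Suc m + 1 / Suc k \<le> 1 / Suc k + 1 / Suc k"
      using that by (intro add_right_mono) (simp add: frac_le)
    ultimately have "L2_norm (\<lambda>\<xi>. ?G m \<xi> - ?G k \<xi>) \<le> \<kappa> * (1 / Suc k + 1 / Suc k)"
      using mult_left_mono[OF order_trans \<kappa>] by presburger
    then show ?thesis by (simp add: mult.commute)
  qed
  have lim: "(\<lambda>m. ?G m \<xi>) \<longlonglongrightarrow> ?F \<xi>" for \<xi>
  proof (rule Lim_transform[OF tendsto_const])
    show "(\<lambda>m. ?G m \<xi> - ?F \<xi>) \<longlonglongrightarrow> 0"
    proof (rule Lim_null_comparison[OF _ LIMSEQ_Suc[OF lim_1_over_n]])
      have "norm (?G m \<xi> - ?F \<xi>) \<le> 1 / Suc m" for m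
      proof -
        have "norm (?G m \<xi> - ?F \<xi>) = norm (fourier_integral (\<lambda>x. f x - g m x) \<xi>)"
          by (simp add: fourier_integral_diff f gi norm_minus_commute)
        also have "\<dots> \<le> (\<integral>x. norm (f x - g m x) \<partial>lebesgue)"
          by (rule fourier_integral_bound) (use f gi in auto)
        finally show ?thesis using g1[of m] by linarith
      qed
      then show "\<forall>\<^sub>F m in sequentially. norm (?G m \<xi> - ?F \<xi>) \<le> 1 / real (Suc m)" by simp
    qed
  qed
  have FG: "L2 (\<lambda>\<xi>. ?F \<xi> - ?G k \<xi>)" "L2_norm (\<lambda>\<xi>. ?F \<xi> - ?G k \<xi>) \<le> 2 * \<kappa> / Suc k" for k
  proof -
    have 1: "\<And>m. L2 (\<lambda>\<xi>. ?G m \<xi> - ?G k \<xi>)" by (rule L2_diff[OF gi(3) gi(3)])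
    have 2: "AE \<xi> in lebesgue. (\<lambda>m. ?G m \<xi> - ?G k \<xi>) \<longlonglongrightarrow> ?F \<xi> - ?G k \<xi>"
      by (intro AE_I2 tendsto_intros lim)
    have 3: "(\<lambda>\<xi>. ?F \<xi> - ?G k \<xi>) \<in> borel_measurable lebesgue"
      using fourier_integral_measurable_lebesgue[OF f(2)] L2_measurable[OF gi(3)] by measurable
    have 4: "\<forall>\<^sub>F m in sequentially. L2_norm (\<lambda>\<xi>. ?G m \<xi> - ?G k \<xi>) \<le> 2 * \<kappa> / Suc k"
      using Gdiff by (intro eventually_sequentiallyI[of k]) auto
    show "L2 (\<lambda>\<xi>. ?F \<xi> - ?G k \<xi>)" "L2_norm (\<lambda>\<xi>. ?F \<xi> - ?G k \<xi>) \<le> 2 * \<kappa> / Suc k"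
      using L2_norm_Fatou[OF 1 2 3 4] by auto
  qed
  show F: "L2 ?F" using L2_add[OF FG(1)[of 0] gi(3)[of 0]] by simp
  have "(\<lambda>k. L2_norm (?G k)) \<longlonglongrightarrow> L2_norm ?F"
  proof (rule L2_norm_tendsto[OF gi(3) F])
    have "(\<lambda>k. 2 * \<kappa> * (1 / Suc k)) \<longlonglongrightarrow> 2 * \<kappa> * 0"
      by (intro tendsto_intros LIMSEQ_Suc[OF lim_1_over_n])
    then have "(\<lambda>k. 2 * \<kappa> / Suc k) \<longlonglongrightarrow> 0" by simp
    then show "(\<lambda>k. L2_norm (\<lambda>x. ?G k x - ?F x)) \<longlonglongrightarrow> 0"
      by (rule Lim_null_comparison[rotated]) (use FG(2) in \<open>simp add: L2_norm_minus_commute[of "?G _"]\<close>)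
  qed
  moreover have "(\<lambda>k. \<kappa> * L2_norm (g k)) \<longlonglongrightarrow> \<kappa> * L2_norm f"
  proof (intro tendsto_intros L2_norm_tendsto[OF gi(2) f(1)])
    show "(\<lambda>k. L2_norm (\<lambda>x. g k x - f x)) \<longlonglongrightarrow> 0"
      by (rule Lim_null_comparison[OF _ LIMSEQ_Suc[OF lim_1_over_n]])
        (use less_imp_le[OF g2] in \<open>simp add: L2_norm_minus_commute[of "g _"]\<close>)
  qed
  ultimately show "L2_norm ?F = \<kappa> * L2_norm f"
    unfolding planch[OF g] by (rule LIMSEQ_unique)
qed

section \<open>The Fourier transform of square integrable functions\<close>

lemma L2_norm_fun: 
  assumes f: "L2 f" shows "L2 (\<lambda>x. norm (f x))"
  by (rule L2_dominated[OF measurable_compose[OF L2_measurable[OF f] borel_measurable_norm] f, of 1]) auto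

definition ball_cut :: "real \<Rightarrow> ('a::euclidean_space \<Rightarrow> complex) \<Rightarrow> 'a \<Rightarrow> complex" where
  "ball_cut R f = (\<lambda>x. indicator (ball 0 R) x * f x)"

lemma ball_cut_norm_le: "norm (ball_cut R f x) \<le> norm (f x)"
  by (simp add: ball_cut_def indicator_def)

lemma ball_cut_measurable:
  "f \<in> borel_measurable lebesgue \<Longrightarrow> ball_cut R f \<in> borel_measurable lebesgue"
  unfolding ball_cut_def by (intro borel_measurable_times borel_measurable_indicator) auto

lemma ball_cut_L2: "L2 f \<Longrightarrow> L2 (ball_cut R f)"
  by (rule L2_dominated[of _ f 1]) (auto simp: ball_cut_norm_le intro: ball_cut_measurable L2_measurable)

lemma ball_cut_integrable: 
  assumes "L2 f" shows "integrable lebesgue (ball_cut R f)"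
proof (rule Bochner_Integration.integrable_bound)
  show "integrable lebesgue (\<lambda>x. norm (indicat_real (cball 0 R) x * 1) * norm (f x))"
    using L2_dot_integrable(1)[OF L2_indicator_ball L2_norm_fun[OF assms], of R 1] by simp
  show "ball_cut R f \<in> borel_measurable lebesgue"
    by (rule ball_cut_measurable[OF L2_measurable[OF assms]])
qed (auto simp: ball_cut_def indicator_def)

lemma ball_cut_diff: "ball_cut R (\<lambda>x. a * f x + b * g x) = (\<lambda>x. a * ball_cut R f x + b * ball_cut R g x)"
  by (auto simp: ball_cut_def algebra_simps)

lemma ball_cut_cnj: "ball_cut R (\<lambda>x. cnj (f x)) x = cnj (ball_cut R f x)"
  by (simp add: ball_cut_def indicator_def)

lemma ball_cut_tendsto:
  fixes f :: "'a::euclidean_space \<Rightarrow> complex"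
  assumes f: "L2 f"
  shows "((\<lambda>R. L2_norm (\<lambda>x. ball_cut R f x - f x)) \<longlongrightarrow> 0) at_top"
proof (rule tendsto_at_topI_sequentially)
  fix X :: "nat \<Rightarrow> real" assume X: "filterlim X at_top sequentially"
  have "L2 (\<lambda>x. norm (f x))" by (rule L2_norm_fun[OF f])
  then show "(\<lambda>n. L2_norm (\<lambda>x. ball_cut (X n) f x - f x)) \<longlonglongrightarrow> 0"
  proof (rule L2_dominated_convergence[rotated 2])
    show "AE x in lebesgue. (\<lambda>n. ball_cut (X n) f x) \<longlonglongrightarrow> f x"
    proof (rule AE_I2, rule tendsto_eventually)
      fix x :: 'a
      have "\<forall>\<^sub>F n in sequentially. norm x < X n"
        using X by (simp add: filterlim_at_top_dense)
      then show "\<forall>\<^sub>F n in sequentially. ball_cut (X n) f x = f x"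
        by eventually_elim (simp add: ball_cut_def)
    qed
  qed (auto simp: ball_cut_norm_le intro: ball_cut_measurable L2_measurable f)
qed

text \<open>The defining property in \<open>fourier_L2\<close>, restated with \<open>L2_norm\<close>
  in place of an extended integral of the square.\<close>

definition is_fourier_L2 :: "('a::euclidean_space \<Rightarrow> complex) \<Rightarrow> ('a \<Rightarrow> complex) \<Rightarrow> bool" where
  "is_fourier_L2 f g \<longleftrightarrow> L2 g \<and>
     ((\<lambda>R. L2_norm (\<lambda>\<xi>. fourier_integral (ball_cut R f) \<xi> - g \<xi>)) \<longlongrightarrow> 0) at_top"

lemma fourier_ball_cut_L2: "L2 f \<Longrightarrow> L2 (fourier_integral (ball_cut R f))"
  by (intro plancherel_L1 ball_cut_L2 ball_cut_integrable)

lemma fourier_integral_diff_norm: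
  fixes f g :: "'a::euclidean_space \<Rightarrow> complex"
  assumes "L2 f" "integrable lebesgue f" "L2 g" "integrable lebesgue g"
  shows "L2_norm (\<lambda>\<xi>. fourier_integral f \<xi> - fourier_integral g \<xi>) =
    sqrt ((2 * pi) ^ DIM('a)) * L2_norm (\<lambda>x. f x - g x)"
proof -
  have "fourier_integral (\<lambda>x. f x - g x) = (\<lambda>\<xi>. fourier_integral f \<xi> - fourier_integral g \<xi>)"
    by (rule ext) (rule fourier_integral_diff[OF assms(2,4)])
  with plancherel_L1(2)[OF L2_diff[OF assms(1,3)] Bochner_Integration.integrable_diff[OF assms(2,4)]]
  show ?thesis by (simp only:)
qed

text \<open>By Plancherel the transforms of the truncations are as close to each other as the
  truncations themselves, hence Cauchy.\<close>

lemma is_fourier_L2_exists: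
  fixes f :: "'a::euclidean_space \<Rightarrow> complex"
  assumes f: "L2 f"
  shows "\<exists>g. is_fourier_L2 f g"
proof -
  define \<kappa> where "\<kappa> = sqrt ((2 * pi) ^ DIM('a))"
  have \<kappa>: "\<kappa> > 0" by (simp add: \<kappa>_def)
  let ?F = "\<lambda>R. fourier_integral (ball_cut R f)"
  let ?d = "\<lambda>R. \<kappa> * L2_norm (\<lambda>x. ball_cut R f x - f x)"
  have d: "L2_norm (\<lambda>\<xi>. ?F R \<xi> - ?F S \<xi>) \<le> ?d R + ?d S" for R S
  proof -
    have "L2_norm (\<lambda>\<xi>. ?F R \<xi> - ?F S \<xi>) = \<kappa> * L2_norm (\<lambda>x. ball_cut R f x - ball_cut S f x)"
      unfolding \<kappa>_def by (intro fourier_integral_diff_norm ball_cut_L2 ball_cut_integrable f)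
    also have "\<dots> \<le> \<kappa> * (L2_norm (\<lambda>x. ball_cut R f x - f x) + L2_norm (\<lambda>x. f x - ball_cut S f x))"
      using \<kappa> by (intro mult_left_mono L2_norm_triangle_mid ball_cut_L2 f) auto
    finally show ?thesis by (simp add: L2_norm_minus_commute[of f] distrib_left)
  qed
  have d0: "(?d \<longlongrightarrow> 0) at_top"
    using tendsto_mult_right_zero[OF ball_cut_tendsto[OF f]] .
  have d0n: "(\<lambda>n. ?d (real n)) \<longlonglongrightarrow> 0"
    using filterlim_compose[OF d0 filterlim_real_sequentially] .
  have "\<exists>g. L2 g \<and> (\<lambda>n. L2_norm (\<lambda>\<xi>. ?F (real n) \<xi> - g \<xi>)) \<longlonglongrightarrow> 0"
  proof (rule L2_complete)
    fix e :: real assume "e > 0"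
    then have "\<forall>\<^sub>F n in sequentially. ?d (real n) < e / 2"
      using order_tendstoD(2)[OF d0n, of "e/2"] by simp
    then obtain N where N: "\<And>n. n \<ge> N \<Longrightarrow> ?d (real n) < e / 2"
      unfolding eventually_sequentially by blast
    have "L2_norm (\<lambda>\<xi>. ?F (real m) \<xi> - ?F (real n) \<xi>) < e" if "m \<ge> N" "n \<ge> N" for m n
      using d[of "real m" "real n"] N[OF that(1)] N[OF that(2)] by linarith
    then show "\<exists>N. \<forall>m\<ge>N. \<forall>n\<ge>N. L2_norm (\<lambda>\<xi>. ?F (real m) \<xi> - ?F (real n) \<xi>) < e" by blast
  qed (rule fourier_ball_cut_L2[OF f])
  then obtain g where g: "L2 g" and lim: "(\<lambda>n. L2_norm (\<lambda>\<xi>. ?F (real n) \<xi> - g \<xi>)) \<longlonglongrightarrow> 0" by blast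
  \<comment> \<open>The limit \<open>g\<close> was found along integer radii; this bound for
    arbitrary \<open>R\<close> extends the convergence to all real radii.\<close>
  have "L2_norm (\<lambda>\<xi>. ?F R \<xi> - g \<xi>) \<le> ?d R" for R
  proof (rule LIMSEQ_le_const)
    show "(\<lambda>n. ?d R + ?d (real n) + L2_norm (\<lambda>\<xi>. ?F (real n) \<xi> - g \<xi>)) \<longlonglongrightarrow> ?d R"
      using tendsto_add[OF tendsto_add[OF tendsto_const[of "?d R"] d0n] lim] by simp
    have "L2_norm (\<lambda>\<xi>. ?F R \<xi> - g \<xi>) \<le> ?d R + ?d (real n) + L2_norm (\<lambda>\<xi>. ?F (real n) \<xi> - g \<xi>)" for n
      using L2_norm_triangle_mid[OF fourier_ball_cut_L2[OF f] g fourier_ball_cut_L2[OF f], of R "real n"] d[of R "real n"]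
      by linarith
    then show "\<exists>N. \<forall>n\<ge>N. L2_norm (\<lambda>\<xi>. ?F R \<xi> - g \<xi>) \<le> ?d R + ?d (real n) + L2_norm (\<lambda>\<xi>. ?F (real n) \<xi> - g \<xi>)"
      by blast
  qed
  then have "((\<lambda>R. L2_norm (\<lambda>\<xi>. ?F R \<xi> - g \<xi>)) \<longlongrightarrow> 0) at_top"
    by (intro Lim_null_comparison[OF _ d0]) simp
  then show ?thesis using g by (auto simp: is_fourier_L2_def)
qed

lemma fourier_L2_some:
  assumes f: "L2 f"
  shows "is_fourier_L2 f (fourier_L2 f)"
proof -
  have eq: "(\<integral>\<^sup>+\<xi>. ennreal ((norm (fourier_integral (ball_cut R f) \<xi> - g \<xi>))\<^sup>2) \<partial>lebesgue) =
      ennreal ((L2_norm (\<lambda>\<xi>. fourier_integral (ball_cut R f) \<xi> - g \<xi>))\<^sup>2)" if "L2 g" for R g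
    unfolding L2_norm_sq
    by (rule nn_integral_eq_integral[OF L2_integrable]) (auto intro: L2_diff fourier_ball_cut_L2 f that)
  have "(((\<lambda>R::real. \<integral>\<^sup>+\<xi>. ennreal ((norm (fourier_integral (\<lambda>x. indicator (ball 0 R) x * f x) \<xi> - g \<xi>))\<^sup>2)
        \<partial>lebesgue) \<longlongrightarrow> 0) at_top) \<longleftrightarrow>
      ((\<lambda>R. L2_norm (\<lambda>\<xi>. fourier_integral (ball_cut R f) \<xi> - g \<xi>)) \<longlongrightarrow> 0) at_top" if "L2 g" for g
  proof -
    let ?n = "\<lambda>R. L2_norm (\<lambda>\<xi>. fourier_integral (ball_cut R f) \<xi> - g \<xi>)"
    have "((\<lambda>R. ennreal ((?n R)\<^sup>2)) \<longlongrightarrow> ennreal 0) at_top \<longleftrightarrow> ((\<lambda>R. (?n R)\<^sup>2) \<longlongrightarrow> 0) at_top"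
      by (rule tendsto_ennreal_iff) auto
    also have "\<dots> \<longleftrightarrow> (?n \<longlongrightarrow> 0) at_top"
      using tendsto_real_sqrt[of "\<lambda>R. (?n R)\<^sup>2" 0 at_top] tendsto_power[of ?n 0 at_top 2] by auto
    finally show ?thesis using eq[OF that] by (simp add: ball_cut_def)
  qed
  then have iff: "(L2 g \<and> (((\<lambda>R::real. \<integral>\<^sup>+\<xi>. ennreal ((norm (fourier_integral (\<lambda>x. indicator (ball 0 R) x * f x) \<xi> - g \<xi>))\<^sup>2)
        \<partial>lebesgue) \<longlongrightarrow> 0) at_top)) \<longleftrightarrow> is_fourier_L2 f g" for g
    by (auto simp: is_fourier_L2_def)
  show ?thesis
    unfolding fourier_L2_def iff by (rule someI_ex[OF is_fourier_L2_exists[OF f]])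
qed

lemma fourier_L2_L2: "L2 f \<Longrightarrow> L2 (fourier_L2 f)"
  using fourier_L2_some by (auto simp: is_fourier_L2_def)

text \<open>The choice in \<open>fourier_L2\<close> is controlled only up to null sets. A transform
  is therefore computed by exhibiting some \<open>g\<close> with the limit property.\<close>

lemma fourier_L2_unique: 
  assumes f: "L2 f" and g: "is_fourier_L2 f g"
  shows "AE \<xi> in lebesgue. fourier_L2 f \<xi> = g \<xi>"
  using fourier_L2_some[OF f] g
  by (intro L2_limit_unique[where X="\<lambda>R. fourier_integral (ball_cut R f)" and F=at_top])
     (auto simp: is_fourier_L2_def fourier_ball_cut_L2 f)

lemma fourier_L2_eq_integral:
  fixes f :: "'a::euclidean_space \<Rightarrow> complex"
  assumes f: "L2 f" "integrable lebesgue f"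
  shows "AE \<xi> in lebesgue. fourier_L2 f \<xi> = fourier_integral f \<xi>"
proof (rule fourier_L2_unique[OF f(1)])
  have "L2_norm (\<lambda>\<xi>. fourier_integral (ball_cut R f) \<xi> - fourier_integral f \<xi>)
      = sqrt ((2 * pi) ^ DIM('a)) * L2_norm (\<lambda>x. ball_cut R f x - f x)" for R
    by (intro fourier_integral_diff_norm ball_cut_L2 ball_cut_integrable f)
  then show "is_fourier_L2 f (fourier_integral f)"
    using tendsto_mult_right_zero[OF ball_cut_tendsto[OF f(1)]] plancherel_L1(1)[OF f]
    by (simp add: is_fourier_L2_def)
qed

lemma fourier_L2_norm:
  fixes f :: "'a::euclidean_space \<Rightarrow> complex"
  assumes f: "L2 f"
  shows "L2_norm (fourier_L2 f) = sqrt ((2 * pi) ^ DIM('a)) * L2_norm f"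
proof (rule tendsto_unique)
  show "((\<lambda>R. L2_norm (fourier_integral (ball_cut R f))) \<longlongrightarrow> L2_norm (fourier_L2 f)) at_top"
    using fourier_L2_some[OF f] 
    by (intro L2_norm_tendsto fourier_ball_cut_L2 f) (auto simp: is_fourier_L2_def)
  have "((\<lambda>R. sqrt ((2 * pi) ^ DIM('a)) * L2_norm (ball_cut R f)) \<longlongrightarrow> sqrt ((2 * pi) ^ DIM('a)) * L2_norm f) at_top"
    by (intro tendsto_mult_left L2_norm_tendsto ball_cut_L2 f ball_cut_tendsto)
  then show "((\<lambda>R. L2_norm (fourier_integral (ball_cut R f))) \<longlongrightarrow> sqrt ((2 * pi) ^ DIM('a)) * L2_norm f) at_top"
    by (simp add: plancherel_L1(2) ball_cut_L2 ball_cut_integrable f)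
qed simp

lemma L2_cmult:
  assumes f: "L2 f" shows "L2 (\<lambda>x. (a::complex) * f x)"
  by (rule L2_dominated[OF borel_measurable_times[OF borel_measurable_const L2_measurable[OF f]] f, of _ "norm a"])
    (auto simp: norm_mult)

lemma L2_norm_cmult: "L2_norm (\<lambda>x. (a::complex) * f x) = norm a * L2_norm f"
  by (simp add: L2_norm_def norm_mult power_mult_distrib real_sqrt_mult)

lemma fourier_L2_lin:
  fixes f g :: "'a::euclidean_space \<Rightarrow> complex"
  assumes f: "L2 f" and g: "L2 g"
  shows "AE \<xi> in lebesgue. fourier_L2 (\<lambda>x. a * f x + b * g x) \<xi> = a * fourier_L2 f \<xi> + b * fourier_L2 g \<xi>"
proof (rule fourier_L2_unique)
  note F = fourier_L2_some[OF f, unfolded is_fourier_L2_def] fourier_L2_some[OF g, unfolded is_fourier_L2_def]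
  let ?n = "\<lambda>f R. L2_norm (\<lambda>\<xi>. fourier_integral (ball_cut R f) \<xi> - fourier_L2 f \<xi>)"
  have "L2_norm (\<lambda>\<xi>. fourier_integral (ball_cut R (\<lambda>x. a * f x + b * g x)) \<xi> - (a * fourier_L2 f \<xi> + b * fourier_L2 g \<xi>))
      \<le> norm a * ?n f R + norm b * ?n g R" for R
  proof -
    have "(\<lambda>\<xi>. fourier_integral (ball_cut R (\<lambda>x. a * f x + b * g x)) \<xi> - (a * fourier_L2 f \<xi> + b * fourier_L2 g \<xi>)) =
      (\<lambda>\<xi>. a * (fourier_integral (ball_cut R f) \<xi> - fourier_L2 f \<xi>) + b * (fourier_integral (ball_cut R g) \<xi> - fourier_L2 g \<xi>))"
      unfolding ball_cut_diff
      by (simp add: fourier_integral_lin ball_cut_integrable f g algebra_simps fun_eq_iff)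
    then show ?thesis
      using L2_norm_triangle[OF L2_cmult[of "\<lambda>\<xi>. fourier_integral (ball_cut R f) \<xi> - fourier_L2 f \<xi>" a]
         L2_cmult[of "\<lambda>\<xi>. fourier_integral (ball_cut R g) \<xi> - fourier_L2 g \<xi>" b]]
      by (simp add: L2_norm_cmult L2_diff fourier_ball_cut_L2 f g fourier_L2_L2)
  qed
  note bound = this
  have lim: "((\<lambda>R. norm a * ?n f R + norm b * ?n g R) \<longlongrightarrow> 0) at_top"
    by (intro tendsto_add_zero tendsto_mult_right_zero) (use F in auto)
  have "((\<lambda>R. L2_norm (\<lambda>\<xi>. fourier_integral (ball_cut R (\<lambda>x. a * f x + b * g x)) \<xi>
      - (a * fourier_L2 f \<xi> + b * fourier_L2 g \<xi>))) \<longlongrightarrow> 0) at_top"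
    by (rule Lim_null_comparison[OF _ lim]) (use bound in simp)
  then show "is_fourier_L2 (\<lambda>x. a * f x + b * g x) (\<lambda>\<xi>. a * fourier_L2 f \<xi> + b * fourier_L2 g \<xi>)"
    using F by (simp add: is_fourier_L2_def L2_add L2_cmult)
qed (intro L2_add L2_cmult f g)

lemma fourier_L2_cong_AE:
  assumes f: "L2 f" and eq: "AE x in lebesgue. g x = f x"
  shows "AE \<xi> in lebesgue. fourier_L2 g \<xi> = fourier_L2 f \<xi>"
proof -
  note g = L2_cong_AE[OF f eq]
  have "fourier_integral (ball_cut R g) = fourier_integral (ball_cut R f)" for R
    unfolding fourier_integral_def
    by (intro ext integral_cong_AE borel_measurable_times cis_inner_measurable ball_cut_measurable L2_measurable f g)
       (use eq in \<open>auto simp: ball_cut_def elim!: eventually_mono\<close>)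
  then show ?thesis
    using fourier_L2_unique[OF f, of "fourier_L2 g"] fourier_L2_some[OF g]
    by (auto simp: is_fourier_L2_def eq_commute)
qed

section \<open>Reflection, Parseval's identity and Fourier inversion\<close>

lemma lebesgue_distr_uminus:
  "uminus \<in> lebesgue \<rightarrow>\<^sub>M (lebesgue :: 'a::euclidean_space measure)"
  "distr lebesgue lebesgue uminus = (lebesgue :: 'a measure)"
proof -
  define T where "T x = 0 + (\<Sum>j\<in>Basis. (-1 * (x \<bullet> j)) *\<^sub>R j)" for x :: 'a
  have T: "T = uminus"
    unfolding T_def by (auto simp: fun_eq_iff sum_negf euclidean_representation)
  show "uminus \<in> lebesgue \<rightarrow>\<^sub>M (lebesgue :: 'a measure)"
    using lebesgue_affine_measurable[of "\<lambda>_. -1" 0] unfolding T[symmetric] T_def[abs_def] by simp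
  have "lebesgue = density (distr lebesgue lebesgue (uminus :: 'a \<Rightarrow> 'a)) (\<lambda>_. 1)"
    using lebesgue_affine_euclidean[of "\<lambda>_::'a. -1" 0] unfolding T[symmetric] T_def[abs_def] by simp
  then show "distr lebesgue lebesgue uminus = (lebesgue :: 'a measure)" by (simp add: density_1)
qed

lemma lebesgue_integral_reflect:
  fixes f :: "'a::euclidean_space \<Rightarrow> 'b::{banach,second_countable_topology}"
  assumes f: "f \<in> borel_measurable lebesgue"
  shows "(\<lambda>x. f (- x)) \<in> borel_measurable lebesgue" "(\<integral>x. f (- x) \<partial>lebesgue) = (\<integral>x. f x \<partial>lebesgue)"
    "integrable lebesgue (\<lambda>x. f (- x)) \<longleftrightarrow> integrable lebesgue f"
  using measurable_compose[OF lebesgue_distr_uminus(1) f] integral_distr[OF lebesgue_distr_uminus(1) f]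
    integrable_distr_eq[OF lebesgue_distr_uminus(1) f] by (simp_all add: lebesgue_distr_uminus(2))

lemma AE_lebesgue_reflect: "AE x in lebesgue. P (x::'a::euclidean_space) \<Longrightarrow> AE x in lebesgue. P (- x)"
  by (rule AE_distrD[OF lebesgue_distr_uminus(1)]) (subst lebesgue_distr_uminus(2))

lemma L2_reflect: "L2 f \<Longrightarrow> L2 (\<lambda>x. f (- x))"
  and L2_norm_reflect: "f \<in> borel_measurable lebesgue \<Longrightarrow> L2_norm (\<lambda>x. f (- x)) = L2_norm f"
  using lebesgue_integral_reflect[of f] lebesgue_integral_reflect[of "\<lambda>x. (norm (f x))\<^sup>2"]
  by (auto simp: L2_def L2_norm_def)

lemma fourier_L2_cnj_reflect:
  fixes f :: "'a::euclidean_space \<Rightarrow> complex"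
  assumes f: "L2 f"
  shows "AE \<xi> in lebesgue. fourier_L2 (\<lambda>x. cnj (f (- x))) \<xi> = cnj (fourier_L2 f \<xi>)"
    and "AE \<xi> in lebesgue. fourier_L2 (\<lambda>x. cnj (f x)) \<xi> = cnj (fourier_L2 f (- \<xi>))"
proof -
  note F = fourier_L2_some[OF f, unfolded is_fourier_L2_def]
  have L2_cnj: "L2 (\<lambda>x. cnj (g x))" if "L2 g" for g :: "'a \<Rightarrow> complex"
    by (rule L2_dominated[OF _ that, of _ 1]) (use L2_measurable[OF that] in auto)
  have 1: "fourier_integral (ball_cut R (\<lambda>x. cnj (f x))) \<xi> = cnj (fourier_integral (ball_cut R f) (- \<xi>))" for R \<xi>
    unfolding fourier_integral_def ball_cut_cnj
    by (subst Bochner_Integration.integral_cnj[symmetric]) (simp add: cis_cnj)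
  have 2: "fourier_integral (ball_cut R (\<lambda>x. cnj (f (- x)))) \<xi> = cnj (fourier_integral (ball_cut R f) \<xi>)" for R \<xi>
  proof -
    have "fourier_integral (ball_cut R (\<lambda>x. cnj (f (- x)))) \<xi> =
        (\<integral>x. cis ((- x) \<bullet> \<xi>) * ball_cut R (\<lambda>x. cnj (f x)) (- x) \<partial>lebesgue)"
      unfolding fourier_integral_def ball_cut_def by (simp add: indicator_def)
    also have "\<dots> = (\<integral>x. cis (x \<bullet> \<xi>) * ball_cut R (\<lambda>x. cnj (f x)) x \<partial>lebesgue)"
    proof (rule lebesgue_integral_reflect(2)[where f="\<lambda>x. cis (x \<bullet> \<xi>) * ball_cut R (\<lambda>x. cnj (f x)) x"], rule borel_measurable_times)
      show "(\<lambda>x. cis (x \<bullet> \<xi>)) \<in> borel_measurable lebesgue"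
        using cis_inner_measurable[of "- \<xi>"] by simp
      show "ball_cut R (\<lambda>x. cnj (f x)) \<in> borel_measurable lebesgue"
        by (intro ball_cut_measurable L2_measurable L2_cnj f)
    qed
    also have "\<dots> = fourier_integral (ball_cut R (\<lambda>x. cnj (f x))) (- \<xi>)"
      by (simp add: fourier_integral_def)
    finally show ?thesis by (simp add: 1)
  qed
  have n1: "L2_norm (\<lambda>\<xi>. fourier_integral (ball_cut R (\<lambda>x. cnj (f x))) \<xi> - cnj (fourier_L2 f (- \<xi>))) =
      L2_norm (\<lambda>\<xi>. fourier_integral (ball_cut R f) \<xi> - fourier_L2 f \<xi>)" for R
  proof -
    have "L2_norm (\<lambda>\<xi>. fourier_integral (ball_cut R (\<lambda>x. cnj (f x))) \<xi> - cnj (fourier_L2 f (- \<xi>))) =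
      L2_norm (\<lambda>\<xi>. fourier_integral (ball_cut R f) (- \<xi>) - fourier_L2 f (- \<xi>))"
      unfolding 1 complex_cnj_diff[symmetric] L2_norm_def complex_mod_cnj ..
    also have "\<dots> = L2_norm (\<lambda>\<xi>. fourier_integral (ball_cut R f) \<xi> - fourier_L2 f \<xi>)"
      by (rule L2_norm_reflect[where f="\<lambda>\<xi>. fourier_integral (ball_cut R f) \<xi> - fourier_L2 f \<xi>"])
        (intro borel_measurable_diff L2_measurable fourier_L2_L2 fourier_ball_cut_L2 f)
    finally show ?thesis .
  qed
  have n2: "L2_norm (\<lambda>\<xi>. fourier_integral (ball_cut R (\<lambda>x. cnj (f (- x)))) \<xi> - cnj (fourier_L2 f \<xi>)) =
      L2_norm (\<lambda>\<xi>. fourier_integral (ball_cut R f) \<xi> - fourier_L2 f \<xi>)" for R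
    unfolding 2 complex_cnj_diff[symmetric] L2_norm_def complex_mod_cnj ..
  show "AE \<xi> in lebesgue. fourier_L2 (\<lambda>x. cnj (f x)) \<xi> = cnj (fourier_L2 f (- \<xi>))"
    by (rule fourier_L2_unique)
      (use F in \<open>auto simp: is_fourier_L2_def n1 intro: L2_cnj f L2_reflect\<close>)
  show "AE \<xi> in lebesgue. fourier_L2 (\<lambda>x. cnj (f (- x))) \<xi> = cnj (fourier_L2 f \<xi>)"
    by (rule fourier_L2_unique)
      (use F L2_cnj[OF L2_reflect[OF f]] in \<open>auto simp: is_fourier_L2_def n2 intro: L2_cnj\<close>)
qed

lemma fourier_L2_real_lin:
  fixes f g :: "'a::euclidean_space \<Rightarrow> complex"
  assumes "L2 f" "L2 g"
  shows "AE \<xi> in lebesgue. fourier_L2 (\<lambda>x. a *\<^sub>R f x + b *\<^sub>R g x) \<xi> = a *\<^sub>R fourier_L2 f \<xi> + b *\<^sub>R fourier_L2 g \<xi>"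
  using fourier_L2_lin[OF assms, of "of_real a" "of_real b"] by (simp add: scaleR_conv_of_real)

lemma L2_dot_polar:
  assumes "L2 f" "L2 g"
  shows "L2_dot f g = ((L2_norm (\<lambda>x. f x + g x))\<^sup>2 - (L2_norm (\<lambda>x. f x - g x))\<^sup>2) / 4"
  using L2.quadratic[of f g 1 1] L2.quadratic[of f g 1 "-1"] assms
  by (simp flip: L2_dot_self)

theorem parseval:
  fixes f g :: "'a::euclidean_space \<Rightarrow> complex"
  assumes f: "L2 f" and g: "L2 g"
  shows "L2_dot (fourier_L2 f) (fourier_L2 g) = (2 * pi) ^ DIM('a) * L2_dot f g"
proof -
  let ?\<kappa> = "(2 * pi) ^ DIM('a)"
  have sq: "(L2_norm (\<lambda>\<xi>. 1 *\<^sub>R fourier_L2 f \<xi> + b *\<^sub>R fourier_L2 g \<xi>))\<^sup>2 = ?\<kappa> * (L2_norm (\<lambda>x. 1 *\<^sub>R f x + b *\<^sub>R g x))\<^sup>2" for b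
  proof -
    have L: "L2 (\<lambda>x. 1 *\<^sub>R f x + b *\<^sub>R g x)" by (intro L2_lin f g)
    have "L2_norm (\<lambda>\<xi>. 1 *\<^sub>R fourier_L2 f \<xi> + b *\<^sub>R fourier_L2 g \<xi>) = L2_norm (fourier_L2 (\<lambda>x. 1 *\<^sub>R f x + b *\<^sub>R g x))"
      by (rule L2_norm_cong_AE[symmetric, OF fourier_L2_real_lin[OF f g] L2_measurable[OF fourier_L2_L2[OF L]]])
    then show ?thesis by (simp only: fourier_L2_norm[OF L] power_mult_distrib) simp
  qed
  have "L2_dot (fourier_L2 f) (fourier_L2 g) = (?\<kappa> * (L2_norm (\<lambda>x. f x + g x))\<^sup>2 - ?\<kappa> * (L2_norm (\<lambda>x. f x - g x))\<^sup>2) / 4"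
    using sq[of 1] sq[of "-1"] by (subst L2_dot_polar) (auto simp: fourier_L2_L2 f g)
  also have "\<dots> = ?\<kappa> * L2_dot f g"
    by (simp add: L2_dot_polar[OF f g] algebra_simps)
  finally show ?thesis .
qed

lemma fourier_L2_diff_norm:
  fixes f g :: "'a::euclidean_space \<Rightarrow> complex"
  assumes f: "L2 f" and g: "L2 g"
  shows "L2_norm (\<lambda>\<xi>. fourier_L2 f \<xi> - fourier_L2 g \<xi>) = sqrt ((2 * pi) ^ DIM('a)) * L2_norm (\<lambda>x. f x - g x)"
proof -
  have "AE \<xi> in lebesgue. fourier_L2 f \<xi> - fourier_L2 g \<xi> = fourier_L2 (\<lambda>x. f x - g x) \<xi>"
    using fourier_L2_lin[OF f g, of 1 "-1"] by (auto elim: eventually_mono)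
  then have "L2_norm (\<lambda>\<xi>. fourier_L2 f \<xi> - fourier_L2 g \<xi>) = L2_norm (fourier_L2 (\<lambda>x. f x - g x))"
    by (rule L2_norm_cong_AE) (intro borel_measurable_diff L2_measurable fourier_L2_L2 f g)
  then show ?thesis by (simp only: fourier_L2_norm[OF L2_diff[OF f g]])
qed

lemma complex_inner_Re: "z \<bullet> w = Re (z * cnj w)"
  by (simp add: inner_complex_def)

text \<open>The multiplication formula for \<open>f\<close> and the conjugate of \<open>g\<close>:
  the transform of the conjugate is the conjugate of the transform of \<open>g\<close> at the
  reflected point.\<close>

lemma fourier_adjoint_L1:
  fixes f g :: "'a::euclidean_space \<Rightarrow> complex"
  assumes f: "L2 f" "integrable lebesgue f" and g: "L2 g" "integrable lebesgue g"
  shows "L2_dot (fourier_L2 f) g = L2_dot f (\<lambda>x. fourier_L2 g (- x))"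
proof -
  let ?c = "\<lambda>x. cnj (g x)"
  have c: "integrable lebesgue ?c" using g(2) by simp
  have F: "integrable lebesgue (\<lambda>x. fourier_integral f x * ?c x)"
  proof (rule Bochner_Integration.integrable_bound)
    show "integrable lebesgue (\<lambda>x. (\<integral>x. norm (f x) \<partial>lebesgue) * norm (g x))" using g(2) by simp
    show "(\<lambda>x. fourier_integral f x * ?c x) \<in> borel_measurable lebesgue"
      by (intro borel_measurable_times fourier_integral_measurable_lebesgue f borel_measurable_integrable c)
    show "AE x in lebesgue. norm (fourier_integral f x * ?c x) \<le> norm ((\<integral>x. norm (f x) \<partial>lebesgue) * norm (g x))"
      using fourier_integral_bound[OF f(2)] by (auto simp: norm_mult intro!: mult_right_mono)
  qed
  have G: "integrable lebesgue (\<lambda>x. f x * fourier_integral ?c x)"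
  proof (rule Bochner_Integration.integrable_bound)
    show "integrable lebesgue (\<lambda>x. norm (f x) * (\<integral>x. norm (g x) \<partial>lebesgue))" using f(2) by simp
    show "(\<lambda>x. f x * fourier_integral ?c x) \<in> borel_measurable lebesgue"
      by (intro borel_measurable_times fourier_integral_measurable_lebesgue f borel_measurable_integrable c)
    show "AE x in lebesgue. norm (f x * fourier_integral ?c x) \<le> norm (norm (f x) * (\<integral>x. norm (g x) \<partial>lebesgue))"
      using fourier_integral_bound[OF c] by (auto simp: norm_mult intro!: mult_left_mono)
  qed
  have cn: "fourier_integral ?c x = cnj (fourier_integral g (- x))" for x
    unfolding fourier_integral_def by (subst Bochner_Integration.integral_cnj[symmetric]) (simp add: cis_cnj)
  have "L2_dot (fourier_L2 f) g = L2_dot (fourier_integral f) g"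
    by (rule L2_dot_cong_AE[OF fourier_L2_eq_integral[OF f]])
       (auto intro: L2_measurable fourier_L2_L2 f g)
  also have "\<dots> = Re (\<integral>x. fourier_integral f x * ?c x \<partial>lebesgue)"
    by (simp only: L2_dot_def complex_inner_Re integral_Re[OF F])
  also have "\<dots> = Re (\<integral>x. f x * fourier_integral ?c x \<partial>lebesgue)"
    by (simp only: fourier_multiplication[OF f(2) c])
  also have "\<dots> = L2_dot f (\<lambda>x. fourier_integral g (- x))"
    unfolding integral_Re[OF G, symmetric] by (simp only: L2_dot_def complex_inner_Re cn)
  also have "\<dots> = L2_dot f (\<lambda>x. fourier_L2 g (- x))"
    by (rule L2_dot_cong_AE[symmetric])
      (use AE_lebesgue_reflect[OF fourier_L2_eq_integral[OF g]] L2_reflect[OF fourier_L2_L2[OF g(1)]]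
       in \<open>auto intro: L2_measurable f\<close>)
  finally show ?thesis .
qed

lemma L2_dot_commute: "L2_dot f g = L2_dot g f"
  by (simp add: L2_dot_def inner_commute)

text \<open>The cutoffs of \<open>f\<close> and of \<open>g\<close> are removed one after the other,
  so that in each limit only one argument of the pairing varies.\<close>

theorem fourier_adjoint:
  fixes f g :: "'a::euclidean_space \<Rightarrow> complex"
  assumes f: "L2 f" and g: "L2 g"
  shows "L2_dot (fourier_L2 f) g = L2_dot f (\<lambda>x. fourier_L2 g (- x))"
proof -
  let ?f = "\<lambda>R. ball_cut R f" and ?g = "\<lambda>R. ball_cut R g"
  let ?\<kappa> = "sqrt ((2 * pi) ^ DIM('a))"
  have F0: "((\<lambda>R. L2_norm (\<lambda>\<xi>. fourier_L2 (ball_cut R h) \<xi> - fourier_L2 h \<xi>)) \<longlongrightarrow> 0) at_top" if "L2 h" for h :: "'a \<Rightarrow> complex"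
    using tendsto_mult_right_zero[OF ball_cut_tendsto[OF that]]
    by (simp only: fourier_L2_diff_norm[OF ball_cut_L2[OF that] that])
  have F0': "((\<lambda>R. L2_norm (\<lambda>\<xi>. fourier_L2 (ball_cut R h) (- \<xi>) - fourier_L2 h (- \<xi>))) \<longlongrightarrow> 0) at_top" if h: "L2 h" for h :: "'a \<Rightarrow> complex"
  proof -
    have "L2_norm (\<lambda>\<xi>. fourier_L2 (ball_cut R h) (- \<xi>) - fourier_L2 h (- \<xi>)) = L2_norm (\<lambda>\<xi>. fourier_L2 (ball_cut R h) \<xi> - fourier_L2 h \<xi>)" for R
      by (rule L2_norm_reflect[where f="\<lambda>\<xi>. fourier_L2 (ball_cut R h) \<xi> - fourier_L2 h \<xi>"])
         (intro borel_measurable_diff L2_measurable fourier_L2_L2 ball_cut_L2 h)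
    then show ?thesis using F0[OF h] by simp
  qed
  note L = fourier_L2_L2 ball_cut_L2 L2_reflect f g
  have cut: "L2_dot (fourier_L2 (?f R)) (?g S) = L2_dot (?f R) (\<lambda>x. fourier_L2 (?g S) (- x))" for R S
    by (intro fourier_adjoint_L1 ball_cut_L2 ball_cut_integrable f g)
  have 1: "L2_dot (fourier_L2 f) (?g S) = L2_dot f (\<lambda>x. fourier_L2 (?g S) (- x))" for S
  proof (rule tendsto_unique)
    show "((\<lambda>R. L2_dot (fourier_L2 (?f R)) (?g S)) \<longlongrightarrow> L2_dot (fourier_L2 f) (?g S)) at_top"
      by (intro L2_dot_tendsto F0 L)
    show "((\<lambda>R. L2_dot (fourier_L2 (?f R)) (?g S)) \<longlongrightarrow> L2_dot f (\<lambda>x. fourier_L2 (?g S) (- x))) at_top"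
      unfolding cut by (intro L2_dot_tendsto ball_cut_tendsto L)
  qed simp
  show ?thesis
  proof (rule tendsto_unique)
    show "((\<lambda>S. L2_dot (fourier_L2 f) (?g S)) \<longlongrightarrow> L2_dot (fourier_L2 f) g) at_top"
      unfolding L2_dot_commute[of "fourier_L2 f"] by (intro L2_dot_tendsto ball_cut_tendsto L)
    show "((\<lambda>S. L2_dot (fourier_L2 f) (?g S)) \<longlongrightarrow> L2_dot f (\<lambda>x. fourier_L2 g (- x))) at_top"
      unfolding 1 L2_dot_commute[of f] by (rule L2_dot_tendsto) (intro F0' L | rule L)+
  qed simp
qed

text \<open>Let \<open>h\<close> be the difference of the two sides. The adjoint formula and
  Parseval's identity show that both sides have the same product with \<open>h\<close>, so
  \<open>h\<close> has norm 0. No pointwise inversion formula is involved.\<close>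

theorem fourier_inversion:
  fixes f :: "'a::euclidean_space \<Rightarrow> complex"
  assumes f: "L2 f"
  shows "AE x in lebesgue. fourier_L2 (fourier_L2 f) (- x) = (2 * pi) ^ DIM('a) *\<^sub>R f x"
proof -
  let ?G = "\<lambda>x. fourier_L2 (fourier_L2 f) (- x)" and ?\<kappa> = "(2 * pi) ^ DIM('a)"
  have G: "L2 ?G" by (intro L2_reflect fourier_L2_L2 f)
  define h where "h = (\<lambda>x. 1 *\<^sub>R ?G x + (- ?\<kappa>) *\<^sub>R f x)"
  have h: "L2 h" unfolding h_def by (intro L2_lin G f)
  have "L2_dot h h = 1 * L2_dot ?G h + (- ?\<kappa>) * L2_dot f h"
    by (subst (1) h_def) (rule L2.linl; simp add: G f h)
  also have "L2_dot ?G h = L2_dot (fourier_L2 h) (fourier_L2 f)"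
    by (subst L2_dot_commute) (rule fourier_adjoint[OF h fourier_L2_L2[OF f], symmetric])
  also have "\<dots> = ?\<kappa> * L2_dot f h" by (simp add: parseval h f L2_dot_commute[of h])
  finally have "L2_norm h = 0" by (simp add: L2_dot_self)
  then have "AE x in lebesgue. h x = 0" by (simp add: L2_norm_eq_0_iff[OF h])
  then show ?thesis by (auto simp: h_def elim: eventually_mono)
qed

section \<open>Transforms of real functions and the fractional Laplacian\<close>

lemma L2_of_real: 
  assumes u: "L2 u" shows "L2 (\<lambda>x. complex_of_real (u x))"
  by (rule L2_dominated[OF measurable_compose[OF L2_measurable[OF u] borel_measurable_of_real] u, of 1]) auto

lemma L2_norm_of_real: "L2_norm (\<lambda>x. complex_of_real (u x)) = L2_norm u"
  by (simp add: L2_norm_def)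

lemma L2_Re:
  assumes u: "L2 u" shows "L2 (\<lambda>x. Re (u x))"
  by (rule L2_dominated[OF _ u, of _ 1]) (use L2_measurable[OF u] abs_Re_le_cmod in auto)

lemma fourier_real_lin:
  fixes u v :: "'a::euclidean_space \<Rightarrow> real"
  assumes "L2 u" "L2 v"
  shows "AE \<xi> in lebesgue. fourier_real (\<lambda>x. a * u x + b * v x) \<xi> = a *\<^sub>R fourier_real u \<xi> + b *\<^sub>R fourier_real v \<xi>"
  using fourier_L2_lin[OF L2_of_real L2_of_real, OF assms, of "of_real a" "of_real b"]
  by (simp add: scaleR_conv_of_real)

lemma fourier_real_hermitian:
  fixes u :: "'a::euclidean_space \<Rightarrow> real"
  assumes "L2 u"
  shows "AE \<xi> in lebesgue. fourier_real u (- \<xi>) = cnj (fourier_real u \<xi>)"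
  using fourier_L2_cnj_reflect(2)[OF L2_of_real[OF assms]] by (auto elim: eventually_mono)

lemma hermitian_fourier_real:
  fixes g :: "'a::euclidean_space \<Rightarrow> complex"
  assumes g: "L2 g" and herm: "AE \<xi> in lebesgue. g (- \<xi>) = cnj (g \<xi>)"
  shows "AE x in lebesgue. of_real (Re (fourier_L2 g x)) = fourier_L2 g x"
proof -
  have "AE \<xi> in lebesgue. cnj (g (- \<xi>)) = g \<xi>" using herm by eventually_elim simp
  from fourier_L2_cong_AE[OF g this] fourier_L2_cnj_reflect(1)[OF g]
  show ?thesis by eventually_elim (simp add: complex_eq_iff)
qed

definition frac_mult :: "real \<Rightarrow> ('a::euclidean_space \<Rightarrow> real) \<Rightarrow> 'a \<Rightarrow> complex" where
  "frac_mult r u = (\<lambda>\<xi>. of_real (norm \<xi> powr r) * fourier_real u \<xi>)"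

lemma frac_lap_half_alt: "frac_lap_half r u x = Re (fourier_L2 (frac_mult r u) (- x)) / (2 * pi) ^ DIM('a)"
  for x :: "'a::euclidean_space"
  by (simp add: frac_lap_half_def inv_fourier_L2_def frac_mult_def flip: of_real_power of_real_mult)

lemma L2_frac_lap_half:
  assumes "L2 (frac_mult r u)"
  shows "L2 (frac_lap_half r u)"
  using L2_scaleR[OF L2_Re[OF L2_reflect[OF fourier_L2_L2[OF assms]]], of "1 / (2 * pi) ^ DIM('a)"]
  by (simp add: frac_lap_half_alt[abs_def])

lemma frac_mult_lin:
  fixes u v :: "'a::euclidean_space \<Rightarrow> real"
  assumes "L2 u" "L2 v"
  shows "AE \<xi> in lebesgue. frac_mult r (\<lambda>x. a * u x + b * v x) \<xi> = a *\<^sub>R frac_mult r u \<xi> + b *\<^sub>R frac_mult r v \<xi>"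
  using fourier_real_lin[OF assms, of a b] by eventually_elim (simp add: frac_mult_def algebra_simps scaleR_conv_of_real)

lemma frac_lap_half_lin:
  fixes u v :: "'a::euclidean_space \<Rightarrow> real"
  assumes u: "L2 u" "L2 (frac_mult r u)" and v: "L2 v" "L2 (frac_mult r v)"
  shows "AE x in lebesgue. frac_lap_half r (\<lambda>x. a * u x + b * v x) x = a * frac_lap_half r u x + b * frac_lap_half r v x"
proof -
  have "AE x in lebesgue. fourier_L2 (frac_mult r (\<lambda>x. a * u x + b * v x)) x =
      fourier_L2 (\<lambda>\<xi>. a *\<^sub>R frac_mult r u \<xi> + b *\<^sub>R frac_mult r v \<xi>) x"
    by (rule fourier_L2_cong_AE[OF L2_lin[OF u(2) v(2)] frac_mult_lin[OF u(1) v(1)]])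
  then have "AE x in lebesgue. fourier_L2 (frac_mult r (\<lambda>x. a * u x + b * v x)) x =
      a *\<^sub>R fourier_L2 (frac_mult r u) x + b *\<^sub>R fourier_L2 (frac_mult r v) x"
    using fourier_L2_real_lin[OF u(2) v(2)] by eventually_elim simp
  from AE_lebesgue_reflect[OF this] show ?thesis
    by eventually_elim (simp add: frac_lap_half_alt add_divide_distrib)
qed

text \<open>Both inverse transforms are real almost everywhere by Hermitian symmetry, so taking real
  parts leaves the product unchanged and Parseval's identity applies. The two normalising factors of
  the inverse transform against one from Parseval leave a single division by (2 pi)^n.\<close>

lemma frac_lap_half_dot:
  fixes u v :: "'a::euclidean_space \<Rightarrow> real"
  assumes u: "L2 u" "L2 (frac_mult r u)" and v: "L2 v" "L2 (frac_mult r v)"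
  shows "L2_inner (frac_lap_half r u) (frac_lap_half r v) = L2_dot (frac_mult r u) (frac_mult r v) / (2 * pi) ^ DIM('a)"
proof -
  let ?\<kappa> = "(2 * pi) ^ DIM('a)"
  let ?F = "\<lambda>u. fourier_L2 (frac_mult r u)"
  have real: "AE x in lebesgue. of_real (Re (?F u x)) = ?F u x" if u: "L2 u" "L2 (frac_mult r u)" for u
    by (rule hermitian_fourier_real[OF u(2)])
      (use fourier_real_hermitian[OF u(1)] in \<open>auto simp: frac_mult_def elim: eventually_mono\<close>)
  have "L2_inner (frac_lap_half r u) (frac_lap_half r v) = (\<integral>x. Re (?F u (- x)) * Re (?F v (- x)) / ?\<kappa>\<^sup>2 \<partial>lebesgue)"
    by (simp add: L2_inner_def frac_lap_half_alt power2_eq_square)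
  also have "\<dots> = (\<integral>x. Re (?F u (- x)) * Re (?F v (- x)) \<partial>lebesgue) / ?\<kappa>\<^sup>2" by (rule integral_divide_zero)
  also have "(\<integral>x. Re (?F u (- x)) * Re (?F v (- x)) \<partial>lebesgue) = (\<integral>x. Re (?F u x) * Re (?F v x) \<partial>lebesgue)"
    by (rule lebesgue_integral_reflect(2)[where f="\<lambda>x. Re (?F u x) * Re (?F v x)"])
      (intro borel_measurable_times L2_measurable L2_Re fourier_L2_L2 u v)
  also have "\<dots> = L2_dot (?F u) (?F v)"
    unfolding L2_dot_def
  proof (rule integral_cong_AE)
    show "(\<lambda>x. Re (?F u x) * Re (?F v x)) \<in> borel_measurable lebesgue"
      by (intro borel_measurable_times L2_measurable L2_Re fourier_L2_L2 u v)
    show "(\<lambda>x. ?F u x \<bullet> ?F v x) \<in> borel_measurable lebesgue"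
      by (intro borel_measurable_inner L2_measurable fourier_L2_L2 u v)
    show "AE x in lebesgue. Re (?F u x) * Re (?F v x) = ?F u x \<bullet> ?F v x"
      using real[OF u] real[OF v]
    proof eventually_elim
      case (elim x)
      then have "Im (?F u x) = 0" by (metis Im_complex_of_real)
      then show ?case by (simp add: inner_complex_def)
    qed
  qed
  also have "\<dots> = ?\<kappa> * L2_dot (frac_mult r u) (frac_mult r v)" by (rule parseval[OF u(2) v(2)])
  finally show ?thesis by (simp add: power2_eq_square)
qed

lemma frac_lap_half_eqI:
  fixes u \<psi> :: "'a::euclidean_space \<Rightarrow> real"
  assumes \<psi>: "L2 \<psi>" and eq: "AE \<xi> in lebesgue. frac_mult r u \<xi> = fourier_real \<psi> \<xi>"
  shows "AE x in lebesgue. frac_lap_half r u x = \<psi> x"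
  using AE_lebesgue_reflect[OF fourier_L2_cong_AE[OF fourier_L2_L2[OF L2_of_real[OF \<psi>]] eq]]
    fourier_inversion[OF L2_of_real[OF \<psi>]]
  by eventually_elim (simp add: frac_lap_half_alt scaleR_conv_of_real flip: of_real_power of_real_mult)

section \<open>Bessel potential spaces\<close>

lemma Hs_iff: "u \<in> Hs s \<longleftrightarrow> L2 u \<and> L2 (bessel_weighted s u)"
  by (simp add: Hs_def)

lemma HsD: "u \<in> Hs s \<Longrightarrow> L2 u" "u \<in> Hs s \<Longrightarrow> L2 (bessel_weighted s u)"
  by (auto simp: Hs_iff)

lemma bessel_weighted_lin:
  assumes "L2 u" "L2 v"
  shows "AE \<xi> in lebesgue. bessel_weighted s (\<lambda>x. a * u x + b * v x) \<xi> =
    a *\<^sub>R bessel_weighted s u \<xi> + b *\<^sub>R bessel_weighted s v \<xi>"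
  using fourier_real_lin[OF assms, of a b]
  by eventually_elim (simp add: bessel_weighted_def algebra_simps scaleR_conv_of_real)

lemma Hs_lin:
  assumes "u \<in> Hs s" "v \<in> Hs s"
  shows "(\<lambda>x. a * u x + b * v x) \<in> Hs s"
  using L2_lin[of u v a b] L2_cong_AE[OF L2_lin bessel_weighted_lin] assms by (auto simp: Hs_iff)

definition Hs_dot :: "real \<Rightarrow> ('a::euclidean_space \<Rightarrow> real) \<Rightarrow> ('a \<Rightarrow> real) \<Rightarrow> real" where
  "Hs_dot s u v = L2_dot (bessel_weighted s u) (bessel_weighted s v)"

global_interpretation Hs: semi_inner "Hs s :: ('a::euclidean_space \<Rightarrow> real) set" "Hs_dot s" for s
proof
  fix f g h :: "'a \<Rightarrow> real" and a b :: real
  show "Hs_dot s f g = Hs_dot s g f" by (simp add: Hs_dot_def L2_dot_commute)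
  show "0 \<le> Hs_dot s f f" by (simp add: Hs_dot_def L2_dot_self)
  assume f: "f \<in> Hs s" and g: "g \<in> Hs s"
  then show "(\<lambda>x. a *\<^sub>R f x + b *\<^sub>R g x) \<in> Hs s" by (simp add: Hs_lin)
  assume h: "h \<in> Hs s"
  have "Hs_dot s (\<lambda>x. a * f x + b * g x) h =
      L2_dot (\<lambda>\<xi>. a *\<^sub>R bessel_weighted s f \<xi> + b *\<^sub>R bessel_weighted s g \<xi>) (bessel_weighted s h)"
    unfolding Hs_dot_def
    by (rule L2_dot_cong_AE[OF bessel_weighted_lin[OF HsD(1)[OF f] HsD(1)[OF g]] AE_I2[OF refl]])
       (intro L2_measurable HsD(2) Hs_lin f g h)+
  also have "\<dots> = a * Hs_dot s f h + b * Hs_dot s g h"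
    unfolding Hs_dot_def by (rule L2.linl) (auto intro: HsD f g h)
  finally show "Hs_dot s (\<lambda>x. a *\<^sub>R f x + b *\<^sub>R g x) h = a * Hs_dot s f h + b * Hs_dot s g h" by simp
qed

lemma Hs_norm_eq: "sqrt (Hs_dot s u u) = Hs_norm s u"
  by (simp add: Hs_dot_def Hs_norm_def L2_dot_self)

lemma Hs_norm_nonneg [simp]: "0 \<le> Hs_norm s u"
  by (simp add: Hs_norm_def)

lemma powr_le_bessel:
  fixes \<xi> :: "'a::euclidean_space"
  assumes "0 \<le> r" "r \<le> s"
  shows "norm \<xi> powr r \<le> (1 + (norm \<xi>)\<^sup>2) powr (s / 2)"
\<comment> \<open>At the origin the left side is 0, since \<open>0 powr r = 0\<close> even for
  \<open>r = 0\<close>.\<close>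
proof (cases "\<xi> = 0")
  case False
  then have "norm \<xi> powr r = ((norm \<xi>)\<^sup>2) powr (r / 2)" by (simp add: powr_powr flip: powr_numeral)
  also have "\<dots> \<le> (1 + (norm \<xi>)\<^sup>2) powr (r / 2)" using assms by (intro powr_mono2) auto
  also have "\<dots> \<le> (1 + (norm \<xi>)\<^sup>2) powr (s / 2)" using assms by (intro powr_mono) auto
  finally show ?thesis .
qed simp

lemma bessel_ge_1: "s \<ge> 0 \<Longrightarrow> 1 \<le> (1 + (norm \<xi>)\<^sup>2) powr (s / 2)"
  by (rule ge_one_powr_ge_zero) auto

lemma radial_measurable_lebesgue:
  "g \<in> borel_measurable borel \<Longrightarrow> (\<lambda>\<xi>. g (norm \<xi>)) \<in> borel_measurable (lebesgue :: 'a::euclidean_space measure)"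
  by (intro measurable_completion) simp

lemma frac_mult_measurable:
  assumes "L2 u" shows "frac_mult r u \<in> borel_measurable lebesgue"
  unfolding frac_mult_def
  by (intro borel_measurable_times L2_measurable fourier_L2_L2 L2_of_real assms
      radial_measurable_lebesgue[where g="\<lambda>t. complex_of_real (t powr r)"]) measurable

lemma bessel_weighted_measurable:
  assumes "L2 u" shows "bessel_weighted r u \<in> borel_measurable lebesgue"
  unfolding bessel_weighted_def
  by (intro borel_measurable_times L2_measurable fourier_L2_L2 L2_of_real assms
      radial_measurable_lebesgue[where g="\<lambda>t. complex_of_real ((1 + t\<^sup>2) powr (r / 2))"]) measurable

lemma frac_mult_le_Hs:
  assumes r: "0 \<le> r" "r \<le> s" and u: "u \<in> Hs s"
  shows "L2 (frac_mult r u)" "L2_norm (frac_mult r u) \<le> Hs_norm s u"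
proof -
  have le: "AE \<xi> in lebesgue. norm (frac_mult r u \<xi>) \<le> 1 * norm (bessel_weighted s u \<xi>)"
    using powr_le_bessel[OF r]
    by (intro AE_I2) (auto simp: frac_mult_def bessel_weighted_def norm_mult intro!: mult_right_mono)
  show L: "L2 (frac_mult r u)"
    by (rule L2_dominated[OF frac_mult_measurable[OF HsD(1)[OF u]] HsD(2)[OF u] le])
  show "L2_norm (frac_mult r u) \<le> Hs_norm s u"
    using L2_norm_mono[OF L HsD(2)[OF u] le] by (simp add: Hs_norm_def)
qed

lemma fourier_le_bessel:
  assumes "s \<ge> 0"
  shows "norm (fourier_real u \<xi>) \<le> norm (bessel_weighted s u \<xi>)"
  using mult_right_mono[OF bessel_ge_1[OF assms, of \<xi>] norm_ge_zero[of "fourier_real u \<xi>"]]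
  by (simp add: bessel_weighted_def norm_mult)

lemma L2_le_Hs:
  fixes u :: "'a::euclidean_space \<Rightarrow> real"
  assumes s: "s \<ge> 0" and u: "u \<in> Hs s"
  shows "sqrt ((2 * pi) ^ DIM('a)) * L2_norm u \<le> Hs_norm s u"
proof -
  have "L2_norm (fourier_real u) \<le> 1 * L2_norm (bessel_weighted s u)"
    by (rule L2_norm_mono) (use fourier_le_bessel[OF s] HsD[OF u] in \<open>auto intro: fourier_L2_L2 L2_of_real\<close>)
  then show ?thesis
    by (simp add: fourier_L2_norm[OF L2_of_real[OF HsD(1)[OF u]]] L2_norm_of_real Hs_norm_def)
qed

text \<open>Converse to \<open>L2_le_Hs\<close> and \<open>frac_mult_le_Hs\<close>: the lowest and
  the highest order parts control the whole norm. This is what makes the forms coercive.\<close>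

lemma Hs_norm_le:
  fixes u :: "'a::euclidean_space \<Rightarrow> real"
  assumes s: "s \<ge> 0" and u: "u \<in> Hs s"
  shows "(Hs_norm s u)\<^sup>2 \<le> 2 powr s * ((2 * pi) ^ DIM('a) * (L2_norm u)\<^sup>2 + (L2_norm (frac_mult s u))\<^sup>2)"
proof -
  have F: "L2 (fourier_real u)" by (intro fourier_L2_L2 L2_of_real HsD[OF u])
  have M: "L2 (frac_mult s u)" by (rule frac_mult_le_Hs[OF s order_refl u])
  have "(Hs_norm s u)\<^sup>2 \<le> (\<integral>\<xi>. 2 powr s * ((norm (fourier_real u \<xi>))\<^sup>2 + (norm (frac_mult s u \<xi>))\<^sup>2) \<partial>lebesgue)"
    unfolding Hs_norm_def L2_norm_sq
  proof (rule integral_mono)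
    fix \<xi> :: 'a
    define a where "a = (norm \<xi>)\<^sup>2"
    have a: "a \<ge> 0" by (simp add: a_def)
    have 1: "((1 + a) powr (s / 2))\<^sup>2 = (1 + a) powr s" using a by (simp add: powr_powr flip: powr_numeral)
    have 2: "(norm \<xi> powr s)\<^sup>2 = a powr s"
      by (cases "\<xi> = 0") (simp_all add: a_def powr_powr mult.commute flip: powr_numeral)
    \<comment> \<open>The larger of 1 and \<open>a\<close> is at least half of
      \<open>1 + a\<close>.\<close>
    have "(1 + a) powr s \<le> 2 powr s * (1 + a powr s)"
    proof (cases "a \<le> 1")
      case True
      then have "(1 + a) powr s \<le> 2 powr s" using s a by (intro powr_mono2) auto
      then show ?thesis by (simp add: distrib_left add_increasing2)
    next
      case False
      then have "(1 + a) powr s \<le> (2 * a) powr s" using s by (intro powr_mono2) auto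
      then show ?thesis using a by (simp add: powr_mult distrib_left add_increasing)
    qed
    then have "(1 + a) powr s * (norm (fourier_real u \<xi>))\<^sup>2 \<le> 2 powr s * (1 + a powr s) * (norm (fourier_real u \<xi>))\<^sup>2"
      by (rule mult_right_mono) simp
    then show "(norm (bessel_weighted s u \<xi>))\<^sup>2 \<le> 2 powr s * ((norm (fourier_real u \<xi>))\<^sup>2 + (norm (frac_mult s u \<xi>))\<^sup>2)"
      unfolding bessel_weighted_def frac_mult_def norm_mult power_mult_distrib
      by (simp add: 1[unfolded a_def] 2[unfolded a_def] a_def algebra_simps)
  qed (use L2_integrable[OF F] L2_integrable[OF M] L2_integrable[OF HsD(2)[OF u]] in auto)
  also have "\<dots> = 2 powr s * ((L2_norm (fourier_real u))\<^sup>2 + (L2_norm (frac_mult s u))\<^sup>2)"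
    using L2_integrable[OF F] L2_integrable[OF M] by (simp add: L2_norm_sq)
  finally show ?thesis
    by (simp add: fourier_L2_norm[OF L2_of_real[OF HsD(1)[OF u]]] L2_norm_of_real power_mult_distrib)
qed

lemma bessel_weighted_diff:
  fixes u v :: "'a::euclidean_space \<Rightarrow> real"
  assumes "L2 u" "L2 v"
  shows "AE \<xi> in lebesgue. bessel_weighted s (\<lambda>x. u x - v x) \<xi> = bessel_weighted s u \<xi> - bessel_weighted s v \<xi>"
  using bessel_weighted_lin[OF assms, of s 1 "-1"] by simp

lemma Hs_norm_diff:
  assumes "u \<in> Hs s" "v \<in> Hs s"
  shows "Hs_norm s (\<lambda>x. u x - v x) = L2_norm (\<lambda>\<xi>. bessel_weighted s u \<xi> - bessel_weighted s v \<xi>)"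
  unfolding Hs_norm_def using Hs.diff_mem[OF assms]
  by (intro L2_norm_cong_AE bessel_weighted_diff L2_measurable HsD) (use assms HsD in auto)

text \<open>The functions and their weighted transforms have separate L2 limits. Dividing by the
  weight, which is at least 1, shows that the second limit is the weighted transform of the
  first.\<close>

theorem Hs_complete:
  fixes X :: "nat \<Rightarrow> 'a::euclidean_space \<Rightarrow> real"
  assumes s: "s \<ge> 0" and X: "\<And>n. X n \<in> Hs s"
    and Cauchy: "\<And>e. e > 0 \<Longrightarrow> \<exists>N. \<forall>m\<ge>N. \<forall>n\<ge>N. Hs_norm s (\<lambda>x. X m x - X n x) < e"
  shows "\<exists>u\<in>Hs s. (\<lambda>n. Hs_norm s (\<lambda>x. X n x - u x)) \<longlonglongrightarrow> 0"
proof -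
  let ?\<kappa> = "sqrt ((2 * pi) ^ DIM('a))"
  have \<kappa>: "?\<kappa> > 0" by simp
  have "\<exists>u. L2 u \<and> (\<lambda>n. L2_norm (\<lambda>x. X n x - u x)) \<longlonglongrightarrow> 0"
  proof (rule L2_complete)
    fix e :: real assume "e > 0"
    then have "?\<kappa> * e > 0" by simp
    from Cauchy[OF this] obtain N where N: "\<And>m n. m \<ge> N \<Longrightarrow> n \<ge> N \<Longrightarrow> Hs_norm s (\<lambda>x. X m x - X n x) < ?\<kappa> * e"
      by blast
    have "L2_norm (\<lambda>x. X m x - X n x) < e" if "m \<ge> N" "n \<ge> N" for m n
    proof -
      have "?\<kappa> * L2_norm (\<lambda>x. X m x - X n x) < ?\<kappa> * e"
        using L2_le_Hs[OF s Hs.diff_mem[OF X[of m] X[of n]]] N[OF that] by (rule order_le_less_trans)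
      then show ?thesis using \<kappa> by (simp only: mult_less_cancel_left_pos)
    qed
    then show "\<exists>N. \<forall>m\<ge>N. \<forall>n\<ge>N. L2_norm (\<lambda>x. X m x - X n x) < e" by blast
  qed (rule HsD(1)[OF X])
  then obtain u where u: "L2 u" and ulim: "(\<lambda>n. L2_norm (\<lambda>x. X n x - u x)) \<longlonglongrightarrow> 0" by blast
  have "\<exists>g. L2 g \<and> (\<lambda>n. L2_norm (\<lambda>\<xi>. bessel_weighted s (X n) \<xi> - g \<xi>)) \<longlonglongrightarrow> 0"
    by (rule L2_complete) (use Cauchy in \<open>auto simp: Hs_norm_diff[OF X X] intro: HsD(2)[OF X]\<close>)
  then obtain g where g: "L2 g" and glim: "(\<lambda>n. L2_norm (\<lambda>\<xi>. bessel_weighted s (X n) \<xi> - g \<xi>)) \<longlonglongrightarrow> 0"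
    by blast
  let ?w = "\<lambda>\<xi>::'a. (1 + (norm \<xi>)\<^sup>2) powr (s / 2)"
  have w0: "?w \<xi> > 0" for \<xi> by (rule powr_gt_zero[THEN iffD2]) (metis add_pos_nonneg zero_less_one zero_le_power2 less_irrefl)
  have w1: "\<bar>1 / ?w \<xi>\<bar> \<le> 1" for \<xi> using bessel_ge_1[OF s, of \<xi>] w0[of \<xi>] by (simp add: divide_le_eq)
  have wm: "(\<lambda>\<xi>. 1 / ?w \<xi>) \<in> borel_measurable lebesgue"
    by (rule radial_measurable_lebesgue[where g="\<lambda>t. 1 / (1 + t\<^sup>2) powr (s / 2)"]) measurable
  define G where "G \<xi> = (1 / ?w \<xi>) *\<^sub>R g \<xi>" for \<xi>
  have G: "L2 G" unfolding G_def by (rule L2_bounded_scaleR[OF wm AE_I2[OF w1] g])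
  have F: "L2 (fourier_real v)" if "L2 v" for v :: "'a \<Rightarrow> real"
    by (intro fourier_L2_L2 L2_of_real that)
  have "AE \<xi> in lebesgue. fourier_real u \<xi> = G \<xi>"
  proof (rule L2_limit_unique[where X="\<lambda>n. fourier_real (X n)" and F=sequentially])
    have "L2_norm (\<lambda>\<xi>. fourier_real (X n) \<xi> - fourier_real u \<xi>) = ?\<kappa> * L2_norm (\<lambda>x. X n x - u x)" for n
      unfolding fourier_L2_diff_norm[OF L2_of_real[OF HsD(1)[OF X]] L2_of_real[OF u]]
      unfolding of_real_diff[symmetric] L2_norm_of_real ..
    then show "(\<lambda>n. L2_norm (\<lambda>\<xi>. fourier_real (X n) \<xi> - fourier_real u \<xi>)) \<longlonglongrightarrow> 0"
      using tendsto_mult_right_zero[OF ulim] by (simp only:)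
    have "L2_norm (\<lambda>\<xi>. fourier_real (X n) \<xi> - G \<xi>) \<le> 1 * L2_norm (\<lambda>\<xi>. bessel_weighted s (X n) \<xi> - g \<xi>)" for n
    proof (rule L2_norm_mono)
      have "fourier_real (X n) \<xi> - G \<xi> = (1 / ?w \<xi>) *\<^sub>R (bessel_weighted s (X n) \<xi> - g \<xi>)" for \<xi>
      proof -
        have "z - (1 / w) *\<^sub>R y = (1 / w) *\<^sub>R (of_real w * z - y)" if "w > 0" for w :: real and z y :: complex
          using that by (simp add: scaleR_conv_of_real field_simps)
        from this[OF w0[of \<xi>]] show ?thesis by (simp only: G_def bessel_weighted_def)
      qed
      note eq = this
      show "AE \<xi> in lebesgue. norm (fourier_real (X n) \<xi> - G \<xi>) \<le> 1 * norm (bessel_weighted s (X n) \<xi> - g \<xi>)"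
        unfolding eq norm_scaleR by (intro AE_I2 mult_right_mono[OF w1 norm_ge_zero])
    qed (auto intro: L2_diff F HsD[OF X] G g)
    then show "(\<lambda>n. L2_norm (\<lambda>\<xi>. fourier_real (X n) \<xi> - G \<xi>)) \<longlonglongrightarrow> 0"
      by (intro Lim_null_comparison[OF _ glim]) simp
  qed (auto intro: F u HsD[OF X] G)
  then have eq: "AE \<xi> in lebesgue. bessel_weighted s u \<xi> = g \<xi>"
  proof eventually_elim
    case (elim \<xi>)
    have "of_real w * ((1 / w) *\<^sub>R y) = y" if "w > 0" for w :: real and y :: complex
      using that by (simp add: scaleR_conv_of_real)
    from this[OF w0[of \<xi>]] show ?case by (simp only: bessel_weighted_def G_def elim)
  qed
  have uH: "u \<in> Hs s" using L2_cong_AE[OF g eq] u by (simp add: Hs_iff)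
  have "Hs_norm s (\<lambda>x. X n x - u x) = L2_norm (\<lambda>\<xi>. bessel_weighted s (X n) \<xi> - g \<xi>)" for n
    unfolding Hs_norm_diff[OF X uH]
    by (rule L2_norm_cong_AE) (use eq in \<open>auto intro!: L2_measurable L2_diff HsD[OF X] HsD[OF uH]\<close>)
  then show ?thesis using uH glim by (intro bexI[of _ u]) simp_all
qed

lemma Hs_norm_triangle_mid:
  assumes "u \<in> Hs s" "v \<in> Hs s" "w \<in> Hs s"
  shows "Hs_norm s (\<lambda>x. u x - v x) \<le> Hs_norm s (\<lambda>x. u x - w x) + Hs_norm s (\<lambda>x. w x - v x)"
  using Hs.triangle[OF Hs.diff_mem[of u s w] Hs.diff_mem[of w s v]] assms by (simp add: Hs_norm_eq)

lemma Hs_norm_minus_commute: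
  "\<lbrakk>u \<in> Hs s; v \<in> Hs s\<rbrakk> \<Longrightarrow> Hs_norm s (\<lambda>x. u x - v x) = Hs_norm s (\<lambda>x. v x - u x)"
  using Hs.diff_self_commute[of u s v] by (simp flip: Hs_norm_eq)

lemma Hs_norm_eq_0:
  fixes u :: "'a::euclidean_space \<Rightarrow> real"
  assumes s: "s \<ge> 0" and u: "u \<in> Hs s" and "Hs_norm s u = 0"
  shows "AE x in lebesgue. u x = 0"
proof -
  have "sqrt ((2 * pi) ^ DIM('a)) * L2_norm u \<le> 0" using L2_le_Hs[OF s u] assms(3) by simp
  then have "sqrt ((2 * pi) ^ DIM('a)) * L2_norm u \<le> sqrt ((2 * pi) ^ DIM('a)) * 0" by simp
  then have "L2_norm u \<le> 0" by (rule mult_left_le_imp_le) simp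
  then have "L2_norm u = 0" using L2_norm_nonneg[of u] by simp
  then show ?thesis using L2_norm_eq_0_iff[OF HsD(1)[OF u]] by simp
qed

section \<open>Test functions\<close>

lemma differentiable_UNIV_continuous: "(\<And>x. f differentiable (at x)) \<Longrightarrow> continuous_on UNIV f"
  by (simp add: continuous_at_imp_continuous_on differentiable_imp_continuous_within)

text \<open>Smoothness is proved by exhibiting a set of differentiable functions that is closed
  under partial derivatives.\<close>

lemma Ck_coinduct:
  assumes S: "\<And>f. f \<in> S \<Longrightarrow> (\<forall>x. f differentiable (at x)) \<and> (\<forall>i\<in>Basis. (\<lambda>x. frechet_derivative f (at x) i) \<in> S)"
    and f: "f \<in> S"
  shows "Ck k f"
  using f
proof (induction k arbitrary: f)
  case 0
  then show ?case using S[OF 0] by (simp add: differentiable_UNIV_continuous)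
next
  case (Suc k)
  then show ?case using S[OF Suc.prems] by simp
qed

lemma frechet_derivative_lin:
  fixes f g :: "'a::euclidean_space \<Rightarrow> real"
  assumes "f differentiable (at x)" "g differentiable (at x)"
  shows "((\<lambda>x. a * f x + b * g x) has_derivative
      (\<lambda>h. a * frechet_derivative f (at x) h + b * frechet_derivative g (at x) h)) (at x)"
  using assms[THEN frechet_derivative_works[THEN iffD1]]
  by (rule has_derivative_add[OF has_derivative_mult_right has_derivative_mult_right])

lemma Ck_lin: "\<lbrakk>Ck k f; Ck k g\<rbrakk> \<Longrightarrow> Ck k (\<lambda>x. a * f x + b * g x)"
proof (induction k arbitrary: f g)
  case (Suc k)
  have d: "f differentiable (at x)" "g differentiable (at x)" for x using Suc.prems by auto
  have "(\<lambda>x. frechet_derivative (\<lambda>x. a * f x + b * g x) (at x) i) =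
      (\<lambda>x. a * frechet_derivative f (at x) i + b * frechet_derivative g (at x) i)" for i
    by (simp add: frechet_derivative_at[OF frechet_derivative_lin[OF d], symmetric])
  moreover have "(\<lambda>x. a * f x + b * g x) differentiable (at x)" for x
    by (rule differentiableI) (rule frechet_derivative_lin[OF d])
  moreover have "Ck k (\<lambda>x. a * frechet_derivative f (at x) i + b * frechet_derivative g (at x) i)" if "i \<in> Basis" for i
    using Suc.prems that by (intro Suc.IH) auto
  ultimately show ?case by simp
next
  case 0
  then have "continuous_on UNIV f" "continuous_on UNIV g" by simp_all
  from continuous_on_add[OF continuous_on_mult_left[OF this(1)] continuous_on_mult_left[OF this(2)]]
  show ?case by simp
qed

text \<open>The powers of t in the denominator make the family closed under differentiation up to
  linear combinations, see \<open>expinv_deriv\<close>.\<close>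

definition expinv :: "nat \<Rightarrow> real \<Rightarrow> real" where
  "expinv j t = (if t > 0 then exp (- 1 / t) / t ^ j else 0)"

lemma expinv_tendsto_0: "(expinv j \<longlongrightarrow> 0) (at 0)"
proof -
  have "((\<lambda>x. x ^ j / exp x) \<longlongrightarrow> (0::real)) at_top" by (rule tendsto_power_div_exp_0)
  then have "((\<lambda>x. expinv j (inverse x)) \<longlongrightarrow> 0) at_top"
  proof (rule Lim_transform_eventually)
    show "\<forall>\<^sub>F x in at_top. x ^ j / exp x = expinv j (inverse x)"
      using eventually_gt_at_top[of 0]
      by eventually_elim (simp add: expinv_def exp_minus field_simps)
  qed
  then have "(expinv j \<longlongrightarrow> 0) (at_right 0)" by (simp add: filterlim_at_right_to_top)
  moreover have "(expinv j \<longlongrightarrow> 0) (at_left 0)"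
    by (rule tendsto_eventually) (auto simp: expinv_def eventually_at_filter)
  ultimately show ?thesis by (simp add: filterlim_split_at)
qed

lemma expinv_deriv: "(expinv j has_real_derivative (expinv (j + 2) t - real j * expinv (j + 1) t)) (at t)"
proof (cases "t = 0")
  case True
  \<comment> \<open>The difference quotient at 0 is the next member of the family, which tends to
    0.\<close>
  have "((\<lambda>h. expinv j h / h) \<longlongrightarrow> 0) (at 0)"
  proof (rule Lim_transform_eventually[OF expinv_tendsto_0[of "j + 1"]])
    show "\<forall>\<^sub>F h in at 0. expinv (j + 1) h = expinv j h / h"
      by (auto simp: expinv_def eventually_at_filter mult.commute)
  qed
  then show ?thesis using True by (simp add: DERIV_def expinv_def)
next
  case False
  show ?thesis
  proof (cases "t > 0")
    case True
    have "((\<lambda>t. exp (- 1 / t) / t ^ j) has_real_derivative (expinv (j + 2) t - real j * expinv (j + 1) t)) (at t)"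
    proof -
      have "((\<lambda>t. exp (- 1 / t) / t ^ j) has_real_derivative
          (exp (- 1 / t) * (1 / t\<^sup>2) * t ^ j - exp (- 1 / t) * (real j * t ^ (j - 1))) / (t ^ j * t ^ j)) (at t)"
        using True by (auto intro!: derivative_eq_intros simp: power2_eq_square)
      also have "(exp (- 1 / t) * (1 / t\<^sup>2) * t ^ j - exp (- 1 / t) * (real j * t ^ (j - 1))) / (t ^ j * t ^ j)
          = expinv (j + 2) t - real j * expinv (j + 1) t"
        using True by (cases j) (auto simp: expinv_def field_simps power2_eq_square)
      finally show ?thesis .
    qed
    then show ?thesis
      by (rule has_field_derivative_transform_within_open[where S="{0<..}"]) (use True in \<open>auto simp: expinv_def\<close>)
  next
    case neg: False
    have "((\<lambda>_. 0) has_real_derivative 0) (at t)" by simp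
    then have "(expinv j has_real_derivative 0) (at t)"
      by (rule has_field_derivative_transform_within_open[where S="{..<0}"]) (use False neg in \<open>auto simp: expinv_def\<close>)
    then show ?thesis using neg by (simp add: expinv_def)
  qed
qed

text \<open>An algebra of functions closed under partial derivatives that contains a bump function.\<close>

inductive_set bump_alg :: "'a::euclidean_space \<Rightarrow> real \<Rightarrow> ('a \<Rightarrow> real) set" for a r where
  const: "(\<lambda>x. c) \<in> bump_alg a r"
| coord: "(\<lambda>x. x \<bullet> y) \<in> bump_alg a r"
| expinv: "(\<lambda>x. expinv j (r - (x - a) \<bullet> (x - a))) \<in> bump_alg a r"
| add: "\<lbrakk>f \<in> bump_alg a r; g \<in> bump_alg a r\<rbrakk> \<Longrightarrow> (\<lambda>x. f x + g x) \<in> bump_alg a r"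
| mult: "\<lbrakk>f \<in> bump_alg a r; g \<in> bump_alg a r\<rbrakk> \<Longrightarrow> (\<lambda>x. f x * g x) \<in> bump_alg a r"

lemma bump_alg_deriv:
  "f \<in> bump_alg a r \<Longrightarrow> \<exists>F. \<forall>i. F i \<in> bump_alg a r \<and>
     (\<forall>x. (f has_derivative (\<lambda>h. \<Sum>i\<in>Basis. (h \<bullet> i) * F i x)) (at x))"
proof (induction rule: bump_alg.induct)
  case (const c)
  show ?case by (rule exI[of _ "\<lambda>i x. 0"]) (auto intro: bump_alg.const)
next
  case (coord y)
  have "(\<lambda>h. h \<bullet> y) = (\<lambda>h. \<Sum>i\<in>Basis. (h \<bullet> i) * (y \<bullet> i))" by (rule ext) (rule euclidean_inner)
  then show ?case
    by (intro exI[of _ "\<lambda>i x. y \<bullet> i"]) (auto intro: bump_alg.const intro!: derivative_eq_intros simp flip: fun_eq_iff)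
next
  case (expinv j)
  let ?q = "\<lambda>x. r - (x - a) \<bullet> (x - a)"
  let ?D = "\<lambda>x. expinv (j + 2) (?q x) + (- real j) * expinv (j + 1) (?q x)"
  let ?F = "\<lambda>i x. ?D x * ((- 2) * (x \<bullet> i + - (a \<bullet> i)))"
  have "?F i \<in> bump_alg a r" for i
    by (intro bump_alg.mult bump_alg.add bump_alg.expinv bump_alg.const bump_alg.coord)
  moreover have "((\<lambda>x. expinv j (?q x)) has_derivative (\<lambda>h. \<Sum>i\<in>Basis. (h \<bullet> i) * ?F i x)) (at x)" for x
  proof -
    have q: "(?q has_derivative (\<lambda>h. - (2 * ((x - a) \<bullet> h)))) (at x)"
      by (auto intro!: derivative_eq_intros simp: inner_commute)
    have "((\<lambda>x. expinv j (?q x)) has_derivative (\<lambda>h. - (2 * ((x - a) \<bullet> h)) * ?D x)) (at x)"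
      using DERIV_compose_FDERIV[OF expinv_deriv[of j "?q x"] q] by simp
    moreover have "- (2 * ((x - a) \<bullet> h)) * d = (\<Sum>i\<in>Basis. (h \<bullet> i) * (d * ((- 2) * (x \<bullet> i + - (a \<bullet> i)))))" for h d
    proof -
      have "- (2 * ((x - a) \<bullet> h)) * d = (\<Sum>i\<in>Basis. ((x - a) \<bullet> i) * (h \<bullet> i)) * (- 2 * d)"
        by (simp flip: euclidean_inner)
      also have "\<dots> = (\<Sum>i\<in>Basis. (h \<bullet> i) * (d * ((- 2) * (x \<bullet> i + - (a \<bullet> i)))))"
        unfolding sum_distrib_right by (rule sum.cong) (auto simp: inner_diff_left algebra_simps)
      finally show ?thesis .
    qed
    ultimately show ?thesis by (simp only:)
  qed
  ultimately show ?case by (intro exI[of _ ?F]) blast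
next
  case (add f g)
  obtain F where F: "\<And>i. F i \<in> bump_alg a r" "\<And>x. (f has_derivative (\<lambda>h. \<Sum>i\<in>Basis. (h \<bullet> i) * F i x)) (at x)"
    using add.IH(1) by blast
  obtain G where G: "\<And>i. G i \<in> bump_alg a r" "\<And>x. (g has_derivative (\<lambda>h. \<Sum>i\<in>Basis. (h \<bullet> i) * G i x)) (at x)"
    using add.IH(2) by blast
  show ?case
  proof (intro exI[of _ "\<lambda>i x. F i x + G i x"] allI conjI bump_alg.add F G)
    fix x
    show "((\<lambda>x. f x + g x) has_derivative (\<lambda>h. \<Sum>i\<in>Basis. (h \<bullet> i) * (F i x + G i x))) (at x)"
      using has_derivative_add[OF F(2) G(2)] by (simp add: distrib_left sum.distrib)
  qed
next
  case (mult f g)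
  obtain F where F: "\<And>i. F i \<in> bump_alg a r" "\<And>x. (f has_derivative (\<lambda>h. \<Sum>i\<in>Basis. (h \<bullet> i) * F i x)) (at x)"
    using mult.IH(1) by blast
  obtain G where G: "\<And>i. G i \<in> bump_alg a r" "\<And>x. (g has_derivative (\<lambda>h. \<Sum>i\<in>Basis. (h \<bullet> i) * G i x)) (at x)"
    using mult.IH(2) by blast
  show ?case
  proof (intro exI[of _ "\<lambda>i x. f x * G i x + F i x * g x"] allI conjI bump_alg.add bump_alg.mult mult.hyps F G)
    fix x
    show "((\<lambda>x. f x * g x) has_derivative (\<lambda>h. \<Sum>i\<in>Basis. (h \<bullet> i) * (f x * G i x + F i x * g x))) (at x)"
      using has_derivative_mult[OF F(2) G(2)]
      by (simp add: distrib_left sum.distrib sum_distrib_left sum_distrib_right mult_ac)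
  qed
qed

lemma bump_alg_Ck:
  assumes "f \<in> bump_alg a r" shows "Ck k f"
proof (rule Ck_coinduct[OF _ assms])
  fix f assume "f \<in> bump_alg a r"
  then obtain F where F: "\<And>i. F i \<in> bump_alg a r" "\<And>x. (f has_derivative (\<lambda>h. \<Sum>i\<in>Basis. (h \<bullet> i) * F i x)) (at x)"
    using bump_alg_deriv[of f a r] by blast
  have "frechet_derivative f (at x) i = F i x" if "i \<in> Basis" for i x
    using that by (simp add: frechet_derivative_at[OF F(2), symmetric] inner_Basis if_distrib[of "\<lambda>t. t * _"] cong: if_cong)
  then have "(\<lambda>x. frechet_derivative f (at x) i) = F i" if "i \<in> Basis" for i using that by auto
  then show "(\<forall>x. f differentiable (at x)) \<and> (\<forall>i\<in>Basis. (\<lambda>x. frechet_derivative f (at x) i) \<in> bump_alg a r)"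
    using F by (auto simp: differentiable_def)
qed

lemma bump_exists:
  fixes a :: "'a::euclidean_space"
  assumes e: "e > 0"
  obtains \<phi> where "\<phi> \<in> Cc_inf (ball a e)" "\<And>x. \<phi> x \<ge> 0" "\<phi> a > 0"
proof -
  \<comment> \<open>The radius \<open>e/2\<close> keeps the closed support inside the open ball of
    radius \<open>e\<close>.\<close>
  define \<phi> where "\<phi> x = expinv 0 ((e/2)\<^sup>2 - (x - a) \<bullet> (x - a))" for x
  have sub: "{x. \<phi> x \<noteq> 0} \<subseteq> cball a (e/2)"
  proof
    fix x assume "x \<in> {x. \<phi> x \<noteq> 0}"
    then have "(norm (x - a))\<^sup>2 < (e/2)\<^sup>2"
      by (auto simp: \<phi>_def expinv_def power2_norm_eq_inner split: if_splits)
    then have "norm (x - a) < e/2" by (rule power_less_imp_less_base) (use e in simp)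
    then show "x \<in> cball a (e/2)" by (simp add: dist_norm norm_minus_commute)
  qed
  then have cl: "closure {x. \<phi> x \<noteq> 0} \<subseteq> cball a (e/2)" by (rule closure_minimal) simp
  have "bounded {x. \<phi> x \<noteq> 0}" using sub bounded_subset bounded_cball by blast
  then have "compact (closure {x. \<phi> x \<noteq> 0})" by (simp add: compact_closure)
  moreover have "cball a (e/2) \<subseteq> ball a e" using e by auto
  moreover have "Ck k \<phi>" for k
    unfolding \<phi>_def by (rule bump_alg_Ck) (rule bump_alg.expinv)
  ultimately have "\<phi> \<in> Cc_inf (ball a e)" using cl unfolding Cc_inf_def by blast
  then show ?thesis using that e by (simp add: \<phi>_def expinv_def)
qed

section \<open>Derivatives of test functions and their Fourier transforms\<close>

definition pd :: "'a::euclidean_space \<Rightarrow> ('a \<Rightarrow> real) \<Rightarrow> 'a \<Rightarrow> real" where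
  "pd i f = (\<lambda>x. frechet_derivative f (at x) i)"

lemma Cc_inf_lin:
  assumes "f \<in> Cc_inf W" "g \<in> Cc_inf W"
  shows "(\<lambda>x. a * f x + b * g x) \<in> Cc_inf W"
proof -
  have sub: "{x. a * f x + b * g x \<noteq> 0} \<subseteq> {x. f x \<noteq> 0} \<union> {x. g x \<noteq> 0}" by auto
  have cl: "closure {x. a * f x + b * g x \<noteq> 0} \<subseteq> closure {x. f x \<noteq> 0} \<union> closure {x. g x \<noteq> 0}"
    using closure_mono[OF sub] by (simp only: closure_Un)
  have "compact (closure {x. f x \<noteq> 0} \<union> closure {x. g x \<noteq> 0})"
    using assms by (intro compact_Un) (auto simp: Cc_inf_def)
  from bounded_subset[OF compact_imp_bounded[OF this] cl]
  have "compact (closure {x. a * f x + b * g x \<noteq> 0})" by (simp add: compact_eq_bounded_closed)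
  moreover have "Ck k (\<lambda>x. a * f x + b * g x)" for k
    by (rule Ck_lin) (use assms in \<open>simp_all add: Cc_inf_def\<close>)
  moreover have "closure {x. f x \<noteq> 0} \<subseteq> W" "closure {x. g x \<noteq> 0} \<subseteq> W"
    using assms by (simp_all add: Cc_inf_def)
  ultimately show ?thesis using cl unfolding Cc_inf_def by blast
qed

lemma Cc_inf_zero: "(\<lambda>x. 0) \<in> Cc_inf (W :: 'a::euclidean_space set)"
proof -
  have "(\<lambda>x::'a::euclidean_space. 0) \<in> bump_alg 0 0" by (rule bump_alg.const)
  from bump_alg_Ck[OF this] show ?thesis by (simp add: Cc_inf_def)
qed

lemma Cc_inf_sum: "\<lbrakk>finite I; \<And>i. i \<in> I \<Longrightarrow> f i \<in> Cc_inf W\<rbrakk> \<Longrightarrow> (\<lambda>x. \<Sum>i\<in>I. f i x) \<in> Cc_inf W"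
proof (induction I rule: finite_induct)
  case (insert i I)
  then show ?case using Cc_inf_lin[of "f i" W "\<lambda>x. \<Sum>i\<in>I. f i x" 1 1] by simp
qed (simp add: Cc_inf_zero)

lemma Cc_inf_mono: "W \<subseteq> W' \<Longrightarrow> Cc_inf W \<subseteq> Cc_inf W'"
  by (auto simp: Cc_inf_def)

lemma Cc_inf_differentiable:
  assumes "f \<in> Cc_inf W" shows "f differentiable (at x)"
proof -
  have "Ck (Suc 0) f" using assms unfolding Cc_inf_def by blast
  then show ?thesis by simp
qed

lemma Cc_inf_continuous: "f \<in> Cc_inf W \<Longrightarrow> continuous_on UNIV f"
  by (rule differentiable_UNIV_continuous) (rule Cc_inf_differentiable)

lemma Cc_inf_outside: "\<lbrakk>f \<in> Cc_inf W; x \<notin> W\<rbrakk> \<Longrightarrow> f x = 0"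
  using closure_subset[of "{x. f x \<noteq> 0}"] unfolding Cc_inf_def by blast

lemma Cc_inf_pd:
  assumes f: "f \<in> Cc_inf W" and i: "i \<in> Basis"
  shows "pd i f \<in> Cc_inf W"
proof -
  have Ck: "Ck k (pd i f)" for k
  proof -
    have "Ck (Suc k) f" using f by (auto simp only: Cc_inf_def)
    then show ?thesis using i by (simp add: pd_def)
  qed
  have "{x. pd i f x \<noteq> 0} \<subseteq> closure {x. f x \<noteq> 0}"
  proof (rule subsetI, rule ccontr)
    fix x assume x: "x \<in> {x. pd i f x \<noteq> 0}" "x \<notin> closure {x. f x \<noteq> 0}"
    have "((\<lambda>_. 0) has_derivative (\<lambda>_. 0)) (at x)" by simp
    then have "(f has_derivative (\<lambda>_. 0)) (at x)"
    proof (rule has_derivative_transform_within_open[where s="- closure {x. f x \<noteq> 0}"])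
      show "0 = f y" if "y \<in> - closure {x. f x \<noteq> 0}" for y
        using that closure_subset[of "{x. f x \<noteq> 0}"] by auto
    qed (use x in auto)
    then show False using x(1) by (simp add: pd_def frechet_derivative_at[symmetric])
  qed
  then have cl: "closure {x. pd i f x \<noteq> 0} \<subseteq> closure {x. f x \<noteq> 0}"
    by (rule closure_minimal) simp
  moreover have "compact (closure {x. pd i f x \<noteq> 0})"
    using f bounded_subset[OF compact_imp_bounded cl] by (simp add: compact_eq_bounded_closed Cc_inf_def)
  ultimately show ?thesis using f Ck by (auto simp: Cc_inf_def)
qed

lemma Cc_inf_Cc:
  assumes f: "f \<in> Cc_inf W" shows "Cc f"
proof -
  have "bounded (closure {x. f x \<noteq> 0})" using f by (simp add: Cc_inf_def compact_imp_bounded)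
  then obtain R where R: "\<And>x. x \<in> closure {x. f x \<noteq> 0} \<Longrightarrow> norm x \<le> R" by (auto simp: bounded_iff)
  have "f x = 0" if "norm x > R" for x
    using R[of x] that closure_subset[of "{x. f x \<noteq> 0}"] by (auto simp: not_le[symmetric])
  then show ?thesis using Cc_inf_continuous[OF f] by (auto simp: Cc_def)
qed

lemma directional_derivative:
  assumes "f differentiable (at (x + t *\<^sub>R i))"
  shows "((\<lambda>t. f (x + t *\<^sub>R i)) has_real_derivative pd i f (x + t *\<^sub>R i)) (at t)"
proof -
  let ?D = "frechet_derivative f (at (x + t *\<^sub>R i))"
  have D: "(f has_derivative ?D) (at (x + t *\<^sub>R i))" using assms by (simp add: frechet_derivative_works)
  have "((\<lambda>t. x + t *\<^sub>R i) has_derivative (\<lambda>h. h *\<^sub>R i)) (at t)" by (auto intro!: derivative_eq_intros)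
  from has_derivative_compose[OF this D]
  have "((\<lambda>t. f (x + t *\<^sub>R i)) has_derivative (\<lambda>h. ?D (h *\<^sub>R i))) (at t)" .
  moreover have "?D (h *\<^sub>R i) = pd i f (x + t *\<^sub>R i) * h" for h
    using linear_scale[OF has_derivative_linear[OF D], of h i] by (simp add: pd_def)
  ultimately show ?thesis by (simp only: has_field_derivative_def)
qed

lemma integral_translate:
  fixes f :: "'a::euclidean_space \<Rightarrow> real"
  assumes f: "continuous_on UNIV f" "integrable lebesgue f"
  shows "integrable lebesgue (\<lambda>x. f (x + a))" "(\<integral>x. f (x + a) \<partial>lebesgue) = (\<integral>x. f x \<partial>lebesgue)"
proof -
  have m [measurable]: "f \<in> borel_measurable borel" by (rule borel_measurable_continuous_onI[OF f(1)])
  have i: "integrable lborel f" using f(2) by (simp add: integral_lebesgue_lborel)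
  have m2: "(\<lambda>x. f (x + a)) \<in> borel_measurable borel" by measurable
  have "integrable (distr lborel borel ((+) a)) f" using i by (simp add: lborel_distr_plus)
  then have "integrable lborel (\<lambda>x. f (a + x))" by (subst (asm) integrable_distr_eq) auto
  then show "integrable lebesgue (\<lambda>x. f (x + a))"
    by (simp add: integral_lebesgue_lborel(2)[OF m2] add.commute)
  show "(\<integral>x. f (x + a) \<partial>lebesgue) = (\<integral>x. f x \<partial>lebesgue)"
    using lborel_integral_affine[OF m, of 1 a]
    by (simp add: integral_lebesgue_lborel(1)[OF m2] integral_lebesgue_lborel(1)[OF m] add.commute)
qed

text \<open>Difference quotients have integral 0 by translation invariance. They converge to the
  derivative, and the mean value theorem bounds them.\<close>

lemma integral_directional_derivative:
  fixes f f' :: "'a::euclidean_space \<Rightarrow> real"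
  assumes f: "Cc f" and f': "Cc f'" and i: "norm i \<le> 1"
    and deriv: "\<And>x t. ((\<lambda>t. f (x + t *\<^sub>R i)) has_real_derivative f' (x + t *\<^sub>R i)) (at t)"
  shows "(\<integral>x. f' x \<partial>lebesgue) = 0"
proof -
  obtain R M0 where R: "\<And>x. norm (f x) \<le> indicat_real (cball 0 R) x * M0" using Cc_bounded[OF f] by metis
  obtain M where M: "\<And>x. norm (f' x) \<le> M" using Cc_bounded[OF f'] by metis
  \<comment> \<open>Steps of length at most 1 in a direction of norm at most 1 keep all difference
    quotients supported in the ball of radius \<open>R + 1\<close>, which gives one dominating
    function.\<close>
  define h where "h n = 1 / real (Suc n)" for n
  have h: "h n > 0" "h n \<le> 1" for n by (auto simp: h_def)
  have h0: "h \<longlonglongrightarrow> 0" unfolding h_def by (rule LIMSEQ_Suc[OF lim_1_over_n])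
  define q where "q n x = (f (x + h n *\<^sub>R i) - f x) / h n" for n x
  have int: "integrable lebesgue f" "continuous_on UNIV f" using f Cc_integrable by (auto simp: Cc_def)
  have cq: "continuous_on UNIV (q n)" for n
    unfolding q_def divide_inverse
    by (intro continuous_intros continuous_on_compose2[OF int(2)]) auto
  have "(\<lambda>n. \<integral>x. q n x \<partial>lebesgue) \<longlonglongrightarrow> (\<integral>x. f' x \<partial>lebesgue)"
  proof (rule integral_dominated_convergence)
    show "integrable lebesgue (\<lambda>x::'a. indicat_real (cball 0 (R + 1)) x * M)" by (rule indicator_ball_integrable)
    have "(\<lambda>n. q n x) \<longlonglongrightarrow> f' x" for x
    proof -
      have "((\<lambda>t. (f (x + t *\<^sub>R i) - f x) / t) \<longlongrightarrow> f' x) (at 0)"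
        using deriv[of x 0] by (simp add: DERIV_def)
      then show ?thesis
        unfolding q_def by (rule filterlim_compose) (use h h0 in \<open>auto simp: filterlim_at less_imp_neq[THEN not_sym]\<close>)
    qed
    then show "AE x in lebesgue. (\<lambda>n. q n x) \<longlonglongrightarrow> f' x" by simp
    have "norm (q n x) \<le> indicat_real (cball 0 (R + 1)) x * M" for n x
    proof (cases "norm x \<le> R + 1")
      case True
      obtain t where "f (x + h n *\<^sub>R i) - f (x + 0 *\<^sub>R i) = (h n - 0) * f' (x + t *\<^sub>R i)"
        using MVT2[OF h(1)[of n], of "\<lambda>t. f (x + t *\<^sub>R i)" "\<lambda>t. f' (x + t *\<^sub>R i)"] deriv by blast
      then have "q n x = f' (x + t *\<^sub>R i)" using h(1)[of n] by (simp add: q_def)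
      then show ?thesis using M True by simp
    next
      case False
      have "norm (h n *\<^sub>R i) \<le> 1" using h[of n] i by (simp add: mult_le_one)
      then have "norm (x + h n *\<^sub>R i) > R" using False norm_triangle_ineq2[of x "- (h n *\<^sub>R i)"] by simp
      then have "f (x + h n *\<^sub>R i) = 0" "f x = 0" using R[of "x + h n *\<^sub>R i"] R[of x] False by auto
      then show ?thesis using False by (simp add: q_def)
    qed
    then show "AE x in lebesgue. norm (q n x) \<le> indicat_real (cball 0 (R + 1)) x * M" for n by simp
  qed (use cq Cc_measurable[OF f'] in \<open>auto intro: continuous_measurable_lebesgue\<close>)
  moreover have "(\<integral>x. q n x \<partial>lebesgue) = 0" for n
    unfolding q_def using integral_translate[OF int(2,1)] int by simp
  ultimately show ?thesis by (simp add: LIMSEQ_const_iff)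
qed

lemma Cc_mult:
  fixes f g :: "'a::euclidean_space \<Rightarrow> real"
  assumes "Cc f" "continuous_on UNIV g" shows "Cc (\<lambda>x. f x * g x)"
proof -
  obtain R where "\<And>x. norm x > R \<Longrightarrow> f x = 0" using assms(1) by (auto simp: Cc_def)
  moreover have "continuous_on UNIV (\<lambda>x. f x * g x)"
    using assms by (intro continuous_on_mult) (auto simp: Cc_def)
  ultimately show ?thesis by (auto simp: Cc_def)
qed

lemma Cc_add:
  assumes f: "Cc f" and g: "Cc g" shows "Cc (\<lambda>x. f x + g x)"
proof -
  obtain R R' where "\<And>x. norm x > R \<Longrightarrow> f x = 0" "\<And>x. norm x > R' \<Longrightarrow> g x = 0"
    using assms by (auto simp: Cc_def)
  then have "\<forall>x. norm x > max R R' \<longrightarrow> f x + g x = 0" by auto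
  moreover have "continuous_on UNIV (\<lambda>x. f x + g x)"
    using assms by (intro continuous_on_add) (auto simp: Cc_def)
  ultimately show ?thesis unfolding Cc_def by blast
qed

text \<open>Splits the transform into real integrals, to which the real-valued integration by parts
  applies.\<close>

lemma fourier_integral_cos_sin:
  fixes g :: "'a::euclidean_space \<Rightarrow> real"
  assumes g: "Cc g"
  shows "fourier_integral (\<lambda>x. complex_of_real (g x)) \<xi> =
    of_real (\<integral>x. g x * cos (x \<bullet> \<xi>) \<partial>lebesgue) - \<i> * of_real (\<integral>x. g x * sin (x \<bullet> \<xi>) \<partial>lebesgue)"
proof -
  have c: "integrable lebesgue (\<lambda>x. g x * cos (x \<bullet> \<xi>))" and s: "integrable lebesgue (\<lambda>x. g x * sin (x \<bullet> \<xi>))"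
    by (intro Cc_integrable Cc_mult g continuous_intros)+
  have "fourier_integral (\<lambda>x. complex_of_real (g x)) \<xi> =
      (\<integral>x. of_real (g x * cos (x \<bullet> \<xi>)) - \<i> * of_real (g x * sin (x \<bullet> \<xi>)) \<partial>lebesgue)"
    unfolding fourier_integral_def by (rule Bochner_Integration.integral_cong) (auto simp: complex_eq_iff)
  also have "\<dots> = (\<integral>x. complex_of_real (g x * cos (x \<bullet> \<xi>)) \<partial>lebesgue) - (\<integral>x. \<i> * complex_of_real (g x * sin (x \<bullet> \<xi>)) \<partial>lebesgue)"
    using c s by (intro Bochner_Integration.integral_diff integrable_mult_right) (auto simp only: complex_of_real_integrable_eq)
  finally show ?thesis by (simp only: integral_mult_right_zero integral_complex_of_real)
qed

lemma fourier_integral_pd: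
  fixes \<phi> :: "'a::euclidean_space \<Rightarrow> real"
  assumes \<phi>: "\<phi> \<in> Cc_inf W" and i: "i \<in> Basis"
  shows "fourier_integral (\<lambda>x. complex_of_real (pd i \<phi> x)) \<xi> =
    \<i> * of_real (i \<bullet> \<xi>) * fourier_integral (\<lambda>x. complex_of_real (\<phi> x)) \<xi>"
proof -
  note C = Cc_inf_Cc[OF \<phi>] Cc_inf_Cc[OF Cc_inf_pd[OF \<phi> i]]
  have ni: "norm i \<le> 1" using i by simp
  note dd = directional_derivative[OF Cc_inf_differentiable[OF \<phi>]]
  have cc: "Cc (\<lambda>x. \<phi> x * cos (x \<bullet> \<xi>))" "Cc (\<lambda>x. \<phi> x * sin (x \<bullet> \<xi>))"
    "Cc (\<lambda>x. pd i \<phi> x * cos (x \<bullet> \<xi>))" "Cc (\<lambda>x. pd i \<phi> x * sin (x \<bullet> \<xi>))"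
    "Cc (\<lambda>x. \<phi> x * sin (x \<bullet> \<xi>) * (- (i \<bullet> \<xi>)))" "Cc (\<lambda>x. \<phi> x * cos (x \<bullet> \<xi>) * (i \<bullet> \<xi>))"
    by (intro Cc_mult C continuous_intros)+
  have "(\<integral>x. pd i \<phi> x * cos (x \<bullet> \<xi>) + \<phi> x * sin (x \<bullet> \<xi>) * (- (i \<bullet> \<xi>)) \<partial>lebesgue) = 0"
  proof (rule integral_directional_derivative[OF cc(1) Cc_add[OF cc(3,5)] ni])
    show "((\<lambda>t. \<phi> (x + t *\<^sub>R i) * cos ((x + t *\<^sub>R i) \<bullet> \<xi>)) has_real_derivative
        pd i \<phi> (x + t *\<^sub>R i) * cos ((x + t *\<^sub>R i) \<bullet> \<xi>) + \<phi> (x + t *\<^sub>R i) * sin ((x + t *\<^sub>R i) \<bullet> \<xi>) * (- (i \<bullet> \<xi>))) (at t)" for x t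
      unfolding inner_add_left inner_scaleR_left by (auto intro!: derivative_eq_intros dd)
  qed
  then have "(\<integral>x. pd i \<phi> x * cos (x \<bullet> \<xi>) \<partial>lebesgue) + (\<integral>x. \<phi> x * sin (x \<bullet> \<xi>) \<partial>lebesgue) * (- (i \<bullet> \<xi>)) = 0"
    by (subst (asm) Bochner_Integration.integral_add[OF Cc_integrable[OF cc(3)] Cc_integrable[OF cc(5)]])
      (simp only: integral_mult_left_zero)
  then have c: "(\<integral>x. pd i \<phi> x * cos (x \<bullet> \<xi>) \<partial>lebesgue) = (i \<bullet> \<xi>) * (\<integral>x. \<phi> x * sin (x \<bullet> \<xi>) \<partial>lebesgue)"
    by (simp add: mult.commute)
  have "(\<integral>x. pd i \<phi> x * sin (x \<bullet> \<xi>) + \<phi> x * cos (x \<bullet> \<xi>) * (i \<bullet> \<xi>) \<partial>lebesgue) = 0"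
  proof (rule integral_directional_derivative[OF cc(2) Cc_add[OF cc(4,6)] ni])
    show "((\<lambda>t. \<phi> (x + t *\<^sub>R i) * sin ((x + t *\<^sub>R i) \<bullet> \<xi>)) has_real_derivative
        pd i \<phi> (x + t *\<^sub>R i) * sin ((x + t *\<^sub>R i) \<bullet> \<xi>) + \<phi> (x + t *\<^sub>R i) * cos ((x + t *\<^sub>R i) \<bullet> \<xi>) * (i \<bullet> \<xi>)) (at t)" for x t
      unfolding inner_add_left inner_scaleR_left by (auto intro!: derivative_eq_intros dd)
  qed
  then have "(\<integral>x. pd i \<phi> x * sin (x \<bullet> \<xi>) \<partial>lebesgue) + (\<integral>x. \<phi> x * cos (x \<bullet> \<xi>) \<partial>lebesgue) * (i \<bullet> \<xi>) = 0"
    by (subst (asm) Bochner_Integration.integral_add[OF Cc_integrable[OF cc(4)] Cc_integrable[OF cc(6)]])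
      (simp only: integral_mult_left_zero)
  then have s: "(\<integral>x. pd i \<phi> x * sin (x \<bullet> \<xi>) \<partial>lebesgue) = - ((i \<bullet> \<xi>) * (\<integral>x. \<phi> x * cos (x \<bullet> \<xi>) \<partial>lebesgue))"
    by (simp add: add_eq_0_iff mult.commute)
  show ?thesis
    unfolding fourier_integral_cos_sin[OF C(1)] fourier_integral_cos_sin[OF C(2)] c s
    by (simp add: complex_eq_iff)
qed

text \<open>The negative Laplacian; the sign makes its Fourier symbol the nonnegative function
  |xi|^2.\<close>

definition nlap :: "('a::euclidean_space \<Rightarrow> real) \<Rightarrow> 'a \<Rightarrow> real" where
  "nlap f = (\<lambda>x. - (\<Sum>i\<in>Basis. pd i (pd i f) x))"

lemma Cc_inf_nlap: "\<phi> \<in> Cc_inf W \<Longrightarrow> nlap \<phi> \<in> Cc_inf W"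
  using Cc_inf_lin[OF Cc_inf_sum Cc_inf_zero, of Basis "\<lambda>i. pd i (pd i \<phi>)" W "-1" 0]
  by (simp add: nlap_def[abs_def] Cc_inf_pd)

lemma Cc_inf_nlap_pow: "\<phi> \<in> Cc_inf W \<Longrightarrow> (nlap ^^ k) \<phi> \<in> Cc_inf W"
  by (induction k) (auto intro: Cc_inf_nlap)

lemma integrable_of_real_Cc_inf:
  "\<phi> \<in> Cc_inf W \<Longrightarrow> integrable lebesgue (\<lambda>x. complex_of_real (\<phi> x))"
  using Cc_integrable[OF Cc_inf_Cc] by (simp only: complex_of_real_integrable_eq)

lemma fourier_integral_nlap:
  fixes \<phi> :: "'a::euclidean_space \<Rightarrow> real"
  assumes \<phi>: "\<phi> \<in> Cc_inf W"
  shows "fourier_integral (\<lambda>x. complex_of_real (nlap \<phi> x)) \<xi> =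
    of_real ((norm \<xi>)\<^sup>2) * fourier_integral (\<lambda>x. complex_of_real (\<phi> x)) \<xi>"
proof -
  let ?F = "\<lambda>f. fourier_integral (\<lambda>x. complex_of_real (f x)) \<xi>"
  have int: "integrable lebesgue (\<lambda>x. cis (- (x \<bullet> \<xi>)) * complex_of_real (pd i (pd i \<phi>) x))" if "i \<in> Basis" for i
    by (rule integrable_cis_inner[OF integrable_of_real_Cc_inf[OF Cc_inf_pd[OF Cc_inf_pd[OF \<phi> that] that]]])
  have "?F (nlap \<phi>) = (\<integral>x. - (\<Sum>i\<in>Basis. cis (- (x \<bullet> \<xi>)) * complex_of_real (pd i (pd i \<phi>) x)) \<partial>lebesgue)"
    unfolding fourier_integral_def nlap_def by (simp add: sum_distrib_left)
  also have "\<dots> = - (\<Sum>i\<in>Basis. ?F (pd i (pd i \<phi>)))"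
    using int by (simp add: fourier_integral_def)
  also have "\<dots> = (\<Sum>i\<in>Basis. of_real ((\<xi> \<bullet> i)\<^sup>2) * ?F \<phi>)"
    unfolding sum_negf[symmetric]
  proof (rule sum.cong[OF refl])
    fix i :: 'a assume i: "i \<in> Basis"
    show "- ?F (pd i (pd i \<phi>)) = of_real ((\<xi> \<bullet> i)\<^sup>2) * ?F \<phi>"
    proof -
      have "\<i> * r * (\<i> * r * z) = (\<i> * \<i>) * (r * r * z)" for r z :: complex by (simp only: mult_ac)
      then show ?thesis
        unfolding fourier_integral_pd[OF Cc_inf_pd[OF \<phi> i] i] fourier_integral_pd[OF \<phi> i]
        by (simp add: power2_eq_square inner_commute)
    qed
  qed
  also have "\<dots> = of_real ((norm \<xi>)\<^sup>2) * ?F \<phi>"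
    unfolding norm_sq_Basis of_real_sum by (simp only: sum_distrib_right)
  finally show ?thesis .
qed

lemma fourier_integral_nlap_pow:
  "\<phi> \<in> Cc_inf W \<Longrightarrow> fourier_integral (\<lambda>x. complex_of_real ((nlap ^^ k) \<phi> x)) \<xi> =
    of_real (norm \<xi> ^ (2 * k)) * fourier_integral (\<lambda>x. complex_of_real (\<phi> x)) \<xi>"
proof (induction k)
  case (Suc k)
  have "fourier_integral (\<lambda>x. complex_of_real ((nlap ^^ Suc k) \<phi> x)) \<xi> =
      of_real ((norm \<xi>)\<^sup>2) * fourier_integral (\<lambda>x. complex_of_real ((nlap ^^ k) \<phi> x)) \<xi>"
    using fourier_integral_nlap[OF Cc_inf_nlap_pow[OF Suc.prems]] by simp
  then show ?case using Suc by (simp add: power_add power2_eq_square)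
qed simp

lemma Cc_inf_L2: "\<phi> \<in> Cc_inf W \<Longrightarrow> L2 \<phi>"
  by (rule Cc_L2[OF Cc_inf_Cc])

lemma fourier_real_Cc_inf:
  "\<phi> \<in> Cc_inf W \<Longrightarrow> AE \<xi> in lebesgue. fourier_real \<phi> \<xi> = fourier_integral (\<lambda>x. complex_of_real (\<phi> x)) \<xi>"
  by (rule fourier_L2_eq_integral[OF L2_of_real[OF Cc_inf_L2] integrable_of_real_Cc_inf])

lemma fourier_real_nlap_pow:
  assumes \<phi>: "\<phi> \<in> Cc_inf W"
  shows "AE \<xi> in lebesgue. fourier_real ((nlap ^^ k) \<phi>) \<xi> = of_real (norm \<xi> ^ (2 * k)) * fourier_real \<phi> \<xi>"
  using fourier_real_Cc_inf[OF \<phi>] fourier_real_Cc_inf[OF Cc_inf_nlap_pow[OF \<phi>, of k]]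
  by eventually_elim (simp only: fourier_integral_nlap_pow[OF \<phi>])

text \<open>For an integer \<open>k \<ge> s / 2\<close> the weight is at most \<open>2 ^ k\<close>
  times 1 + |xi|^(2k). The factor |xi|^(2k) belongs to the transform of the k-th iterate of
  \<open>nlap\<close>, which is again a test function and so square integrable.\<close>

lemma Cc_inf_Hs:
  fixes \<phi> :: "'a::euclidean_space \<Rightarrow> real"
  assumes \<phi>: "\<phi> \<in> Cc_inf W" shows "\<phi> \<in> Hs s"
proof -
  obtain k :: nat where k: "s / 2 \<le> real k" using real_arch_simple by blast
  define \<psi> where "\<psi> = (nlap ^^ k) \<phi>"
  have \<psi>: "\<psi> \<in> Cc_inf W" unfolding \<psi>_def by (rule Cc_inf_nlap_pow[OF \<phi>])
  let ?g = "\<lambda>\<xi>. norm (fourier_real \<phi> \<xi>) + norm (fourier_real \<psi> \<xi>)"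
  have g: "L2 ?g" by (intro L2_add L2_norm_fun fourier_L2_L2 L2_of_real Cc_inf_L2[OF \<phi>] Cc_inf_L2[OF \<psi>])
  have "L2 (bessel_weighted s \<phi>)"
  proof (rule L2_dominated[OF bessel_weighted_measurable[OF Cc_inf_L2[OF \<phi>]] g])
    show "AE \<xi> in lebesgue. norm (bessel_weighted s \<phi> \<xi>) \<le> 2 ^ k * norm (?g \<xi>)"
      using fourier_real_nlap_pow[OF \<phi>, of k]
    proof eventually_elim
      case (elim \<xi>)
      define a where "a = (norm \<xi>)\<^sup>2"
      have a: "a \<ge> 0" by (simp add: a_def)
      have "(1 + a) powr (s / 2) \<le> (1 + a) powr real k" using a k by (intro powr_mono) auto
      also have "\<dots> = (1 + a) ^ k" using a by (simp add: powr_realpow)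
      also have "\<dots> \<le> 2 ^ k * (1 + a ^ k)"
      proof (cases "a \<le> 1")
        case True
        then have "(1 + a) ^ k \<le> 2 ^ k" using a by (intro power_mono) auto
        then show ?thesis using a by (simp add: distrib_left add_increasing2)
      next
        case False
        then have "(1 + a) ^ k \<le> (2 * a) ^ k" by (intro power_mono) auto
        then show ?thesis using a by (simp add: power_mult_distrib distrib_left add_increasing)
      qed
      finally have le: "(1 + a) powr (s / 2) \<le> 2 ^ k * (1 + a ^ k)" .
      have "norm (bessel_weighted s \<phi> \<xi>) = (1 + a) powr (s / 2) * norm (fourier_real \<phi> \<xi>)"
        by (simp add: bessel_weighted_def norm_mult a_def)
      also have "\<dots> \<le> 2 ^ k * (1 + a ^ k) * norm (fourier_real \<phi> \<xi>)" by (rule mult_right_mono[OF le]) simp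
      also have "\<dots> = 2 ^ k * (norm (fourier_real \<phi> \<xi>) + a ^ k * norm (fourier_real \<phi> \<xi>))"
        by (simp add: algebra_simps)
      also have "a ^ k * norm (fourier_real \<phi> \<xi>) = norm (fourier_real \<psi> \<xi>)"
        unfolding \<psi>_def elim norm_mult by (simp add: a_def norm_power flip: power_mult)
      also have "2 ^ k * (norm (fourier_real \<phi> \<xi>) + norm (fourier_real \<psi> \<xi>)) = 2 ^ k * norm (?g \<xi>)"
        by simp
      finally show ?case .
    qed
  qed
  then show ?thesis using Cc_inf_L2[OF \<phi>] by (simp add: Hs_iff)
qed

lemma AE_lebesgue_neq: "AE x in lebesgue. x \<noteq> (a::'a::euclidean_space)"
  by (rule AE_completion[OF AE_lborel_singleton])

text \<open>For an even exponent the operator is a power of the Laplacian. This is the source of the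
  locality of \<open>conductivity_form\<close>.\<close>

lemma frac_lap_half_even:
  fixes \<phi> :: "'a::euclidean_space \<Rightarrow> real"
  assumes \<phi>: "\<phi> \<in> Cc_inf W"
  shows "AE x in lebesgue. frac_lap_half (2 * real k) \<phi> x = (nlap ^^ k) \<phi> x"
proof (rule frac_lap_half_eqI[OF Cc_inf_L2[OF Cc_inf_nlap_pow[OF \<phi>]]])
  \<comment> \<open>The origin is excluded because for \<open>k = 0\<close> the two powers disagree
    there: \<open>0 powr 0 = 0\<close> but \<open>0 ^ 0 = 1\<close>.\<close>
  show "AE \<xi> in lebesgue. frac_mult (2 * real k) \<phi> \<xi> = fourier_real ((nlap ^^ k) \<phi>) \<xi>"
    using fourier_real_nlap_pow[OF \<phi>, of k] AE_lebesgue_neq[of 0]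
  proof eventually_elim
    case (elim \<xi>)
    have "norm \<xi> powr (2 * real k) = norm \<xi> ^ (2 * k)"
      using elim powr_realpow[of "norm \<xi>" "2 * k"] by simp
    then show ?case by (simp only: frac_mult_def elim)
  qed
qed

section \<open>The closure of the test functions\<close>

lemma Hs_tildeD: "u \<in> Hs_tilde s \<Omega> \<Longrightarrow> u \<in> Hs s"
  by (simp add: Hs_tilde_def)

lemma Hs_tilde_approx:
  "\<lbrakk>u \<in> Hs_tilde s \<Omega>; e > 0\<rbrakk> \<Longrightarrow> \<exists>\<phi>\<in>Cc_inf \<Omega>. Hs_norm s (\<lambda>x. u x - \<phi> x) < e"
  by (simp add: Hs_tilde_def)

lemma Hs_norm_scale: "u \<in> Hs s \<Longrightarrow> Hs_norm s (\<lambda>x. a * u x) = \<bar>a\<bar> * Hs_norm s u"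
  using Hs.scale_self[of u s a] by (simp add: real_sqrt_mult flip: Hs_norm_eq)

lemma Hs_norm_add: "\<lbrakk>u \<in> Hs s; v \<in> Hs s\<rbrakk> \<Longrightarrow> Hs_norm s (\<lambda>x. u x + v x) \<le> Hs_norm s u + Hs_norm s v"
  using Hs.triangle[of u s v] by (simp add: Hs_norm_eq)

lemma Hs_tilde_lin:
  assumes u: "u \<in> Hs_tilde s \<Omega>" and v: "v \<in> Hs_tilde s \<Omega>"
  shows "(\<lambda>x. a * u x + b * v x) \<in> Hs_tilde s \<Omega>"
  unfolding Hs_tilde_def
proof (safe)
  show "(\<lambda>x. a * u x + b * v x) \<in> Hs s" by (intro Hs_lin Hs_tildeD[OF u] Hs_tildeD[OF v])
  fix e :: real assume e: "e > 0"
  \<comment> \<open>The added 1 keeps the denominator positive when \<open>a = b = 0\<close> and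
    gives the strict inequality at the end.\<close>
  define d where "d = e / (\<bar>a\<bar> + \<bar>b\<bar> + 1)"
  have d: "d > 0" using e by (simp add: d_def)
  obtain \<phi> \<psi> where \<phi>: "\<phi> \<in> Cc_inf \<Omega>" "Hs_norm s (\<lambda>x. u x - \<phi> x) < d"
    and \<psi>: "\<psi> \<in> Cc_inf \<Omega>" "Hs_norm s (\<lambda>x. v x - \<psi> x) < d"
    using Hs_tilde_approx[OF u d] Hs_tilde_approx[OF v d] by blast
  have m: "(\<lambda>x. u x - \<phi> x) \<in> Hs s" "(\<lambda>x. v x - \<psi> x) \<in> Hs s"
    by (intro Hs.diff_mem Hs_tildeD[OF u] Hs_tildeD[OF v] Cc_inf_Hs[OF \<phi>(1)] Cc_inf_Hs[OF \<psi>(1)])+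
  have "Hs_norm s (\<lambda>x. (a * u x + b * v x) - (a * \<phi> x + b * \<psi> x)) =
      Hs_norm s (\<lambda>x. a * (u x - \<phi> x) + b * (v x - \<psi> x))"
    by (simp add: algebra_simps)
  also have "\<dots> \<le> Hs_norm s (\<lambda>x. a * (u x - \<phi> x)) + Hs_norm s (\<lambda>x. b * (v x - \<psi> x))"
    using Hs.scale_mem[OF m(1), of a] Hs.scale_mem[OF m(2), of b] by (intro Hs_norm_add) simp_all
  also have "\<dots> = \<bar>a\<bar> * Hs_norm s (\<lambda>x. u x - \<phi> x) + \<bar>b\<bar> * Hs_norm s (\<lambda>x. v x - \<psi> x)"
    by (simp only: Hs_norm_scale[OF m(1)] Hs_norm_scale[OF m(2)])
  also have "\<dots> \<le> \<bar>a\<bar> * d + \<bar>b\<bar> * d"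
    using \<phi>(2) \<psi>(2) by (intro add_mono mult_left_mono) auto
  also have "\<dots> < (\<bar>a\<bar> + \<bar>b\<bar> + 1) * d" using d by (simp add: algebra_simps)
  also have "\<dots> = e" by (simp add: d_def)
  finally show "\<exists>\<phi>\<in>Cc_inf \<Omega>. Hs_norm s (\<lambda>x. a * u x + b * v x - \<phi> x) < e"
    by (intro bexI[OF _ Cc_inf_lin[OF \<phi>(1) \<psi>(1), of a b]])
qed

lemma Cc_inf_Hs_tilde: "\<phi> \<in> Cc_inf \<Omega> \<Longrightarrow> \<phi> \<in> Hs_tilde s \<Omega>"
proof -
  assume \<phi>: "\<phi> \<in> Cc_inf \<Omega>"
  have "Hs_norm s (\<lambda>x. \<phi> x - \<phi> x) = 0"
    using Hs_norm_scale[OF Cc_inf_Hs[OF \<phi>], of s 0] by simp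
  then have "\<exists>\<psi>\<in>Cc_inf \<Omega>. Hs_norm s (\<lambda>x. \<phi> x - \<psi> x) < e" if "e > 0" for e
    using \<phi> that by (intro bexI[of _ \<phi>]) simp_all
  then show ?thesis using Cc_inf_Hs[OF \<phi>] by (simp add: Hs_tilde_def)
qed

lemma Hs_tilde_zero: "(\<lambda>x. 0) \<in> Hs_tilde s (\<Omega> :: 'a::euclidean_space set)"
  by (rule Cc_inf_Hs_tilde[OF Cc_inf_zero])

lemma Hs_tilde_closed:
  assumes X: "\<And>n. X n \<in> Hs_tilde s \<Omega>" and u: "u \<in> Hs s"
    and lim: "(\<lambda>n. Hs_norm s (\<lambda>x. X n x - u x)) \<longlonglongrightarrow> 0"
  shows "u \<in> Hs_tilde s \<Omega>"
  unfolding Hs_tilde_def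
proof (safe)
  fix e :: real assume e: "e > 0"
  then have "\<forall>\<^sub>F n in sequentially. Hs_norm s (\<lambda>x. X n x - u x) < e / 2"
    using order_tendstoD(2)[OF lim, of "e/2"] by simp
  then obtain n where n: "Hs_norm s (\<lambda>x. X n x - u x) < e / 2"
    by (auto dest: eventually_happens'[OF sequentially_bot])
  obtain \<phi> where \<phi>: "\<phi> \<in> Cc_inf \<Omega>" "Hs_norm s (\<lambda>x. X n x - \<phi> x) < e / 2"
    using Hs_tilde_approx[OF X, of "e/2" n] e by auto
  have "Hs_norm s (\<lambda>x. u x - \<phi> x) < e"
    using Hs_norm_triangle_mid[OF u Cc_inf_Hs[OF \<phi>(1)] Hs_tildeD[OF X[of n]]]
      Hs_norm_minus_commute[OF u Hs_tildeD[OF X[of n]]] n \<phi>(2) by linarith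
  then show "\<exists>\<phi>\<in>Cc_inf \<Omega>. Hs_norm s (\<lambda>x. u x - \<phi> x) < e" using \<phi>(1) by blast
qed (rule u)

text \<open>Restriction to the complement of \<open>\<Omega>\<close> does not increase the norm and
  kills the approximants, so the restriction of \<open>w\<close> has arbitrarily small norm. It is
  applied to functions in \<open>Hs_tilde\<close> and to their images under even powers.\<close>

lemma L2_vanish_limit:
  fixes w :: "'a::euclidean_space \<Rightarrow> real"
  assumes w: "L2 w" and \<Omega>: "open \<Omega>"
    and approx: "\<And>e. e > 0 \<Longrightarrow> \<exists>\<psi>. L2 \<psi> \<and> (AE x in lebesgue. x \<notin> \<Omega> \<longrightarrow> \<psi> x = 0) \<and> L2_norm (\<lambda>x. w x - \<psi> x) < e"
  shows "AE x in lebesgue. x \<notin> \<Omega> \<longrightarrow> w x = 0"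
proof -
  let ?w = "\<lambda>x. indicat_real (- \<Omega>) x *\<^sub>R w x"
  have S: "- \<Omega> \<in> sets lebesgue" by (rule sets_completionI_sets) (use \<Omega> in simp)
  have w': "L2 ?w" by (rule L2_restrict[OF w S])
  have "L2_norm ?w \<le> 0 + e" if e: "e > 0" for e
  proof -
    obtain \<psi> where \<psi>: "L2 \<psi>" "AE x in lebesgue. x \<notin> \<Omega> \<longrightarrow> \<psi> x = 0" "L2_norm (\<lambda>x. w x - \<psi> x) < e"
      using approx[OF e] by blast
    have "L2_norm ?w \<le> 1 * L2_norm (\<lambda>x. w x - \<psi> x)"
      by (rule L2_norm_mono[OF w' L2_diff[OF w \<psi>(1)]])
         (use \<psi>(2) in \<open>auto elim!: eventually_mono simp: indicator_def\<close>)
    then show ?thesis using \<psi>(3) by simp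
  qed
  then have "L2_norm ?w \<le> 0" by (rule field_le_epsilon)
  then have "L2_norm ?w = 0" using L2_norm_nonneg[of ?w] by linarith
  then have "AE x in lebesgue. ?w x = 0" by (simp only: L2_norm_eq_0_iff[OF w'])
  then show ?thesis by eventually_elim (auto simp: indicator_def)
qed

lemma L2_norm_small_of_Hs:
  fixes u :: "'a::euclidean_space \<Rightarrow> real"
  assumes "sqrt ((2 * pi) ^ DIM('a)) * a \<le> Hs_norm s u" "Hs_norm s u < sqrt ((2 * pi) ^ DIM('a)) * e"
  shows "a < e"
proof -
  have "sqrt ((2 * pi) ^ DIM('a)) * a < sqrt ((2 * pi) ^ DIM('a)) * e" using assms by linarith
  then show ?thesis by (rule mult_left_less_imp_less) simp
qed

lemma Hs_tilde_vanish:
  fixes u :: "'a::euclidean_space \<Rightarrow> real"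
  assumes s: "s \<ge> 0" and \<Omega>: "open \<Omega>" and u: "u \<in> Hs_tilde s \<Omega>"
  shows "AE x in lebesgue. x \<notin> \<Omega> \<longrightarrow> u x = 0"
proof (rule L2_vanish_limit[OF HsD(1)[OF Hs_tildeD[OF u]] \<Omega>])
  fix e :: real assume "e > 0"
  then have "sqrt ((2 * pi) ^ DIM('a)) * e > 0" by simp
  then obtain \<phi> where \<phi>: "\<phi> \<in> Cc_inf \<Omega>" "Hs_norm s (\<lambda>x. u x - \<phi> x) < sqrt ((2 * pi) ^ DIM('a)) * e"
    using Hs_tilde_approx[OF u] by blast
  have "L2_norm (\<lambda>x. u x - \<phi> x) < e"
    by (rule L2_norm_small_of_Hs[OF L2_le_Hs[OF s Hs.diff_mem[OF Hs_tildeD[OF u] Cc_inf_Hs[OF \<phi>(1)]]] \<phi>(2)])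
  then show "\<exists>\<psi>. L2 \<psi> \<and> (AE x in lebesgue. x \<notin> \<Omega> \<longrightarrow> \<psi> x = 0) \<and> L2_norm (\<lambda>x. u x - \<psi> x) < e"
    using Cc_inf_L2[OF \<phi>(1)] Cc_inf_outside[OF \<phi>(1)] by (intro exI[of _ \<phi>]) simp
qed

lemma frac_lap_half_norm:
  fixes u :: "'a::euclidean_space \<Rightarrow> real"
  assumes r: "0 \<le> r" "r \<le> s" and u: "u \<in> Hs s"
  shows "L2 (frac_lap_half r u)"
    "(L2_norm (frac_lap_half r u))\<^sup>2 = (L2_norm (frac_mult r u))\<^sup>2 / (2 * pi) ^ DIM('a)"
    "sqrt ((2 * pi) ^ DIM('a)) * L2_norm (frac_lap_half r u) \<le> Hs_norm s u"
proof -
  note M = frac_mult_le_Hs[OF r u]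
  show "L2 (frac_lap_half r u)" by (rule L2_frac_lap_half[OF M(1)])
  have "L2_inner v v = (L2_norm v)\<^sup>2" for v :: "'a \<Rightarrow> real"
    unfolding L2_inner_def L2_norm_sq by (simp add: power2_eq_square)
  then show sq: "(L2_norm (frac_lap_half r u))\<^sup>2 = (L2_norm (frac_mult r u))\<^sup>2 / (2 * pi) ^ DIM('a)"
    using frac_lap_half_dot[OF HsD(1)[OF u] M(1) HsD(1)[OF u] M(1)] by (simp add: L2_dot_self)
  have "(sqrt ((2 * pi) ^ DIM('a)) * L2_norm (frac_lap_half r u))\<^sup>2 = (L2_norm (frac_mult r u))\<^sup>2"
    unfolding power_mult_distrib sq by simp
  then have "sqrt ((2 * pi) ^ DIM('a)) * L2_norm (frac_lap_half r u) = L2_norm (frac_mult r u)"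
    by (rule power2_eq_imp_eq) simp_all
  then show "sqrt ((2 * pi) ^ DIM('a)) * L2_norm (frac_lap_half r u) \<le> Hs_norm s u" using M(2) by (simp only:)
qed

lemma frac_lap_half_diff:
  fixes u v :: "'a::euclidean_space \<Rightarrow> real"
  assumes r: "0 \<le> r" "r \<le> s" and u: "u \<in> Hs s" and v: "v \<in> Hs s"
  shows "AE x in lebesgue. frac_lap_half r (\<lambda>x. u x - v x) x = frac_lap_half r u x - frac_lap_half r v x"
  using frac_lap_half_lin[OF HsD(1)[OF u] frac_mult_le_Hs(1)[OF r u] HsD(1)[OF v] frac_mult_le_Hs(1)[OF r v], of 1 "-1"]
  by simp

text \<open>Locality holds for test functions by \<open>frac_lap_half_even\<close> and survives the
  limit because the operator is bounded from \<open>Hs\<close> to L2.\<close>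

lemma frac_lap_half_even_vanish:
  fixes u :: "'a::euclidean_space \<Rightarrow> real"
  assumes \<Omega>: "open \<Omega>" and u: "u \<in> Hs_tilde (2 * real k) \<Omega>"
  shows "AE x in lebesgue. x \<notin> \<Omega> \<longrightarrow> frac_lap_half (2 * real k) u x = 0"
proof -
  let ?s = "2 * real k"
  have r: "0 \<le> ?s" "?s \<le> ?s" by auto
  note uH = Hs_tildeD[OF u]
  show ?thesis
  proof (rule L2_vanish_limit[OF frac_lap_half_norm(1)[OF r uH] \<Omega>])
    fix e :: real assume "e > 0"
    then have "sqrt ((2 * pi) ^ DIM('a)) * e > 0" by simp
    then obtain \<phi> where \<phi>: "\<phi> \<in> Cc_inf \<Omega>" "Hs_norm ?s (\<lambda>x. u x - \<phi> x) < sqrt ((2 * pi) ^ DIM('a)) * e"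
      using Hs_tilde_approx[OF u] by blast
    note \<phi>H = Cc_inf_Hs[OF \<phi>(1), of ?s]
    have "L2_norm (frac_lap_half ?s (\<lambda>x. u x - \<phi> x)) < e"
      by (rule L2_norm_small_of_Hs[OF frac_lap_half_norm(3)[OF r Hs.diff_mem[OF uH \<phi>H]] \<phi>(2)])
    moreover have "L2_norm (frac_lap_half ?s (\<lambda>x. u x - \<phi> x)) = L2_norm (\<lambda>x. frac_lap_half ?s u x - frac_lap_half ?s \<phi> x)"
      by (rule L2_norm_cong_AE[OF frac_lap_half_diff[OF r uH \<phi>H] L2_measurable[OF frac_lap_half_norm(1)[OF r Hs.diff_mem[OF uH \<phi>H]]]])
    moreover have "AE x in lebesgue. x \<notin> \<Omega> \<longrightarrow> frac_lap_half ?s \<phi> x = 0"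
      using frac_lap_half_even[OF \<phi>(1), of k]
      by eventually_elim (simp add: Cc_inf_outside[OF Cc_inf_nlap_pow[OF \<phi>(1)]])
    ultimately show "\<exists>\<psi>. L2 \<psi> \<and> (AE x in lebesgue. x \<notin> \<Omega> \<longrightarrow> \<psi> x = 0) \<and> L2_norm (\<lambda>x. frac_lap_half ?s u x - \<psi> x) < e"
      using frac_lap_half_norm(1)[OF r \<phi>H] by (intro exI[of _ "frac_lap_half ?s \<phi>"]) simp
  qed
qed

section \<open>Coercive forms and their DN maps\<close>

lemma Hs_norm_AE_zero:
  fixes u :: "'a::euclidean_space \<Rightarrow> real"
  assumes u: "u \<in> Hs s" and zero: "AE x in lebesgue. u x = 0"
  shows "Hs_norm s u = 0"
proof -
  \<comment> \<open>Writing 0 as a multiple of \<open>u\<close> lets linearity of the transform show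
    that the transform of zero vanishes almost everywhere.\<close>
  have "AE x in lebesgue. complex_of_real (u x) = 0 * complex_of_real (u x)" using zero by eventually_elim simp
  from fourier_L2_cong_AE[OF L2_cmult[OF L2_of_real[OF HsD(1)[OF u]]] this]
    fourier_L2_lin[OF L2_of_real L2_of_real, OF HsD(1)[OF u] HsD(1)[OF u], of 0 0]
  have "AE \<xi> in lebesgue. bessel_weighted s u \<xi> = 0"
    by eventually_elim (simp add: bessel_weighted_def)
  then show ?thesis unfolding Hs_norm_def by (simp only: L2_norm_eq_0_iff[OF HsD(2)[OF u]])
qed

text \<open>Coercivity is asked on \<open>Hs_tilde s \<Omega>\<close> only, because the coefficients
  are positive only in \<open>\<Omega>\<close>. Bilinearity, symmetry and boundedness are asked on
  all of \<open>Hs s\<close>, because exterior data live there.\<close>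

locale coercive_form =
  fixes s :: real and \<Omega> :: "'a::euclidean_space set" and B :: "'a form" and M c :: real
  assumes s: "s \<ge> 0" and \<Omega>: "open \<Omega>"
    and lin: "\<lbrakk>u \<in> Hs s; v \<in> Hs s; w \<in> Hs s\<rbrakk> \<Longrightarrow> B (\<lambda>x. a * u x + b * v x) w = a * B u w + b * B v w"
    and sym: "\<lbrakk>u \<in> Hs s; v \<in> Hs s\<rbrakk> \<Longrightarrow> B u v = B v u"
    and M: "M > 0" and bounded: "\<lbrakk>u \<in> Hs s; v \<in> Hs s\<rbrakk> \<Longrightarrow> \<bar>B u v\<bar> \<le> M * Hs_norm s u * Hs_norm s v"
    and c: "c > 0" and coercive: "u \<in> Hs_tilde s \<Omega> \<Longrightarrow> c * (Hs_norm s u)\<^sup>2 \<le> B u u"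
begin

lemma linr: "\<lbrakk>u \<in> Hs s; v \<in> Hs s; w \<in> Hs s\<rbrakk> \<Longrightarrow> B w (\<lambda>x. a * u x + b * v x) = a * B w u + b * B w v"
  using lin[of u v w a b] sym[of w] Hs_lin[of u s v a b] by simp

lemma diff_left: "\<lbrakk>u \<in> Hs s; v \<in> Hs s; w \<in> Hs s\<rbrakk> \<Longrightarrow> B (\<lambda>x. u x - v x) w = B u w - B v w"
  using lin[of u v w 1 "-1"] by simp

lemma diff_right: "\<lbrakk>u \<in> Hs s; v \<in> Hs s; w \<in> Hs s\<rbrakk> \<Longrightarrow> B w (\<lambda>x. u x - v x) = B w u - B w v"
  using linr[of u v w 1 "-1"] by simp

lemma tilde_diff: "\<lbrakk>u \<in> Hs_tilde s \<Omega>; v \<in> Hs_tilde s \<Omega>\<rbrakk> \<Longrightarrow> (\<lambda>x. u x - v x) \<in> Hs_tilde s \<Omega>"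
  using Hs_tilde_lin[of u s \<Omega> v 1 "-1"] by simp

lemma zero_left: "\<lbrakk>u \<in> Hs s; Hs_norm s u = 0; v \<in> Hs s\<rbrakk> \<Longrightarrow> B u v = 0"
  using bounded[of u v] by simp

sublocale tilde: semi_inner "Hs_tilde s \<Omega>" B
proof
  fix f g h a b assume f: "f \<in> Hs_tilde s \<Omega>"
  have "0 \<le> c * (Hs_norm s f)\<^sup>2" using c by simp
  then show "0 \<le> B f f" using coercive[OF f] by linarith
  assume g: "g \<in> Hs_tilde s \<Omega>"
  show "(\<lambda>x. a *\<^sub>R f x + b *\<^sub>R g x) \<in> Hs_tilde s \<Omega>" using Hs_tilde_lin[OF f g] by simp
  show "B f g = B g f" by (rule sym[OF Hs_tildeD[OF f] Hs_tildeD[OF g]])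
  assume h: "h \<in> Hs_tilde s \<Omega>"
  show "B (\<lambda>x. a *\<^sub>R f x + b *\<^sub>R g x) h = a * B f h + b * B g h"
    using lin[OF Hs_tildeD[OF f] Hs_tildeD[OF g] Hs_tildeD[OF h]] by simp
qed

lemma norm_le_energy: "u \<in> Hs_tilde s \<Omega> \<Longrightarrow> sqrt c * Hs_norm s u \<le> sqrt (B u u)"
  using real_sqrt_le_mono[OF coercive, of u] by (simp add: real_sqrt_mult)

text \<open>On \<open>Hs_tilde s \<Omega>\<close> the energy \<open>B u u\<close> is comparable to
  the squared Sobolev norm, by coercivity and boundedness. So the symmetric form \<open>B\<close>
  itself serves as a complete inner product, and Lax-Milgram reduces to
  \<open>Riesz\<close>.\<close>

lemma tilde_Riesz:
  assumes linear: "\<And>u v a b. \<lbrakk>u \<in> Hs_tilde s \<Omega>; v \<in> Hs_tilde s \<Omega>\<rbrakk> \<Longrightarrow> \<ll> (\<lambda>x. a * u x + b * v x) = a * \<ll> u + b * \<ll> v"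
    and bound: "\<And>u. u \<in> Hs_tilde s \<Omega> \<Longrightarrow> \<bar>\<ll> u\<bar> \<le> K * Hs_norm s u"
  shows "\<exists>w\<in>Hs_tilde s \<Omega>. \<forall>v\<in>Hs_tilde s \<Omega>. \<ll> v = B w v"
proof (rule tilde.Riesz)
  show "Hs_tilde s \<Omega> \<noteq> {}" using Hs_tilde_zero by blast
  show "\<ll> (\<lambda>x. a *\<^sub>R f x + b *\<^sub>R g x) = a * \<ll> f + b * \<ll> g"
    if "f \<in> Hs_tilde s \<Omega>" "g \<in> Hs_tilde s \<Omega>" for f g a b
    using linear[OF that] by simp
  show "\<bar>\<ll> f\<bar> \<le> (\<bar>K\<bar> / sqrt c) * sqrt (B f f)" if f: "f \<in> Hs_tilde s \<Omega>" for f
  proof -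
    have "\<bar>\<ll> f\<bar> \<le> \<bar>K\<bar> * Hs_norm s f"
      using bound[OF f] mult_right_mono[OF abs_ge_self[of K] Hs_norm_nonneg[of s f]] by linarith
    also have "Hs_norm s f \<le> sqrt (B f f) / sqrt c"
      using norm_le_energy[OF f] c by (simp add: pos_le_divide_eq mult.commute)
    finally show ?thesis by (simp add: mult_left_mono)
  qed
  fix X :: "nat \<Rightarrow> 'a \<Rightarrow> real" assume X: "\<And>n. X n \<in> Hs_tilde s \<Omega>"
    and Cauchy: "\<And>e. 0 < e \<Longrightarrow> \<exists>N. \<forall>m\<ge>N. \<forall>n\<ge>N. B (\<lambda>x. X m x - X n x) (\<lambda>x. X m x - X n x) < e"
  have "\<exists>l\<in>Hs s. (\<lambda>n. Hs_norm s (\<lambda>x. X n x - l x)) \<longlonglongrightarrow> 0"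
  proof (rule Hs_complete[OF s])
    fix e :: real assume e: "e > 0"
    then have "c * e\<^sup>2 > 0" using c by simp
    from Cauchy[OF this] obtain N where
      N: "\<And>m n. m \<ge> N \<Longrightarrow> n \<ge> N \<Longrightarrow> B (\<lambda>x. X m x - X n x) (\<lambda>x. X m x - X n x) < c * e\<^sup>2" by blast
    have "Hs_norm s (\<lambda>x. X m x - X n x) < e" if "m \<ge> N" "n \<ge> N" for m n
    proof -
      have "c * (Hs_norm s (\<lambda>x. X m x - X n x))\<^sup>2 < c * e\<^sup>2"
        using coercive[OF tilde_diff[OF X X]] N[OF that] by (rule order_le_less_trans)
      then have "(Hs_norm s (\<lambda>x. X m x - X n x))\<^sup>2 < e\<^sup>2" using c by simp
      then show ?thesis by (rule power_less_imp_less_base) (use e in simp)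
    qed
    then show "\<exists>N. \<forall>m\<ge>N. \<forall>n\<ge>N. Hs_norm s (\<lambda>x. X m x - X n x) < e" by blast
  qed (rule Hs_tildeD[OF X])
  then obtain l where l: "l \<in> Hs s" and lim: "(\<lambda>n. Hs_norm s (\<lambda>x. X n x - l x)) \<longlonglongrightarrow> 0" by blast
  have lt: "l \<in> Hs_tilde s \<Omega>" by (rule Hs_tilde_closed[OF X l lim])
  have "(\<lambda>n. M * Hs_norm s (\<lambda>x. X n x - l x) * Hs_norm s (\<lambda>x. X n x - l x)) \<longlonglongrightarrow> M * 0 * 0"
    by (intro tendsto_intros lim)
  then have lim2: "(\<lambda>n. M * Hs_norm s (\<lambda>x. X n x - l x) * Hs_norm s (\<lambda>x. X n x - l x)) \<longlonglongrightarrow> 0" by simp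
  have m: "(\<lambda>x. X n x - l x) \<in> Hs s" for n by (rule Hs.diff_mem[OF Hs_tildeD[OF X] l])
  have "(\<lambda>n. B (\<lambda>x. X n x - l x) (\<lambda>x. X n x - l x)) \<longlonglongrightarrow> 0"
    by (rule Lim_null_comparison[OF _ lim2]) (use bounded[OF m m] in simp)
  then show "\<exists>l\<in>Hs_tilde s \<Omega>. (\<lambda>n. B (\<lambda>x. X n x - l x) (\<lambda>x. X n x - l x)) \<longlonglongrightarrow> 0"
    using lt by blast
qed

text \<open>The solution is \<open>f + w\<close>, where \<open>w\<close> represents the functional
  \<open>- B f\<close> on \<open>Hs_tilde s \<Omega>\<close>.\<close>

lemma solution_exists:
  assumes f: "f \<in> Hs s" shows "\<exists>u. dirichlet_solution s \<Omega> B f u"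
proof -
  have "\<exists>w\<in>Hs_tilde s \<Omega>. \<forall>v\<in>Hs_tilde s \<Omega>. - B f v = B w v"
  proof (rule tilde_Riesz)
    show "\<bar>- B f v\<bar> \<le> (M * Hs_norm s f) * Hs_norm s v" if "v \<in> Hs_tilde s \<Omega>" for v
      using bounded[OF f Hs_tildeD[OF that]] by simp
  qed (simp add: linr[OF Hs_tildeD Hs_tildeD f])
  then obtain w where w: "w \<in> Hs_tilde s \<Omega>" and eq: "\<And>v. v \<in> Hs_tilde s \<Omega> \<Longrightarrow> - B f v = B w v" by blast
  have "B (\<lambda>x. f x + w x) v = 0" if v: "v \<in> Hs_tilde s \<Omega>" for v
    using lin[OF f Hs_tildeD[OF w] Hs_tildeD[OF v], of 1 1] eq[OF v] by simp
  moreover have "(\<lambda>x. f x + w x) \<in> Hs s" by (rule Hs.add_mem[OF f Hs_tildeD[OF w]])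
  ultimately have "dirichlet_solution s \<Omega> B f (\<lambda>x. f x + w x)" using w by (simp add: dirichlet_solution_def)
  then show ?thesis by blast
qed

text \<open>The difference lies in \<open>Hs_tilde s \<Omega>\<close> and can be tested against
  itself. Allowing different data in one trace class covers uniqueness and independence of
  representatives together.\<close>

lemma solution_unique:
  assumes u: "dirichlet_solution s \<Omega> B f u" and u': "dirichlet_solution s \<Omega> B f' u'"
    and ff: "(\<lambda>x. f x - f' x) \<in> Hs_tilde s \<Omega>"
  shows "Hs_norm s (\<lambda>x. u x - u' x) = 0"
proof -
  let ?d = "\<lambda>x. u x - u' x"
  have uH: "u \<in> Hs s" "u' \<in> Hs s" using u u' by (auto simp: dirichlet_solution_def)
  have d1: "(\<lambda>x. (u x - f x) - (u' x - f' x)) \<in> Hs_tilde s \<Omega>"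
    by (rule tilde_diff) (use u u' in \<open>auto simp: dirichlet_solution_def\<close>)
  have "(\<lambda>x. 1 * ((u x - f x) - (u' x - f' x)) + 1 * (f x - f' x)) \<in> Hs_tilde s \<Omega>"
    by (rule Hs_tilde_lin[OF d1 ff])
  then have d: "?d \<in> Hs_tilde s \<Omega>" by simp
  have "B ?d ?d = B u ?d - B u' ?d" by (rule diff_left[OF uH Hs_tildeD[OF d]])
  also have "\<dots> = 0" using u u' d by (simp add: dirichlet_solution_def)
  finally have "c * (Hs_norm s ?d)\<^sup>2 \<le> 0" using coercive[OF d] by simp
  then show ?thesis using c by (simp add: mult_le_0_iff)
qed

text \<open>Testing with \<open>u - f\<close> and using coercivity bounds the norm of
  \<open>u - f\<close> by \<open>M / c\<close> times that of \<open>f\<close>; the 1 accounts for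
  \<open>f\<close> itself.\<close>

lemma solution_norm:
  assumes u: "dirichlet_solution s \<Omega> B f u" and f: "f \<in> Hs s"
  shows "Hs_norm s u \<le> (1 + M / c) * Hs_norm s f"
proof -
  let ?w = "\<lambda>x. u x - f x"
  have uH: "u \<in> Hs s" and w: "?w \<in> Hs_tilde s \<Omega>" and Bw: "B u ?w = 0"
    using u by (auto simp: dirichlet_solution_def)
  note wH = Hs_tildeD[OF w]
  have "c * (Hs_norm s ?w)\<^sup>2 \<le> B ?w ?w" by (rule coercive[OF w])
  also have "\<dots> = - B f ?w" using diff_left[OF uH f wH] Bw by simp
  also have "\<dots> \<le> M * Hs_norm s f * Hs_norm s ?w" using bounded[OF f wH] by linarith
  finally have "c * (Hs_norm s ?w)\<^sup>2 \<le> M * Hs_norm s f * Hs_norm s ?w" .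
  then have "Hs_norm s ?w * (c * Hs_norm s ?w) \<le> Hs_norm s ?w * (M * Hs_norm s f)"
    by (simp add: power2_eq_square mult_ac)
  then have "c * Hs_norm s ?w \<le> M * Hs_norm s f"
    using M Hs_norm_nonneg[of s ?w] by (cases "Hs_norm s ?w = 0") (auto simp: mult_le_cancel_left)
  then have "Hs_norm s ?w \<le> M / c * Hs_norm s f" using c by (simp add: field_simps)
  moreover have "Hs_norm s u \<le> Hs_norm s ?w + Hs_norm s f" using Hs_norm_add[OF wH f] by simp
  ultimately show ?thesis by (simp add: distrib_right)
qed

text \<open>Two solutions with data in one class differ by a function of norm 0, on which the
  bounded form vanishes, and \<open>B u'\<close> annihilates the difference of \<open>g\<close> and
  \<open>g'\<close>. So the value depends on classes only.\<close>

lemma solution_form_cong: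
  assumes u: "dirichlet_solution s \<Omega> B f u" and u': "dirichlet_solution s \<Omega> B f' u'"
    and ff: "(\<lambda>x. f x - f' x) \<in> Hs_tilde s \<Omega>"
    and g: "g \<in> Hs s" "g' \<in> Hs s" "(\<lambda>x. g x - g' x) \<in> Hs_tilde s \<Omega>"
  shows "B u g = B u' g'"
proof -
  have uH: "u \<in> Hs s" "u' \<in> Hs s" using u u' by (auto simp: dirichlet_solution_def)
  have "B (\<lambda>x. u x - u' x) g = 0"
    by (rule zero_left[OF Hs.diff_mem[OF uH] solution_unique[OF u u' ff] g(1)])
  moreover have "B u' (\<lambda>x. g x - g' x) = 0" using u' g(3) by (simp add: dirichlet_solution_def)
  ultimately show ?thesis using diff_left[OF uH g(1)] diff_right[OF g(1,2) uH(2)] by simp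
qed

lemma solution_lin:
  assumes u: "dirichlet_solution s \<Omega> B f u" and v: "dirichlet_solution s \<Omega> B g v"
  shows "dirichlet_solution s \<Omega> B (\<lambda>x. a * f x + b * g x) (\<lambda>x. a * u x + b * v x)"
proof -
  have uH: "u \<in> Hs s" "v \<in> Hs s" and w: "(\<lambda>x. u x - f x) \<in> Hs_tilde s \<Omega>" "(\<lambda>x. v x - g x) \<in> Hs_tilde s \<Omega>"
    using u v by (auto simp: dirichlet_solution_def)
  have "(\<lambda>x. a * (u x - f x) + b * (v x - g x)) \<in> Hs_tilde s \<Omega>" by (rule Hs_tilde_lin[OF w])
  then have "(\<lambda>x. (a * u x + b * v x) - (a * f x + b * g x)) \<in> Hs_tilde s \<Omega>" by (simp add: algebra_simps)
  moreover have "B (\<lambda>x. a * u x + b * v x) \<phi> = 0" if "\<phi> \<in> Hs_tilde s \<Omega>" for \<phi>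
    using lin[OF uH Hs_tildeD[OF that]] u v that by (simp add: dirichlet_solution_def)
  ultimately show ?thesis using Hs_lin[OF uH] by (simp add: dirichlet_solution_def)
qed

end

section \<open>Trace classes and the DN map as a map between them\<close>

lemma le_mult_cINF:
  fixes g :: "'b \<Rightarrow> real"
  assumes "\<And>b. b \<in> S \<Longrightarrow> x \<le> a * g b" "a \<ge> 0" "S \<noteq> {}"
  shows "x \<le> a * (INF b\<in>S. g b)"
proof (cases "a = 0")
  case False
  have "x / a \<le> (INF b\<in>S. g b)"
    by (rule cINF_greatest[OF assms(3)]) (use assms False in \<open>simp add: divide_le_eq mult.commute\<close>)
  then show ?thesis using False assms(2) by (simp add: divide_le_eq mult.commute)
qed (use assms in auto)

lemma trace_class_mem: "g \<in> trace_class s \<Omega> f \<longleftrightarrow> f \<in> Hs s \<and> g \<in> Hs s \<and> (\<lambda>x. f x - g x) \<in> Hs_tilde s \<Omega>"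
  by (simp add: trace_class_def trace_rel_def)

lemma trace_class_self: "f \<in> Hs s \<Longrightarrow> f \<in> trace_class s \<Omega> f"
  by (simp add: trace_class_mem Hs_tilde_zero)

lemma trace_spaceE:
  assumes "F \<in> trace_space s \<Omega>"
  obtains f where "f \<in> Hs s" "F = trace_class s \<Omega> f"
  using assms by (auto simp: trace_space_def trace_class_def elim: quotientE)

lemma trace_class_space: "f \<in> Hs s \<Longrightarrow> trace_class s \<Omega> f \<in> trace_space s \<Omega>"
  by (simp add: trace_space_def trace_class_def quotientI)

lemma trace_norm_nonneg: "F \<in> trace_space s \<Omega> \<Longrightarrow> 0 \<le> trace_norm s F"
  by (elim trace_spaceE) (auto simp: trace_norm_def intro!: cINF_greatest dest: trace_class_self)

lemma trace_norm_le: "g \<in> F \<Longrightarrow> trace_norm s F \<le> Hs_norm s g"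
  unfolding trace_norm_def by (rule cINF_lower) (auto intro: bdd_belowI2[where m=0])

text \<open>A map on classes is built by choosing representatives; \<open>solution_form_cong\<close>
  makes its values independent of the choice, so every property may be checked on convenient
  representatives.\<close>

lemma (in coercive_form) DN_well_defined:
  assumes B: "B = add_form L Q"
  shows "DN_well_defined s \<Omega> L Q"
proof -
  \<comment> \<open>The solution is chosen directly for some datum in the class, in one
    choice.\<close>
  define \<Lambda> where "\<Lambda> F G = B (SOME u. \<exists>f\<in>F. dirichlet_solution s \<Omega> B f u) (SOME g. g \<in> G)" for F G
  have \<Lambda>: "\<Lambda> (trace_class s \<Omega> f) (trace_class s \<Omega> g) = B u g"
    if f: "f \<in> Hs s" and g: "g \<in> Hs s" and u: "dirichlet_solution s \<Omega> B f u" for f g u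
  proof -
    let ?u = "SOME u. \<exists>f'\<in>trace_class s \<Omega> f. dirichlet_solution s \<Omega> B f' u" and ?g = "SOME g'. g' \<in> trace_class s \<Omega> g"
    have "\<exists>u. \<exists>f'\<in>trace_class s \<Omega> f. dirichlet_solution s \<Omega> B f' u"
      using trace_class_self[OF f] u by blast
    from someI_ex[OF this] obtain f' where f': "f' \<in> trace_class s \<Omega> f" "dirichlet_solution s \<Omega> B f' ?u" by blast
    have g': "?g \<in> trace_class s \<Omega> g" by (rule someI[of _ g]) (rule trace_class_self[OF g])
    have "B u g = B ?u ?g"
      by (rule solution_form_cong[OF u f'(2)]) (use f'(1) g' in \<open>auto simp: trace_class_mem\<close>)
    then show ?thesis by (simp add: \<Lambda>_def)
  qed
  define K where "K = M * (1 + M / c)"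
  have K: "K \<ge> 0" using M c by (simp add: K_def)
  have bound: "\<bar>\<Lambda> F G\<bar> \<le> K * trace_norm s F * trace_norm s G"
    if F: "F \<in> trace_space s \<Omega>" and G: "G \<in> trace_space s \<Omega>" for F G
  proof -
    obtain f where f: "f \<in> Hs s" "F = trace_class s \<Omega> f" using F by (rule trace_spaceE)
    obtain g where g: "g \<in> Hs s" "G = trace_class s \<Omega> g" using G by (rule trace_spaceE)
    have pt: "\<bar>\<Lambda> F G\<bar> \<le> K * Hs_norm s f' * Hs_norm s g'" if f': "f' \<in> F" and g': "g' \<in> G" for f' g'
    proof -
      have m: "f' \<in> Hs s" "(\<lambda>x. f x - f' x) \<in> Hs_tilde s \<Omega>" "g' \<in> Hs s" "(\<lambda>x. g x - g' x) \<in> Hs_tilde s \<Omega>"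
        using f' g' by (auto simp: f(2) g(2) trace_class_mem)
      obtain u where u: "dirichlet_solution s \<Omega> B f u" using solution_exists[OF f(1)] by blast
      obtain u' where u': "dirichlet_solution s \<Omega> B f' u'" using solution_exists[OF m(1)] by blast
      have "\<bar>\<Lambda> F G\<bar> = \<bar>B u' g'\<bar>"
        using \<Lambda>[OF f(1) g(1) u] solution_form_cong[OF u u' m(2) g(1) m(3,4)] by (simp add: f(2) g(2))
      also have "\<dots> \<le> M * Hs_norm s u' * Hs_norm s g'"
        using bounded[OF _ m(3)] u' by (simp add: dirichlet_solution_def)
      also have "\<dots> \<le> M * ((1 + M / c) * Hs_norm s f') * Hs_norm s g'"
        using solution_norm[OF u' m(1)] M by (intro mult_right_mono mult_left_mono) auto
      finally show ?thesis by (simp add: K_def mult.assoc)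
    qed
    have ne: "F \<noteq> {}" "G \<noteq> {}" using trace_class_self f g by blast+
    \<comment> \<open>The product bound holds for every pair of representatives; the two infima are
      taken one after the other.\<close>
    have "\<bar>\<Lambda> F G\<bar> \<le> (K * trace_norm s F) * (INF g\<in>G. Hs_norm s g)"
    proof (rule le_mult_cINF[OF _ _ ne(2)])
      fix g' assume g': "g' \<in> G"
      have "\<bar>\<Lambda> F G\<bar> \<le> (K * Hs_norm s g') * (INF f\<in>F. Hs_norm s f)"
        by (rule le_mult_cINF[OF _ _ ne(1)]) (use pt[OF _ g'] K in \<open>auto simp: mult_ac\<close>)
      then show "\<bar>\<Lambda> F G\<bar> \<le> (K * trace_norm s F) * Hs_norm s g'" by (simp add: trace_norm_def mult_ac)
    qed (use K trace_norm_nonneg[OF F] in simp)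
    then show ?thesis by (simp add: trace_norm_def)
  qed
  have linF: "\<Lambda> (trace_class s \<Omega> (\<lambda>x. a * f x + b * g x)) G = a * \<Lambda> (trace_class s \<Omega> f) G + b * \<Lambda> (trace_class s \<Omega> g) G"
    if f: "f \<in> Hs s" and g: "g \<in> Hs s" and G: "G \<in> trace_space s \<Omega>" for f g a b G
  proof -
    obtain h where h: "h \<in> Hs s" "G = trace_class s \<Omega> h" using G by (rule trace_spaceE)
    obtain u where u: "dirichlet_solution s \<Omega> B f u" using solution_exists[OF f] by blast
    obtain v where v: "dirichlet_solution s \<Omega> B g v" using solution_exists[OF g] by blast
    have uv: "u \<in> Hs s" "v \<in> Hs s" using u v by (auto simp: dirichlet_solution_def)
    show ?thesis
      unfolding h(2) \<Lambda>[OF f h(1) u] \<Lambda>[OF g h(1) v] \<Lambda>[OF Hs_lin[OF f g] h(1) solution_lin[OF u v]]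
      by (rule lin[OF uv h(1)])
  qed
  have linG: "\<Lambda> F (trace_class s \<Omega> (\<lambda>x. a * f x + b * g x)) = a * \<Lambda> F (trace_class s \<Omega> f) + b * \<Lambda> F (trace_class s \<Omega> g)"
    if f: "f \<in> Hs s" and g: "g \<in> Hs s" and F: "F \<in> trace_space s \<Omega>" for f g a b F
  proof -
    obtain h where h: "h \<in> Hs s" "F = trace_class s \<Omega> h" using F by (rule trace_spaceE)
    obtain u where u: "dirichlet_solution s \<Omega> B h u" using solution_exists[OF h(1)] by blast
    then have uH: "u \<in> Hs s" by (simp add: dirichlet_solution_def)
    show ?thesis
      unfolding h(2) \<Lambda>[OF h(1) f u] \<Lambda>[OF h(1) g u] \<Lambda>[OF h(1) Hs_lin[OF f g] u]
      by (rule linr[OF f g uH])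
  qed
  have dual: "trace_dual_norm s \<Omega> (\<Lambda> F) \<le> K * trace_norm s F" if F: "F \<in> trace_space s \<Omega>" for F
    unfolding trace_dual_norm_def
  proof (rule cSUP_least)
    \<comment> \<open>The class of 0 shows that the supremum in \<open>trace_dual_norm\<close> is
      over a nonempty set.\<close>
    have z: "(\<lambda>x::'a. 0) \<in> Hs s" by (rule Hs_tildeD[OF Hs_tilde_zero])
    have "trace_norm s (trace_class s \<Omega> (\<lambda>x. 0)) \<le> Hs_norm s (\<lambda>x::'a. 0)"
      by (rule trace_norm_le[OF trace_class_self[OF z]])
    also have "\<dots> = 0" by (rule Hs_norm_AE_zero[OF z]) simp
    finally show "{G \<in> trace_space s \<Omega>. trace_norm s G \<le> 1} \<noteq> {}"
      using trace_class_space[OF z, of \<Omega>] by force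
    fix G assume "G \<in> {G \<in> trace_space s \<Omega>. trace_norm s G \<le> 1}"
    then have G: "G \<in> trace_space s \<Omega>" "trace_norm s G \<le> 1" by auto
    have "K * trace_norm s F * trace_norm s G \<le> K * trace_norm s F * 1"
      using G(2) K trace_norm_nonneg[OF F] by (intro mult_left_mono) auto
    then show "\<bar>\<Lambda> F G\<bar> \<le> K * trace_norm s F" using bound[OF F G(1)] by simp
  qed
  have "bounded_linear_to_dual s \<Omega> \<Lambda>"
    unfolding bounded_linear_to_dual_def trace_dual_def
    using linF linG bound dual by blast
  moreover have "\<exists>u. dirichlet_solution s \<Omega> B f u \<and>
      (\<forall>u'. dirichlet_solution s \<Omega> B f u' \<longrightarrow> (AE x in lebesgue. u' x = u x))" if f: "f \<in> Hs s" for f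
  proof -
    obtain u where u: "dirichlet_solution s \<Omega> B f u" using solution_exists[OF f] by blast
    have "AE x in lebesgue. u' x = u x" if u': "dirichlet_solution s \<Omega> B f u'" for u'
    proof -
      have m: "(\<lambda>x. u' x - u x) \<in> Hs s" using u u' by (intro Hs.diff_mem) (auto simp: dirichlet_solution_def)
      have "Hs_norm s (\<lambda>x. u' x - u x) = 0"
        by (rule solution_unique[OF u' u]) (simp add: Hs_tilde_zero)
      from Hs_norm_eq_0[OF s m this] show ?thesis by eventually_elim simp
    qed
    then show ?thesis using u by blast
  qed
  ultimately show ?thesis
    unfolding DN_well_defined_def Let_def B[symmetric] using \<Lambda> by blast
qed

text \<open>Locality, unique continuation and equality of the DN data enter as hypotheses.
  \<open>D = Q1 - Q2\<close> vanishes first on pairs of interior parts of solutions, then for an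
  arbitrary first argument, then for arbitrary arguments. One solution of each equation is paired:
  \<open>S1\<close> for data in \<open>W1\<close>, \<open>S2\<close> for data in
  \<open>W2\<close>.\<close>

lemma weak_uniqueness:
  assumes C1: "coercive_form s \<Omega> (add_form L Q1) M1 c1" and C2: "coercive_form s \<Omega> (add_form L Q2) M2 c2"
    and local_tilde: "\<And>f v. \<lbrakk>f \<in> Cc_inf W1 \<union> Cc_inf W2; v \<in> Hs_tilde s \<Omega>\<rbrakk> \<Longrightarrow> Q1 f v = 0 \<and> Q2 f v = 0"
    and local_disjoint: "\<And>f g. \<lbrakk>f \<in> Cc_inf W1; g \<in> Cc_inf W2\<rbrakk> \<Longrightarrow> Q1 f g = Q2 f g"
    and ucp: "\<And>W \<phi>. \<lbrakk>W = W1 \<or> W = W2; \<phi> \<in> Hs_tilde s \<Omega>; \<And>f. f \<in> Cc_inf W \<Longrightarrow> L f \<phi> = 0\<rbrakk>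
      \<Longrightarrow> AE x in lebesgue. \<phi> x = 0"
    and DN: "\<And>f g. \<lbrakk>f \<in> Cc_inf W1; g \<in> Cc_inf W2\<rbrakk> \<Longrightarrow> DN_map s \<Omega> L Q1 f g = DN_map s \<Omega> L Q2 f g"
    and u: "u \<in> Hs_tilde s \<Omega>" and v: "v \<in> Hs_tilde s \<Omega>"
  shows "Q1 u v = Q2 u v"
proof -
  let ?B1 = "add_form L Q1" and ?B2 = "add_form L Q2"
  interpret B1: coercive_form s \<Omega> ?B1 M1 c1 by (rule C1)
  interpret B2: coercive_form s \<Omega> ?B2 M2 c2 by (rule C2)
  define D where "D u v = ?B1 u v - ?B2 u v" for u v
  have DQ: "D u v = Q1 u v - Q2 u v" for u v by (simp add: D_def add_form_def)
  have Dlin: "D (\<lambda>x. a * f x + b * g x) h = a * D f h + b * D g h"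
    if "f \<in> Hs s" "g \<in> Hs s" "h \<in> Hs s" for f g h a b
    unfolding D_def B1.lin[OF that] B2.lin[OF that] by (simp add: algebra_simps)
  have Dsym: "D f g = D g f" if "f \<in> Hs s" "g \<in> Hs s" for f g
    unfolding D_def using B1.sym[OF that] B2.sym[OF that] by simp
  have Dadd: "D (\<lambda>x. f x + g x) h = D f h + D g h" if "f \<in> Hs s" "g \<in> Hs s" "h \<in> Hs s" for f g h
    using Dlin[OF that, of 1 1] by simp
  \<comment> \<open>The factor of \<open>f\<close> comes last, as \<open>tilde_Riesz\<close> expects
    for the functional that sends \<open>f\<close> to \<open>D f g\<close>.\<close>
  have Dbound: "\<bar>D f g\<bar> \<le> (M1 + M2) * Hs_norm s g * Hs_norm s f" if "f \<in> Hs s" "g \<in> Hs s" for f g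
    using B1.bounded[OF that] B2.bounded[OF that] unfolding D_def by (simp add: algebra_simps)
  define S1 where "S1 f = (SOME u. dirichlet_solution s \<Omega> ?B1 f u)" for f
  define S2 where "S2 f = (SOME u. dirichlet_solution s \<Omega> ?B2 f u)" for f
  have S1: "dirichlet_solution s \<Omega> ?B1 f (S1 f)" if "f \<in> Hs s" for f
    unfolding S1_def by (rule someI_ex[OF B1.solution_exists[OF that]])
  have S2: "dirichlet_solution s \<Omega> ?B2 f (S2 f)" if "f \<in> Hs s" for f
    unfolding S2_def by (rule someI_ex[OF B2.solution_exists[OF that]])
  \<comment> \<open>Integral identity: both DN values are rewritten as forms at the same pair
    \<open>S1 f\<close>, \<open>S2 g\<close>, so equal data give
    \<open>D (S1 f) (S2 g) = 0\<close>.\<close>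
  have key: "D (\<lambda>x. S1 f x - f x) (\<lambda>x. S2 g x - g x) = 0" if f: "f \<in> Cc_inf W1" and g: "g \<in> Cc_inf W2" for f g
  proof -
    note fH = Cc_inf_Hs[OF f, of s] and gH = Cc_inf_Hs[OF g, of s]
    note s1 = S1[OF fH, unfolded dirichlet_solution_def] and s2 = S2[OF gH, unfolded dirichlet_solution_def]
      and t2 = S2[OF fH, unfolded dirichlet_solution_def]
    let ?w1 = "\<lambda>x. S1 f x - f x" and ?w2 = "\<lambda>x. S2 g x - g x" and ?w3 = "\<lambda>x. S2 f x - f x"
    have w1: "?w1 \<in> Hs_tilde s \<Omega>" and w2: "?w2 \<in> Hs_tilde s \<Omega>" and w3: "?w3 \<in> Hs_tilde s \<Omega>"
      and h1: "S1 f \<in> Hs s" and h2: "S2 g \<in> Hs s" and h3: "S2 f \<in> Hs s" using s1 s2 t2 by auto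
    have "DN_map s \<Omega> L Q1 f g = ?B1 (S1 f) g" by (simp add: DN_map_def Let_def S1_def)
    also have "\<dots> = ?B1 (S1 f) (S2 g)" using B1.diff_right[OF h2 gH h1] s1 w2 by simp
    finally have 1: "DN_map s \<Omega> L Q1 f g = ?B1 (S1 f) (S2 g)" .
    have "DN_map s \<Omega> L Q2 f g = ?B2 (S2 f) g" by (simp add: DN_map_def Let_def S2_def)
    also have "\<dots> = ?B2 (S2 f) (S2 g)" using B2.diff_right[OF h2 gH h3] t2 w2 by simp
    \<comment> \<open>\<open>S2 f\<close> is exchanged for \<open>S1 f\<close> by way of
      \<open>f\<close>: both differ from \<open>f\<close> by an element of
      \<open>Hs_tilde s \<Omega>\<close>, which \<open>?B2 (S2 g)\<close> annihilates.\<close>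
    also have "\<dots> = ?B2 (S2 g) (S2 f)" by (rule B2.sym[OF h3 h2])
    also have "\<dots> = ?B2 (S2 g) f" using B2.diff_right[OF h3 fH h2] s2 w3 by simp
    also have "\<dots> = ?B2 (S2 g) (S1 f)" using B2.diff_right[OF h1 fH h2] s2 w1 by simp
    also have "\<dots> = ?B2 (S1 f) (S2 g)" by (rule B2.sym[OF h2 h1])
    finally have D0: "D (S1 f) (S2 g) = 0" using 1 DN[OF f g] by (simp add: D_def)
    \<comment> \<open>Expanding both solutions into interior part plus datum leaves only the
      interior parts: a datum against an interior part gives 0 by locality, and datum against datum
      gives 0 because \<open>W1\<close> and \<open>W2\<close> are disjoint.\<close>
    have "D (S1 f) (S2 g) = D ?w1 (S2 g) + D f (S2 g)"
      using Dadd[OF Hs_tildeD[OF w1] fH h2] by simp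
    also have "D ?w1 (S2 g) = D (\<lambda>x. ?w2 x + g x) ?w1" using Dsym[OF Hs_tildeD[OF w1] h2] by simp
    also have "\<dots> = D ?w2 ?w1 + D g ?w1" by (rule Dadd[OF Hs_tildeD[OF w2] gH Hs_tildeD[OF w1]])
    also have "D g ?w1 = 0" using local_tilde[OF _ w1, of g] g by (simp add: DQ)
    also have "D f (S2 g) = D (\<lambda>x. ?w2 x + g x) f" using Dsym[OF fH h2] by simp
    also have "\<dots> = D ?w2 f + D g f" by (rule Dadd[OF Hs_tildeD[OF w2] gH fH])
    also have "D ?w2 f = D f ?w2" by (rule Dsym[OF Hs_tildeD[OF w2] fH])
    also have "D f ?w2 = 0" using local_tilde[OF _ w2, of f] f by (simp add: DQ)
    also have "D g f = D f g" by (rule Dsym[OF gH fH])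
    also have "D f g = 0" using local_disjoint[OF f g] by (simp add: DQ)
    finally show ?thesis using D0 Dsym[OF Hs_tildeD[OF w1] Hs_tildeD[OF w2]] by simp
  qed
  text \<open>Runge approximation in dual form: the Riesz representer of a functional that vanishes on
    all \<open>S f - f\<close> vanishes by unique continuation.\<close>
  have runge: "D x y = 0"
    if B: "coercive_form s \<Omega> (add_form L Q) M c" and Q: "Q = Q1 \<or> Q = Q2" and W: "W = W1 \<or> W = W2"
      and S: "\<And>f. f \<in> Hs s \<Longrightarrow> dirichlet_solution s \<Omega> (add_form L Q) f (S f)"
      and zero: "\<And>f. f \<in> Cc_inf W \<Longrightarrow> D (\<lambda>x. S f x - f x) y = 0"
      and x: "x \<in> Hs_tilde s \<Omega>" and y: "y \<in> Hs_tilde s \<Omega>" for x y Q M c W S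
  proof -
    interpret B: coercive_form s \<Omega> "add_form L Q" M c by (rule B)
    have "\<exists>w\<in>Hs_tilde s \<Omega>. \<forall>v\<in>Hs_tilde s \<Omega>. D v y = add_form L Q w v"
      by (rule B.tilde_Riesz[OF Dlin Dbound]) (auto intro: Hs_tildeD y)
    then obtain w where w: "w \<in> Hs_tilde s \<Omega>" and eq: "\<And>v. v \<in> Hs_tilde s \<Omega> \<Longrightarrow> D v y = add_form L Q w v" by blast
    note wH = Hs_tildeD[OF w]
    have "L f w = 0" if f: "f \<in> Cc_inf W" for f
    proof -
      note fH = Cc_inf_Hs[OF f, of s]
      note sol = S[OF fH, unfolded dirichlet_solution_def]
      have t: "(\<lambda>x. S f x - f x) \<in> Hs_tilde s \<Omega>" using sol by blast
      have "0 = add_form L Q w (\<lambda>x. S f x - f x)" using eq[OF t] zero[OF f] by simp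
      also have "\<dots> = add_form L Q (\<lambda>x. S f x - f x) w" by (rule B.sym[OF wH Hs_tildeD[OF t]])
      also have "\<dots> = add_form L Q (S f) w - add_form L Q f w" using sol by (intro B.diff_left fH wH) blast
      also have "add_form L Q (S f) w = 0" using sol w by blast
      finally have "add_form L Q f w = 0" by simp
      moreover have "Q f w = 0" using local_tilde[OF _ w, of f] f Q W by auto
      ultimately show ?thesis by (simp add: add_form_def)
    qed
    then have "AE x in lebesgue. w x = 0" by (rule ucp[OF W w])
    then have "add_form L Q w x = 0"
      by (intro B.zero_left Hs_norm_AE_zero wH Hs_tildeD[OF x])
    then show ?thesis using eq[OF x] by simp
  qed
  \<comment> \<open>The second argument stays the interior part of a solution, and Runge
    approximation with data in \<open>W1\<close> frees the first.\<close>
  have 1: "D x (\<lambda>x. S2 g x - g x) = 0" if x: "x \<in> Hs_tilde s \<Omega>" and g: "g \<in> Cc_inf W2" for x g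
    by (rule runge[OF C1 _ _ S1 key[OF _ g] x])
      (use S2[OF Cc_inf_Hs[OF g]] in \<open>auto simp: dirichlet_solution_def\<close>)
  \<comment> \<open>By symmetry of \<open>D\<close> the roles are exchanged, and Runge approximation
    with data in \<open>W2\<close> frees the remaining argument.\<close>
  have 2: "D y x = 0" if x: "x \<in> Hs_tilde s \<Omega>" and y: "y \<in> Hs_tilde s \<Omega>" for x y
  proof (rule runge[OF C2 _ _ S2 _ y x])
    fix g assume g: "g \<in> Cc_inf W2"
    have "(\<lambda>x. S2 g x - g x) \<in> Hs s"
      using S2[OF Cc_inf_Hs[OF g]] Hs_tildeD by (auto simp: dirichlet_solution_def)
    then show "D (\<lambda>x. S2 g x - g x) x = 0" using 1[OF x g] Dsym[OF Hs_tildeD[OF x]] by simp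
  qed auto
  show ?thesis using 2[OF v u] by (simp add: DQ)
qed

section \<open>Unique continuation for the fractional Laplacian\<close>

lemma powser_zero_coeff:
  fixes a :: "nat \<Rightarrow> real"
  assumes e: "e > 0" and zero: "\<And>z. \<bar>z\<bar> < e \<Longrightarrow> (\<lambda>k. a k * z ^ k) sums 0"
  shows "a k = 0"
proof (induction k rule: less_induct)
  case (less k)
  have "(\<lambda>j. a (j + k) * z ^ j) sums 0" if z: "z \<noteq> 0" "norm z < e" for z
  proof -
    have "(\<lambda>j. a (j + k) * z ^ (j + k)) sums 0"
      using sums_iff_shift[of "\<lambda>k. a k * z ^ k" k 0] zero[of z] z less by simp
    then have "(\<lambda>j. inverse (z ^ k) * (a (j + k) * z ^ (j + k))) sums (inverse (z ^ k) * 0)" by (rule sums_mult)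
    then show ?thesis using z by (simp add: power_add field_simps)
  qed
  from powser_limit_0_strong[OF e this] have "((\<lambda>_. 0) \<longlongrightarrow> a (0 + k)) (at (0::real))" .
  then show ?case using tendsto_unique[OF _ tendsto_const] by (metis add_0 at_neq_bot)
qed

text \<open>The common majorant of the heat integrals in \<open>t\<close>: bounded near 0 and an
  integrable power at infinity.\<close>

lemma integrable_powr_tail:
  fixes p :: real
  assumes p: "p > 1"
  shows "integrable lborel (\<lambda>t. indicator {0<..} t * min 1 (t powr (- p)))"
proof -
  have "(\<lambda>x. x powr (- p)) absolutely_integrable_on {1..}"
    using has_integral_powr_to_inf[of "-p" 1] p
    by (intro nonnegative_absolutely_integrable_1) (auto simp: integrable_on_def)
  then have "integrable lebesgue (\<lambda>t. indicator {1..} t * t powr (- p))" by (simp add: set_integrable_def)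
  then have 1: "integrable lborel (\<lambda>t. indicator {1..} t * t powr (- p))"
    by (subst (asm) integral_lebesgue_lborel(2)) auto
  have 2: "integrable lborel (indicator {0..1::real} :: real \<Rightarrow> real)" by (intro integrable_real_indicator) auto
  show ?thesis
  proof (rule Bochner_Integration.integrable_bound[OF Bochner_Integration.integrable_add[OF 2 1]])
    show "AE t in lborel. norm (indicator {0<..} t * min 1 (t powr (- p)))
        \<le> norm (indicat_real {0..1} t + indicator {1..} t * t powr (- p))"
      by (intro AE_I2) (auto simp: indicator_def min_def)
  qed measurable
qed

lemma nn_integral_gamma:
  assumes x: "x > 0" and l: "l > 0"
  shows "(\<integral>\<^sup>+t. ennreal (indicator {0<..} t * t powr (x - 1) * exp (- (t * l))) \<partial>lborel) = ennreal (Gamma x * l powr (- x))"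
proof -
  let ?f = "\<lambda>t. indicator {0..} t * t powr (x - 1) / exp t"
  have "ennreal (Gamma x) = (\<integral>\<^sup>+t. ennreal (?f t) \<partial>lborel)" by (rule Gamma_conv_nn_integral_real[OF x])
  also have "\<dots> = ennreal l * (\<integral>\<^sup>+t. ennreal (?f (0 + l * t)) \<partial>lborel)"
    using nn_integral_real_affine[of "\<lambda>t. ennreal (?f t)" l 0] l by simp
  also have "(\<integral>\<^sup>+t. ennreal (?f (0 + l * t)) \<partial>lborel) =
      (\<integral>\<^sup>+t. ennreal (l powr (x - 1)) * ennreal (indicator {0<..} t * t powr (x - 1) * exp (- (t * l))) \<partial>lborel)"
  proof (rule nn_integral_cong_AE)
    show "AE t in lborel. ennreal (?f (0 + l * t)) = ennreal (l powr (x - 1)) * ennreal (indicator {0<..} t * t powr (x - 1) * exp (- (t * l)))"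
      using AE_lborel_singleton[of 0]
    proof eventually_elim
      case (elim t)
      then show ?case using l
        by (cases "t > 0") (auto simp: powr_mult exp_minus mult.commute divide_inverse zero_le_mult_iff simp flip: ennreal_mult)
    qed
  qed
  also have "\<dots> = ennreal (l powr (x - 1)) * (\<integral>\<^sup>+t. ennreal (indicator {0<..} t * t powr (x - 1) * exp (- (t * l))) \<partial>lborel)"
    by (rule nn_integral_cmult) measurable
  finally have eq: "ennreal (Gamma x) = ennreal l * (ennreal (l powr (x - 1)) * (\<integral>\<^sup>+t. ennreal (indicator {0<..} t * t powr (x - 1) * exp (- (t * l))) \<partial>lborel))" .
  have "l * l powr (x - 1) = l powr x" using l powr_add[of l 1 "x - 1"] by simp
  then have "ennreal (Gamma x) = ennreal (l powr x) * (\<integral>\<^sup>+t. ennreal (indicator {0<..} t * t powr (x - 1) * exp (- (t * l))) \<partial>lborel)"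
    using l unfolding eq by (simp add: mult.assoc[symmetric] ennreal_mult[symmetric])
  then have "ennreal (l powr (- x)) * ennreal (Gamma x) = ennreal (l powr (- x) * l powr x) * (\<integral>\<^sup>+t. ennreal (indicator {0<..} t * t powr (x - 1) * exp (- (t * l))) \<partial>lborel)"
    by (simp add: mult.assoc ennreal_mult)
  also have "l powr (- x) * l powr x = 1" using l by (simp flip: powr_add)
  finally show ?thesis using x by (simp add: mult.commute Gamma_real_pos less_imp_le flip: ennreal_mult)
qed

text \<open>Trades exponential decay for decay of any prescribed order; it is the inequality
  \<open>y \<le> exp y\<close> at \<open>y = x / q\<close>, raised to the power
  \<open>q\<close>.\<close>

lemma exp_le_powr:
  fixes x q :: real
  assumes x: "x > 0" and q: "q > 0" shows "exp (- x) \<le> (q / x) powr q"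
proof -
  have "x / q \<le> exp (x / q)" using exp_ge_add_one_self[of "x / q"] by linarith
  then have "(x / q) powr q \<le> exp (x / q) powr q" using x q by (intro powr_mono2) auto
  also have "\<dots> = exp x" using q by (simp add: powr_def)
  finally have "inverse (exp x) \<le> inverse ((x / q) powr q)" using x q by (intro le_imp_inverse_le) auto
  then show ?thesis using x q by (simp add: exp_minus powr_divide)
qed

text \<open>Rescaling \<open>t\<close> by \<open>r\<close> extracts the power of \<open>r\<close>.
  What remains is a constant \<open>K\<close>, of which only positivity and finiteness
  matter.\<close>

lemma nn_integral_inverse_gamma:
  assumes b: "\<beta> > 0"
  obtains K where "K > 0"
    "\<And>r. r > 0 \<Longrightarrow> (\<integral>\<^sup>+t. ennreal (indicator {0<..} t * t powr (- \<beta> - 1) * exp (- (r / (4 * t)))) \<partial>lborel) = ennreal (K * r powr (- \<beta>))"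
proof -
  define f :: "real \<Rightarrow> real \<Rightarrow> real" where "f r t = indicator {0<..} t * t powr (- \<beta> - 1) * exp (- (r / (4 * t)))" for r t
  have [measurable]: "f r \<in> borel_measurable borel" for r unfolding f_def by measurable
  have nn: "f r t \<ge> 0" for r t by (simp add: f_def)
  \<comment> \<open>1 serves for the bound by the power of \<open>t\<close>; the other term comes
    from \<open>exp_le_powr\<close> with exponent \<open>\<beta> + 1\<close>, which cancels the
    singularity at 0.\<close>
  define C where "C = max 1 ((4 * (\<beta> + 1)) powr (\<beta> + 1))"
  have int: "integrable lborel (f 1)"
  proof (rule Bochner_Integration.integrable_bound)
    show "integrable lborel (\<lambda>t. C * (indicator {0<..} t * min 1 (t powr (- (\<beta> + 1)))))"
      using integrable_powr_tail[of "\<beta> + 1"] b by simp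
    have "norm (f 1 t) \<le> norm (C * (indicator {0<..} t * min 1 (t powr (- (\<beta> + 1)))))" for t
    proof (cases "t > 0")
      case True
      have "exp (- (1 / (4 * t))) \<le> ((\<beta> + 1) / (1 / (4 * t))) powr (\<beta> + 1)"
        using True b by (intro exp_le_powr) auto
      also have "\<dots> = (4 * (\<beta> + 1)) powr (\<beta> + 1) * t powr (\<beta> + 1)"
      proof -
        have "(\<beta> + 1) / (1 / (4 * t)) = (4 * (\<beta> + 1)) * t" by simp
        then show ?thesis using True b by (simp only: powr_mult)
      qed
      finally have "t powr (- \<beta> - 1) * exp (- (1 / (4 * t))) \<le> t powr (- \<beta> - 1) * ((4 * (\<beta> + 1)) powr (\<beta> + 1) * t powr (\<beta> + 1))"
        by (rule mult_left_mono) simp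
      also have "\<dots> = (4 * (\<beta> + 1)) powr (\<beta> + 1) * (t powr (- \<beta> - 1) * t powr (\<beta> + 1))" by simp
      also have "t powr (- \<beta> - 1) * t powr (\<beta> + 1) = 1" using True by (simp flip: powr_add)
      finally have 1: "t powr (- \<beta> - 1) * exp (- (1 / (4 * t))) \<le> C * 1" by (simp add: C_def)
      have "t powr (- \<beta> - 1) * exp (- (1 / (4 * t))) \<le> t powr (- \<beta> - 1) * 1"
        using True by (intro mult_left_mono) auto
      also have "\<dots> \<le> C * t powr (- (\<beta> + 1))"
        using mult_right_mono[of 1 C "t powr (- \<beta> - 1)"] by (simp add: C_def)
      finally have "t powr (- \<beta> - 1) * exp (- (1 / (4 * t))) \<le> C * min 1 (t powr (- (\<beta> + 1)))"
        using 1 by (simp add: min_def)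
      then show ?thesis using True by (simp add: f_def)
    qed (simp add: f_def)
    then show "AE t in lborel. norm (f 1 t) \<le> norm (C * (indicator {0<..} t * min 1 (t powr (- (\<beta> + 1)))))" by simp
  qed measurable
  define K where "K = (\<integral>t. f 1 t \<partial>lborel)"
  have K_eq: "(\<integral>\<^sup>+t. ennreal (f 1 t) \<partial>lborel) = ennreal K"
    unfolding K_def by (rule nn_integral_eq_integral[OF int]) (simp add: nn)
  \<comment> \<open>The integrand is positive on the interval from 0 to 1, which is not a null
    set.\<close>
  have "K \<noteq> 0"
  proof
    assume "K = 0"
    then have "AE t in lborel. f 1 t = 0"
      using integral_nonneg_eq_0_iff_AE[OF int] nn by (simp add: K_def)
    then have "AE t in lborel. t \<notin> {0<..<1::real}" by eventually_elim (auto simp: f_def split: if_splits)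
    then have "{0<..<1::real} \<in> null_sets lborel" by (subst AE_iff_null_sets) auto
    then show False by (simp add: null_sets_def)
  qed
  moreover have "K \<ge> 0" unfolding K_def using nn by simp
  ultimately have K: "K > 0" by simp
  have "(\<integral>\<^sup>+t. ennreal (f r t) \<partial>lborel) = ennreal (K * r powr (- \<beta>))" if r: "r > 0" for r
  proof -
    have "(\<integral>\<^sup>+t. ennreal (f r t) \<partial>lborel) = ennreal r * (\<integral>\<^sup>+t. ennreal (f r (0 + r * t)) \<partial>lborel)"
      using nn_integral_real_affine[of "\<lambda>t. ennreal (f r t)" r 0] r by simp
    also have "(\<lambda>t. ennreal (f r (0 + r * t))) = (\<lambda>t. ennreal (r powr (- \<beta> - 1)) * ennreal (f 1 t))"
      using r by (auto simp: fun_eq_iff f_def indicator_def powr_mult zero_less_mult_iff simp flip: ennreal_mult)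
    also have "(\<integral>\<^sup>+t. ennreal (r powr (- \<beta> - 1)) * ennreal (f 1 t) \<partial>lborel) = ennreal (r powr (- \<beta> - 1)) * ennreal K"
      by (subst nn_integral_cmult) (auto simp: K_eq)
    also have "ennreal r * (ennreal (r powr (- \<beta> - 1)) * ennreal K) = ennreal (r * r powr (- \<beta> - 1) * K)"
      using r K by (simp add: ennreal_mult mult.assoc)
    also have "r * r powr (- \<beta> - 1) = r powr (- \<beta>)" using r powr_add[of r 1 "- \<beta> - 1"] by simp
    finally show ?thesis by (simp add: mult.commute)
  qed
  then show ?thesis using that[OF K] unfolding f_def by blast
qed

text \<open>The weights \<open>\<rho>\<^sup>-\<^sup>i\<close> determine the signed measure \<open>\<omega>\<close> on the level sets of \<open>\<rho>\<close>, by Weierstrass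
  approximation in the variable \<open>1 / \<rho>\<close>, which ranges over a compact interval.\<close>

lemma moments_vanish:
  assumes \<omega>: "integrable N \<omega>" and \<rho>: "\<rho> \<in> borel_measurable N" and d: "d > 0" "\<And>p. \<rho> p \<ge> d"
    and e: "e \<ge> 0"
    and zero: "\<And>i::nat. (\<integral>p. \<omega> p * \<rho> p powr (- e - real i) \<partial>N) = 0"
    and F: "continuous_on {0..1/d} F" and Fm: "F \<in> borel_measurable borel"
  shows "(\<integral>p. \<omega> p * \<rho> p powr (- e) * F (1 / \<rho> p) \<partial>N) = (0::real)"
proof -
  note [measurable] = \<rho> Fm borel_measurable_integrable[OF \<omega>]
  have pos: "\<rho> p > 0" for p using d(2)[of p] d(1) by linarith
  have le: "\<rho> p powr (- e) \<le> d powr (- e)" for p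
    using d pos[of p] e by (intro powr_mono2') auto
  have range: "1 / \<rho> p \<in> {0..1/d}" for p using d pos[of p] by (auto simp: frac_le)
  have int: "integrable N (\<lambda>p. \<omega> p * \<rho> p powr (- e) * G (1 / \<rho> p))"
    if G: "continuous_on {0..1/d} G" and Gm [measurable]: "G \<in> borel_measurable borel" for G :: "real \<Rightarrow> real"
  proof -
    have "compact (G ` {0..1/d})" by (intro compact_continuous_image G) simp
    then have "bounded (G ` {0..1/d})" by (rule compact_imp_bounded)
    then obtain B where B: "\<And>x. x \<in> {0..1/d} \<Longrightarrow> \<bar>G x\<bar> \<le> B"
      unfolding bounded_iff real_norm_def by blast
    have B0: "B \<ge> 0" using B[OF range] abs_ge_zero order_trans by blast
    show ?thesis
    proof (rule Bochner_Integration.integrable_bound)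
      show "integrable N (\<lambda>p. (d powr (- e) * B) * \<omega> p)" by (intro integrable_mult_right \<omega>)
      show "AE p in N. norm (\<omega> p * \<rho> p powr (- e) * G (1 / \<rho> p)) \<le> norm ((d powr (- e) * B) * \<omega> p)"
      proof (rule AE_I2)
        fix p
        have "\<bar>\<omega> p\<bar> * (\<rho> p powr (- e) * \<bar>G (1 / \<rho> p)\<bar>) \<le> \<bar>\<omega> p\<bar> * (d powr (- e) * B)"
          by (intro mult_left_mono mult_mono le B range) auto
        then show "norm (\<omega> p * \<rho> p powr (- e) * G (1 / \<rho> p)) \<le> norm ((d powr (- e) * B) * \<omega> p)"
          using B0 by (simp add: abs_mult mult_ac)
      qed
    qed measurable
  qed
  \<comment> \<open>A power of \<open>1 / \<rho>\<close> shifts the exponent by an integer, so the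
    assumption \<open>zero\<close> covers polynomials.\<close>
  have poly: "(\<integral>p. \<omega> p * \<rho> p powr (- e) * (\<Sum>i\<le>n. a i * (1 / \<rho> p) ^ i) \<partial>N) = 0" for a and n :: nat
  proof -
    have "\<omega> p * \<rho> p powr (- e) * (\<Sum>i\<le>n. a i * (1 / \<rho> p) ^ i) = (\<Sum>i\<le>n. a i * (\<omega> p * \<rho> p powr (- e - real i)))" for p
      unfolding sum_distrib_left
    proof (rule sum.cong[OF refl])
      fix i
      have "\<rho> p powr (- e - real i) = \<rho> p powr (- e) * (1 / \<rho> p) ^ i"
        using pos[of p] by (simp add: powr_diff powr_realpow power_one_over)
      then show "\<omega> p * \<rho> p powr (- e) * (a i * (1 / \<rho> p) ^ i) = a i * (\<omega> p * \<rho> p powr (- e - real i))" by simp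
    qed
    moreover have "integrable N (\<lambda>p. \<omega> p * \<rho> p powr (- e - real i))" for i
    proof -
      have "integrable N (\<lambda>p. \<omega> p * \<rho> p powr (- e) * (1 / \<rho> p) ^ i)"
        by (rule int[of "\<lambda>x. x ^ i"]) (auto intro!: continuous_intros)
      moreover have "\<rho> p powr (- e - real i) = \<rho> p powr (- e) * (1 / \<rho> p) ^ i" for p
        using pos[of p] by (simp add: powr_diff powr_realpow power_one_over)
      ultimately show ?thesis by (simp add: mult.assoc)
    qed
    ultimately show ?thesis by (simp add: zero)
  qed
  have "\<bar>\<integral>p. \<omega> p * \<rho> p powr (- e) * F (1 / \<rho> p) \<partial>N\<bar> \<le> 0 + \<epsilon>" if \<epsilon>: "\<epsilon> > 0" for \<epsilon>
  proof -
    define I where "I = (\<integral>p. \<bar>\<omega> p\<bar> \<partial>N)"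
    have I: "I \<ge> 0" by (simp add: I_def)
    \<comment> \<open>Uniform accuracy \<open>\<eta>\<close> changes the integral by at most
      \<open>\<eta>\<close> times the weighted total mass; the added 1 avoids division by 0.\<close>
    define \<eta> where "\<eta> = \<epsilon> / (d powr (- e) * I + 1)"
    have den: "d powr (- e) * I + 1 > 0" using I by (simp add: add_nonneg_pos)
    have \<eta>: "\<eta> > 0" using \<epsilon> den by (simp add: \<eta>_def)
    obtain g where g: "real_polynomial_function g" "\<And>x. x \<in> {0..1/d} \<Longrightarrow> \<bar>F x - g x\<bar> < \<eta>"
      using Stone_Weierstrass_real_polynomial_function[OF compact_Icc F \<eta>] by blast
    obtain a n where gs: "g = (\<lambda>x. \<Sum>i\<le>n. a i * x ^ i)"
      using g(1) real_polynomial_function_iff_sum by blast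
    have gc: "continuous_on {0..1/d} g" unfolding gs by (intro continuous_intros)
    have gm [measurable]: "g \<in> borel_measurable borel" unfolding gs by measurable
    have "(\<integral>p. \<omega> p * \<rho> p powr (- e) * F (1 / \<rho> p) \<partial>N) = (\<integral>p. \<omega> p * \<rho> p powr (- e) * F (1 / \<rho> p) \<partial>N) - (\<integral>p. \<omega> p * \<rho> p powr (- e) * g (1 / \<rho> p) \<partial>N)"
      using poly[of a n] by (simp add: gs)
    also have "\<dots> = (\<integral>p. \<omega> p * \<rho> p powr (- e) * F (1 / \<rho> p) - \<omega> p * \<rho> p powr (- e) * g (1 / \<rho> p) \<partial>N)"
      by (rule Bochner_Integration.integral_diff[symmetric]) (intro int F Fm gc gm)+
    finally have "\<bar>\<integral>p. \<omega> p * \<rho> p powr (- e) * F (1 / \<rho> p) \<partial>N\<bar> \<le>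
        (\<integral>p. \<bar>\<omega> p * \<rho> p powr (- e) * F (1 / \<rho> p) - \<omega> p * \<rho> p powr (- e) * g (1 / \<rho> p)\<bar> \<partial>N)"
      by (simp only: integral_abs_bound)
    also have "\<dots> \<le> (\<integral>p. d powr (- e) * \<eta> * \<bar>\<omega> p\<bar> \<partial>N)"
    proof (rule integral_mono)
      fix p
      have "\<bar>\<omega> p * \<rho> p powr (- e) * F (1 / \<rho> p) - \<omega> p * \<rho> p powr (- e) * g (1 / \<rho> p)\<bar> =
          \<bar>\<omega> p\<bar> * (\<rho> p powr (- e) * \<bar>F (1 / \<rho> p) - g (1 / \<rho> p)\<bar>)"
        by (simp add: abs_mult flip: right_diff_distrib)
      also have "\<dots> \<le> \<bar>\<omega> p\<bar> * (d powr (- e) * \<eta>)"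
        by (intro mult_left_mono mult_mono le less_imp_le[OF g(2)] range) auto
      finally show "\<bar>\<omega> p * \<rho> p powr (- e) * F (1 / \<rho> p) - \<omega> p * \<rho> p powr (- e) * g (1 / \<rho> p)\<bar> \<le> d powr (- e) * \<eta> * \<bar>\<omega> p\<bar>"
        by (simp add: mult_ac)
    qed (use \<omega> in \<open>auto intro!: integrable_abs Bochner_Integration.integrable_diff int F Fm gc gm\<close>)
    also have "\<dots> = \<eta> * (d powr (- e) * I)" by (simp add: I_def)
    also have "\<dots> \<le> \<eta> * (d powr (- e) * I + 1)" using \<eta> by (intro mult_left_mono) auto
    also have "\<dots> = \<epsilon>" using den by (simp add: \<eta>_def)
    finally show ?thesis by simp
  qed
  then have "\<bar>\<integral>p. \<omega> p * \<rho> p powr (- e) * F (1 / \<rho> p) \<partial>N\<bar> \<le> 0" by (rule field_le_epsilon)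
  then show ?thesis by simp
qed

text \<open>Bounds the difference quotients in \<open>H_deriv\<close> uniformly, for dominated
  convergence.\<close>

lemma exp_minus_lipschitz:
  fixes a b :: real
  assumes "a \<ge> 0" "b \<ge> 0" shows "\<bar>exp (- a) - exp (- b)\<bar> \<le> \<bar>a - b\<bar>"
proof -
  have *: "0 \<le> exp (- a) - exp (- b) \<and> exp (- a) - exp (- b) \<le> b - a" if "0 \<le> a" "a \<le> b" for a b :: real
  proof -
    have "exp (- a) - exp (- b) = exp (- a) * (1 - exp (- (b - a)))" by (simp add: exp_diff exp_minus field_simps)
    also have "\<dots> \<le> 1 * (b - a)"
    proof (rule mult_mono)
      show "1 - exp (- (b - a)) \<le> b - a" using exp_ge_add_one_self[of "- (b - a)"] by linarith
    qed (use that in auto)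
    finally show ?thesis using that by simp
  qed
  show ?thesis using *[of a b] *[of b a] assms by (cases "a \<le> b") auto
qed

lemma gamma_integral:
  fixes x l :: real
  assumes x: "x > 0" and l: "l > 0"
  shows "integrable lborel (\<lambda>t. indicator {0<..} t * t powr (x - 1) * exp (- (t * l)))"
    "(\<integral>t. indicator {0<..} t * t powr (x - 1) * exp (- (t * l)) \<partial>lborel) = Gamma x * l powr (- x)"
proof -
  have "has_bochner_integral lborel (\<lambda>t. indicator {0<..} t * t powr (x - 1) * exp (- (t * l))) (Gamma x * l powr (- x))"
    by (rule has_bochner_integral_nn_integral[OF _ _ _ nn_integral_gamma[OF x l]])
       (use x in \<open>auto simp: Gamma_real_pos less_imp_le\<close>)
  then show "integrable lborel (\<lambda>t. indicator {0<..} t * t powr (x - 1) * exp (- (t * l)))"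
    "(\<integral>t. indicator {0<..} t * t powr (x - 1) * exp (- (t * l)) \<partial>lborel) = Gamma x * l powr (- x)"
    by (auto simp: has_bochner_integral_iff)
qed

text \<open>The heat semigroup pairing of two functions, computed in frequency (the measure \<open>P\<close>, with
  \<open>\<lambda> = |\<xi>|\<^sup>2\<close>) and in space (the measure \<open>N\<close>, with \<open>\<rho> = |x - y|\<^sup>2\<close>). The lower bound on \<open>\<rho>\<close> says that
  the supports are disjoint.\<close>

locale heat_pairing =
  fixes P :: "'b measure" and lam v :: "'b \<Rightarrow> real"
    and N :: "'c measure" and \<omega> :: "nat \<Rightarrow> 'c \<Rightarrow> real" and \<rho> :: "'c \<Rightarrow> real" and d C0 b q :: real
    and H :: "nat \<Rightarrow> real \<Rightarrow> real"
  defines "H k t \<equiv> (\<integral>p. lam p ^ k * exp (- (t * lam p)) * v p \<partial>P)"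
  assumes sfP: "sigma_finite_measure P" and sfN: "sigma_finite_measure N"
    and lam [measurable]: "lam \<in> borel_measurable P" and lam_nn: "\<And>p. lam p \<ge> 0"
    and v: "\<And>k. integrable P (\<lambda>p. lam p ^ k * v p)"
    and \<omega>: "\<And>k. integrable N (\<omega> k)" and \<rho> [measurable]: "\<rho> \<in> borel_measurable N"
    and d: "d > 0" "\<And>p. \<rho> p \<ge> d" and C0: "C0 > 0" and b: "b \<ge> 0" and q: "q \<ge> 0"
    and rep: "\<And>k t. t > 0 \<Longrightarrow> H k t = C0 * t powr (- b) * (\<integral>p. \<omega> k p * \<rho> p powr q * exp (- (\<rho> p / (4 * t))) \<partial>N)"
begin

lemma v_measurable [measurable]: "v \<in> borel_measurable P"
  using borel_measurable_integrable[OF v[of 0]] by simp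

lemma \<omega>_measurable [measurable]: "\<omega> k \<in> borel_measurable N"
  by (rule borel_measurable_integrable[OF \<omega>])

lemma \<rho>_pos: "\<rho> p > 0"
  using d(1) d(2)[of p] by linarith

lemma H_integrable:
  assumes t: "t \<ge> 0" shows "integrable P (\<lambda>p. lam p ^ k * exp (- (t * lam p)) * v p)"
proof (rule Bochner_Integration.integrable_bound[OF v[of k]])
  show "AE p in P. norm (lam p ^ k * exp (- (t * lam p)) * v p) \<le> norm (lam p ^ k * v p)"
  proof (rule AE_I2)
    fix p
    have "exp (- (t * lam p)) \<le> 1" using t lam_nn[of p] by simp
    then have "\<bar>lam p ^ k * v p\<bar> * exp (- (t * lam p)) \<le> \<bar>lam p ^ k * v p\<bar> * 1" by (rule mult_left_mono) simp
    then show "norm (lam p ^ k * exp (- (t * lam p)) * v p) \<le> norm (lam p ^ k * v p)" by (simp add: abs_mult mult_ac)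
  qed
qed measurable

text \<open>Differentiation under the integral costs one factor \<open>lam\<close>, which is why all
  weighted functions \<open>lam p ^ k * v p\<close> are assumed integrable.\<close>

lemma H_deriv:
  assumes t: "t > 0" shows "(H k has_real_derivative - H (Suc k) t) (at t)"
proof -
  \<comment> \<open>Restricting to positive times keeps the exponents in the range of
    \<open>exp_minus_lipschitz\<close>.\<close>
  have "((\<lambda>y. (H k y - H k t) / (y - t)) \<longlongrightarrow> - H (Suc k) t) (at t within {0<..})"
    unfolding tendsto_at_iff_sequentially comp_def
  proof (intro allI impI)
    fix X assume X: "\<forall>i. X i \<in> {0<..} - {t}" "X \<longlonglongrightarrow> t"
    let ?q = "\<lambda>i p. lam p ^ k * v p * ((exp (- (X i * lam p)) - exp (- (t * lam p))) / (X i - t))"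
    have eq: "(H k (X i) - H k t) / (X i - t) = (\<integral>p. ?q i p \<partial>P)" for i
    proof -
      have "0 \<le> X i" using X(1) by (auto intro: less_imp_le)
      then have "H k (X i) - H k t = (\<integral>p. lam p ^ k * exp (- (X i * lam p)) * v p - lam p ^ k * exp (- (t * lam p)) * v p \<partial>P)"
        unfolding H_def using t by (intro Bochner_Integration.integral_diff[symmetric] H_integrable) auto
      also have "(\<lambda>p. lam p ^ k * exp (- (X i * lam p)) * v p - lam p ^ k * exp (- (t * lam p)) * v p) =
          (\<lambda>p. lam p ^ k * v p * (exp (- (X i * lam p)) - exp (- (t * lam p))))"
        by (simp add: fun_eq_iff algebra_simps)
      finally show ?thesis by (simp only: times_divide_eq_right integral_divide_zero)
    qed
    have "(\<lambda>i. \<integral>p. ?q i p \<partial>P) \<longlonglongrightarrow> (\<integral>p. lam p ^ k * v p * (- (lam p * exp (- (t * lam p)))) \<partial>P)"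
    proof (rule integral_dominated_convergence)
      show "integrable P (\<lambda>p. \<bar>lam p ^ Suc k * v p\<bar>)" using v[of "Suc k"] by (rule integrable_abs)
      show "AE p in P. (\<lambda>i. ?q i p) \<longlonglongrightarrow> lam p ^ k * v p * (- (lam p * exp (- (t * lam p))))"
      proof (intro AE_I2 tendsto_mult_left)
        fix p
        have "((\<lambda>y. exp (- (y * lam p))) has_real_derivative - (lam p * exp (- (t * lam p)))) (at t)"
          by (auto intro!: derivative_eq_intros)
        then have "((\<lambda>y. (exp (- (y * lam p)) - exp (- (t * lam p))) / (y - t)) \<longlongrightarrow> - (lam p * exp (- (t * lam p)))) (at t)"
          by (simp add: has_field_derivative_iff)
        then show "(\<lambda>i. (exp (- (X i * lam p)) - exp (- (t * lam p))) / (X i - t)) \<longlonglongrightarrow> - (lam p * exp (- (t * lam p)))"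
          using X by (auto simp: tendsto_at_iff_sequentially comp_def)
      qed
      show "AE p in P. norm (?q i p) \<le> \<bar>lam p ^ Suc k * v p\<bar>" for i
      proof (rule AE_I2)
        fix p
        have "X i - t \<noteq> 0" "X i > 0" using X(1) by auto
        have "\<bar>exp (- (X i * lam p)) - exp (- (t * lam p))\<bar> \<le> \<bar>X i * lam p - t * lam p\<bar>"
          using \<open>X i > 0\<close> t lam_nn[of p] by (intro exp_minus_lipschitz) auto
        also have "\<dots> = lam p * \<bar>X i - t\<bar>" using lam_nn[of p] by (simp add: abs_mult mult.commute flip: left_diff_distrib)
        finally have "\<bar>(exp (- (X i * lam p)) - exp (- (t * lam p))) / (X i - t)\<bar> \<le> lam p"
          using \<open>X i - t \<noteq> 0\<close> by (simp add: divide_le_eq)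
        then have "\<bar>lam p ^ k * v p\<bar> * \<bar>(exp (- (X i * lam p)) - exp (- (t * lam p))) / (X i - t)\<bar> \<le> \<bar>lam p ^ k * v p\<bar> * lam p"
          by (rule mult_left_mono) simp
        also have "\<dots> = \<bar>lam p ^ Suc k * v p\<bar>" using lam_nn[of p] by (simp add: abs_mult mult_ac)
        finally show "norm (?q i p) \<le> \<bar>lam p ^ Suc k * v p\<bar>" by (simp add: abs_mult)
      qed
    qed measurable
    also have "(\<integral>p. lam p ^ k * v p * (- (lam p * exp (- (t * lam p)))) \<partial>P) = - H (Suc k) t"
      unfolding H_def by (subst Bochner_Integration.integral_minus[symmetric]) (simp add: mult_ac)
    finally show "(\<lambda>i. (H k (X i) - H k t) / (X i - t)) \<longlonglongrightarrow> - H (Suc k) t" by (simp only: eq)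
  qed
  then show ?thesis using t at_within_open[of t "{0<..}"] by (simp add: has_field_derivative_iff)
qed

lemma H_continuous: "continuous_on {0<..} (H k)"
  by (intro continuous_at_imp_continuous_on ballI DERIV_isCont[OF H_deriv]) auto

text \<open>\<open>lam * exp (- (t * lam))\<close> is at most \<open>1 / t\<close>: decay in time is
  bought with one power of \<open>lam\<close>, hence the index \<open>Suc k\<close>.\<close>

lemma H_bound_large: "\<exists>C. \<forall>t>0. \<bar>H (Suc k) t\<bar> \<le> C / t"
proof (intro exI allI impI)
  fix t :: real assume t: "t > 0"
  have "\<bar>H (Suc k) t\<bar> \<le> (\<integral>p. \<bar>lam p ^ Suc k * exp (- (t * lam p)) * v p\<bar> \<partial>P)" unfolding H_def by (rule integral_abs_bound)
  also have "\<dots> \<le> (\<integral>p. \<bar>lam p ^ k * v p\<bar> / t \<partial>P)"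
  proof (rule integral_mono)
    fix p
    have "t * lam p \<le> exp (t * lam p)" using exp_ge_add_one_self[of "t * lam p"] by linarith
    then have "t * lam p * exp (- (t * lam p)) \<le> 1" by (simp add: exp_minus field_simps)
    then have "lam p * exp (- (t * lam p)) \<le> 1 / t" using t by (simp add: field_simps)
    then have "\<bar>lam p ^ k * v p\<bar> * (lam p * exp (- (t * lam p))) \<le> \<bar>lam p ^ k * v p\<bar> * (1 / t)" by (rule mult_left_mono) simp
    then show "\<bar>lam p ^ Suc k * exp (- (t * lam p)) * v p\<bar> \<le> \<bar>lam p ^ k * v p\<bar> / t"
      using lam_nn[of p] by (simp add: abs_mult mult_ac)
  qed (use H_integrable[of t "Suc k"] v[of k] t in \<open>auto intro!: integrable_abs integrable_divide\<close>)
  finally show "\<bar>H (Suc k) t\<bar> \<le> (\<integral>p. \<bar>lam p ^ k * v p\<bar> \<partial>P) / t" by simp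
qed

text \<open>Since \<open>\<rho>\<close> is bounded below, the Gaussian factor is smaller than any
  power of \<open>t\<close>. Choosing \<open>Q \<ge> q\<close> leaves a nonpositive power of
  \<open>\<rho>\<close>, which is largest at \<open>d\<close>.\<close>

lemma heat_weight_bound:
  assumes Q: "Q > 0" "Q \<ge> q" and t: "t > 0"
  shows "\<rho> p powr q * exp (- (\<rho> p / (4 * t))) \<le> (4 * Q) powr Q * d powr (q - Q) * t powr Q"
proof -
  have "exp (- (\<rho> p / (4 * t))) \<le> (Q / (\<rho> p / (4 * t))) powr Q"
    using \<rho>_pos[of p] t Q by (intro exp_le_powr) auto
  also have "Q / (\<rho> p / (4 * t)) = (4 * Q) * t / \<rho> p" by simp
  also have "\<dots> powr Q = (4 * Q) powr Q * t powr Q * \<rho> p powr (- Q)"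
    using \<rho>_pos[of p] t Q by (simp add: powr_divide powr_mult powr_minus_divide)
  finally have "\<rho> p powr q * exp (- (\<rho> p / (4 * t))) \<le> \<rho> p powr q * ((4 * Q) powr Q * t powr Q * \<rho> p powr (- Q))"
    by (rule mult_left_mono) simp
  also have "\<dots> = (4 * Q) powr Q * t powr Q * \<rho> p powr (q - Q)"
    using \<rho>_pos[of p] by (simp add: powr_diff powr_minus_divide)
  also have "\<dots> \<le> (4 * Q) powr Q * t powr Q * d powr (q - Q)"
    using d Q by (intro mult_left_mono powr_mono2') auto
  finally show ?thesis by (simp add: mult_ac)
qed

lemma H_bound_small:
  assumes m: "m \<ge> 0" shows "\<exists>C. \<forall>t. 0 < t \<and> t \<le> 1 \<longrightarrow> \<bar>H k t\<bar> \<le> C * t powr m"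
proof (intro exI allI impI)
  fix t :: real assume "0 < t \<and> t \<le> 1"
  then have t: "0 < t" "t \<le> 1" by auto
  \<comment> \<open>Large enough that after the loss of \<open>t powr (- b)\<close> an exponent
    above \<open>m\<close> remains, with \<open>Q > 0\<close> and \<open>Q \<ge> q\<close> as
    \<open>heat_weight_bound\<close> requires.\<close>
  define Q where "Q = q + m + b + 1"
  have Q: "Q > 0" "Q \<ge> q" using q m b by (auto simp: Q_def)
  let ?A = "(4 * Q) powr Q * d powr (q - Q)"
  have "\<bar>\<integral>p. \<omega> k p * \<rho> p powr q * exp (- (\<rho> p / (4 * t))) \<partial>N\<bar> \<le> (\<integral>p. ?A * t powr Q * \<bar>\<omega> k p\<bar> \<partial>N)"
  proof (rule order_trans[OF integral_abs_bound], rule integral_mono_AE')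
    show "integrable N (\<lambda>p. ?A * t powr Q * \<bar>\<omega> k p\<bar>)" using \<omega> by (intro integrable_mult_right integrable_abs)
    show "AE p in N. \<bar>\<omega> k p * \<rho> p powr q * exp (- (\<rho> p / (4 * t)))\<bar> \<le> ?A * t powr Q * \<bar>\<omega> k p\<bar>"
    proof (rule AE_I2)
      fix p
      have "\<bar>\<omega> k p\<bar> * (\<rho> p powr q * exp (- (\<rho> p / (4 * t)))) \<le> \<bar>\<omega> k p\<bar> * (?A * t powr Q)"
        by (rule mult_left_mono[OF heat_weight_bound[OF Q t(1)]]) simp
      then show "\<bar>\<omega> k p * \<rho> p powr q * exp (- (\<rho> p / (4 * t)))\<bar> \<le> ?A * t powr Q * \<bar>\<omega> k p\<bar>"
        by (simp add: abs_mult mult_ac)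
    qed
  qed auto
  also have "\<dots> = ?A * (\<integral>p. \<bar>\<omega> k p\<bar> \<partial>N) * t powr Q" by simp
  finally have "C0 * t powr (- b) * \<bar>\<integral>p. \<omega> k p * \<rho> p powr q * exp (- (\<rho> p / (4 * t))) \<partial>N\<bar> \<le>
      C0 * t powr (- b) * (?A * (\<integral>p. \<bar>\<omega> k p\<bar> \<partial>N) * t powr Q)"
    using C0 by (intro mult_left_mono) auto
  then have "\<bar>H k t\<bar> \<le> C0 * t powr (- b) * (?A * (\<integral>p. \<bar>\<omega> k p\<bar> \<partial>N) * t powr Q)"
    using C0 by (simp add: rep[OF t(1)] abs_mult)
  also have "\<dots> = C0 * ?A * (\<integral>p. \<bar>\<omega> k p\<bar> \<partial>N) * (t powr (- b) * t powr Q)" by (simp add: mult_ac)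
  also have "\<dots> \<le> C0 * ?A * (\<integral>p. \<bar>\<omega> k p\<bar> \<partial>N) * t powr m"
  proof (rule mult_left_mono)
    have "t powr (- b) * t powr Q = t powr (Q - b)" using t by (simp flip: powr_add)
    also have "\<dots> \<le> t powr m" using t by (intro powr_mono') (auto simp: Q_def q add_nonneg_nonneg)
    finally show "t powr (- b) * t powr Q \<le> t powr m" .
  qed (use C0 in auto)
  finally show "\<bar>H k t\<bar> \<le> C0 * ((4 * (q + m + b + 1)) powr (q + m + b + 1) * d powr (q - (q + m + b + 1))) * (\<integral>p. \<bar>\<omega> k p\<bar> \<partial>N) * t powr m"
    by (simp only: Q_def)
qed

text \<open>Joins the estimates for small and large times into the majorant of
  \<open>integrable_powr_tail\<close>.\<close>

lemma H_bound:
  assumes a: "a \<ge> 0"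
  shows "\<exists>C\<ge>0. \<forall>t>0. \<bar>t powr (- a) * H (Suc k) t\<bar> \<le> C * min 1 (t powr (- (a + 1)))"
proof -
  obtain C1 where C1: "\<And>t. t > 0 \<Longrightarrow> \<bar>H (Suc k) t\<bar> \<le> C1 / t" using H_bound_large by blast
  obtain C2 where C2: "\<And>t. 0 < t \<Longrightarrow> t \<le> 1 \<Longrightarrow> \<bar>H (Suc k) t\<bar> \<le> C2 * t powr a"
    using H_bound_small[OF a] by blast
  define C where "C = max 0 (max C1 C2)"
  have C: "C \<ge> 0" "C1 \<le> C" "C2 \<le> C" by (auto simp: C_def)
  have "\<bar>t powr (- a) * H (Suc k) t\<bar> \<le> C * min 1 (t powr (- (a + 1)))" if t: "t > 0" for t
  proof (cases "t \<le> 1")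
    case True
    have "t powr (- a) * \<bar>H (Suc k) t\<bar> \<le> t powr (- a) * (C2 * t powr a)"
      by (rule mult_left_mono[OF C2[OF t True]]) simp
    also have "\<dots> = C2" using t by (simp add: powr_minus)
    finally have 1: "t powr (- a) * \<bar>H (Suc k) t\<bar> \<le> C * 1" using C by simp
    have "1 \<le> t powr (- (a + 1))" using t True a powr_mono2'[of "- (a + 1)" t 1] by simp
    then show ?thesis using 1 by (simp add: abs_mult min_def)
  next
    case False
    have "t powr (- a) * \<bar>H (Suc k) t\<bar> \<le> t powr (- a) * (C1 / t)"
      by (rule mult_left_mono[OF C1[OF t]]) simp
    also have "\<dots> = C1 * t powr (- (a + 1))" using t by (simp add: powr_diff)
    also have "\<dots> \<le> C * t powr (- (a + 1))" using C by (intro mult_right_mono) auto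
    finally have 1: "t powr (- a) * \<bar>H (Suc k) t\<bar> \<le> C * t powr (- (a + 1))" .
    have "t powr (- (a + 1)) \<le> 1" using False a powr_mono2'[of "- (a + 1)" 1 t] by simp
    then show ?thesis using 1 by (simp add: abs_mult min_def)
  qed
  then show ?thesis using C(1) by blast
qed

text \<open>A Mellin transform of \<open>H k\<close> in time.\<close>

definition J :: "real \<Rightarrow> nat \<Rightarrow> real" where
  "J a k = (\<integral>t. indicator {0<..} t * (t powr (- a) * H k t) \<partial>lborel)"

lemma J_integrable:
  assumes a: "a > 0"
  shows "integrable lborel (\<lambda>t. indicator {0<..} t * (t powr (- a) * H (Suc k) t))"
proof -
  obtain C where C: "C \<ge> 0" "\<And>t. t > 0 \<Longrightarrow> \<bar>t powr (- a) * H (Suc k) t\<bar> \<le> C * min 1 (t powr (- (a + 1)))"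
    using H_bound[OF less_imp_le[OF a]] by blast
  show ?thesis
  proof (rule Bochner_Integration.integrable_bound)
    show "integrable lborel (\<lambda>t. C * (indicator {0<..} t * min 1 (t powr (- (a + 1)))))"
      using integrable_powr_tail[of "a + 1"] a by simp
    have "continuous_on {0<..} (\<lambda>t. t powr (- a) * H (Suc k) t)"
      by (intro continuous_intros H_continuous) auto
    from borel_measurable_continuous_on_indicator[OF _ this]
    show "(\<lambda>t. indicator {0<..} t * (t powr (- a) * H (Suc k) t)) \<in> borel_measurable lborel" by simp
    show "AE t in lborel. norm (indicator {0<..} t * (t powr (- a) * H (Suc k) t)) \<le> norm (C * (indicator {0<..} t * min 1 (t powr (- (a + 1)))))"
      using C by (intro AE_I2) (auto simp: indicator_def)
  qed
qed

text \<open>The derivative of \<open>t powr (- a) * H (Suc k) t\<close> has integral 0, since the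
  function tends to 0 at both ends. This reads
  \<open>- a * J (a + 1) (Suc k) - J a (Suc (Suc k)) = 0\<close>.\<close>

lemma J_parts:
  assumes a: "a > 0" and zero: "J a (Suc (Suc k)) = 0"
  shows "J (a + 1) (Suc k) = 0"
proof -
  let ?F = "\<lambda>t. t powr (- a) * H (Suc k) t"
  let ?f = "\<lambda>t. - a * (t powr (- (a + 1)) * H (Suc k) t) - t powr (- a) * H (Suc (Suc k)) t"
  have der: "(?F has_vector_derivative ?f t) (at t)" if t: "0 < t" for t
  proof -
    have e: "- a - 1 = - (a + 1)" by simp
    have "(?F has_real_derivative (- a * t powr (- a - 1)) * H (Suc k) t + (- H (Suc (Suc k)) t) * t powr (- a)) (at t)"
      by (rule DERIV_mult[OF has_real_derivative_powr[OF t] H_deriv[OF t]])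
    also have "(- a * t powr (- a - 1)) * H (Suc k) t + (- H (Suc (Suc k)) t) * t powr (- a) = ?f t"
      unfolding e by simp
    finally have "(?F has_real_derivative ?f t) (at t)" .
    then show ?thesis by (simp add: has_real_derivative_iff_has_vector_derivative)
  qed
  have cont: "isCont ?f t" if t: "0 < t" for t
    using t by (intro continuous_intros DERIV_isCont[OF H_deriv]) auto
  have 1: "integrable lborel (\<lambda>t. indicator {0<..} t * (t powr (- (a + 1)) * H (Suc k) t))"
    using J_integrable[of "a + 1" k] a by simp
  note 2 = J_integrable[OF a, of "Suc k"]
  have split: "indicator {0<..} t *\<^sub>R ?f t = - a * (indicator {0<..} t * (t powr (- (a + 1)) * H (Suc k) t))
      - indicator {0<..} t * (t powr (- a) * H (Suc (Suc k)) t)" for t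
    by (simp add: indicator_def)
  have int: "set_integrable lborel (einterval (ereal 0) \<infinity>) ?f"
    unfolding set_integrable_def einterval_eq_Ici split by (intro Bochner_Integration.integrable_diff integrable_mult_right 1 2)
  obtain C where C: "\<And>t. 0 < t \<Longrightarrow> t \<le> 1 \<Longrightarrow> \<bar>H (Suc k) t\<bar> \<le> C * t powr (a + 1)"
    using H_bound_small[of "a + 1"] a by force
  have lim0: "(?F \<longlongrightarrow> 0) (at_right 0)"
  proof (rule Lim_null_comparison)
    have "norm (?F t) \<le> C * t" if t: "0 < t" "t < 1" for t
    proof -
      have "t powr (- a) * \<bar>H (Suc k) t\<bar> \<le> t powr (- a) * (C * t powr (a + 1))"
        using C[of t] t by (intro mult_left_mono) auto
      also have "\<dots> = C * (t powr (- a) * t powr (a + 1))" by simp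
      also have "t powr (- a) * t powr (a + 1) = t" using t by (simp flip: powr_add)
      finally show ?thesis by (simp add: abs_mult)
    qed
    then show "\<forall>\<^sub>F t in at_right 0. norm (?F t) \<le> C * t"
      by (subst eventually_at_right[of 0 1]) (auto intro: exI[of _ 1])
    show "((\<lambda>t. C * t) \<longlongrightarrow> 0) (at_right 0)" by (auto intro!: tendsto_eq_intros)
  qed
  obtain D where D: "\<And>t. t > 0 \<Longrightarrow> \<bar>?F t\<bar> \<le> D * min 1 (t powr (- (a + 1)))"
    using H_bound[OF less_imp_le[OF a]] by blast
  have lim1: "(?F \<longlongrightarrow> 0) at_top"
  proof (rule Lim_null_comparison)
    show "\<forall>\<^sub>F t in at_top. norm (?F t) \<le> \<bar>D\<bar> * t powr (- (a + 1))"
      using eventually_gt_at_top[of 0]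
    proof eventually_elim
      case (elim t)
      have "D * min 1 (t powr (- (a + 1))) \<le> \<bar>D\<bar> * t powr (- (a + 1))" by (intro mult_mono) auto
      then show ?case using D[OF elim] by simp
    qed
    have "((\<lambda>t. t powr (- (a + 1))) \<longlongrightarrow> 0) at_top"
      using a by (intro tendsto_neg_powr filterlim_ident) auto
    then show "((\<lambda>t. \<bar>D\<bar> * t powr (- (a + 1))) \<longlongrightarrow> 0) at_top" by (rule tendsto_mult_right_zero)
  qed
  have "(LBINT t=ereal 0..\<infinity>. ?f t) = 0 - 0"
    using int by (intro interval_integral_FTC_integrable[where F="?F"])
      (use der cont lim0 lim1 in \<open>auto simp: ereal_tendsto_simps\<close>)
  then have "(\<integral>t. indicator {0<..} t *\<^sub>R ?f t \<partial>lborel) = 0"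
    by (simp add: interval_lebesgue_integral_def set_lebesgue_integral_def einterval_eq_Ici)
  then have "- a * J (a + 1) (Suc k) - J a (Suc (Suc k)) = 0"
    unfolding split J_def
    by (subst (asm) Bochner_Integration.integral_diff) (use 1 2 in auto)
  then show ?thesis using zero a by simp
qed

text \<open>By Fubini, integrating \<open>t powr (- \<sigma>) * exp (- (t * l))\<close> over time
  first gives \<open>Gamma (1 - \<sigma>) * l powr (\<sigma> - 1)\<close>, which requires
  \<open>\<sigma> < 1\<close>. So \<open>J \<sigma> (Suc k)\<close> is a multiple of the integral
  assumed to vanish.\<close>

lemma J_subordination:
  assumes \<sigma>: "0 < \<sigma>" "\<sigma> < 1"
    and zero: "(\<integral>p. lam p powr (real (Suc k) + \<sigma> - 1) * v p \<partial>P) = 0"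
  shows "J \<sigma> (Suc k) = 0"
proof -
  interpret P: sigma_finite_measure P by (rule sfP)
  interpret PL: pair_sigma_finite P lborel ..
  let ?g = "\<lambda>p t. indicator {0<..} t * (t powr (- \<sigma>) * (lam p ^ Suc k * exp (- (t * lam p)) * v p))"
  let ?G = "\<lambda>t l. indicator {0<..} t * t powr ((1 - \<sigma>) - 1) * exp (- (t * l))"
  have g: "?g p t = lam p ^ Suc k * v p * ?G t (lam p)" for p t by simp
  have G: "integrable lborel (\<lambda>t. ?G t l)" "(\<integral>t. ?G t l \<partial>lborel) = Gamma (1 - \<sigma>) * l powr (- (1 - \<sigma>))" if "l > 0" for l
    using gamma_integral[of "1 - \<sigma>" l] \<sigma> that by simp_all
  have pw: "lam p ^ Suc k * lam p powr (- (1 - \<sigma>)) = lam p powr (real (Suc k) + \<sigma> - 1)" for p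
  proof (cases "lam p = 0")
    case False
    then have "lam p > 0" using lam_nn[of p] by simp
    then show ?thesis
      by (simp only: powr_realpow[symmetric] powr_add[symmetric]) (simp add: algebra_simps)
  qed simp
  have inner: "integrable lborel (?g p)" "(\<integral>t. ?g p t \<partial>lborel) = Gamma (1 - \<sigma>) * (lam p powr (real (Suc k) + \<sigma> - 1) * v p)"
    "(\<integral>t. norm (?g p t) \<partial>lborel) = Gamma (1 - \<sigma>) * (lam p powr (real (Suc k) + \<sigma> - 1) * \<bar>v p\<bar>)" for p
  proof -
    have "integrable lborel (?g p) \<and> (\<integral>t. ?g p t \<partial>lborel) = Gamma (1 - \<sigma>) * (lam p powr (real (Suc k) + \<sigma> - 1) * v p) \<and>
      (\<integral>t. norm (?g p t) \<partial>lborel) = Gamma (1 - \<sigma>) * (lam p powr (real (Suc k) + \<sigma> - 1) * \<bar>v p\<bar>)"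
    \<comment> \<open>The Gamma integral is available only for positive \<open>lam p\<close>; at 0
      the positive power of \<open>lam p\<close> makes all terms vanish.\<close>
    proof (cases "lam p = 0")
      case False
      then have l: "lam p > 0" using lam_nn[of p] by simp
      have 1: "integrable lborel (?g p)" unfolding g by (rule integrable_mult_right[OF G(1)[OF l]])
      have 2: "(\<integral>t. c * ?G t (lam p) \<partial>lborel) = c * (Gamma (1 - \<sigma>) * lam p powr (- (1 - \<sigma>)))" for c
        unfolding G(2)[OF l, symmetric] by (rule integral_mult_right_zero)
      have 3: "norm (?g p t) = lam p ^ Suc k * \<bar>v p\<bar> * ?G t (lam p)" for t
        using l by (simp add: abs_mult indicator_def)
      show ?thesis using 1 unfolding 3 unfolding g 2 pw[symmetric] by (simp add: mult_ac)
    qed simp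
    then show "integrable lborel (?g p)" "(\<integral>t. ?g p t \<partial>lborel) = Gamma (1 - \<sigma>) * (lam p powr (real (Suc k) + \<sigma> - 1) * v p)"
      "(\<integral>t. norm (?g p t) \<partial>lborel) = Gamma (1 - \<sigma>) * (lam p powr (real (Suc k) + \<sigma> - 1) * \<bar>v p\<bar>)" by auto
  qed
  have "integrable P (\<lambda>p. lam p powr (real (Suc k) + \<sigma> - 1) * \<bar>v p\<bar>)"
  proof (rule Bochner_Integration.integrable_bound)
    show "integrable P (\<lambda>p. \<bar>lam p ^ k * v p\<bar> + \<bar>lam p ^ Suc k * v p\<bar>)"
      by (intro Bochner_Integration.integrable_add integrable_abs v)
    show "AE p in P. norm (lam p powr (real (Suc k) + \<sigma> - 1) * \<bar>v p\<bar>) \<le> norm (\<bar>lam p ^ k * v p\<bar> + \<bar>lam p ^ Suc k * v p\<bar>)"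
    proof (rule AE_I2)
      fix p
      \<comment> \<open>The exponent \<open>k + \<sigma>\<close> lies between \<open>k\<close> and
        \<open>Suc k\<close>, so one of the two integer powers dominates, depending on whether
        \<open>lam p \<le> 1\<close>.\<close>
      have "lam p powr (real (Suc k) + \<sigma> - 1) \<le> lam p ^ k + lam p ^ Suc k"
      proof (cases "lam p = 0")
        case False
        then have l: "lam p > 0" using lam_nn[of p] by simp
        show ?thesis
        proof (cases "lam p \<le> 1")
          case True
          then have "lam p powr (real (Suc k) + \<sigma> - 1) \<le> lam p powr real k" using l \<sigma> by (intro powr_mono') auto
          then show ?thesis using l by (simp add: powr_realpow add_increasing2)
        next
          case False
          then have "lam p powr (real (Suc k) + \<sigma> - 1) \<le> lam p powr real (Suc k)" using \<sigma> by (intro powr_mono) auto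
          then show ?thesis using l powr_realpow[OF l, of "Suc k"] by (simp add: add_increasing)
        qed
      qed simp
      then have "lam p powr (real (Suc k) + \<sigma> - 1) * \<bar>v p\<bar> \<le> (lam p ^ k + lam p ^ Suc k) * \<bar>v p\<bar>"
        by (rule mult_right_mono) simp
      then show "norm (lam p powr (real (Suc k) + \<sigma> - 1) * \<bar>v p\<bar>) \<le> norm (\<bar>lam p ^ k * v p\<bar> + \<bar>lam p ^ Suc k * v p\<bar>)"
        using lam_nn[of p] by (simp add: abs_mult distrib_right)
    qed
  qed measurable
  then have "integrable P (\<lambda>p. \<integral>t. norm (?g p t) \<partial>lborel)" unfolding inner(3) by simp
  then have "integrable (P \<Otimes>\<^sub>M lborel) (case_prod ?g)"
    using inner(1) by (intro PL.Fubini_integrable) (auto simp: case_prod_beta')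
  from PL.Fubini_integral[OF this]
  have "(\<integral>t. (\<integral>p. ?g p t \<partial>P) \<partial>lborel) = Gamma (1 - \<sigma>) * (\<integral>p. lam p powr (real (Suc k) + \<sigma> - 1) * v p \<partial>P)"
    unfolding inner(2) by simp
  also have "\<dots> = 0" by (simp only: zero mult_zero_right)
  finally show ?thesis unfolding J_def H_def by simp
qed

text \<open>Inserting the spatial formula \<open>rep\<close> and integrating over time first turns
  the weight of order \<open>a\<close> into a power of \<open>\<rho>\<close>. The condition
  \<open>a + b - 1 \<ge> q\<close> makes that power bounded on \<open>\<rho> \<ge> d\<close>, as
  Fubini requires.\<close>

lemma J_moment:
  assumes \<beta>: "a + b - 1 \<ge> q" "a + b - 1 > 0" and zero: "J a k = 0"
  shows "(\<integral>p. \<omega> k p * \<rho> p powr (q - (a + b - 1)) \<partial>N) = 0"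
proof -
  interpret N: sigma_finite_measure N by (rule sfN)
  interpret NL: pair_sigma_finite N lborel ..
  define \<beta> where "\<beta> = a + b - 1"
  obtain K where K: "K > 0"
    and Kint: "\<And>r. r > 0 \<Longrightarrow> (\<integral>\<^sup>+t. ennreal (indicator {0<..} t * t powr (- \<beta> - 1) * exp (- (r / (4 * t)))) \<partial>lborel) = ennreal (K * r powr (- \<beta>))"
    by (rule nn_integral_inverse_gamma[OF \<beta>(2), folded \<beta>_def]) blast
  let ?G = "\<lambda>t r. indicator {0<..} t * t powr (- \<beta> - 1) * exp (- (r / (4 * t)))"
  have G: "integrable lborel (\<lambda>t. ?G t r)" "(\<integral>t. ?G t r \<partial>lborel) = K * r powr (- \<beta>)" if r: "r > 0" for r
  proof -
    have "has_bochner_integral lborel (\<lambda>t. ?G t r) (K * r powr (- \<beta>))"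
      by (rule has_bochner_integral_nn_integral[OF _ _ _ Kint[OF r]]) (use K in auto)
    then show "integrable lborel (\<lambda>t. ?G t r)" "(\<integral>t. ?G t r \<partial>lborel) = K * r powr (- \<beta>)"
      by (auto simp: has_bochner_integral_iff)
  qed
  let ?g = "\<lambda>p t. (\<omega> k p * \<rho> p powr q) * ?G t (\<rho> p)"
  have pw: "\<rho> p powr q * \<rho> p powr (- \<beta>) = \<rho> p powr (q - \<beta>)" for p
    using \<rho>_pos[of p] by (simp flip: powr_add)
  have i1: "integrable lborel (?g p)" for p by (rule integrable_mult_right[OF G(1)[OF \<rho>_pos]])
  have i2: "(\<integral>t. ?g p t \<partial>lborel) = K * (\<omega> k p * \<rho> p powr (q - \<beta>))" for p
  proof -
    have "(\<integral>t. ?g p t \<partial>lborel) = (\<omega> k p * \<rho> p powr q) * (K * \<rho> p powr (- \<beta>))"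
      unfolding G(2)[OF \<rho>_pos, symmetric] by (rule integral_mult_right_zero)
    then show ?thesis by (simp add: pw[symmetric] mult_ac)
  qed
  have i3: "(\<integral>t. norm (?g p t) \<partial>lborel) = K * (\<bar>\<omega> k p\<bar> * \<rho> p powr (q - \<beta>))" for p
  proof -
    have "norm (?g p t) = (\<bar>\<omega> k p\<bar> * \<rho> p powr q) * ?G t (\<rho> p)" for t by (simp add: abs_mult)
    then have "(\<integral>t. norm (?g p t) \<partial>lborel) = (\<integral>t. (\<bar>\<omega> k p\<bar> * \<rho> p powr q) * ?G t (\<rho> p) \<partial>lborel)" by (simp only:)
    also have "\<dots> = (\<bar>\<omega> k p\<bar> * \<rho> p powr q) * (K * \<rho> p powr (- \<beta>))"
      unfolding G(2)[OF \<rho>_pos, symmetric] by (rule integral_mult_right_zero)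
    finally show ?thesis by (simp add: pw[symmetric] mult_ac)
  qed
  have "integrable N (\<lambda>p. \<bar>\<omega> k p\<bar> * \<rho> p powr (q - \<beta>))"
  proof (rule Bochner_Integration.integrable_bound)
    show "integrable N (\<lambda>p. d powr (q - \<beta>) * \<bar>\<omega> k p\<bar>)" by (intro integrable_mult_right integrable_abs \<omega>)
    have "\<rho> p powr (q - \<beta>) \<le> d powr (q - \<beta>)" for p using d \<beta> by (intro powr_mono2') (auto simp: \<beta>_def)
    then show "AE p in N. norm (\<bar>\<omega> k p\<bar> * \<rho> p powr (q - \<beta>)) \<le> norm (d powr (q - \<beta>) * \<bar>\<omega> k p\<bar>)"
      by (intro AE_I2) (simp add: abs_mult mult.commute[of "d powr _"] mult_left_mono)
  qed measurable
  then have "integrable N (\<lambda>p. \<integral>t. norm (?g p t) \<partial>lborel)" unfolding i3 by simp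
  then have "integrable (N \<Otimes>\<^sub>M lborel) (case_prod ?g)"
    using i1 by (intro NL.Fubini_integrable) (auto simp: case_prod_beta')
  from NL.Fubini_integral[OF this]
  have eq: "(\<integral>t. (\<integral>p. ?g p t \<partial>N) \<partial>lborel) = K * (\<integral>p. \<omega> k p * \<rho> p powr (q - \<beta>) \<partial>N)"
    unfolding i2 by simp
  have "indicator {0<..} t * (t powr (- a) * H k t) = C0 * (\<integral>p. ?g p t \<partial>N)" for t
  proof (cases "t > 0")
    case True
    have "t powr (- a) * t powr (- b) = t powr (- \<beta> - 1)" using True by (simp add: \<beta>_def flip: powr_add)
    moreover have "(\<integral>p. ?g p t \<partial>N) = (\<integral>p. t powr (- \<beta> - 1) * (\<omega> k p * \<rho> p powr q * exp (- (\<rho> p / (4 * t)))) \<partial>N)"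
      using True by (simp add: mult_ac)
    then have "(\<integral>p. ?g p t \<partial>N) = t powr (- \<beta> - 1) * (\<integral>p. \<omega> k p * \<rho> p powr q * exp (- (\<rho> p / (4 * t))) \<partial>N)"
      by (simp only: integral_mult_right_zero)
    ultimately show ?thesis using True by (simp add: rep mult_ac)
  qed simp
  then have "J a k = C0 * (\<integral>t. (\<integral>p. ?g p t \<partial>N) \<partial>lborel)" unfolding J_def by (simp only: integral_mult_right_zero)
  then show ?thesis using zero C0 K unfolding eq \<beta>_def[symmetric] by simp
qed

theorem heat_pairing_zero:
  assumes \<sigma>: "0 < \<sigma>" "\<sigma> < 1"
    and zero: "\<And>k. k \<ge> k0 \<Longrightarrow> (\<integral>p. lam p powr (real (Suc k) + \<sigma> - 1) * v p \<partial>P) = 0"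
  shows "H (Suc k0) 1 = 0"
proof -
  \<comment> \<open>The induction on \<open>i\<close> is for all \<open>k \<ge> k0\<close> at once,
    since each integration by parts uses the statement at \<open>k + 1\<close>.\<close>
  have J0: "J (\<sigma> + real i) (Suc k) = 0" if "k \<ge> k0" for i k
    using that
  proof (induction i arbitrary: k)
    case 0
    then show ?case using J_subordination[OF \<sigma> zero[OF 0]] by simp
  next
    case (Suc i)
    have "J (\<sigma> + real i + 1) (Suc k) = 0"
      by (rule J_parts) (use \<sigma> Suc in auto)
    then show ?case by (simp add: add_ac)
  qed
  \<comment> \<open>Finitely many initial orders are skipped, so that the exponents satisfy the
    conditions of \<open>J_moment\<close> and \<open>e\<close> is positive.\<close>
  obtain i0 :: nat where i0: "q + 2 \<le> real i0" using real_arch_simple by blast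
  define e where "e = \<sigma> + real i0 + b - 1 - q"
  have e: "e > 0" using i0 \<sigma> b q by (simp add: e_def)
  have mom: "(\<integral>p. \<omega> (Suc k0) p * \<rho> p powr (- e - real j) \<partial>N) = 0" for j :: nat
  proof -
    have "(\<integral>p. \<omega> (Suc k0) p * \<rho> p powr (q - (\<sigma> + real (i0 + j) + b - 1)) \<partial>N) = 0"
      by (rule J_moment[OF _ _ J0[OF order_refl]]) (use i0 \<sigma> b q in auto)
    also have "q - (\<sigma> + real (i0 + j) + b - 1) = - e - real j" by (simp add: e_def)
    finally show ?thesis .
  qed
  \<comment> \<open>Chosen so that \<open>\<rho> p powr (- e) * F (1 / \<rho> p)\<close> is the
    spatial heat weight at time 1. Zero is its continuous extension to the origin.\<close>
  define F where "F x = (if x > 0 then x powr (- e - q) * exp (- (1 / (4 * x))) else 0)" for x :: real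
  have Fm: "F \<in> borel_measurable borel" unfolding F_def by measurable
  have Fc: "continuous_on {0..1/d} F"
  proof (rule continuous_on_eq_continuous_within[THEN iffD2], rule ballI)
    fix x assume x: "x \<in> {0..1/d}"
    show "continuous (at x within {0..1/d}) F"
    proof (cases "x = 0")
      case False
      then have x0: "x > 0" using x by simp
      have "isCont (\<lambda>x. x powr (- e - q) * exp (- (1 / (4 * x)))) x"
        using x0 by (intro continuous_intros) auto
      moreover have ev: "\<forall>\<^sub>F y in nhds x. F y = y powr (- e - q) * exp (- (1 / (4 * y)))"
        using eventually_nhds_in_open[of "{0<..}" x] x0 by (auto simp: F_def elim!: eventually_mono)
      ultimately have "isCont F x" by (simp only: isCont_cong[OF ev])
      then show ?thesis by (rule continuous_at_imp_continuous_at_within)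
    next
      case True
      \<comment> \<open>The exponent exceeds \<open>e + q\<close> by 1, which leaves a factor
        \<open>y\<close> that tends to 0.\<close>
      define Q where "Q = e + q + 1"
      have Q: "Q > 0" using e q by (simp add: Q_def)
      have bound: "norm (F y) \<le> (4 * Q) powr Q * y" if y: "y \<in> {0..1/d}" for y
      proof (cases "y = 0")
        case False
        then have y0: "y > 0" using y by simp
        have "exp (- (1 / (4 * y))) \<le> (Q / (1 / (4 * y))) powr Q" using y0 Q by (intro exp_le_powr) auto
        also have "Q / (1 / (4 * y)) = 4 * Q * y" by simp
        also have "(4 * Q * y) powr Q = (4 * Q) powr Q * y powr Q" by (rule powr_mult)
        finally have "y powr (- e - q) * exp (- (1 / (4 * y))) \<le> y powr (- e - q) * ((4 * Q) powr Q * y powr Q)"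
          by (rule mult_left_mono) simp
        also have "\<dots> = (4 * Q) powr Q * (y powr (- e - q) * y powr Q)" by simp
        also have "y powr (- e - q) * y powr Q = y" using y0 by (simp add: Q_def flip: powr_add)
        finally show ?thesis using y0 by (simp add: F_def)
      qed (simp add: F_def)
      have "((\<lambda>y. (4 * Q) powr Q * y) \<longlongrightarrow> 0) (at 0 within {0..1/d})" by (auto intro!: tendsto_eq_intros)
      then have "(F \<longlongrightarrow> 0) (at 0 within {0..1/d})"
        by (rule Lim_null_comparison[rotated]) (use bound in \<open>auto simp: eventually_at_filter\<close>)
      then show ?thesis using True by (simp add: continuous_within F_def)
    qed
  qed
  have "(\<integral>p. \<omega> (Suc k0) p * \<rho> p powr (- e) * F (1 / \<rho> p) \<partial>N) = 0"
    by (rule moments_vanish[OF \<omega> \<rho> d less_imp_le[OF e] mom Fc Fm])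
  moreover have "\<omega> (Suc k0) p * \<rho> p powr (- e) * F (1 / \<rho> p) = \<omega> (Suc k0) p * \<rho> p powr q * exp (- (\<rho> p / (4 * 1)))" for p
  proof -
    have "(1 / \<rho> p) powr (- e - q) = \<rho> p powr (e + q)"
      using \<rho>_pos[of p] by (simp add: powr_divide powr_minus_divide powr_add powr_diff)
    moreover have "\<rho> p powr (- e) * \<rho> p powr (e + q) = \<rho> p powr q" using \<rho>_pos[of p] by (simp flip: powr_add)
    ultimately show ?thesis using \<rho>_pos[of p] by (simp add: F_def mult.assoc[symmetric])
  qed
  ultimately show ?thesis by (simp add: rep)
qed

end

section \<open>The heat pairing in frequency and in space\<close>

lemma japanese_integrable:
  "integrable lebesgue (\<lambda>y::'a::euclidean_space. 1 / (1 + (norm y)\<^sup>2) ^ DIM('a))"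
proof -
  have "integrable lborel (\<lambda>x::real. 1 / (1 + x\<^sup>2))"
    using integrable_inverse_1_plus_square by (simp add: set_integrable_def einterval_def divide_inverse)
  from lborel_prod(1)[of "\<lambda>_::'a. \<lambda>x::real. 1 / (1 + x\<^sup>2)", OF this]
  have *: "integrable lborel (\<lambda>x::'a. \<Prod>b\<in>Basis. 1 / (1 + (x \<bullet> b)\<^sup>2))" .
  have "integrable lborel (\<lambda>y::'a. 1 / (1 + (norm y)\<^sup>2) ^ DIM('a))"
  proof (rule Bochner_Integration.integrable_bound[OF *])
    show "AE y::'a in lborel. norm (1 / (1 + (norm y)\<^sup>2) ^ DIM('a)) \<le> norm (\<Prod>b\<in>Basis. 1 / (1 + (y \<bullet> b)\<^sup>2))"
    proof (rule AE_I2)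
      fix y :: 'a
      \<comment> \<open>Each coordinate weight is at most 1 + |y|^2, so the function is dominated by
        a product of integrable functions of one variable.\<close>
      have "(\<Prod>b\<in>Basis. 1 + (y \<bullet> b)\<^sup>2) \<le> (\<Prod>b\<in>(Basis::'a set). 1 + (norm y)\<^sup>2)"
        by (intro prod_mono conjI add_left_mono) (auto simp: abs_le_square_iff[symmetric] Basis_le_norm)
      moreover have "(\<Prod>b\<in>Basis. 1 + (y \<bullet> b)\<^sup>2) > 0" by (intro prod_pos) (auto intro: add_pos_nonneg)
      ultimately have "1 / (1 + (norm y)\<^sup>2) ^ DIM('a) \<le> 1 / (\<Prod>b\<in>Basis. 1 + (y \<bullet> b)\<^sup>2)"
        by (intro divide_left_mono) (auto intro!: mult_pos_pos zero_less_power add_pos_nonneg)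
      then show "norm (1 / (1 + (norm y)\<^sup>2) ^ DIM('a)) \<le> norm (\<Prod>b\<in>Basis. 1 / (1 + (y \<bullet> b)\<^sup>2))"
        by (simp add: prod_dividef abs_prod)
    qed
  qed measurable
  then show ?thesis by (subst integral_lebesgue_lborel(2)) auto
qed

lemma japanese_L2: "L2 (\<lambda>y::'a::euclidean_space. 1 / (1 + (norm y)\<^sup>2) ^ DIM('a))"
  unfolding L2_def
proof
  show m: "(\<lambda>y::'a. 1 / (1 + (norm y)\<^sup>2) ^ DIM('a)) \<in> borel_measurable lebesgue"
    using borel_measurable_integrable[OF japanese_integrable] .
  show "integrable lebesgue (\<lambda>y::'a. (norm (1 / (1 + (norm y)\<^sup>2) ^ DIM('a)))\<^sup>2)"
  proof (rule Bochner_Integration.integrable_bound[OF japanese_integrable])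
    have "(norm (1 / (1 + (norm y)\<^sup>2) ^ DIM('a)))\<^sup>2 \<le> 1 / (1 + (norm y)\<^sup>2) ^ DIM('a)" for y :: 'a
    proof -
      have "1 \<le> (1 + (norm y)\<^sup>2) ^ DIM('a)" by (intro one_le_power) simp
      moreover from this have "0 < (1 + (norm y)\<^sup>2) ^ DIM('a)" by linarith
      ultimately have "0 \<le> 1 / (1 + (norm y)\<^sup>2) ^ DIM('a)" "1 / (1 + (norm y)\<^sup>2) ^ DIM('a) \<le> 1"
        by (simp_all add: divide_le_eq_1 del: one_le_power)
      then show ?thesis by (simp only: power2_eq_square real_norm_def abs_of_nonneg) (rule mult_left_le)
    qed
    then show "AE y::'a in lebesgue. norm ((norm (1 / (1 + (norm y)\<^sup>2) ^ DIM('a)))\<^sup>2) \<le> norm (1 / (1 + (norm y)\<^sup>2) ^ DIM('a))"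
      by (intro AE_I2) (auto intro: order_trans)
  qed (use m in measurable)
qed

text \<open>\<open>u\<close> is only square integrable, so decay in \<open>y\<close> must come from
  the kernel. The inequality 1 + |y|^2 \<le> 2 (1 + |x|^2) (1 + |x - y|^2) converts decay in
  \<open>x - y\<close> into decay in \<open>y\<close>, at the price of polynomial growth in
  \<open>x\<close> that the compact support of \<open>\<psi>\<close> absorbs.\<close>

lemma pair_kernel_integrable:
  fixes \<psi> u :: "'a::euclidean_space \<Rightarrow> real" and g :: "'a \<times> 'a \<Rightarrow> real"
  assumes \<psi>: "Cc \<psi>" and u: "L2 u" and gm: "g \<in> borel_measurable (lebesgue \<Otimes>\<^sub>M lebesgue)"
    and C: "C \<ge> 0" and g: "\<And>x y. \<bar>g (x, y)\<bar> \<le> C / (1 + (norm (x - y))\<^sup>2) ^ DIM('a)"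
  shows "integrable (lebesgue \<Otimes>\<^sub>M lebesgue) (\<lambda>p. \<psi> (fst p) * u (snd p) * g p)"
proof (rule integrable_lebesgue_pair_bound)
  let ?n = "DIM('a)"
  show "integrable lebesgue (\<lambda>x. C * 2 ^ ?n * (\<psi> x * (1 + (norm x)\<^sup>2) ^ ?n))"
    by (intro integrable_mult_right Cc_integrable Cc_mult \<psi> continuous_intros)
  have "integrable lebesgue (\<lambda>y. norm (u y) * norm (1 / (1 + (norm y)\<^sup>2) ^ ?n))"
    by (rule L2_dot_integrable(1)[OF u japanese_L2])
  then show "integrable lebesgue (\<lambda>y. norm (u y) * norm (1 / (1 + (norm y)\<^sup>2) ^ ?n))" .
  note [measurable] = Cc_measurable[OF \<psi>] L2_measurable[OF u] gm
  show "(\<lambda>p. \<psi> (fst p) * u (snd p) * g p) \<in> borel_measurable (lebesgue \<Otimes>\<^sub>M lebesgue)"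
    by (intro borel_measurable_times gm measurable_compose[OF measurable_fst Cc_measurable[OF \<psi>]]
        measurable_compose[OF measurable_snd L2_measurable[OF u]])
  fix x y :: 'a
  have "(norm y)\<^sup>2 \<le> 2 * (norm x)\<^sup>2 + 2 * (norm (x - y))\<^sup>2"
  proof -
    have "norm y \<le> norm x + norm (x - y)" using norm_triangle_ineq4[of x "x - y"] by simp
    then have "(norm y)\<^sup>2 \<le> (norm x + norm (x - y))\<^sup>2" by (intro power_mono) auto
    also have "\<dots> \<le> 2 * (norm x)\<^sup>2 + 2 * (norm (x - y))\<^sup>2"
      using sum_squares_ge_zero[of "norm x - norm (x - y)" 0] by (simp add: power2_eq_square algebra_simps)
    finally show ?thesis .
  qed
  then have "1 + (norm y)\<^sup>2 \<le> 2 * (1 + (norm x)\<^sup>2) * (1 + (norm (x - y))\<^sup>2)"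
    using mult_nonneg_nonneg[OF zero_le_power2[of "norm x"] zero_le_power2[of "norm (x - y)"]]
    unfolding distrib_left distrib_right mult_1_right by linarith
  then have le: "(1 + (norm y)\<^sup>2) ^ ?n \<le> 2 ^ ?n * (1 + (norm x)\<^sup>2) ^ ?n * (1 + (norm (x - y))\<^sup>2) ^ ?n"
    unfolding power_mult_distrib[symmetric] by (intro power_mono) auto
  have pos: "(1 + (norm z)\<^sup>2) ^ ?n > 0" for z :: 'a by (intro zero_less_power add_pos_nonneg) auto
  have "1 / (1 + (norm (x - y))\<^sup>2) ^ ?n \<le> 2 ^ ?n * (1 + (norm x)\<^sup>2) ^ ?n * (1 / (1 + (norm y)\<^sup>2) ^ ?n)"
    using le pos[of y] pos[of "x - y"] by (simp add: field_simps)
  then have "C * (1 / (1 + (norm (x - y))\<^sup>2) ^ ?n) \<le> C * (2 ^ ?n * (1 + (norm x)\<^sup>2) ^ ?n * (1 / (1 + (norm y)\<^sup>2) ^ ?n))"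
    using C by (rule mult_left_mono)
  then have "\<bar>g (x, y)\<bar> \<le> C * (2 ^ ?n * (1 + (norm x)\<^sup>2) ^ ?n * (1 / (1 + (norm y)\<^sup>2) ^ ?n))"
    using g[of x y] by simp
  then have "\<bar>\<psi> x\<bar> * \<bar>u y\<bar> * \<bar>g (x, y)\<bar> \<le> \<bar>\<psi> x\<bar> * \<bar>u y\<bar> * (C * (2 ^ ?n * (1 + (norm x)\<^sup>2) ^ ?n * (1 / (1 + (norm y)\<^sup>2) ^ ?n)))"
    by (rule mult_left_mono) simp
  moreover have "\<bar>(1 + (norm z)\<^sup>2) ^ ?n\<bar> = (1 + (norm z)\<^sup>2) ^ ?n" for z :: 'a using pos[of z] by (rule abs_of_pos)
  ultimately show "norm (\<psi> (fst (x, y)) * u (snd (x, y)) * g (x, y)) \<le>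
      norm (C * 2 ^ ?n * (\<psi> x * (1 + (norm x)\<^sup>2) ^ ?n)) * norm (norm (u y) * norm (1 / (1 + (norm y)\<^sup>2) ^ ?n))"
    using C by (simp only: fst_conv snd_conv real_norm_def abs_mult abs_divide abs_one abs_abs abs_of_nonneg abs_numeral power_abs)
      (simp add: mult_ac)
qed

lemma gauss_hat_bound:
  assumes t: "t > 0"
  obtains C where "C \<ge> 0" "\<And>z::'a::euclidean_space. \<bar>gauss_hat t z\<bar> \<le> C / (1 + (norm z)\<^sup>2) ^ DIM('a)"
proof -
  let ?n = "DIM('a)"
  \<comment> \<open>\<open>exp_le_powr\<close> is applied to 1 + |z|^2 in place of |z|^2, which
    costs the factor \<open>exp (1 / (4 * t))\<close>.\<close>
  define C where "C = sqrt (pi / t) ^ ?n * (exp (1 / (4 * t)) * (4 * t * ?n) ^ ?n)"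
  have "\<bar>gauss_hat t z\<bar> \<le> C / (1 + (norm z)\<^sup>2) ^ ?n" for z :: 'a
  proof -
    define a where "a = 1 + (norm z)\<^sup>2"
    have a: "a > 0" by (auto simp: a_def intro: add_pos_nonneg)
    have "exp (- (a / (4 * t))) \<le> (real ?n / (a / (4 * t))) powr real ?n"
      using a t by (intro exp_le_powr) auto
    also have "\<dots> = (real ?n / (a / (4 * t))) ^ ?n" using a t by (intro powr_realpow) auto
    also have "\<dots> = (4 * t * ?n) ^ ?n / a ^ ?n" by (simp add: power_divide mult_ac)
    finally have "exp (1 / (4 * t)) * exp (- (a / (4 * t))) \<le> exp (1 / (4 * t)) * ((4 * t * ?n) ^ ?n / a ^ ?n)"
      by (rule mult_left_mono) simp
    moreover have "exp (1 / (4 * t)) * exp (- (a / (4 * t))) = exp (- ((norm z)\<^sup>2 / (4 * t)))"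
      by (simp add: a_def add_divide_distrib flip: exp_add)
    ultimately have "sqrt (pi / t) ^ ?n * exp (- ((norm z)\<^sup>2 / (4 * t))) \<le> sqrt (pi / t) ^ ?n * (exp (1 / (4 * t)) * ((4 * t * ?n) ^ ?n / a ^ ?n))"
      using t by (intro mult_left_mono) auto
    then show ?thesis using t by (simp add: gauss_hat_def C_def a_def abs_mult)
  qed
  moreover have "C \<ge> 0" using t by (simp add: C_def)
  ultimately show ?thesis using that by blast
qed

lemma gauss_L2: 
  assumes t: "t > 0" shows "L2 (gauss t :: 'a::euclidean_space \<Rightarrow> real)"
proof -
  have "(\<lambda>x::'a. (norm (gauss t x))\<^sup>2) = gauss (2 * t)"
    by (simp add: fun_eq_iff gauss_def flip: exp_double)
  then show ?thesis
    using gauss_integrable[of "2 * t", where 'a='a] borel_measurable_integrable[OF gauss_integrable[OF t, where 'a='a]] t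
    by (simp add: L2_def)
qed

text \<open>The adjoint formula moves the transform off \<open>u\<close>, onto a Gaussian times a
  bounded function. That product is integrable, so its transform is an honest integral given by
  \<open>fourier_gauss_inverse\<close>.\<close>

lemma gauss_pairing:
  fixes u \<psi> :: "'a::euclidean_space \<Rightarrow> real"
  assumes u: "L2 u" and \<psi>: "\<psi> \<in> Cc_inf W" and t: "t > 0"
  shows "(\<integral>\<xi>. gauss t \<xi> * (fourier_real u \<xi> \<bullet> fourier_real \<psi> \<xi>) \<partial>lebesgue) =
    (\<integral>p. \<psi> (fst p) * u (snd p) * gauss_hat t (fst p - snd p) \<partial>(lebesgue \<Otimes>\<^sub>M lebesgue))"
proof -
  note \<psi>i = integrable_of_real_Cc_inf[OF \<psi>]
  let ?F = "fourier_integral (\<lambda>x. complex_of_real (\<psi> x))"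
  define C where "C = (\<integral>x. norm (complex_of_real (\<psi> x)) \<partial>lebesgue)"
  define g where "g \<xi> = complex_of_real (gauss t \<xi>) * ?F \<xi>" for \<xi>
  have gm: "g \<in> borel_measurable lebesgue"
    unfolding g_def by (intro borel_measurable_times fourier_integral_measurable_lebesgue \<psi>i
        continuous_measurable_lebesgue continuous_intros)
  have gle: "norm (g \<xi>) \<le> C * norm (gauss t \<xi>)" for \<xi>
    using mult_right_mono[OF fourier_integral_bound[OF \<psi>i, of \<xi>] norm_ge_zero[of "gauss t \<xi>"]]
    by (simp add: C_def g_def norm_mult mult.commute)
  have g2: "L2 g" by (rule L2_dominated[OF gm gauss_L2[OF t] AE_I2[OF gle]])
  have g1: "integrable lebesgue g"
  proof (rule Bochner_Integration.integrable_bound[OF integrable_mult_right[OF gauss_integrable[OF t, where 'a='a], of C] gm])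
    show "AE \<xi> in lebesgue. norm (g \<xi>) \<le> norm (C * gauss t \<xi>)"
    proof (rule AE_I2)
      fix \<xi> show "norm (g \<xi>) \<le> norm (C * gauss t \<xi>)"
        using order_trans[OF gle[of \<xi>] abs_ge_self] by (simp add: gauss_def)
    qed
  qed
  have gh: "fourier_integral g (- y) = of_real (\<integral>x. \<psi> x * gauss_hat t (x - y) \<partial>lebesgue)" for y
  proof -
    have "fourier_integral g (- y) = (\<integral>\<xi>. cis (\<xi> \<bullet> y) * (of_real (gauss t \<xi>) * ?F \<xi>) \<partial>lebesgue)"
      by (simp add: fourier_integral_def[of g] g_def)
    also have "\<dots> = (\<integral>x. of_real (\<psi> x) * of_real (gauss_hat t (x - y)) \<partial>lebesgue)"
      by (rule fourier_gauss_inverse[OF \<psi>i t])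
    also have "\<dots> = of_real (\<integral>x. \<psi> x * gauss_hat t (x - y) \<partial>lebesgue)"
      unfolding of_real_mult[symmetric] by (rule integral_complex_of_real)
    finally show ?thesis .
  qed
  have "(\<integral>\<xi>. gauss t \<xi> * (fourier_real u \<xi> \<bullet> fourier_real \<psi> \<xi>) \<partial>lebesgue) = L2_dot (fourier_real u) g"
    unfolding L2_dot_def
  proof (rule integral_cong_AE)
    note Fm = L2_measurable[OF fourier_L2_L2[OF L2_of_real[OF u]]] L2_measurable[OF fourier_L2_L2[OF L2_of_real[OF Cc_inf_L2[OF \<psi>]]]]
    show "(\<lambda>\<xi>. gauss t \<xi> * (fourier_real u \<xi> \<bullet> fourier_real \<psi> \<xi>)) \<in> borel_measurable lebesgue"
      by (intro borel_measurable_times borel_measurable_inner Fm continuous_measurable_lebesgue continuous_intros)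
    show "(\<lambda>\<xi>. fourier_real u \<xi> \<bullet> g \<xi>) \<in> borel_measurable lebesgue"
      by (intro borel_measurable_inner Fm gm)
    show "AE \<xi> in lebesgue. gauss t \<xi> * (fourier_real u \<xi> \<bullet> fourier_real \<psi> \<xi>) = fourier_real u \<xi> \<bullet> g \<xi>"
      using fourier_real_Cc_inf[OF \<psi>] by eventually_elim (simp add: g_def flip: scaleR_conv_of_real)
  qed
  also have "\<dots> = L2_dot (\<lambda>x. complex_of_real (u x)) (\<lambda>y. fourier_L2 g (- y))"
    by (rule fourier_adjoint[OF L2_of_real[OF u] g2])
  also have "\<dots> = L2_dot (\<lambda>x. complex_of_real (u x)) (\<lambda>y. fourier_integral g (- y))"
    by (rule L2_dot_cong_AE[OF AE_I2[OF refl] AE_lebesgue_reflect[OF fourier_L2_eq_integral[OF g2 g1]]])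
      (intro L2_measurable L2_of_real u L2_reflect fourier_L2_L2 g2)+
  also have "\<dots> = (\<integral>y. (\<integral>x. \<psi> x * u y * gauss_hat t (x - y) \<partial>lebesgue) \<partial>lebesgue)"
    unfolding L2_dot_def gh
  proof (rule Bochner_Integration.integral_cong[OF refl])
    fix y
    have "(\<integral>x. \<psi> x * u y * gauss_hat t (x - y) \<partial>lebesgue) = (\<integral>x. u y * (\<psi> x * gauss_hat t (x - y)) \<partial>lebesgue)"
      by (simp add: mult_ac)
    also have "\<dots> = u y * (\<integral>x. \<psi> x * gauss_hat t (x - y) \<partial>lebesgue)" by (rule integral_mult_right_zero)
    finally show "complex_of_real (u y) \<bullet> complex_of_real (\<integral>x. \<psi> x * gauss_hat t (x - y) \<partial>lebesgue) =
        (\<integral>x. \<psi> x * u y * gauss_hat t (x - y) \<partial>lebesgue)" by (simp add: inner_complex_def)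
  qed
  also have "\<dots> = (\<integral>p. \<psi> (fst p) * u (snd p) * gauss_hat t (fst p - snd p) \<partial>(lebesgue \<Otimes>\<^sub>M lebesgue))"
  proof -
    obtain C where C: "C \<ge> 0" "\<And>z::'a. \<bar>gauss_hat t z\<bar> \<le> C / (1 + (norm z)\<^sup>2) ^ DIM('a)"
      by (rule gauss_hat_bound[OF t]) blast
    have "(\<lambda>p. gauss_hat t (fst p - snd p)) \<in> borel_measurable (lebesgue \<Otimes>\<^sub>M (lebesgue :: 'a measure))"
      by measurable
    from pair_kernel_integrable[OF Cc_inf_Cc[OF \<psi>] u this C(1)] C(2)
    have "integrable (lebesgue \<Otimes>\<^sub>M lebesgue) (\<lambda>p. \<psi> (fst p) * u (snd p) * gauss_hat t (fst p - snd p))" by simp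
    from lebesgue_pair.integral_snd[of "\<lambda>x y. \<psi> x * u y * gauss_hat t (x - y)"] this
    show ?thesis by (simp add: case_prod_beta')
  qed
  finally show ?thesis .
qed

text \<open>Instantiates \<open>heat_pairing\<close> with frequency space on one side and pairs of
  points on the other. The conclusion says that the heat flow at time 1 of a power of the Laplacian
  of \<open>u\<close> is orthogonal to every test function in \<open>W\<close>.\<close>

lemma heat_vanish:
  fixes u :: "'a::euclidean_space \<Rightarrow> real"
  assumes W: "open W" and u: "L2 u" and u0: "\<And>x. x \<in> W \<Longrightarrow> u x = 0"
    and s: "s \<ge> 0" "s \<notin> \<int>"
    and zero: "\<And>\<phi>. \<phi> \<in> Cc_inf W \<Longrightarrow> (\<integral>\<xi>. norm \<xi> powr (2 * s) * (fourier_real u \<xi> \<bullet> fourier_real \<phi> \<xi>) \<partial>lebesgue) = 0"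
    and \<phi>: "\<phi> \<in> Cc_inf W"
  shows "(\<integral>\<xi>. norm \<xi> ^ (2 * Suc (nat \<lfloor>s\<rfloor>)) * gauss 1 \<xi> * (fourier_real u \<xi> \<bullet> fourier_real \<phi> \<xi>) \<partial>lebesgue) = 0"
proof -
  \<comment> \<open>\<open>s = m + \<sigma>\<close> with \<open>0 < \<sigma> < 1\<close>; this is
    where \<open>s\<close> must not be an integer.\<close>
  define m where "m = nat \<lfloor>s\<rfloor>"
  define \<sigma> where "\<sigma> = s - real m"
  have m: "real m = of_int \<lfloor>s\<rfloor>" using s(1) by (simp add: m_def)
  have \<sigma>: "0 < \<sigma>" "\<sigma> < 1"
  proof -
    have "s \<noteq> of_int \<lfloor>s\<rfloor>" using s(2) by (metis Ints_of_int)
    then show "0 < \<sigma>" "\<sigma> < 1" unfolding \<sigma>_def m by linarith+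
  qed
  let ?n = "DIM('a)"
  define K where "K = closure {x. \<phi> x \<noteq> 0}"
  have K: "compact K" "K \<subseteq> W" using \<phi> by (auto simp: K_def Cc_inf_def)
  have \<phi>K: "\<phi> \<in> Cc_inf K" using \<phi> by (auto simp: K_def Cc_inf_def)
  \<comment> \<open>\<open>u\<close> vanishes within distance \<open>\<delta>\<close> of the support
    of \<open>\<phi>\<close>.\<close>
  obtain \<delta> where \<delta>: "\<delta> > 0" "(\<Union>x\<in>K. ball x \<delta>) \<subseteq> W"
    by (rule compact_subset_open_imp_ball_epsilon_subset[OF K(1) W K(2)])
  define \<psi> where "\<psi> k = (nlap ^^ k) \<phi>" for k
  have \<psi>K: "\<psi> k \<in> Cc_inf K" for k unfolding \<psi>_def by (rule Cc_inf_nlap_pow[OF \<phi>K])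
  have \<psi>W: "\<psi> k \<in> Cc_inf W" for k unfolding \<psi>_def by (rule Cc_inf_nlap_pow[OF \<phi>])
  have F\<psi>: "AE \<xi> in lebesgue. fourier_real (\<psi> k) \<xi> = of_real (norm \<xi> ^ (2 * k)) * fourier_real \<phi> \<xi>" for k
    unfolding \<psi>_def by (rule fourier_real_nlap_pow[OF \<phi>])
  define lam where "lam \<xi> = (norm \<xi>)\<^sup>2" for \<xi> :: 'a
  define v where "v \<xi> = fourier_real u \<xi> \<bullet> fourier_real \<phi> \<xi>" for \<xi>
  \<comment> \<open>The maximum gives the lower bound for all pairs of points. It equals the squared
    distance wherever \<open>\<psi> k (fst p) * u (snd p)\<close> is nonzero, so the integrals see
    only the true distance.\<close>
  define \<rho> where "\<rho> p = max (\<delta>\<^sup>2) ((norm (fst p - snd p))\<^sup>2)" for p :: "'a \<times> 'a"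
  \<comment> \<open>The factor of order \<open>- n\<close> in \<open>\<rho>\<close> makes
    \<open>\<omega> k\<close> integrable although \<open>u\<close> is only in L2. The parameter
    \<open>q = n\<close> of the locale restores it in the heat formula.\<close>
  define \<omega> where "\<omega> k p = \<psi> k (fst p) * u (snd p) * \<rho> p powr (- real ?n)" for k and p :: "'a \<times> 'a"
  have \<rho>m: "\<rho> \<in> borel_measurable (lebesgue \<Otimes>\<^sub>M lebesgue)" unfolding \<rho>_def by measurable
  have \<rho>d: "\<rho> p \<ge> \<delta>\<^sup>2" for p by (simp add: \<rho>_def)
  have \<rho>pos: "\<rho> p > 0" for p using \<rho>d[of p] \<delta>(1) zero_less_power[of \<delta> 2] by linarith
  have Fu: "L2 (fourier_real u)" by (intro fourier_L2_L2 L2_of_real u)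
  have F\<psi>L: "L2 (fourier_real (\<psi> k))" for k by (intro fourier_L2_L2 L2_of_real Cc_inf_L2[OF \<psi>K])
  have F\<phi>L: "L2 (fourier_real \<phi>)" by (intro fourier_L2_L2 L2_of_real Cc_inf_L2[OF \<phi>])
  have vm: "v \<in> borel_measurable lebesgue"
    unfolding v_def by (intro borel_measurable_inner L2_measurable Fu F\<phi>L)
  have lamm: "lam \<in> borel_measurable lebesgue"
    unfolding lam_def by (intro continuous_measurable_lebesgue continuous_intros)
  have lamv: "AE \<xi> in lebesgue. lam \<xi> ^ k * v \<xi> = fourier_real u \<xi> \<bullet> fourier_real (\<psi> k) \<xi>" for k
    using F\<psi>[of k]
  proof eventually_elim
    case (elim \<xi>)
    then show ?case
      by (simp add: v_def lam_def elim power_mult flip: scaleR_conv_of_real of_real_power)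
  qed
  have v_int: "integrable lebesgue (\<lambda>\<xi>. lam \<xi> ^ k * v \<xi>)" for k
  proof (rule integrable_cong_AE_imp[OF L2_dot_integrable(2)[OF Fu F\<psi>L[of k]]])
    show "(\<lambda>\<xi>. lam \<xi> ^ k * v \<xi>) \<in> borel_measurable lebesgue" using lamm vm by measurable
    show "AE \<xi> in lebesgue. fourier_real u \<xi> \<bullet> fourier_real (\<psi> k) \<xi> = lam \<xi> ^ k * v \<xi>"
      using lamv[of k] by eventually_elim simp
  qed
  have \<omega>_int: "integrable (lebesgue \<Otimes>\<^sub>M lebesgue) (\<omega> k)" for k
    unfolding \<omega>_def
  proof (rule pair_kernel_integrable[OF Cc_inf_Cc[OF \<psi>K] u])
    show "(\<lambda>p. \<rho> p powr (- real ?n)) \<in> borel_measurable (lebesgue \<Otimes>\<^sub>M lebesgue)" using \<rho>m by measurable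
    \<comment> \<open>The constant for which \<open>1 + r \<le> ?c * \<rho>\<close> holds both for
      \<open>r \<le> \<delta>\<^sup>2\<close>, where \<open>\<rho> = \<delta>\<^sup>2\<close>, and
      beyond, where \<open>\<rho> = r\<close>.\<close>
    let ?c = "(1 + \<delta>\<^sup>2) / \<delta>\<^sup>2"
    have c: "?c > 0" using \<delta>(1) by (intro divide_pos_pos add_pos_nonneg) auto
    then show "?c ^ ?n \<ge> 0" by (intro zero_le_power less_imp_le)
    fix x y :: 'a
    define r where "r = (norm (x - y))\<^sup>2"
    have r: "r \<ge> 0" by (simp add: r_def)
    have "1 + r \<le> ?c * \<rho> (x, y)"
    proof (cases "r \<le> \<delta>\<^sup>2")
      case True
      then have "?c * \<rho> (x, y) = 1 + \<delta>\<^sup>2" using \<delta>(1) by (simp add: \<rho>_def r_def max_def)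
      then show ?thesis using True by simp
    next
      case False
      then have "\<rho> (x, y) = r" by (simp add: \<rho>_def r_def)
      moreover have "?c * r = r / \<delta>\<^sup>2 + r" using \<delta>(1) by (simp add: field_simps)
      moreover have "r / \<delta>\<^sup>2 \<ge> 1" using False \<delta>(1) by simp
      ultimately show ?thesis by simp
    qed
    then have "(1 + r) ^ ?n \<le> (?c * \<rho> (x, y)) ^ ?n" using r by (intro power_mono) auto
    then have "(1 + r) ^ ?n \<le> ?c ^ ?n * \<rho> (x, y) ^ ?n" by (simp only: power_mult_distrib)
    moreover have "(1 + r) ^ ?n > 0" "\<rho> (x, y) ^ ?n > 0" using r \<rho>pos by (auto intro: add_pos_nonneg)
    ultimately have "1 / \<rho> (x, y) ^ ?n \<le> ?c ^ ?n / (1 + r) ^ ?n"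
      by (simp add: pos_divide_le_eq pos_le_divide_eq mult.commute del: power_divide)
    then show "\<bar>\<rho> (x, y) powr (- real ?n)\<bar> \<le> ?c ^ ?n / (1 + (norm (x - y))\<^sup>2) ^ ?n"
      using \<rho>pos[of "(x, y)"] by (simp add: r_def powr_minus_divide powr_realpow)
  qed
  have rep: "(\<integral>\<xi>. lam \<xi> ^ k * exp (- (t * lam \<xi>)) * v \<xi> \<partial>lebesgue) = sqrt pi ^ ?n * t powr (- (real ?n / 2)) *
      (\<integral>p. \<omega> k p * \<rho> p powr real ?n * exp (- (\<rho> p / (4 * t))) \<partial>(lebesgue \<Otimes>\<^sub>M lebesgue))" if t: "t > 0" for k t
  proof -
    have "(\<integral>\<xi>. lam \<xi> ^ k * exp (- (t * lam \<xi>)) * v \<xi> \<partial>lebesgue) = (\<integral>\<xi>. gauss t \<xi> * (fourier_real u \<xi> \<bullet> fourier_real (\<psi> k) \<xi>) \<partial>lebesgue)"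
    proof (rule integral_cong_AE)
      show "(\<lambda>\<xi>. lam \<xi> ^ k * exp (- (t * lam \<xi>)) * v \<xi>) \<in> borel_measurable lebesgue" using lamm vm by measurable
      show "(\<lambda>\<xi>. gauss t \<xi> * (fourier_real u \<xi> \<bullet> fourier_real (\<psi> k) \<xi>)) \<in> borel_measurable lebesgue"
        by (intro borel_measurable_times borel_measurable_inner L2_measurable Fu F\<psi>L continuous_measurable_lebesgue continuous_intros)
      show "AE \<xi> in lebesgue. lam \<xi> ^ k * exp (- (t * lam \<xi>)) * v \<xi> = gauss t \<xi> * (fourier_real u \<xi> \<bullet> fourier_real (\<psi> k) \<xi>)"
        using lamv[of k]
      proof eventually_elim
        case (elim \<xi>)
        show ?case unfolding elim[symmetric] by (simp add: gauss_def lam_def)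
      qed
    qed
    also have "\<dots> = (\<integral>p. \<psi> k (fst p) * u (snd p) * gauss_hat t (fst p - snd p) \<partial>(lebesgue \<Otimes>\<^sub>M lebesgue))"
      by (rule gauss_pairing[OF u \<psi>K t])
    also have "\<dots> = (\<integral>p. sqrt pi ^ ?n * t powr (- (real ?n / 2)) * (\<omega> k p * \<rho> p powr real ?n * exp (- (\<rho> p / (4 * t)))) \<partial>(lebesgue \<Otimes>\<^sub>M lebesgue))"
    proof (rule Bochner_Integration.integral_cong[OF refl])
      fix p :: "'a \<times> 'a"
      obtain x y where p: "p = (x, y)" by (cases p)
      show "\<psi> k (fst p) * u (snd p) * gauss_hat t (fst p - snd p) =
          sqrt pi ^ ?n * t powr (- (real ?n / 2)) * (\<omega> k p * \<rho> p powr real ?n * exp (- (\<rho> p / (4 * t))))"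
      proof (cases "\<psi> k x = 0 \<or> u y = 0")
        case False
        then have "x \<in> K" "y \<notin> W" using Cc_inf_outside[OF \<psi>K] u0 by auto
        then have "y \<notin> ball x \<delta>" using \<delta>(2) by blast
        then have "\<delta> \<le> norm (x - y)" by (simp add: dist_norm)
        then have "\<delta>\<^sup>2 \<le> (norm (x - y))\<^sup>2" using \<delta>(1) by (intro power_mono) auto
        then have \<rho>p: "\<rho> p = (norm (x - y))\<^sup>2" by (simp add: \<rho>_def p)
        have "\<rho> p powr (- real ?n) * \<rho> p powr real ?n = 1" using \<rho>pos[of p] by (simp flip: powr_add)
        then have 1: "\<omega> k p * \<rho> p powr real ?n = \<psi> k x * u y" by (simp add: \<omega>_def p mult.assoc)
        have "sqrt (pi / t) ^ ?n = sqrt pi ^ ?n * (inverse (sqrt t)) ^ ?n"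
          by (metis real_sqrt_divide divide_inverse power_mult_distrib)
        also have "inverse (sqrt t) = t powr (- (1/2))" using t by (simp add: powr_minus powr_half_sqrt)
        also have "(t powr (- (1/2))) ^ ?n = t powr (- (real ?n / 2))" using t by (simp add: powr_powr flip: powr_realpow)
        finally have 2: "sqrt (pi / t) ^ ?n = sqrt pi ^ ?n * t powr (- (real ?n / 2))" .
        show ?thesis unfolding 1 unfolding \<rho>p by (simp add: gauss_hat_def 2 p)
      qed (auto simp: p \<omega>_def)
    qed
    also have "\<dots> = sqrt pi ^ ?n * t powr (- (real ?n / 2)) *
      (\<integral>p. \<omega> k p * \<rho> p powr real ?n * exp (- (\<rho> p / (4 * t))) \<partial>(lebesgue \<Otimes>\<^sub>M lebesgue))" by (rule integral_mult_right_zero)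
    finally show ?thesis .
  qed
  interpret hp: heat_pairing lebesgue lam v "lebesgue \<Otimes>\<^sub>M lebesgue" \<omega> \<rho> "\<delta>\<^sup>2" "sqrt pi ^ ?n" "real ?n / 2" "real ?n"
      "\<lambda>k t. (\<integral>\<xi>. lam \<xi> ^ k * exp (- (t * lam \<xi>)) * v \<xi> \<partial>lebesgue)"
  proof (unfold heat_pairing_def, intro conjI allI impI)
    show "sigma_finite_measure (lebesgue \<Otimes>\<^sub>M (lebesgue :: 'a measure) :: ('a \<times> 'a) measure)"
      by (rule lebesgue_pair.P.sigma_finite_measure_axioms)
  qed (use lamm v_int \<omega>_int \<rho>m \<delta>(1) \<rho>d rep lebesgue.sigma_finite_measure_axioms in \<open>auto simp: lam_def\<close>)
  have "(\<integral>\<xi>. lam \<xi> ^ Suc m * exp (- (1 * lam \<xi>)) * v \<xi> \<partial>lebesgue) = 0"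
  proof (rule hp.heat_pairing_zero[OF \<sigma>])
    fix k assume k: "k \<ge> m"
    \<comment> \<open>\<open>real (Suc k) + \<sigma> - 1 = s + (k - m)\<close>, and the surplus
      \<open>k - m\<close> powers of \<open>lam\<close> turn \<open>\<phi>\<close> into the test
      function \<open>\<psi> (k - m)\<close>.\<close>
    have "(\<integral>\<xi>. lam \<xi> powr (real (Suc k) + \<sigma> - 1) * v \<xi> \<partial>lebesgue) =
        (\<integral>\<xi>. norm \<xi> powr (2 * s) * (fourier_real u \<xi> \<bullet> fourier_real (\<psi> (k - m)) \<xi>) \<partial>lebesgue)"
    proof (rule integral_cong_AE)
      show "(\<lambda>\<xi>. lam \<xi> powr (real (Suc k) + \<sigma> - 1) * v \<xi>) \<in> borel_measurable lebesgue" using lamm vm by measurable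
      show "(\<lambda>\<xi>. norm \<xi> powr (2 * s) * (fourier_real u \<xi> \<bullet> fourier_real (\<psi> (k - m)) \<xi>)) \<in> borel_measurable lebesgue"
        by (intro borel_measurable_times borel_measurable_inner L2_measurable Fu F\<psi>L
            radial_measurable_lebesgue[where g="\<lambda>t. t powr (2 * s)"]) measurable
      show "AE \<xi> in lebesgue. lam \<xi> powr (real (Suc k) + \<sigma> - 1) * v \<xi> =
          norm \<xi> powr (2 * s) * (fourier_real u \<xi> \<bullet> fourier_real (\<psi> (k - m)) \<xi>)"
        using lamv[of "k - m"] AE_lebesgue_neq[of "0::'a"]
      proof eventually_elim
        case (elim \<xi>)
        have "lam \<xi> powr (real (Suc k) + \<sigma> - 1) = lam \<xi> powr s * lam \<xi> powr real (k - m)"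
          unfolding powr_add[symmetric] using k by (intro arg_cong[where f="\<lambda>r. lam \<xi> powr r"]) (simp add: \<sigma>_def)
        also have "lam \<xi> powr s = norm \<xi> powr (2 * s)"
          using elim(2) by (simp add: lam_def powr_powr flip: powr_numeral)
        also have "lam \<xi> powr real (k - m) = lam \<xi> ^ (k - m)" using elim(2) by (intro powr_realpow) (simp add: lam_def)
        finally show ?case unfolding elim(1)[symmetric] by simp
      qed
    qed
    also have "\<dots> = 0" by (rule zero[OF \<psi>W])
    finally show "(\<integral>\<xi>. lam \<xi> powr (real (Suc k) + \<sigma> - 1) * v \<xi> \<partial>lebesgue) = 0" .
  qed
  then show ?thesis unfolding lam_def v_def m_def gauss_def power_mult .
qed

section \<open>Real analyticity and the unique continuation theorem\<close>

lemma test_function_zero: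
  fixes h :: "'a::euclidean_space \<Rightarrow> real"
  assumes W: "open W" and h: "continuous_on UNIV h"
    and zero: "\<And>\<phi>. \<phi> \<in> Cc_inf W \<Longrightarrow> (\<integral>x. \<phi> x * h x \<partial>lebesgue) = 0" and x: "x \<in> W"
  shows "h x = 0"
proof (rule ccontr)
  assume nz: "h x \<noteq> 0"
  have "continuous (at x) h" using h by (simp add: continuous_on_eq_continuous_at)
  then obtain d where d: "d > 0" "\<And>y. dist y x < d \<Longrightarrow> \<bar>h y - h x\<bar> < \<bar>h x\<bar>"
    using nz unfolding continuous_at_eps_delta dist_real_def by (metis zero_less_abs_iff)
  obtain e where e: "e > 0" "ball x e \<subseteq> W" using W x by (auto simp: open_contains_ball)
  have "min d e > 0" using d e by simp
  from bump_exists[OF this, of x] obtain \<phi> where \<phi>: "\<phi> \<in> Cc_inf (ball x (min d e))" "\<And>x. \<phi> x \<ge> 0" "\<phi> x > 0"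
    by blast
  \<comment> \<open>The factor \<open>h x\<close> fixes the sign: near \<open>x\<close>, where
    \<open>\<phi>\<close> lives, \<open>h\<close> has the sign of \<open>h x\<close>.\<close>
  define g where "g y = \<phi> y * (h y * h x)" for y
  have g: "g y \<ge> 0" for y
  proof (cases "dist y x < min d e")
    case True
    then have "h y * h x \<ge> 0" using d(2)[of y] by (auto simp: zero_le_mult_iff abs_if split: if_splits)
    then show ?thesis using \<phi>(2)[of y] by (simp add: g_def)
  next
    case False
    then have "\<phi> y = 0" using Cc_inf_outside[OF \<phi>(1), of y] by (simp add: dist_commute)
    then show ?thesis by (simp add: g_def)
  qed
  have gc: "continuous_on UNIV g"
    unfolding g_def by (intro continuous_on_mult Cc_inf_continuous[OF \<phi>(1)] h continuous_on_const)
  have "ball x (min d e) \<subseteq> W" using e(2) by auto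
  then have "\<phi> \<in> Cc_inf W" using \<phi>(1) Cc_inf_mono by blast
  from zero[OF this] have "(\<integral>y. (\<phi> y * h y) * h x \<partial>lebesgue) = 0" by simp
  then have i0: "(\<integral>y. g y \<partial>lebesgue) = 0" unfolding g_def mult.assoc .
  have "integrable lebesgue g"
    unfolding g_def by (intro Cc_integrable Cc_mult Cc_inf_Cc[OF \<phi>(1)] continuous_on_mult h continuous_on_const)
  from integral_nonneg_eq_0_iff_AE[OF this] g i0 have "AE y in lebesgue. g y = 0" by auto
  moreover have "open {y. g y \<noteq> 0}"
    using gc by (intro open_Collect_neq continuous_on_const)
  moreover from this have "{y. g y \<noteq> 0} \<in> sets lebesgue"
    by (simp add: sets_completionI_sets)
  ultimately have "open {y. g y \<noteq> 0}" "negligible {y. g y \<noteq> 0}"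
    using AE_iff_null_sets[of "{y. g y \<noteq> 0}" lebesgue] by (auto simp: negligible_iff_null_sets)
  moreover have "x \<in> {y. g y \<noteq> 0}" using \<phi>(3) nz by (simp add: g_def)
  ultimately show False using open_not_negligible[of "{y. g y \<noteq> 0}"] by blast
qed

text \<open>Decay of \<open>E\<close> beyond every exponential lets the exponential series be
  integrated term by term, so along the line from \<open>x0\<close> to \<open>x\<close> the
  transform is a power series that converges everywhere. It vanishes near \<open>x0\<close>, hence
  all its coefficients do.\<close>

lemma fourier_integral_zero_extend:
  fixes E :: "'a::euclidean_space \<Rightarrow> complex"
  assumes Em: "E \<in> borel_measurable lebesgue"
    and E: "\<And>R. R \<ge> 0 \<Longrightarrow> integrable lebesgue (\<lambda>\<xi>. exp (R * norm \<xi>) * norm (E \<xi>))"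
    and W: "open W" "x0 \<in> W" and zero: "\<And>x. x \<in> W \<Longrightarrow> Re (fourier_integral E x) = 0"
  shows "Re (fourier_integral E x) = 0"
proof -
  define y where "y = x - x0"
  define g where "g k \<xi> = cis (- (\<xi> \<bullet> x0)) * ((- (\<i> * of_real (\<xi> \<bullet> y))) ^ k /\<^sub>R fact k) * E \<xi>" for k \<xi>
  define a where "a k = Re (\<integral>\<xi>. g k \<xi> \<partial>lebesgue)" for k
  have gm: "g k \<in> borel_measurable lebesgue" for k
    unfolding g_def
    by (rule borel_measurable_times[OF continuous_measurable_lebesgue Em]) (intro continuous_intros)
  have sums: "(\<lambda>k. a k * z ^ k) sums Re (fourier_integral E (x0 + z *\<^sub>R y))" for z
  proof -
    define R where "R = \<bar>z\<bar> * norm y"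
    have R: "R \<ge> 0" by (simp add: R_def)
    have bnd: "norm (of_real (z ^ k) * g k \<xi>) \<le> (R * norm \<xi>) ^ k /\<^sub>R fact k * norm (E \<xi>)" for k \<xi>
    proof -
      have "\<bar>z\<bar> * \<bar>\<xi> \<bullet> y\<bar> \<le> R * norm \<xi>"
        using mult_left_mono[OF Cauchy_Schwarz_ineq2[of \<xi> y], of "\<bar>z\<bar>"] by (simp add: R_def mult_ac)
      then have "(\<bar>z\<bar> * \<bar>\<xi> \<bullet> y\<bar>) ^ k \<le> (R * norm \<xi>) ^ k" by (intro power_mono) auto
      then have "(\<bar>z\<bar> * \<bar>\<xi> \<bullet> y\<bar>) ^ k /\<^sub>R fact k * norm (E \<xi>) \<le> (R * norm \<xi>) ^ k /\<^sub>R fact k * norm (E \<xi>)"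
        by (intro mult_right_mono scaleR_left_mono) auto
      then show ?thesis by (simp add: g_def norm_mult norm_power power_mult_distrib mult_ac abs_mult power_abs)
    qed
    have le: "(\<Sum>k<n. (R * norm \<xi>) ^ k /\<^sub>R fact k * norm (E \<xi>)) \<le> exp (R * norm \<xi>) * norm (E \<xi>)" for n \<xi>
    proof -
      have "(\<Sum>k<n. (R * norm \<xi>) ^ k /\<^sub>R fact k) \<le> exp (R * norm \<xi>)"
        unfolding exp_def using R by (intro sum_le_suminf summable_exp_generic) auto
      then show ?thesis unfolding sum_distrib_right[symmetric] by (rule mult_right_mono) simp
    qed
    have int_k: "integrable lebesgue (\<lambda>\<xi>. (R * norm \<xi>) ^ k /\<^sub>R fact k * norm (E \<xi>))" for k
    proof (rule Bochner_Integration.integrable_bound[OF E[OF R]])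
      show "(\<lambda>\<xi>. (R * norm \<xi>) ^ k /\<^sub>R fact k * norm (E \<xi>)) \<in> borel_measurable lebesgue"
        by (rule borel_measurable_times[OF continuous_measurable_lebesgue measurable_compose[OF Em borel_measurable_norm]])
          (intro continuous_intros)
      have "(R * norm \<xi>) ^ k /\<^sub>R fact k * norm (E \<xi>) \<le> (\<Sum>j<Suc k. (R * norm \<xi>) ^ j /\<^sub>R fact j * norm (E \<xi>))" for \<xi>
        using R by (intro member_le_sum) auto
      then have "(R * norm \<xi>) ^ k /\<^sub>R fact k * norm (E \<xi>) \<le> exp (R * norm \<xi>) * norm (E \<xi>)" for \<xi>
        using le[of \<xi> "Suc k"] order_trans by blast
      then show "AE \<xi> in lebesgue. norm ((R * norm \<xi>) ^ k /\<^sub>R fact k * norm (E \<xi>)) \<le> norm (exp (R * norm \<xi>) * norm (E \<xi>))"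
        using R by (intro AE_I2) simp
    qed
    have int_g: "integrable lebesgue (\<lambda>\<xi>. of_real (z ^ k) * g k \<xi>)" for k
    proof (rule Bochner_Integration.integrable_bound[OF int_k[of k]])
      show "(\<lambda>\<xi>. of_real (z ^ k) * g k \<xi>) \<in> borel_measurable lebesgue"
        by (intro borel_measurable_times gm borel_measurable_const)
      show "AE \<xi> in lebesgue. norm (of_real (z ^ k) * g k \<xi>) \<le> norm ((R * norm \<xi>) ^ k /\<^sub>R fact k * norm (E \<xi>))"
        using bnd order_trans[OF _ abs_ge_self] unfolding real_norm_def by (intro AE_I2) blast
    qed
    have exp_sums: "(\<lambda>k. of_real (z ^ k) * g k \<xi>) sums (cis (- (\<xi> \<bullet> (x0 + z *\<^sub>R y))) * E \<xi>)" for \<xi>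
    proof -
      define w where "w = - (\<i> * complex_of_real (z * (\<xi> \<bullet> y)))"
      have "(\<lambda>k. cis (- (\<xi> \<bullet> x0)) * (w ^ k /\<^sub>R fact k) * E \<xi>) sums (cis (- (\<xi> \<bullet> x0)) * exp w * E \<xi>)"
        by (intro sums_mult sums_mult2 exp_converges)
      moreover have "cis (- (\<xi> \<bullet> x0)) * (w ^ k /\<^sub>R fact k) * E \<xi> = of_real (z ^ k) * g k \<xi>" for k
      proof -
        have "w = of_real z * (- (\<i> * of_real (\<xi> \<bullet> y)))" by (simp add: w_def)
        then have "w ^ k = of_real (z ^ k) * (- (\<i> * of_real (\<xi> \<bullet> y))) ^ k" by (simp only: power_mult_distrib of_real_power)
        then show ?thesis by (simp add: g_def)
      qed
      moreover have "cis (- (\<xi> \<bullet> x0)) * exp w = cis (- (\<xi> \<bullet> (x0 + z *\<^sub>R y)))"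
        by (simp add: w_def cis_conv_exp inner_add_right algebra_simps flip: exp_add)
      ultimately show ?thesis by simp
    qed
    have "(\<lambda>k. \<integral>\<xi>. of_real (z ^ k) * g k \<xi> \<partial>lebesgue) sums (\<integral>\<xi>. (\<Sum>k. of_real (z ^ k) * g k \<xi>) \<partial>lebesgue)"
    proof (rule sums_integral[OF int_g])
      have exps: "summable (\<lambda>k. (R * norm \<xi>) ^ k /\<^sub>R fact k * norm (E \<xi>))" for \<xi>
        by (intro summable_mult2 summable_exp_generic)
      show "AE \<xi> in lebesgue. summable (\<lambda>k. norm (of_real (z ^ k) * g k \<xi>))"
        using bnd by (intro AE_I2 summable_comparison_test'[OF exps]) simp
      show "summable (\<lambda>k. \<integral>\<xi>. norm (of_real (z ^ k) * g k \<xi>) \<partial>lebesgue)"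
      proof (rule summableI_nonneg_bounded)
        fix n
        have "(\<Sum>k<n. \<integral>\<xi>. norm (of_real (z ^ k) * g k \<xi>) \<partial>lebesgue) \<le>
            (\<Sum>k<n. \<integral>\<xi>. (R * norm \<xi>) ^ k /\<^sub>R fact k * norm (E \<xi>) \<partial>lebesgue)"
          by (intro sum_mono integral_mono integrable_norm int_g int_k bnd)
        also have "\<dots> = (\<integral>\<xi>. (\<Sum>k<n. (R * norm \<xi>) ^ k /\<^sub>R fact k * norm (E \<xi>)) \<partial>lebesgue)"
          by (rule Bochner_Integration.integral_sum[symmetric]) (rule int_k)
        also have "\<dots> \<le> (\<integral>\<xi>. exp (R * norm \<xi>) * norm (E \<xi>) \<partial>lebesgue)"
          by (intro integral_mono Bochner_Integration.integrable_sum int_k E R le)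
        finally show "(\<Sum>k<n. \<integral>\<xi>. norm (of_real (z ^ k) * g k \<xi>) \<partial>lebesgue) \<le> (\<integral>\<xi>. exp (R * norm \<xi>) * norm (E \<xi>) \<partial>lebesgue)" .
      qed simp
    qed
    also have "(\<integral>\<xi>. (\<Sum>k. of_real (z ^ k) * g k \<xi>) \<partial>lebesgue) = fourier_integral E (x0 + z *\<^sub>R y)"
      unfolding fourier_integral_def using exp_sums by (simp add: sums_iff)
    finally have "(\<lambda>k. Re (\<integral>\<xi>. of_real (z ^ k) * g k \<xi> \<partial>lebesgue)) sums Re (fourier_integral E (x0 + z *\<^sub>R y))"
      by (rule sums_Re)
    moreover have "Re (\<integral>\<xi>. of_real (z ^ k) * g k \<xi> \<partial>lebesgue) = a k * z ^ k" for k
    proof -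
      have "(\<integral>\<xi>. of_real (z ^ k) * g k \<xi> \<partial>lebesgue) = of_real (z ^ k) * (\<integral>\<xi>. g k \<xi> \<partial>lebesgue)"
        by (rule integral_mult_right_zero)
      then show ?thesis by (simp add: a_def mult.commute flip: of_real_power)
    qed
    ultimately show ?thesis by (simp only:)
  qed
  obtain e where e: "e > 0" "ball x0 e \<subseteq> W" using W by (auto simp: open_contains_ball)
  have "a k = 0" for k
  proof (rule powser_zero_coeff)
    \<comment> \<open>The added 1 also covers \<open>y = 0\<close>.\<close>
    show "e / (norm y + 1) > 0" using e by (simp add: add_nonneg_pos)
    fix z :: real assume z: "\<bar>z\<bar> < e / (norm y + 1)"
    have "norm y + 1 > 0" by (simp add: add_nonneg_pos)
    then have "\<bar>z\<bar> * norm y + \<bar>z\<bar> < e" using z by (simp add: pos_less_divide_eq distrib_left)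
    then have "x0 + z *\<^sub>R y \<in> ball x0 e" by (simp add: dist_norm)
    then have "Re (fourier_integral E (x0 + z *\<^sub>R y)) = 0" using e(2) zero by blast
    then show "(\<lambda>k. a k * z ^ k) sums 0" using sums[of z] by simp
  qed
  then show ?thesis using sums[of 1] by (simp add: y_def sums_iff)
qed

text \<open>The power of \<open>r\<close> is absorbed by \<open>exp r\<close>, and then the square
  of \<open>R + 1 - r / 2\<close> is used to absorb the linear exponent into a quarter of
  \<open>r\<^sup>2\<close>; three quarters remain.\<close>

lemma poly_gauss_bound:
  fixes R :: real assumes R: "R \<ge> 0"
  obtains C where "\<And>\<xi>::'a::euclidean_space. exp (R * norm \<xi>) * (norm \<xi> ^ Suc k * gauss 1 \<xi>) \<le> C * gauss (3/4) \<xi>"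
proof
  fix \<xi> :: 'a
  define r where "r = norm \<xi>"
  have r: "r \<ge> 0" by (simp add: r_def)
  have "(r / real (Suc k)) ^ Suc k \<le> (1 + r / real (Suc k)) ^ Suc k" using r by (intro power_mono) auto
  also have "\<dots> \<le> exp r" using r by (intro exp_ge_one_plus_x_over_n_power_n) auto
  finally have "r ^ Suc k \<le> real (Suc k) ^ Suc k * exp r"
    by (simp only: power_divide) (simp add: pos_divide_le_eq mult.commute del: power_Suc)
  then have "r ^ Suc k * exp (R * r - r\<^sup>2) \<le> real (Suc k) ^ Suc k * exp r * exp (R * r - r\<^sup>2)"
    by (rule mult_right_mono) simp
  also have "\<dots> = real (Suc k) ^ Suc k * exp ((R + 1) * r - r\<^sup>2)"
    by (simp add: algebra_simps del: power_Suc flip: exp_add)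
  also have "(R + 1) * r - r\<^sup>2 \<le> (R + 1)\<^sup>2 - 3 / 4 * r\<^sup>2"
    using zero_le_power2[of "R + 1 - r / 2"] by (simp add: power2_eq_square algebra_simps)
  then have "real (Suc k) ^ Suc k * exp ((R + 1) * r - r\<^sup>2) \<le> real (Suc k) ^ Suc k * exp ((R + 1)\<^sup>2 - 3 / 4 * r\<^sup>2)"
    by (intro mult_left_mono) auto
  also have "\<dots> = real (Suc k) ^ Suc k * exp ((R + 1)\<^sup>2) * exp (- (3 / 4 * r\<^sup>2))"
    by (simp flip: exp_add)
  finally show "exp (R * norm \<xi>) * (norm \<xi> ^ Suc k * gauss 1 \<xi>) \<le> (real (Suc k) ^ Suc k * exp ((R + 1)\<^sup>2)) * gauss (3/4) \<xi>"
    by (simp add: gauss_def r_def exp_diff exp_minus field_simps del: power_Suc)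
qed

theorem unique_continuation:
  fixes u :: "'a::euclidean_space \<Rightarrow> real"
  assumes W: "open W" "W \<noteq> {}" and u: "L2 u" and u0: "AE x in lebesgue. x \<in> W \<longrightarrow> u x = 0"
    and s: "s \<ge> 0" "s \<notin> \<int>"
    and zero: "\<And>\<phi>. \<phi> \<in> Cc_inf W \<Longrightarrow> (\<integral>\<xi>. norm \<xi> powr (2 * s) * (fourier_real u \<xi> \<bullet> fourier_real \<phi> \<xi>) \<partial>lebesgue) = 0"
  shows "AE x in lebesgue. u x = 0"
proof -
  \<comment> \<open>Changing \<open>u\<close> on a null set makes it vanish at every point of
    \<open>W\<close>, as \<open>heat_vanish\<close> requires, and alters transforms on null sets
    only.\<close>
  define u' where "u' x = (if x \<in> W then 0 else u x)" for x
  have eq: "AE x in lebesgue. u' x = u x" using u0 by eventually_elim (simp add: u'_def)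
  have u': "L2 u'" by (rule L2_cong_AE[OF u eq])
  have Fu: "L2 (fourier_real u)" and Fu': "L2 (fourier_real u')" by (intro fourier_L2_L2 L2_of_real u u')+
  have F\<phi>: "L2 (fourier_real \<phi>)" if "\<phi> \<in> Cc_inf W" for \<phi>
    using that by (intro fourier_L2_L2 L2_of_real Cc_inf_L2[OF that])
  have Feq: "AE \<xi> in lebesgue. fourier_real u' \<xi> = fourier_real u \<xi>"
    by (rule fourier_L2_cong_AE[OF L2_of_real[OF u]]) (use eq in eventually_elim, simp)
  \<comment> \<open>\<open>Suc k\<close> is then the exponent
    \<open>2 * Suc (nat \<lfloor>s\<rfloor>)\<close> of \<open>heat_vanish\<close>, in the form
    required by \<open>poly_gauss_bound\<close>.\<close>
  define k where "k = Suc (2 * nat \<lfloor>s\<rfloor>)"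
  define P where "P \<xi> = norm \<xi> ^ Suc k * gauss 1 \<xi>" for \<xi> :: 'a
  \<comment> \<open>The transform of the heat flow at time 1 of a power of the Laplacian of
    \<open>u'\<close>. Its Fourier integral at \<open>- x\<close> is that function at
    \<open>x\<close>, up to the factor (2 pi)^n.\<close>
  define E where "E \<xi> = of_real (P \<xi>) * fourier_real u' \<xi>" for \<xi>
  have P0: "P \<xi> \<ge> 0" for \<xi> by (simp add: P_def)
  have Pm: "(\<lambda>\<xi>. complex_of_real (P \<xi>)) \<in> borel_measurable lebesgue"
    unfolding P_def gauss_def by (intro continuous_measurable_lebesgue continuous_intros)
  have Em: "E \<in> borel_measurable lebesgue"
    unfolding E_def by (rule borel_measurable_times[OF Pm L2_measurable[OF Fu']])
  have pair0: "(\<integral>\<xi>. P \<xi> * (fourier_real u' \<xi> \<bullet> fourier_real \<phi> \<xi>) \<partial>lebesgue) = 0" if \<phi>: "\<phi> \<in> Cc_inf W" for \<phi>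
  proof -
    have "2 * Suc (nat \<lfloor>s\<rfloor>) = Suc k" by (simp add: k_def)
    moreover have "(\<integral>\<xi>. norm \<xi> ^ (2 * Suc (nat \<lfloor>s\<rfloor>)) * gauss 1 \<xi> * (fourier_real u' \<xi> \<bullet> fourier_real \<phi> \<xi>) \<partial>lebesgue) = 0"
    proof (rule heat_vanish[OF W(1) u' _ s _ \<phi>])
      fix \<phi> assume \<phi>: "\<phi> \<in> Cc_inf W"
      have "(\<integral>\<xi>. norm \<xi> powr (2 * s) * (fourier_real u' \<xi> \<bullet> fourier_real \<phi> \<xi>) \<partial>lebesgue) =
          (\<integral>\<xi>. norm \<xi> powr (2 * s) * (fourier_real u \<xi> \<bullet> fourier_real \<phi> \<xi>) \<partial>lebesgue)"
      proof (rule integral_cong_AE)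
        show "AE \<xi> in lebesgue. norm \<xi> powr (2 * s) * (fourier_real u' \<xi> \<bullet> fourier_real \<phi> \<xi>) =
            norm \<xi> powr (2 * s) * (fourier_real u \<xi> \<bullet> fourier_real \<phi> \<xi>)"
          using Feq by eventually_elim simp
      qed (intro borel_measurable_times borel_measurable_inner L2_measurable Fu Fu' F\<phi> \<phi>
          radial_measurable_lebesgue[where g="\<lambda>t. t powr (2 * s)"]; measurable)+
      then show "(\<integral>\<xi>. norm \<xi> powr (2 * s) * (fourier_real u' \<xi> \<bullet> fourier_real \<phi> \<xi>) \<partial>lebesgue) = 0"
        using zero[OF \<phi>] by simp
    qed (simp add: u'_def)
    ultimately show ?thesis unfolding P_def by simp
  qed
  have Eint: "integrable lebesgue (\<lambda>\<xi>. exp (R * norm \<xi>) * norm (E \<xi>))" if R: "R \<ge> 0" for R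
  proof -
    obtain C where C: "\<And>\<xi>::'a. exp (R * norm \<xi>) * P \<xi> \<le> C * gauss (3/4) \<xi>"
      using poly_gauss_bound[OF R, of k] unfolding P_def by blast
    have "L2 (\<lambda>\<xi>::'a. exp (R * norm \<xi>) * P \<xi>)"
    proof (rule L2_dominated[OF _ gauss_L2, of _ "3/4" C])
      show "(\<lambda>\<xi>::'a. exp (R * norm \<xi>) * P \<xi>) \<in> borel_measurable lebesgue"
        unfolding P_def gauss_def by (intro continuous_measurable_lebesgue continuous_intros)
      show "AE \<xi>::'a in lebesgue. norm (exp (R * norm \<xi>) * P \<xi>) \<le> C * norm (gauss (3/4) \<xi>)"
        using C P0 by (intro AE_I2) simp
    qed simp
    from L2_dot_integrable(1)[OF L2_of_real[OF this] Fu'] P0 show ?thesis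
      by (simp add: E_def norm_mult mult.assoc)
  qed
  obtain C where C: "\<And>\<xi>::'a. exp (0 * norm \<xi>) * P \<xi> \<le> C * gauss (3/4) \<xi>"
    using poly_gauss_bound[OF order_refl, of k] unfolding P_def by blast
  have C0: "0 \<le> C" using order_trans[OF _ C[of 0]] P0[of 0] by (simp add: gauss_def)
  have EL2: "L2 E"
  proof (rule L2_dominated[OF Em Fu', of C])
    show "AE \<xi> in lebesgue. norm (E \<xi>) \<le> C * norm (fourier_real u' \<xi>)"
    proof (rule AE_I2)
      fix \<xi> :: 'a
      have "C * gauss (3/4) \<xi> \<le> C" using C0 by (intro mult_left_le gauss_le_1) auto
      then have "P \<xi> \<le> C" using C[of \<xi>] by simp
      then show "norm (E \<xi>) \<le> C * norm (fourier_real u' \<xi>)"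
        using P0[of \<xi>] by (simp add: E_def norm_mult mult_right_mono)
    qed
  qed
  have EL1: "integrable lebesgue E"
    by (rule Bochner_Integration.integrable_bound[OF Eint[OF order_refl] Em]) simp
  have FE: "AE x in lebesgue. fourier_L2 E x = fourier_integral E x" by (rule fourier_L2_eq_integral[OF EL2 EL1])
  have W': "Re (fourier_integral E (- x)) = 0" if x: "x \<in> W" for x
  proof (rule test_function_zero[OF W(1) _ _ x])
    show "continuous_on UNIV (\<lambda>x. Re (fourier_integral E (- x)))"
      by (intro continuous_on_Re continuous_on_compose2[OF fourier_integral_continuous[OF EL1]] continuous_intros) auto
    fix \<phi> assume \<phi>: "\<phi> \<in> Cc_inf W"
    have "(\<integral>x. \<phi> x * Re (fourier_integral E (- x)) \<partial>lebesgue) = L2_dot (\<lambda>x. complex_of_real (\<phi> x)) (\<lambda>x. fourier_integral E (- x))"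
      by (simp add: L2_dot_def inner_complex_def)
    also have "\<dots> = L2_dot (\<lambda>x. complex_of_real (\<phi> x)) (\<lambda>x. fourier_L2 E (- x))"
      by (rule L2_dot_cong_AE[symmetric, OF AE_I2[OF refl] AE_lebesgue_reflect[OF FE]])
        (intro L2_measurable L2_of_real Cc_inf_L2[OF \<phi>] L2_reflect fourier_L2_L2 EL2)+
    also have "\<dots> = L2_dot (fourier_real \<phi>) E"
      by (rule fourier_adjoint[symmetric, OF L2_of_real[OF Cc_inf_L2[OF \<phi>]] EL2])
    also have "\<dots> = (\<integral>\<xi>. P \<xi> * (fourier_real u' \<xi> \<bullet> fourier_real \<phi> \<xi>) \<partial>lebesgue)"
      unfolding L2_dot_def E_def scaleR_conv_of_real[symmetric] by (simp add: inner_commute)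
    finally show "(\<integral>x. \<phi> x * Re (fourier_integral E (- x)) \<partial>lebesgue) = 0" using pair0[OF \<phi>] by simp
  qed
  obtain x0 where "x0 \<in> W" using W(2) by blast
  \<comment> \<open>The vanishing is known at the points \<open>- x\<close> with \<open>x\<close> in
    \<open>W\<close>, so the extension starts from the reflected open set.\<close>
  have R0: "Re (fourier_integral E x) = 0" for x
    by (rule fourier_integral_zero_extend[OF Em Eint open_negations[OF W(1)] imageI[OF \<open>x0 \<in> W\<close>]]) (use W' in auto)
  \<comment> \<open>\<open>E\<close> is Hermitian because \<open>u'\<close> is real, so its
    transform is real and the vanishing of the real part suffices.\<close>
  have "AE \<xi> in lebesgue. E (- \<xi>) = cnj (E \<xi>)"
    using fourier_real_hermitian[OF u'] by eventually_elim (simp add: E_def P_def gauss_def)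
  from hermitian_fourier_real[OF EL2 this] FE have "AE x in lebesgue. fourier_L2 E x = 0"
    by eventually_elim (metis R0 of_real_0)
  then have "L2_norm (fourier_L2 E) = 0" using L2_norm_eq_0_iff[OF fourier_L2_L2[OF EL2]] by blast
  then have "L2_norm E = 0" using fourier_L2_norm[OF EL2] by simp
  then have "AE \<xi> in lebesgue. E \<xi> = 0" using L2_norm_eq_0_iff[OF EL2] by blast
  \<comment> \<open>The multiplier \<open>P\<close> vanishes only at the origin, a null set.\<close>
  then have "AE \<xi> in lebesgue. fourier_real u' \<xi> = 0"
    using AE_lebesgue_neq[of "0::'a"] by eventually_elim (simp add: E_def P_def gauss_def)
  then have "L2_norm (fourier_real u') = 0" using L2_norm_eq_0_iff[OF Fu'] by blast
  then have "L2_norm u' = 0" using fourier_L2_norm[OF L2_of_real[OF u']] by (simp add: L2_norm_of_real)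
  then have "AE x in lebesgue. u' x = 0" using L2_norm_eq_0_iff[OF u'] by blast
  with eq show ?thesis by eventually_elim simp
qed

section \<open>Potentials and conductivities\<close>

definition bounded_sym_form :: "real \<Rightarrow> 'a::euclidean_space form \<Rightarrow> real \<Rightarrow> bool" where
  "bounded_sym_form s B M \<longleftrightarrow>
     (\<forall>u\<in>Hs s. \<forall>v\<in>Hs s. \<forall>w\<in>Hs s. \<forall>a b. B (\<lambda>x. a * u x + b * v x) w = a * B u w + b * B v w) \<and>
     (\<forall>u\<in>Hs s. \<forall>v\<in>Hs s. B u v = B v u) \<and>
     (\<forall>u\<in>Hs s. \<forall>v\<in>Hs s. \<bar>B u v\<bar> \<le> M * Hs_norm s u * Hs_norm s v)"

lemma bounded_sym_form_add:
  assumes "bounded_sym_form s A M" "bounded_sym_form s B N"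
  shows "bounded_sym_form s (add_form A B) (M + N)"
proof -
  have "\<bar>A u v + B u v\<bar> \<le> (M + N) * Hs_norm s u * Hs_norm s v" if "u \<in> Hs s" "v \<in> Hs s" for u v
  proof -
    have "\<bar>A u v\<bar> \<le> M * Hs_norm s u * Hs_norm s v" "\<bar>B u v\<bar> \<le> N * Hs_norm s u * Hs_norm s v"
      using assms that unfolding bounded_sym_form_def by blast+
    then show ?thesis unfolding distrib_right by linarith
  qed
  then show ?thesis
    using assms unfolding bounded_sym_form_def add_form_def by (simp add: algebra_simps)
qed

lemma L2_Linf_mult:
  fixes w f :: "'a::euclidean_space \<Rightarrow> real"
  assumes w: "w \<in> borel_measurable lebesgue" "AE x in lebesgue. \<bar>w x\<bar> \<le> M" and f: "L2 f"
  shows "L2 (\<lambda>x. w x * f x)"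
proof (rule L2_dominated[OF borel_measurable_times[OF w(1) L2_measurable[OF f]] f])
  show "AE x in lebesgue. norm (w x * f x) \<le> M * norm (f x)"
    using w(2) by eventually_elim (simp add: abs_mult mult_right_mono)
qed

lemma L2_inner_eq_dot: "L2_inner f g = L2_dot f g"
  by (simp add: L2_inner_def L2_dot_def)

text \<open>Covers potentials with \<open>T\<close> the identity, and conductivities and the
  fractional Laplacian with \<open>T\<close> the operator \<open>frac_lap_half r\<close>. Linearity
  of \<open>T\<close> is asked only almost everywhere, since \<open>frac_lap_half\<close> rests on a
  choice of transforms.\<close>

lemma weighted_form_bounded:
  fixes T :: "('a::euclidean_space \<Rightarrow> real) \<Rightarrow> 'a \<Rightarrow> real"
  assumes w: "Linf w" and T2: "\<And>u. u \<in> Hs s \<Longrightarrow> L2 (T u)"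
    and lin: "\<And>u v a b. \<lbrakk>u \<in> Hs s; v \<in> Hs s\<rbrakk> \<Longrightarrow> AE x in lebesgue. T (\<lambda>x. a * u x + b * v x) x = a * T u x + b * T v x"
    and T: "\<And>u. u \<in> Hs s \<Longrightarrow> L2_norm (T u) \<le> Hs_norm s u"
  obtains M where "bounded_sym_form s (\<lambda>u v. L2_inner (\<lambda>x. w x * T u x) (T v)) M"
proof -
  obtain M where wm: "w \<in> borel_measurable lebesgue" and M: "AE x in lebesgue. \<bar>w x\<bar> \<le> M"
    using w by (auto simp: Linf_def)
  note wT = L2_Linf_mult[OF wm M T2]
  have "L2_inner (\<lambda>x. w x * T (\<lambda>x. a * u x + b * v x) x) (T z) =
      a * L2_inner (\<lambda>x. w x * T u x) (T z) + b * L2_inner (\<lambda>x. w x * T v x) (T z)"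
    if u: "u \<in> Hs s" and v: "v \<in> Hs s" and z: "z \<in> Hs s" for u v z a b
  proof -
    note i = L2_dot_integrable(2)[OF wT[OF u] T2[OF z]] L2_dot_integrable(2)[OF wT[OF v] T2[OF z]]
    have uv: "(\<lambda>x. a * u x + b * v x) \<in> Hs s" by (rule Hs_lin[OF u v])
    have "L2_inner (\<lambda>x. w x * T (\<lambda>x. a * u x + b * v x) x) (T z) =
        (\<integral>x. a * (w x * T u x * T z x) + b * (w x * T v x * T z x) \<partial>lebesgue)"
      unfolding L2_inner_def
    proof (rule integral_cong_AE)
      show "(\<lambda>x. w x * T (\<lambda>x. a * u x + b * v x) x * T z x) \<in> borel_measurable lebesgue"
        by (intro borel_measurable_times wm L2_measurable T2 uv z)
      show "(\<lambda>x. a * (w x * T u x * T z x) + b * (w x * T v x * T z x)) \<in> borel_measurable lebesgue"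
        by (intro borel_measurable_add borel_measurable_times borel_measurable_const wm L2_measurable T2 u v z)
      show "AE x in lebesgue. w x * T (\<lambda>x. a * u x + b * v x) x * T z x =
          a * (w x * T u x * T z x) + b * (w x * T v x * T z x)"
        using lin[OF u v, of a b] by eventually_elim (simp add: algebra_simps)
    qed
    also have "\<dots> = (\<integral>x. a * (w x * T u x * T z x) \<partial>lebesgue) + (\<integral>x. b * (w x * T v x * T z x) \<partial>lebesgue)"
      using i by (intro Bochner_Integration.integral_add integrable_mult_right) auto
    also have "\<dots> = a * L2_inner (\<lambda>x. w x * T u x) (T z) + b * L2_inner (\<lambda>x. w x * T v x) (T z)"
      by (simp add: L2_inner_def)
    finally show ?thesis .
  qed
  moreover have "L2_inner (\<lambda>x. w x * T u x) (T v) = L2_inner (\<lambda>x. w x * T v x) (T u)" for u v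
    by (simp add: L2_inner_def mult_ac)
  moreover have "\<bar>L2_inner (\<lambda>x. w x * T u x) (T v)\<bar> \<le> \<bar>M\<bar> * Hs_norm s u * Hs_norm s v"
    if u: "u \<in> Hs s" and v: "v \<in> Hs s" for u v
  proof -
    have "\<bar>L2_inner (\<lambda>x. w x * T u x) (T v)\<bar> \<le> L2_norm (\<lambda>x. w x * T u x) * L2_norm (T v)"
      unfolding L2_inner_eq_dot by (rule L2_Cauchy_Schwarz[OF wT[OF u] T2[OF v]])
    also have "L2_norm (\<lambda>x. w x * T u x) \<le> \<bar>M\<bar> * L2_norm (T u)"
    proof (rule L2_norm_mono[OF wT[OF u] T2[OF u]])
      show "AE x in lebesgue. norm (w x * T u x) \<le> \<bar>M\<bar> * norm (T u x)"
        using M by eventually_elim (auto simp: abs_mult intro: mult_right_mono)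
    qed simp
    then have "L2_norm (\<lambda>x. w x * T u x) * L2_norm (T v) \<le> (\<bar>M\<bar> * L2_norm (T u)) * L2_norm (T v)"
      by (rule mult_right_mono) (simp add: L2_norm_def)
    also have "\<dots> \<le> (\<bar>M\<bar> * Hs_norm s u) * Hs_norm s v"
      by (intro mult_mono mult_left_mono T u v mult_nonneg_nonneg) (auto simp: L2_norm_def Hs_norm_def)
    finally show ?thesis .
  qed
  ultimately show ?thesis using that[of "\<bar>M\<bar>"] unfolding bounded_sym_form_def by blast
qed

text \<open>The weight may be negative outside \<open>\<Omega>\<close>; the lower bound holds
  because \<open>f\<close> vanishes there.\<close>

lemma weighted_form_lower:
  fixes w f :: "'a::euclidean_space \<Rightarrow> real"
  assumes w: "Linf w" and c: "AE x in lebesgue. x \<in> \<Omega> \<longrightarrow> c \<le> w x"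
    and f: "L2 f" "AE x in lebesgue. x \<notin> \<Omega> \<longrightarrow> f x = 0"
  shows "c * (L2_norm f)\<^sup>2 \<le> L2_inner (\<lambda>x. w x * f x) f"
proof -
  obtain M where wm: "w \<in> borel_measurable lebesgue" and M: "AE x in lebesgue. \<bar>w x\<bar> \<le> M"
    using w by (auto simp: Linf_def)
  have "c * (L2_norm f)\<^sup>2 = (\<integral>x. c * (norm (f x))\<^sup>2 \<partial>lebesgue)" by (simp add: L2_norm_sq)
  also have "\<dots> \<le> L2_inner (\<lambda>x. w x * f x) f"
    unfolding L2_inner_def
  proof (rule integral_mono_AE)
    show "integrable lebesgue (\<lambda>x. c * (norm (f x))\<^sup>2)" by (rule integrable_mult_right[OF L2_integrable[OF f(1)]])
    show "integrable lebesgue (\<lambda>x. w x * f x * f x)"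
      using L2_dot_integrable(2)[OF L2_Linf_mult[OF wm M f(1)] f(1)] by simp
    show "AE x in lebesgue. c * (norm (f x))\<^sup>2 \<le> w x * f x * f x"
      using c f(2)
    proof eventually_elim
      case (elim x)
      then show ?case by (cases "x \<in> \<Omega>") (auto simp: power2_eq_square mult.assoc intro: mult_right_mono)
    qed
  qed
  finally show ?thesis .
qed

lemma weighted_form_disjoint:
  assumes "AE x in lebesgue. x \<notin> A \<longrightarrow> f x = 0" "AE x in lebesgue. x \<notin> B \<longrightarrow> g x = 0" "A \<inter> B = {}"
  shows "L2_inner (\<lambda>x. w x * f x) g = 0"
  unfolding L2_inner_def
proof (rule integral_eq_zero_AE)
  show "AE x in lebesgue. w x * f x * g x = 0"
    using assms(1,2) by eventually_elim (use assms(3) in auto)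
qed

lemma L2_norm_le_of_two_pi:
  fixes r :: real
  assumes "sqrt ((2 * pi) ^ n) * x \<le> r" "x \<ge> 0" shows "x \<le> r"
proof -
  have "1 \<le> (2 * pi) ^ n" using pi_gt3 by (intro one_le_power) simp
  then have "1 * x \<le> sqrt ((2 * pi) ^ n) * x" using assms(2) by (intro mult_right_mono) auto
  then show ?thesis using assms(1) by simp
qed

lemma bounded_potential_form:
  fixes q :: "'a::euclidean_space \<Rightarrow> real"
  assumes s: "s \<ge> 0" and q: "Linf q"
  obtains M where "bounded_sym_form s (potential_form q) M"
proof (rule weighted_form_bounded[OF q, of s "\<lambda>u. u"])
  show "L2_norm u \<le> Hs_norm s u" if "u \<in> Hs s" for u :: "'a \<Rightarrow> real"
    by (rule L2_norm_le_of_two_pi[OF L2_le_Hs[OF s that]]) (simp add: L2_norm_def)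
qed (auto simp: HsD potential_form_def intro: that)

lemma bounded_conductivity_form:
  fixes \<gamma> :: "'a::euclidean_space \<Rightarrow> real"
  assumes r: "0 \<le> r" "r \<le> s" and \<gamma>: "Linf \<gamma>"
  obtains M where "bounded_sym_form s (conductivity_form r \<gamma>) M"
proof (rule weighted_form_bounded[OF \<gamma>, of s "frac_lap_half r"])
  show "L2 (frac_lap_half r u)" if "u \<in> Hs s" for u :: "'a \<Rightarrow> real" by (rule frac_lap_half_norm(1)[OF r that])
  show "AE x in lebesgue. frac_lap_half r (\<lambda>x. a * u x + b * v x) x = a * frac_lap_half r u x + b * frac_lap_half r v x"
    if "u \<in> Hs s" "v \<in> Hs s" for u v :: "'a \<Rightarrow> real" and a b
    by (rule frac_lap_half_lin[OF HsD(1)[OF that(1)] frac_mult_le_Hs(1)[OF r that(1)] HsD(1)[OF that(2)] frac_mult_le_Hs(1)[OF r that(2)]])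
  show "L2_norm (frac_lap_half r u) \<le> Hs_norm s u" if "u \<in> Hs s" for u :: "'a \<Rightarrow> real"
    by (rule L2_norm_le_of_two_pi[OF frac_lap_half_norm(3)[OF r that]]) (simp add: L2_norm_def)
qed (auto simp: conductivity_form_def intro: that)

lemma frac_lap_form_eq: "frac_lap_form r = conductivity_form r (\<lambda>x. 1)"
  by (simp add: frac_lap_form_def conductivity_form_def)

lemma frac_lap_form_self: "frac_lap_form r u u = (L2_norm (frac_lap_half r u))\<^sup>2"
  unfolding frac_lap_form_def L2_inner_def L2_norm_sq by (simp add: power2_eq_square)

lemma Linf_const: "Linf (\<lambda>x. c)"
  by (auto simp: Linf_def)

text \<open>By \<open>Hs_norm_le\<close> a lower bound by the lowest and highest order terms is
  enough. The constants \<open>2 powr s\<close> and (2 pi)^n come from there and from the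
  normalisation of the transform.\<close>

lemma coercive_formI:
  fixes B :: "'a::euclidean_space form"
  assumes s: "s \<ge> 0" and \<Omega>: "open \<Omega>" and B: "bounded_sym_form s B M" and a: "a > 0"
    and lower: "\<And>u. u \<in> Hs_tilde s \<Omega> \<Longrightarrow> a * ((L2_norm u)\<^sup>2 + (L2_norm (frac_lap_half s u))\<^sup>2) \<le> B u u"
  obtains N c where "coercive_form s \<Omega> B N c"
proof
  let ?p = "(2 * pi) ^ DIM('a)"
  have p: "?p > 0" by simp
  show "coercive_form s \<Omega> B (\<bar>M\<bar> + 1) (a / (2 powr s * ?p))"
  proof
    show "\<bar>B u v\<bar> \<le> (\<bar>M\<bar> + 1) * Hs_norm s u * Hs_norm s v" if "u \<in> Hs s" "v \<in> Hs s" for u v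
    proof -
      have "\<bar>B u v\<bar> \<le> M * Hs_norm s u * Hs_norm s v" using B that by (simp add: bounded_sym_form_def)
      also have "\<dots> \<le> (\<bar>M\<bar> + 1) * Hs_norm s u * Hs_norm s v"
        by (intro mult_right_mono) (auto simp: Hs_norm_def L2_norm_def)
      finally show ?thesis .
    qed
    show "a / (2 powr s * ?p) * (Hs_norm s u)\<^sup>2 \<le> B u u" if u: "u \<in> Hs_tilde s \<Omega>" for u
    proof -
      have H: "u \<in> Hs s" by (rule Hs_tildeD[OF u])
      have "(Hs_norm s u)\<^sup>2 \<le> 2 powr s * (?p * (L2_norm u)\<^sup>2 + (L2_norm (frac_mult s u))\<^sup>2)" by (rule Hs_norm_le[OF s H])
      also have "(L2_norm (frac_mult s u))\<^sup>2 = ?p * (L2_norm (frac_lap_half s u))\<^sup>2"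
        using frac_lap_half_norm(2)[OF s order_refl H] by simp
      finally have "(Hs_norm s u)\<^sup>2 \<le> 2 powr s * ?p * ((L2_norm u)\<^sup>2 + (L2_norm (frac_lap_half s u))\<^sup>2)"
        by (simp add: algebra_simps)
      then have "a / (2 powr s * ?p) * (Hs_norm s u)\<^sup>2 \<le>
          a / (2 powr s * ?p) * (2 powr s * ?p * ((L2_norm u)\<^sup>2 + (L2_norm (frac_lap_half s u))\<^sup>2))"
        using a by (intro mult_left_mono) auto
      also have "\<dots> = a * ((L2_norm u)\<^sup>2 + (L2_norm (frac_lap_half s u))\<^sup>2)" by simp
      finally show ?thesis using lower[OF u] by simp
    qed
  qed (use s \<Omega> a B in \<open>auto simp: bounded_sym_form_def\<close>)
qed

text \<open>Transfers \<open>unique_continuation\<close> to the form: in frequency the form is the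
  pairing with multiplier |xi|^(2t), and elements of \<open>Hs_tilde s \<Omega>\<close> vanish on
  \<open>W\<close>. The order \<open>t\<close> may be below \<open>s\<close>.\<close>

lemma frac_lap_form_unique_continuation:
  assumes \<Omega>: "open \<Omega>" and W: "open W" "W \<noteq> {}" "W \<inter> \<Omega> = {}" and t: "0 \<le> t" "t \<le> s" "t \<notin> \<int>"
    and \<phi>: "\<phi> \<in> Hs_tilde s \<Omega>" and zero: "\<And>f. f \<in> Cc_inf W \<Longrightarrow> frac_lap_form t f \<phi> = 0"
  shows "AE x in lebesgue. \<phi> x = 0"
proof (rule unique_continuation[OF W(1,2) HsD(1)[OF Hs_tildeD[OF \<phi>]] _ t(1,3)])
  have s: "s \<ge> 0" using t by simp
  show "AE x in lebesgue. x \<in> W \<longrightarrow> \<phi> x = 0"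
    using Hs_tilde_vanish[OF s \<Omega> \<phi>] by eventually_elim (use W(3) in auto)
  fix f assume f: "f \<in> Cc_inf W"
  note H = Cc_inf_Hs[OF f, of s] Hs_tildeD[OF \<phi>]
  have "L2_dot (frac_mult t f) (frac_mult t \<phi>) = 0"
    using zero[OF f] frac_lap_half_dot[OF HsD(1)[OF H(1)] frac_mult_le_Hs(1)[OF t(1,2) H(1)] HsD(1)[OF H(2)] frac_mult_le_Hs(1)[OF t(1,2) H(2)]]
    by (simp add: frac_lap_form_def)
  moreover have "frac_mult t f \<xi> \<bullet> frac_mult t \<phi> \<xi> = norm \<xi> powr (2 * t) * (fourier_real \<phi> \<xi> \<bullet> fourier_real f \<xi>)" for \<xi>
  proof -
    have "norm \<xi> powr (2 * t) = norm \<xi> powr t * norm \<xi> powr t" by (simp flip: powr_add)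
    then show ?thesis by (simp add: frac_mult_def inner_commute flip: scaleR_conv_of_real)
  qed
  ultimately show "(\<integral>\<xi>. norm \<xi> powr (2 * t) * (fourier_real \<phi> \<xi> \<bullet> fourier_real f \<xi>) \<partial>lebesgue) = 0"
    by (simp add: L2_dot_def)
qed

text \<open>Common frame of both cases: \<open>t\<close> is the order of the nonlocal operator,
  \<open>s\<close> that of the energy space. They agree for potentials, while the conductivity term
  makes \<open>s\<close> larger.\<close>

lemma calderon_frac_lap:
  assumes \<Omega>: "open \<Omega>" and t: "0 \<le> t" "t \<le> s" "t \<notin> \<int>"
    and coercive: "\<And>Q. Q \<in> \<Q> \<Longrightarrow> \<exists>M c. coercive_form s \<Omega> (add_form (frac_lap_form t) Q) M c"
    and local_tilde: "\<And>Q W f v. \<lbrakk>Q \<in> \<Q>; W \<inter> \<Omega> = {}; f \<in> Cc_inf W; v \<in> Hs_tilde s \<Omega>\<rbrakk> \<Longrightarrow> Q f v = 0"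
    and local_disjoint: "\<And>Q W V f g. \<lbrakk>Q \<in> \<Q>; W \<inter> V = {}; f \<in> Cc_inf W; g \<in> Cc_inf V\<rbrakk> \<Longrightarrow> Q f g = 0"
  shows "calderon_well_defined s \<Omega> (frac_lap_form t) \<Q> \<and> calderon_weak_uniqueness s \<Omega> (frac_lap_form t) \<Q>"
proof
  show "calderon_well_defined s \<Omega> (frac_lap_form t) \<Q>"
    unfolding calderon_well_defined_def using coercive coercive_form.DN_well_defined[OF _ refl] by blast
  show "calderon_weak_uniqueness s \<Omega> (frac_lap_form t) \<Q>"
    unfolding calderon_weak_uniqueness_def
  proof (intro allI impI ballI)
    fix W1 W2 Q1 Q2 u v
    assume W: "open W1 \<and> open W2 \<and> W1 \<noteq> {} \<and> W2 \<noteq> {} \<and> W1 \<inter> W2 = {} \<and> W1 \<subseteq> - closure \<Omega> \<and> W2 \<subseteq> - closure \<Omega>"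
      and Q: "Q1 \<in> \<Q>" "Q2 \<in> \<Q>"
      and DN: "\<forall>f\<in>Cc_inf W1. \<forall>g\<in>Cc_inf W2. DN_map s \<Omega> (frac_lap_form t) Q1 f g = DN_map s \<Omega> (frac_lap_form t) Q2 f g"
      and u: "u \<in> Hs_tilde s \<Omega>" and v: "v \<in> Hs_tilde s \<Omega>"
    have dj: "W1 \<inter> \<Omega> = {}" "W2 \<inter> \<Omega> = {}" using W closure_subset[of \<Omega>] by blast+
    obtain M1 c1 where C1: "coercive_form s \<Omega> (add_form (frac_lap_form t) Q1) M1 c1" using coercive[OF Q(1)] by blast
    obtain M2 c2 where C2: "coercive_form s \<Omega> (add_form (frac_lap_form t) Q2) M2 c2" using coercive[OF Q(2)] by blast
    show "Q1 u v = Q2 u v"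
    proof (rule weak_uniqueness[OF C1 C2 _ _ _ _ u v])
      show "Q1 f v = 0 \<and> Q2 f v = 0" if "f \<in> Cc_inf W1 \<union> Cc_inf W2" "v \<in> Hs_tilde s \<Omega>" for f v
        using that local_tilde[OF _ dj(1)] local_tilde[OF _ dj(2)] Q by blast
      show "Q1 f g = Q2 f g" if "f \<in> Cc_inf W1" "g \<in> Cc_inf W2" for f g
      proof -
        have "W1 \<inter> W2 = {}" using W by blast
        then have "Q1 f g = 0" "Q2 f g = 0" using local_disjoint that Q by blast+
        then show ?thesis by simp
      qed
      show "AE x in lebesgue. \<phi> x = 0"
        if "W = W1 \<or> W = W2" "\<phi> \<in> Hs_tilde s \<Omega>" "\<And>f. f \<in> Cc_inf W \<Longrightarrow> frac_lap_form t f \<phi> = 0" for W \<phi>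
      proof (rule frac_lap_form_unique_continuation[OF \<Omega> _ _ _ t that(2)])
        show "open W" "W \<noteq> {}" "W \<inter> \<Omega> = {}" using that(1) W dj by auto
      qed (rule that(3))
      show "DN_map s \<Omega> (frac_lap_form t) Q1 f g = DN_map s \<Omega> (frac_lap_form t) Q2 f g"
        if "f \<in> Cc_inf W1" "g \<in> Cc_inf W2" for f g
        using DN that by blast
    qed
  qed
qed

lemma potential_form_local:
  assumes "s \<ge> 0" "open \<Omega>"
  shows "\<lbrakk>W \<inter> \<Omega> = {}; f \<in> Cc_inf W; v \<in> Hs_tilde s \<Omega>\<rbrakk> \<Longrightarrow> potential_form q f v = 0"
    and "\<lbrakk>W \<inter> V = {}; f \<in> Cc_inf W; g \<in> Cc_inf V\<rbrakk> \<Longrightarrow> potential_form q f g = 0"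
proof -
  have C: "AE x in lebesgue. x \<notin> W \<longrightarrow> f x = 0" if "f \<in> Cc_inf W" for f W
    using Cc_inf_outside[OF that] by (intro AE_I2) blast
  show "potential_form q f v = 0" if "W \<inter> \<Omega> = {}" "f \<in> Cc_inf W" "v \<in> Hs_tilde s \<Omega>"
    unfolding potential_form_def
    by (rule weighted_form_disjoint[OF C[OF that(2)] Hs_tilde_vanish[OF assms that(3)] that(1)])
  show "potential_form q f g = 0" if "W \<inter> V = {}" "f \<in> Cc_inf W" "g \<in> Cc_inf V"
    unfolding potential_form_def
    by (rule weighted_form_disjoint[OF C[OF that(2)] C[OF that(3)] that(1)])
qed

lemma conductivity_form_local:
  assumes "open \<Omega>"
  shows "\<lbrakk>W \<inter> \<Omega> = {}; f \<in> Cc_inf W; v \<in> Hs_tilde (2 * real k) \<Omega>\<rbrakk> \<Longrightarrow> conductivity_form (2 * real k) \<gamma> f v = 0"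
    and "\<lbrakk>W \<inter> V = {}; f \<in> Cc_inf W; g \<in> Cc_inf V\<rbrakk> \<Longrightarrow> conductivity_form (2 * real k) \<gamma> f g = 0"
proof -
  have C: "AE x in lebesgue. x \<notin> W \<longrightarrow> frac_lap_half (2 * real k) f x = 0" if "f \<in> Cc_inf W" for f W
    using frac_lap_half_even[OF that, of k]
    by eventually_elim (use Cc_inf_outside[OF Cc_inf_nlap_pow[OF that, of k]] in auto)
  show "conductivity_form (2 * real k) \<gamma> f v = 0" if "W \<inter> \<Omega> = {}" "f \<in> Cc_inf W" "v \<in> Hs_tilde (2 * real k) \<Omega>"
    unfolding conductivity_form_def
    by (rule weighted_form_disjoint[OF C[OF that(2)] frac_lap_half_even_vanish[OF assms that(3)] that(1)])
  show "conductivity_form (2 * real k) \<gamma> f g = 0" if "W \<inter> V = {}" "f \<in> Cc_inf W" "g \<in> Cc_inf V"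
    unfolding conductivity_form_def
    by (rule weighted_form_disjoint[OF C[OF that(2)] C[OF that(3)] that(1)])
qed

lemma calderon_potential:
  fixes \<Omega> :: "'a::euclidean_space set"
  assumes s: "s \<ge> 0" "s \<notin> \<int>" and \<Omega>: "open \<Omega>"
  shows "calderon_well_defined s \<Omega> (frac_lap_form s) (potential_perturbations \<Omega>) \<and>
    calderon_weak_uniqueness s \<Omega> (frac_lap_form s) (potential_perturbations \<Omega>)"
proof (rule calderon_frac_lap[OF \<Omega> s(1) order_refl s(2)])
  fix Q :: "'a form" assume "Q \<in> potential_perturbations \<Omega>"
  then obtain q where Q: "Q = potential_form q" and q: "Linf q" "uniformly_positive_on \<Omega> q"
    by (auto simp: potential_perturbations_def)
  obtain c where c: "c > 0" "AE x in lebesgue. x \<in> \<Omega> \<longrightarrow> c \<le> q x" using q(2) by (auto simp: uniformly_positive_on_def)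
  obtain M where M: "bounded_sym_form s (frac_lap_form s :: 'a form) M"
    unfolding frac_lap_form_eq by (rule bounded_conductivity_form[OF s(1) order_refl Linf_const])
  obtain N where N: "bounded_sym_form s Q N" unfolding Q by (rule bounded_potential_form[OF s(1) q(1)])
  show "\<exists>M c. coercive_form s \<Omega> (add_form (frac_lap_form s) Q) M c"
  proof (rule coercive_formI[OF s(1) \<Omega> bounded_sym_form_add[OF M N], of "min 1 c"])
    \<comment> \<open>The form \<open>L\<close> supplies the highest order term with coefficient 1,
      the potential the L2 term with coefficient \<open>c\<close>.\<close>
    show "min 1 c > 0" using c by simp
    fix u assume u: "u \<in> Hs_tilde s \<Omega>"
    have "c * (L2_norm u)\<^sup>2 \<le> Q u u"
      unfolding Q potential_form_def
      by (rule weighted_form_lower[OF q(1) c(2) HsD(1)[OF Hs_tildeD[OF u]] Hs_tilde_vanish[OF s(1) \<Omega> u]])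
    moreover have "min 1 c * (L2_norm u)\<^sup>2 \<le> c * (L2_norm u)\<^sup>2" by (intro mult_right_mono) auto
    moreover have "min 1 c * (L2_norm (frac_lap_half s u))\<^sup>2 \<le> 1 * (L2_norm (frac_lap_half s u))\<^sup>2"
      by (intro mult_right_mono) auto
    ultimately show "min 1 c * ((L2_norm u)\<^sup>2 + (L2_norm (frac_lap_half s u))\<^sup>2) \<le> add_form (frac_lap_form s) Q u u"
      unfolding add_form_def frac_lap_form_self distrib_left by linarith
  qed blast
next
  fix Q :: "'a form" and W V :: "'a set" and f g
  assume Q: "Q \<in> potential_perturbations \<Omega>" and f: "f \<in> Cc_inf W"
  show "Q f g = 0" if "W \<inter> \<Omega> = {}" "g \<in> Hs_tilde s \<Omega>"
    using Q potential_form_local(1)[OF s(1) \<Omega> that(1) f that(2)] by (auto simp: potential_perturbations_def)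
  show "Q f g = 0" if "W \<inter> V = {}" "g \<in> Cc_inf V"
    using Q potential_form_local(2)[OF s(1) \<Omega> that(1) f that(2)] by (auto simp: potential_perturbations_def)
qed

lemma calderon_conductivity:
  fixes \<Omega> :: "'a::euclidean_space set"
  assumes s: "s = 2 * real k" and \<Omega>: "open \<Omega>" and t: "0 \<le> t" "t \<le> s" "t \<notin> \<int>"
  shows "calderon_well_defined s \<Omega> (frac_lap_form t) (conductivity_perturbations s \<Omega>) \<and>
    calderon_weak_uniqueness s \<Omega> (frac_lap_form t) (conductivity_perturbations s \<Omega>)"
proof (rule calderon_frac_lap[OF \<Omega> t])
  have s0: "s \<ge> 0" using s by simp
  fix Q :: "'a form" assume "Q \<in> conductivity_perturbations s \<Omega>"
  then obtain \<gamma> q where Q: "Q = add_form (conductivity_form s \<gamma>) (potential_form q)"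
    and \<gamma>: "Linf \<gamma>" "uniformly_positive_on \<Omega> \<gamma>" and q: "Linf q" "uniformly_positive_on \<Omega> q"
    by (auto simp: conductivity_perturbations_def)
  obtain c where c: "c > 0" "AE x in lebesgue. x \<in> \<Omega> \<longrightarrow> c \<le> q x" using q(2) by (auto simp: uniformly_positive_on_def)
  obtain d where d: "d > 0" "AE x in lebesgue. x \<in> \<Omega> \<longrightarrow> d \<le> \<gamma> x" using \<gamma>(2) by (auto simp: uniformly_positive_on_def)
  obtain M where M: "bounded_sym_form s (frac_lap_form t :: 'a form) M"
    unfolding frac_lap_form_eq by (rule bounded_conductivity_form[OF t(1,2) Linf_const])
  obtain M' where M': "bounded_sym_form s (conductivity_form s \<gamma>) M'"
    by (rule bounded_conductivity_form[OF s0 order_refl \<gamma>(1)])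
  obtain N where N: "bounded_sym_form s (potential_form q) N" by (rule bounded_potential_form[OF s0 q(1)])
  have B: "bounded_sym_form s (add_form (frac_lap_form t) Q) (M + (M' + N))"
    unfolding Q by (rule bounded_sym_form_add[OF M bounded_sym_form_add[OF M' N]])
  show "\<exists>M c. coercive_form s \<Omega> (add_form (frac_lap_form t) Q) M c"
  proof (rule coercive_formI[OF s0 \<Omega> B, of "min d c"])
    \<comment> \<open>Here the conductivity term controls the highest order, with constant
      \<open>d\<close>, and the contribution of \<open>L\<close> is only nonnegative.\<close>
    show "min d c > 0" using c d by simp
    fix u assume u: "u \<in> Hs_tilde s \<Omega>"
    note H = Hs_tildeD[OF u]
    have "c * (L2_norm u)\<^sup>2 \<le> potential_form q u u"
      unfolding potential_form_def
      by (rule weighted_form_lower[OF q(1) c(2) HsD(1)[OF H] Hs_tilde_vanish[OF s0 \<Omega> u]])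
    moreover have "d * (L2_norm (frac_lap_half s u))\<^sup>2 \<le> conductivity_form s \<gamma> u u"
      unfolding conductivity_form_def
      by (rule weighted_form_lower[OF \<gamma>(1) d(2) frac_lap_half_norm(1)[OF s0 order_refl H]
            frac_lap_half_even_vanish[OF \<Omega> u[unfolded s], folded s]])
    moreover have "min d c * (L2_norm u)\<^sup>2 \<le> c * (L2_norm u)\<^sup>2" by (intro mult_right_mono) auto
    moreover have "min d c * (L2_norm (frac_lap_half s u))\<^sup>2 \<le> d * (L2_norm (frac_lap_half s u))\<^sup>2"
      by (intro mult_right_mono) auto
    moreover have "(L2_norm (frac_lap_half t u))\<^sup>2 \<ge> 0" by simp
    ultimately show "min d c * ((L2_norm u)\<^sup>2 + (L2_norm (frac_lap_half s u))\<^sup>2) \<le> add_form (frac_lap_form t) Q u u"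
      unfolding Q add_form_def frac_lap_form_self distrib_left by linarith
  qed blast
next
  have s0: "s \<ge> 0" using s by simp
  fix Q :: "'a form" and W V :: "'a set" and f g
  assume Q: "Q \<in> conductivity_perturbations s \<Omega>" and f: "f \<in> Cc_inf W"
  show "Q f g = 0" if "W \<inter> \<Omega> = {}" "g \<in> Hs_tilde s \<Omega>"
    using Q potential_form_local(1)[OF s0 \<Omega> that(1) f that(2)] conductivity_form_local(1)[OF \<Omega> that(1) f that(2)[unfolded s]]
    by (auto simp: conductivity_perturbations_def add_form_def s)
  show "Q f g = 0" if "W \<inter> V = {}" "g \<in> Cc_inf V"
    using Q potential_form_local(2)[OF s0 \<Omega> that(1) f that(2)] conductivity_form_local(2)[OF \<Omega> that(1) f that(2)]
    by (auto simp: conductivity_perturbations_def add_form_def s)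
qed

theorem proposition4p6:
  fixes \<Omega> :: "(real ^ 'n) set" and s :: real
  assumes "s \<ge> 0" and "open \<Omega>" and "- closure \<Omega> \<noteq> {}"
  shows "(s \<notin> \<int> \<longrightarrow>
            calderon_well_defined s \<Omega> (frac_lap_form s) (potential_perturbations \<Omega>) \<and>
            calderon_weak_uniqueness s \<Omega> (frac_lap_form s) (potential_perturbations \<Omega>)) \<and>
         (\<forall>t::real. t \<ge> 0 \<and> t \<notin> \<int> \<and> (\<exists>k::int. s = 2 * of_int k) \<and> t < s \<longrightarrow>
            calderon_well_defined s \<Omega> (frac_lap_form t) (conductivity_perturbations s \<Omega>) \<and>
            calderon_weak_uniqueness s \<Omega> (frac_lap_form t) (conductivity_perturbations s \<Omega>))"
proof (intro conjI[OF impI allI[OF impI]]; (elim conjE exE)?)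
  show "calderon_well_defined s \<Omega> (frac_lap_form s) (potential_perturbations \<Omega>) \<and>
      calderon_weak_uniqueness s \<Omega> (frac_lap_form s) (potential_perturbations \<Omega>)" if "s \<notin> \<int>"
    by (rule calderon_potential[OF assms(1) that assms(2)])
  fix t :: real and k :: int
  assume t: "t \<ge> 0" "t \<notin> \<int>" "t < s" and k: "s = 2 * of_int k"
  \<comment> \<open>\<open>s \<ge> 0\<close> makes the integer \<open>k\<close> nonnegative, so
    \<open>s\<close> is twice a natural number and the operator is an iterated Laplacian.\<close>
  have "s = 2 * real (nat k)" using assms(1) k by simp
  then show "calderon_well_defined s \<Omega> (frac_lap_form t) (conductivity_perturbations s \<Omega>) \<and>
      calderon_weak_uniqueness s \<Omega> (frac_lap_form t) (conductivity_perturbations s \<Omega>)"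
    by (rule calderon_conductivity[OF _ assms(2) t(1) less_imp_le[OF t(3)] t(2)])
qed

end
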